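(* The group $H^*_1(p)$ is always the same regardless of the choice of the independence relation $\perp^*$ satisfying the five basic axioms: if $\perp^{*}$ and $\perp^{\circ}$ are two such relations, then $\ker(\psi^{*}_p)=\ker(\psi^{\circ}_p)$, so that $H_1^{*}(p)$ and $H_1^{\circ}(p)$ are both identified with the same quotient of $\mathrm{Aut}(p(\mathcal M))$; the group is hence denoted $H_1(p)$. Moreover, $H_1(p)$ can also be considered as a quotient group of $\mathrm{Gal}_L(T)$ or of $\mathrm{Gal}^{\mathrm{fix}}_L(p)$, and these equivalently endow $H_1(p)$ with a topological group structure (the two quotient topologies coincide).
   Context: **Setting.** $T$ is a complete theory and $\mathcal M=\mathcal M^{\mathrm{eq}}$ a large saturated (monster) model; sets and tuples are small, tuples possibly infinite; $a\equiv b$ means equality of types over $\emptyset$. The five basic axioms for an $\mathrm{Aut}(\mathcal M)$-invariant ternary relation $A\perp^*_C D$ between small sets are, for all sets: (finite character) $A\perp^*_CD$ iff $a\perp^*_Cd$ for all finite tuples $a\in A$, $d\in D$; (normality) $A\perp^*_CD$ implies $A\perp^*_C\mathrm{acl}(DC)$; (symmetry) $A\perp^*_CD$ iff $D\perp^*_CA$; (transitivity) for $E\subseteq C\subseteq D$, $A\perp^*_ED$ iff $A\perp^*_EC$ and $A\perp^*_CD$; (extension) for $E\subseteq C$ there is $A'\equiv_E A$ with $A'\perp^*_EC$. A family is $*$-independent over $C$ if each member is $*$-independent over $C$ from the union of the others. Fix a strong type $p$ over $B=\mathrm{acl}(B)$; the elements of $B$ are named by constants, so that $B=\mathrm{acl}(\emptyset)=\mathrm{dcl}(\emptyset)$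 and "over $\emptyset$" means "over $B$". It is assumed that $p=\mathrm{tp}(a)$ where either $a$ enumerates $\mathrm{acl}(a)$, or $\mathrm{acl}(a)=\mathrm{dcl}(a)$. **Simplices and homology (for a given $\perp^*$).** For a finite $s\subset\omega$, the power set $\mathcal P(s)$ is a category with one morphism $u\to v$ when $u\subseteq v$ and none otherwise. $\mathcal C$ is the category of small subsets of $\mathcal M$ containing $B$, with elementary maps over $B$ as morphisms. For a functor $f$ write $f^u_v:f(u)\to f(v)$ for the image of $u\to v$, and $f^u_v(u)$ for the set $f^u_v[f(u)]$. An $n$-simplex of $p$ is a functor $f:\mathcal P(s)\to\mathcal C$ with $|s|=n+1$ such that $f(\emptyset)=B$, each $f(\{i\})$ is of the form $\mathrm{acl}(b)$ with $b\models p$, and for nonempty $u\subseteq s$, $f(u)=\mathrm{acl}(\bigcup_{i\in u}f^{\{i\}}_u(\{i\}))$ and $\{f^{\{i\}}_u(\{i\}): i\in u\}$ is $*$-independent over $B$. Put $\mathrm{supp}(f)=s$. $C_n$ is the free abelian group on $n$-simplices. For $s=\{s_0<\dots<s_n\}$ put $\partial^i f=f\restriction\mathcal P(s\setminus\{s_i\})$, $\partial f=\sum_{i}(-1)^i\partial^i f$ (extended linearly), and $H^*_n(p)=\ker\partial_n/\mathrm{Im}\,\partial_{n+1}$. **Shells and the bracket $[a,b]$.** A $1$-shell is a $1$-chain $s=f_0-f_1+f_2$ of $1$-simplices with $\partial^if_j=\partial^{j-1}f_i$ for $0\le i<j\le 2$; its support (the union of the supports of the $f_i$) is $\{n_0<n_1<n_2\}$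 and we write $s=f_{12}-f_{02}+f_{01}$ with $\mathrm{supp}(f_{ij})=\{n_i,n_j\}$. A representation of $s$ is a quadruple $(a_0,a_1,a_2,a_3)$ of realizations of $p$ such that, for some realizations $e_i\models p$ with $\mathrm{acl}(e_i)$ equal to the common vertex set $f_{jk}(\{n_i\})$ ($i=0,1,2$), writing $e_i^{jk}$ for the image of $e_i$ under the map $f_{jk}(\{n_i\})\to f_{jk}(\{n_j,n_k\})$, one has $a_0a_1\equiv e_0^{01}e_1^{01}$, $a_1a_2\equiv e_1^{12}e_2^{12}$, $a_3a_2\equiv e_0^{02}e_2^{02}$. Then $(a_0,a_3)$ is an endpoint pair of $s$. Every pair $(a,b)$ of realizations of $p$ is an endpoint pair of some $1$-shell with support $\{0,1,2\}$, and the class of such a shell in $H_1^*(p)$ depends only on $(a,b)$; it is denoted $[a,b]$. $\mathrm{Aut}(p(\mathcal M))=\{\sigma\restriction p(\mathcal M):\sigma\in\mathrm{Aut}(\mathcal M)\}$, and $\psi^*_p:\mathrm{Aut}(p(\mathcal M))\to H^*_1(p)$ is the surjective homomorphism $\sigma\mapsto[a,\sigma(a)]$ (independent of $a\models p$). **Lascar groups.** $\mathrm{Autf}(\mathcal M)$ is the subgroup of $\mathrm{Aut}(\mathcal M)$ generated by automorphisms fixing pointwise some small elementary submodel; $\bar a\equiv^L\bar b$ iff $\bar b=\sigma(\bar a)$ for some $\sigma\in\mathrm{Autf}(\mathcal M)$; $\mathrm{Gal}_L(T)=\mathrm{Aut}(\mathcal M)/\mathrm{Autf}(\mathcal M)$,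 with the quotient topology under the map $\nu:S_M(N)\to\mathrm{Gal}_L(T)$, $\mathrm{tp}(f(M)/N)\mapsto f\,\mathrm{Autf}(\mathcal M)$, where $M,N$ are small submodels and $S_M(N)$ is the Stone space of types over $N$ of conjugates of $M$. $\mathrm{Gal}_L^{\mathrm{fix}}(p)=\mathrm{Aut}(p(\mathcal M))/\mathrm{Autf}_{\mathrm{fix}}(p(\mathcal M))$, where $\mathrm{Autf}_{\mathrm{fix}}(p(\mathcal M))$ consists of the restrictions to $p(\mathcal M)$ of those $\sigma\in\mathrm{Aut}(\mathcal M)$ with $\bar a\equiv^L\sigma(\bar a)$ for every countable sequence $\bar a$ of realizations of $p$ (equivalently, for an enumeration of $p(\mathcal M)$); it carries the quotient topology from $\mathrm{Gal}_L(T)$. The maps $\mathrm{Gal}_L(T)\to H_1(p)$ and $\mathrm{Gal}_L^{\mathrm{fix}}(p)\to H_1(p)$ are those induced by $\sigma\mapsto[a,\sigma(a)]$. *)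

theory Defs
  imports "HOL-Analysis.Analysis" "HOL-Algebra.Bij" "HOL-Algebra.Generated_Groups" "HOL-Algebra.Free_Abelian_Groups"
begin

unbundle cardinal_syntax

section \<open>Many-sorted first-order logic\<close>

text \<open>Imaginaries live in infinitely many sorts, so the logic is many-sorted. A variable is a pair
  (sort, index); \<open>'f\<close> and \<open>'r\<close> are the function symbols (constants included) and relation symbols.
  The universe of a structure is the whole type \<open>'m\<close>, split into sorts by \<open>srt\<close>; interpretations
  matter only on arguments of the declared sorts.\<close>

type_synonym 's var = "'s \<times> nat"

datatype ('s, 'f) tm = Var "'s var" | Fn 'f "('s, 'f) tm list"

datatype ('s, 'f, 'r) fm =
    Eq "('s, 'f) tm" "('s, 'f) tm"
  | Rel 'r "('s, 'f) tm list"
  | Neg "('s, 'f, 'r) fm"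
  | And "('s, 'f, 'r) fm" "('s, 'f, 'r) fm"
  | Ex "'s var" "('s, 'f, 'r) fm"

record ('s, 'f, 'r, 'm) fostruct =
  fdom :: "'f \<Rightarrow> 's list"
  fcod :: "'f \<Rightarrow> 's"
  rdom :: "'r \<Rightarrow> 's list"
  srt :: "'m \<Rightarrow> 's"
  fI :: "'f \<Rightarrow> 'm list \<Rightarrow> 'm"
  rI :: "'r \<Rightarrow> 'm list \<Rightarrow> bool"

definition wf_struct :: "('s, 'f, 'r, 'm) fostruct \<Rightarrow> bool" where
  "wf_struct \<MM> \<longleftrightarrow> (\<forall>s. \<exists>x. srt \<MM> x = s) \<and>
     (\<forall>f xs. map (srt \<MM>) xs = fdom \<MM> f \<longrightarrow> srt \<MM> (fI \<MM> f xs) = fcod \<MM> f)"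

fun tm_sort :: "('s, 'f, 'r, 'm) fostruct \<Rightarrow> ('s, 'f) tm \<Rightarrow> 's" where
  "tm_sort \<MM> (Var x) = fst x"
| "tm_sort \<MM> (Fn f ts) = fcod \<MM> f"

fun tm_ok :: "('s, 'f, 'r, 'm) fostruct \<Rightarrow> ('s, 'f) tm \<Rightarrow> bool" where
  "tm_ok \<MM> (Var x) \<longleftrightarrow> True"
| "tm_ok \<MM> (Fn f ts) \<longleftrightarrow> map (tm_sort \<MM>) ts = fdom \<MM> f \<and> (\<forall>t\<in>set ts. tm_ok \<MM> t)"

fun fm_ok :: "('s, 'f, 'r, 'm) fostruct \<Rightarrow> ('s, 'f, 'r) fm \<Rightarrow> bool" where
  "fm_ok \<MM> (Eq t u) \<longleftrightarrow> tm_ok \<MM> t \<and> tm_ok \<MM> u \<and> tm_sort \<MM> t = tm_sort \<MM> u"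
| "fm_ok \<MM> (Rel r ts) \<longleftrightarrow> map (tm_sort \<MM>) ts = rdom \<MM> r \<and> (\<forall>t\<in>set ts. tm_ok \<MM> t)"
| "fm_ok \<MM> (Neg \<phi>) \<longleftrightarrow> fm_ok \<MM> \<phi>"
| "fm_ok \<MM> (And \<phi> \<psi>) \<longleftrightarrow> fm_ok \<MM> \<phi> \<and> fm_ok \<MM> \<psi>"
| "fm_ok \<MM> (Ex x \<phi>) \<longleftrightarrow> fm_ok \<MM> \<phi>"

fun tm_vars :: "('s, 'f) tm \<Rightarrow> 's var set" where
  "tm_vars (Var x) = {x}"
| "tm_vars (Fn f ts) = (\<Union>t\<in>set ts. tm_vars t)"

fun FV :: "('s, 'f, 'r) fm \<Rightarrow> 's var set" where
  "FV (Eq t u) = tm_vars t \<union> tm_vars u"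
| "FV (Rel r ts) = (\<Union>t\<in>set ts. tm_vars t)"
| "FV (Neg \<phi>) = FV \<phi>"
| "FV (And \<phi> \<psi>) = FV \<phi> \<union> FV \<psi>"
| "FV (Ex x \<phi>) = FV \<phi> - {x}"

fun tm_val :: "('s, 'f, 'r, 'm) fostruct \<Rightarrow> ('s var \<Rightarrow> 'm) \<Rightarrow> ('s, 'f) tm \<Rightarrow> 'm" where
  "tm_val \<MM> v (Var x) = v x"
| "tm_val \<MM> v (Fn f ts) = fI \<MM> f (map (tm_val \<MM> v) ts)"

text \<open>Satisfaction in the substructure with universe \<open>U\<close>.\<close>

fun sat :: "('s, 'f, 'r, 'm) fostruct \<Rightarrow> 'm set \<Rightarrow> ('s var \<Rightarrow> 'm) \<Rightarrow> ('s, 'f, 'r) fm \<Rightarrow> bool" where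
  "sat \<MM> U v (Eq t u) \<longleftrightarrow> tm_val \<MM> v t = tm_val \<MM> v u"
| "sat \<MM> U v (Rel r ts) \<longleftrightarrow> rI \<MM> r (map (tm_val \<MM> v) ts)"
| "sat \<MM> U v (Neg \<phi>) \<longleftrightarrow> \<not> sat \<MM> U v \<phi>"
| "sat \<MM> U v (And \<phi> \<psi>) \<longleftrightarrow> sat \<MM> U v \<phi> \<and> sat \<MM> U v \<psi>"
| "sat \<MM> U v (Ex x \<phi>) \<longleftrightarrow> (\<exists>y\<in>U. srt \<MM> y = fst x \<and> sat \<MM> U (v(x := y)) \<phi>)"

definition valuation :: "('s, 'f, 'r, 'm) fostruct \<Rightarrow> 'm set \<Rightarrow> ('s var \<Rightarrow> 'm) \<Rightarrow> bool" where
  "valuation \<MM> U v \<longleftrightarrow> (\<forall>x. v x \<in> U \<and> srt \<MM> (v x) = fst x)"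

definition elem_substructure :: "('s, 'f, 'r, 'm) fostruct \<Rightarrow> 'm set \<Rightarrow> bool" where
  "elem_substructure \<MM> U \<longleftrightarrow>
     (\<forall>s. \<exists>x\<in>U. srt \<MM> x = s) \<and>
     (\<forall>f xs. set xs \<subseteq> U \<and> map (srt \<MM>) xs = fdom \<MM> f \<longrightarrow> fI \<MM> f xs \<in> U) \<and>
     (\<forall>\<phi> v. fm_ok \<MM> \<phi> \<and> valuation \<MM> U v \<longrightarrow> sat \<MM> U v \<phi> = sat \<MM> UNIV v \<phi>)"

text \<open>\<open>tp \<MM> I u C\<close> is the complete type over \<open>C\<close> of the tuple \<open>(u i)\<^sub>i\<^sub>\<in>\<^sub>I\<close>. A member \<open>(\<phi>, e)\<close> is the
  formula \<open>\<phi>\<close> in which each free variable \<open>x\<close> is replaced by the type variable number \<open>i\<close> if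
  \<open>e x = Inl i\<close>, and by the parameter \<open>c\<close> if \<open>e x = Inr c\<close>.\<close>

definition tp :: "('s, 'f, 'r, 'm) fostruct \<Rightarrow> 'k set \<Rightarrow> ('k \<Rightarrow> 'm) \<Rightarrow> 'm set
    \<Rightarrow> (('s, 'f, 'r) fm \<times> ('s var \<Rightarrow> 'k + 'm)) set" where
  "tp \<MM> I u C = {(\<phi>, e). fm_ok \<MM> \<phi> \<and>
      (\<forall>x\<in>FV \<phi>. e x \<in> Inl ` I \<union> Inr ` C \<and> srt \<MM> (case_sum u id (e x)) = fst x) \<and>
      (\<exists>v. valuation \<MM> UNIV v \<and> (\<forall>x\<in>FV \<phi>. v x = case_sum u id (e x)) \<and> sat \<MM> UNIV v \<phi>)}"

text \<open>\<open>h\<close> is elementary on \<open>A\<close>: \<open>(x)\<^sub>x\<^sub>\<in>\<^sub>A\<close> and \<open>(h x)\<^sub>x\<^sub>\<in>\<^sub>A\<close> have the same type over \<open>C\<close>.\<close>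

definition elementary_over :: "('s, 'f, 'r, 'm) fostruct \<Rightarrow> 'm set \<Rightarrow> 'm set \<Rightarrow> ('m \<Rightarrow> 'm) \<Rightarrow> bool" where
  "elementary_over \<MM> C A h \<longleftrightarrow> tp \<MM> A h C = tp \<MM> A id C"

definition acl :: "('s, 'f, 'r, 'm) fostruct \<Rightarrow> 'm set \<Rightarrow> 'm set" where
  "acl \<MM> A = {x. \<exists>\<phi> z v. fm_ok \<MM> \<phi> \<and> fst z = srt \<MM> x \<and> valuation \<MM> UNIV v \<and> v ` (FV \<phi> - {z}) \<subseteq> A \<and>
      sat \<MM> UNIV (v(z := x)) \<phi> \<and> finite {y. srt \<MM> y = fst z \<and> sat \<MM> UNIV (v(z := y)) \<phi>}}"

definition dcl :: "('s, 'f, 'r, 'm) fostruct \<Rightarrow> 'm set \<Rightarrow> 'm set" where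
  "dcl \<MM> A = {x. \<exists>\<phi> z v. fm_ok \<MM> \<phi> \<and> fst z = srt \<MM> x \<and> valuation \<MM> UNIV v \<and> v ` (FV \<phi> - {z}) \<subseteq> A \<and>
      {y. srt \<MM> y = fst z \<and> sat \<MM> UNIV (v(z := y)) \<phi>} = {x}}"

section \<open>The monster model\<close>

definition small :: "'m set \<Rightarrow> bool" where
  "small A \<longleftrightarrow> |A| <o |UNIV :: 'm set|"

text \<open>Saturation: a set of formulas in the single variable \<open>z\<close> with parameters in a set of size less
  than that of the model (each formula given with a valuation supplying its parameters) is realized
  as soon as it is finitely satisfiable.\<close>

definition saturated :: "('s, 'f, 'r, 'm) fostruct \<Rightarrow> bool" where
  "saturated \<MM> \<longleftrightarrow> (\<forall>A z \<Sigma>. small A \<and>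
     (\<forall>(\<phi>, v)\<in>\<Sigma>. fm_ok \<MM> \<phi> \<and> valuation \<MM> UNIV v \<and> v ` (FV \<phi> - {z}) \<subseteq> A) \<and>
     (\<forall>F. finite F \<and> F \<subseteq> \<Sigma> \<longrightarrow>
        (\<exists>x. srt \<MM> x = fst z \<and> (\<forall>(\<phi>, v)\<in>F. sat \<MM> UNIV (v(z := x)) \<phi>))) \<longrightarrow>
     (\<exists>x. srt \<MM> x = fst z \<and> (\<forall>(\<phi>, v)\<in>\<Sigma>. sat \<MM> UNIV (v(z := x)) \<phi>)))"

definition monster :: "('s, 'f, 'r, 'm) fostruct \<Rightarrow> bool" where
  "monster \<MM> \<longleftrightarrow> wf_struct \<MM> \<and> saturated \<MM> \<and> |UNIV :: ('s, 'f, 'r) fm set| <o |UNIV :: 'm set|"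

definition definable0 :: "('s, 'f, 'r, 'm) fostruct \<Rightarrow> 's list \<Rightarrow> 'm list set \<Rightarrow> bool" where
  "definable0 \<MM> ss D \<longleftrightarrow> (\<exists>\<phi>. fm_ok \<MM> \<phi> \<and> FV \<phi> \<subseteq> {(ss ! i, i) | i. i < length ss} \<and>
     D = {xs. map (srt \<MM>) xs = ss \<and>
       (\<exists>v. valuation \<MM> UNIV v \<and> (\<forall>i<length ss. v (ss ! i, i) = xs ! i) \<and> sat \<MM> UNIV v \<phi>)})"

text \<open>\<open>\<MM> = \<MM>\<^sup>e\<^sup>q\<close>: every quotient of a finite product of sorts by a 0-definable equivalence relation is
  present in some sort, through a 0-definable projection. The projection is not required to be onto
  the sort, since that would not survive naming parameters by constants.\<close>

definition eq_closed :: "('s, 'f, 'r, 'm) fostruct \<Rightarrow> bool" where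
  "eq_closed \<MM> \<longleftrightarrow> (\<forall>ss E. equiv {xs. map (srt \<MM>) xs = ss} E \<and>
     definable0 \<MM> (ss @ ss) {xs @ ys | xs ys. (xs, ys) \<in> E} \<longrightarrow>
     (\<exists>s g. (\<forall>xs. map (srt \<MM>) xs = ss \<longrightarrow> srt \<MM> (g xs) = s) \<and>
        definable0 \<MM> (ss @ [s]) {xs @ [g xs] | xs. map (srt \<MM>) xs = ss} \<and>
        (\<forall>xs ys. map (srt \<MM>) xs = ss \<and> map (srt \<MM>) ys = ss \<longrightarrow> (g xs = g ys \<longleftrightarrow> (xs, ys) \<in> E))))"

definition aut :: "('s, 'f, 'r, 'm) fostruct \<Rightarrow> ('m \<Rightarrow> 'm) set" where
  "aut \<MM> = {\<sigma>. bij \<sigma> \<and> (\<forall>x. srt \<MM> (\<sigma> x) = srt \<MM> x) \<and>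
     (\<forall>f xs. map (srt \<MM>) xs = fdom \<MM> f \<longrightarrow> \<sigma> (fI \<MM> f xs) = fI \<MM> f (map \<sigma> xs)) \<and>
     (\<forall>r xs. map (srt \<MM>) xs = rdom \<MM> r \<longrightarrow> rI \<MM> r (map \<sigma> xs) = rI \<MM> r xs)}"

definition Aut :: "('s, 'f, 'r, 'm) fostruct \<Rightarrow> ('m \<Rightarrow> 'm) monoid" where
  "Aut \<MM> = BijGroup UNIV \<lparr>carrier := aut \<MM>\<rparr>"

section \<open>Independence relations\<close>

text \<open>\<open>R A C D\<close> reads: \<open>A\<close> is independent from \<open>D\<close> over \<open>C\<close>.\<close>

type_synonym 'm indep = "'m set \<Rightarrow> 'm set \<Rightarrow> 'm set \<Rightarrow> bool"

definition indep_relation :: "('s, 'f, 'r, 'm) fostruct \<Rightarrow> 'm indep \<Rightarrow> bool" where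
  "indep_relation \<MM> R \<longleftrightarrow>
     \<comment> \<open>invariance\<close>
     (\<forall>\<sigma>\<in>aut \<MM>. \<forall>A C D. small A \<and> small C \<and> small D \<longrightarrow> R (\<sigma> ` A) (\<sigma> ` C) (\<sigma> ` D) = R A C D) \<and>
     \<comment> \<open>finite character\<close>
     (\<forall>A C D. small A \<and> small C \<and> small D \<longrightarrow>
        R A C D = (\<forall>A0 D0. finite A0 \<and> A0 \<subseteq> A \<and> finite D0 \<and> D0 \<subseteq> D \<longrightarrow> R A0 C D0)) \<and>
     \<comment> \<open>normality\<close>
     (\<forall>A C D. small A \<and> small C \<and> small D \<and> R A C D \<longrightarrow> R A C (acl \<MM> (D \<union> C))) \<and>
     \<comment> \<open>symmetry\<close>
     (\<forall>A C D. small A \<and> small C \<and> small D \<longrightarrow> R A C D = R D C A) \<and>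
     \<comment> \<open>transitivity\<close>
     (\<forall>A C D E. small A \<and> small D \<and> E \<subseteq> C \<and> C \<subseteq> D \<longrightarrow> R A E D = (R A E C \<and> R A C D)) \<and>
     \<comment> \<open>extension\<close>
     (\<forall>A C E. small A \<and> small C \<and> E \<subseteq> C \<longrightarrow> (\<exists>h. elementary_over \<MM> E A h \<and> R (h ` A) E C))"

definition indep_family :: "'m indep \<Rightarrow> 'm set \<Rightarrow> 'i set \<Rightarrow> ('i \<Rightarrow> 'm set) \<Rightarrow> bool" where
  "indep_family R C I F \<longleftrightarrow> (\<forall>i\<in>I. R (F i) C (\<Union>j\<in>I - {i}. F j))"

section \<open>Simplices and homology\<close>

text \<open>Throughout, the elements of \<open>B\<close> are named, so that \<open>B = acl \<MM> {}\<close>. A type \<open>p\<close> is an element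
  \<open>tp \<MM> UNIV a {}\<close>, for a tuple \<open>a\<close> indexed by a type \<open>'i\<close>.\<close>

type_synonym ('s, 'f, 'r, 'm, 'i) ptype = "(('s, 'f, 'r) fm \<times> ('s var \<Rightarrow> 'i + 'm)) set"

definition realizations :: "('s, 'f, 'r, 'm) fostruct \<Rightarrow> ('s, 'f, 'r, 'm, 'i) ptype \<Rightarrow> ('i \<Rightarrow> 'm) set" where
  "realizations \<MM> p = {b. tp \<MM> UNIV b {} = p}"

text \<open>A functor on \<open>Pow s\<close>: \<open>spt\<close> is \<open>s\<close>, \<open>obj u\<close> is the set \<open>f(u)\<close>, and \<open>mor u v\<close> is the map
  \<open>f\<^sup>u\<^sub>v : f(u) \<rightarrow> f(v)\<close>. Everything is extensional, so that equality of records is equality of functors.\<close>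

record 'm cube =
  spt :: "nat set"
  obj :: "nat set \<Rightarrow> 'm set"
  mor :: "nat set \<Rightarrow> nat set \<Rightarrow> 'm \<Rightarrow> 'm"

definition cube_functor :: "('s, 'f, 'r, 'm) fostruct \<Rightarrow> 'm cube \<Rightarrow> bool" where
  "cube_functor \<MM> f \<longleftrightarrow>
     finite (spt f) \<and>
     obj f \<in> extensional (Pow (spt f)) \<and>
     (\<forall>u v. \<not> (u \<subseteq> v \<and> v \<subseteq> spt f) \<longrightarrow> mor f u v = undefined) \<and>
     (\<forall>u. u \<subseteq> spt f \<longrightarrow> small (obj f u) \<and> acl \<MM> {} \<subseteq> obj f u) \<and>
     (\<forall>u v. u \<subseteq> v \<and> v \<subseteq> spt f \<longrightarrow>
        mor f u v \<in> obj f u \<rightarrow>\<^sub>E obj f v \<and> elementary_over \<MM> (acl \<MM> {}) (obj f u) (mor f u v) \<and>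
        (\<forall>x\<in>acl \<MM> {}. mor f u v x = x)) \<and>
     (\<forall>u. u \<subseteq> spt f \<longrightarrow> (\<forall>x\<in>obj f u. mor f u u x = x)) \<and>
     (\<forall>u v w. u \<subseteq> v \<and> v \<subseteq> w \<and> w \<subseteq> spt f \<longrightarrow> (\<forall>x\<in>obj f u. mor f u w x = mor f v w (mor f u v x)))"

definition vertex :: "'m cube \<Rightarrow> nat set \<Rightarrow> nat \<Rightarrow> 'm set" where
  "vertex f u i = mor f {i} u ` obj f {i}"

definition simplices :: "('s, 'f, 'r, 'm) fostruct \<Rightarrow> 'm indep \<Rightarrow> ('s, 'f, 'r, 'm, 'i) ptype \<Rightarrow> nat
    \<Rightarrow> 'm cube set" where
  "simplices \<MM> R p n = {f. cube_functor \<MM> f \<and> card (spt f) = n + 1 \<and>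
      obj f {} = acl \<MM> {} \<and>
      (\<forall>i\<in>spt f. \<exists>b\<in>realizations \<MM> p. obj f {i} = acl \<MM> (range b)) \<and>
      (\<forall>u. u \<noteq> {} \<and> u \<subseteq> spt f \<longrightarrow>
         obj f u = acl \<MM> (\<Union>i\<in>u. vertex f u i) \<and> indep_family R (acl \<MM> {}) u (vertex f u))}"

definition restrict_cube :: "'m cube \<Rightarrow> nat set \<Rightarrow> 'm cube" where
  "restrict_cube f t = \<lparr>spt = t, obj = restrict (obj f) (Pow t),
     mor = (\<lambda>u v. if u \<subseteq> v \<and> v \<subseteq> t then mor f u v else undefined)\<rparr>"

definition face :: "nat \<Rightarrow> 'm cube \<Rightarrow> 'm cube" where
  "face i f = restrict_cube f (spt f - {sorted_list_of_set (spt f) ! i})"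

definition boundary :: "nat \<Rightarrow> ('m cube \<Rightarrow>\<^sub>0 int) \<Rightarrow> ('m cube \<Rightarrow>\<^sub>0 int)" where
  "boundary n c = (if n = 0 then 0
     else frag_extend (\<lambda>f. \<Sum>i\<le>n. frag_cmul ((-1) ^ i) (frag_of (face i f))) c)"

definition chains :: "('s, 'f, 'r, 'm) fostruct \<Rightarrow> 'm indep \<Rightarrow> ('s, 'f, 'r, 'm, 'i) ptype \<Rightarrow> nat
    \<Rightarrow> ('m cube \<Rightarrow>\<^sub>0 int) monoid" where
  "chains \<MM> R p n = free_Abelian_group (simplices \<MM> R p n)"

definition cycles :: "('s, 'f, 'r, 'm) fostruct \<Rightarrow> 'm indep \<Rightarrow> ('s, 'f, 'r, 'm, 'i) ptype \<Rightarrow> nat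
    \<Rightarrow> ('m cube \<Rightarrow>\<^sub>0 int) monoid" where
  "cycles \<MM> R p n = (chains \<MM> R p n)\<lparr>carrier := {c \<in> carrier (chains \<MM> R p n). boundary n c = 0}\<rparr>"

definition boundaries :: "('s, 'f, 'r, 'm) fostruct \<Rightarrow> 'm indep \<Rightarrow> ('s, 'f, 'r, 'm, 'i) ptype \<Rightarrow> nat
    \<Rightarrow> ('m cube \<Rightarrow>\<^sub>0 int) set" where
  "boundaries \<MM> R p n = boundary (Suc n) ` carrier (chains \<MM> R p (Suc n))"

definition homology :: "('s, 'f, 'r, 'm) fostruct \<Rightarrow> 'm indep \<Rightarrow> ('s, 'f, 'r, 'm, 'i) ptype \<Rightarrow> nat
    \<Rightarrow> ('m cube \<Rightarrow>\<^sub>0 int) set monoid" where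
  "homology \<MM> R p n = cycles \<MM> R p n Mod boundaries \<MM> R p n"

section \<open>Shells and endpoint pairs\<close>

text \<open>The 1-shell \<open>f12 - f02 + f01\<close> is given by the triple of its terms. Matching of the faces forces the
  supports to be \<open>{n\<^sub>1,n\<^sub>2}\<close>, \<open>{n\<^sub>0,n\<^sub>2}\<close>, \<open>{n\<^sub>0,n\<^sub>1}\<close> for some \<open>n\<^sub>0 < n\<^sub>1 < n\<^sub>2\<close>.\<close>

definition shell1 :: "('s, 'f, 'r, 'm) fostruct \<Rightarrow> 'm indep \<Rightarrow> ('s, 'f, 'r, 'm, 'i) ptype
    \<Rightarrow> 'm cube \<Rightarrow> 'm cube \<Rightarrow> 'm cube \<Rightarrow> bool" where
  "shell1 \<MM> R p f12 f02 f01 \<longleftrightarrow> {f12, f02, f01} \<subseteq> simplices \<MM> R p 1 \<and>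
     face 0 f02 = face 0 f12 \<and> face 0 f01 = face 1 f12 \<and> face 1 f01 = face 1 f02"

definition shell_chain :: "'m cube \<Rightarrow> 'm cube \<Rightarrow> 'm cube \<Rightarrow> ('m cube \<Rightarrow>\<^sub>0 int)" where
  "shell_chain f12 f02 f01 = frag_of f12 - frag_of f02 + frag_of f01"

definition same_type_pair :: "('s, 'f, 'r, 'm) fostruct \<Rightarrow> ('i \<Rightarrow> 'm) \<Rightarrow> ('i \<Rightarrow> 'm) \<Rightarrow> ('i \<Rightarrow> 'm)
    \<Rightarrow> ('i \<Rightarrow> 'm) \<Rightarrow> bool" where
  "same_type_pair \<MM> a b c d \<longleftrightarrow> tp \<MM> UNIV (case_sum a b) {} = tp \<MM> UNIV (case_sum c d) {}"

definition shell_rep :: "('s, 'f, 'r, 'm) fostruct \<Rightarrow> ('s, 'f, 'r, 'm, 'i) ptype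
    \<Rightarrow> 'm cube \<Rightarrow> 'm cube \<Rightarrow> 'm cube
    \<Rightarrow> ('i \<Rightarrow> 'm) \<Rightarrow> ('i \<Rightarrow> 'm) \<Rightarrow> ('i \<Rightarrow> 'm) \<Rightarrow> ('i \<Rightarrow> 'm) \<Rightarrow> bool" where
  "shell_rep \<MM> p f12 f02 f01 a0 a1 a2 a3 \<longleftrightarrow>
     {a0, a1, a2, a3} \<subseteq> realizations \<MM> p \<and>
     (\<exists>n0 n1 n2 e0 e1 e2. n0 < n1 \<and> n1 < n2 \<and>
        spt f12 = {n1, n2} \<and> spt f02 = {n0, n2} \<and> spt f01 = {n0, n1} \<and>
        {e0, e1, e2} \<subseteq> realizations \<MM> p \<and>
        acl \<MM> (range e0) = obj f01 {n0} \<and> acl \<MM> (range e0) = obj f02 {n0} \<and>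
        acl \<MM> (range e1) = obj f01 {n1} \<and> acl \<MM> (range e1) = obj f12 {n1} \<and>
        acl \<MM> (range e2) = obj f12 {n2} \<and> acl \<MM> (range e2) = obj f02 {n2} \<and>
        same_type_pair \<MM> a0 a1 (mor f01 {n0} {n0, n1} \<circ> e0) (mor f01 {n1} {n0, n1} \<circ> e1) \<and>
        same_type_pair \<MM> a1 a2 (mor f12 {n1} {n1, n2} \<circ> e1) (mor f12 {n2} {n1, n2} \<circ> e2) \<and>
        same_type_pair \<MM> a3 a2 (mor f02 {n0} {n0, n2} \<circ> e0) (mor f02 {n2} {n0, n2} \<circ> e2))"

definition endpoint_pair :: "('s, 'f, 'r, 'm) fostruct \<Rightarrow> ('s, 'f, 'r, 'm, 'i) ptype
    \<Rightarrow> 'm cube \<Rightarrow> 'm cube \<Rightarrow> 'm cube \<Rightarrow> ('i \<Rightarrow> 'm) \<Rightarrow> ('i \<Rightarrow> 'm) \<Rightarrow> bool" where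
  "endpoint_pair \<MM> p f12 f02 f01 a b \<longleftrightarrow> (\<exists>a1 a2. shell_rep \<MM> p f12 f02 f01 a a1 a2 b)"

definition bracket :: "('s, 'f, 'r, 'm) fostruct \<Rightarrow> 'm indep \<Rightarrow> ('s, 'f, 'r, 'm, 'i) ptype
    \<Rightarrow> ('i \<Rightarrow> 'm) \<Rightarrow> ('i \<Rightarrow> 'm) \<Rightarrow> ('m cube \<Rightarrow>\<^sub>0 int) set" where
  "bracket \<MM> R p a b = (THE Z. \<exists>f12 f02 f01. shell1 \<MM> R p f12 f02 f01 \<and>
     spt f12 \<union> spt f02 \<union> spt f01 = {0, 1, 2} \<and> endpoint_pair \<MM> p f12 f02 f01 a b \<and>
     Z = boundaries \<MM> R p 1 #>\<^bsub>cycles \<MM> R p 1\<^esub> shell_chain f12 f02 f01)"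

section \<open>Automorphisms of the realization set and Lascar groups\<close>

definition act :: "('s, 'f, 'r, 'm) fostruct \<Rightarrow> ('s, 'f, 'r, 'm, 'i) ptype \<Rightarrow> ('m \<Rightarrow> 'm)
    \<Rightarrow> ('i \<Rightarrow> 'm) \<Rightarrow> ('i \<Rightarrow> 'm)" where
  "act \<MM> p \<sigma> = (\<lambda>b\<in>realizations \<MM> p. \<sigma> \<circ> b)"

definition Aut_real :: "('s, 'f, 'r, 'm) fostruct \<Rightarrow> ('s, 'f, 'r, 'm, 'i) ptype
    \<Rightarrow> (('i \<Rightarrow> 'm) \<Rightarrow> ('i \<Rightarrow> 'm)) monoid" where
  "Aut_real \<MM> p = BijGroup (realizations \<MM> p) \<lparr>carrier := act \<MM> p ` aut \<MM>\<rparr>"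

definition Autf :: "('s, 'f, 'r, 'm) fostruct \<Rightarrow> ('m \<Rightarrow> 'm) set" where
  "Autf \<MM> = generate (Aut \<MM>)
     {\<sigma> \<in> aut \<MM>. \<exists>U. small U \<and> elem_substructure \<MM> U \<and> (\<forall>x\<in>U. \<sigma> x = x)}"

definition lascar_equiv :: "('s, 'f, 'r, 'm) fostruct \<Rightarrow> ('k \<Rightarrow> 'm) \<Rightarrow> ('k \<Rightarrow> 'm) \<Rightarrow> bool" where
  "lascar_equiv \<MM> u w \<longleftrightarrow> (\<exists>\<sigma>\<in>Autf \<MM>. w = \<sigma> \<circ> u)"

definition Gal_L :: "('s, 'f, 'r, 'm) fostruct \<Rightarrow> ('m \<Rightarrow> 'm) set monoid" where
  "Gal_L \<MM> = Aut \<MM> Mod Autf \<MM>"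

text \<open>A sequence of tuples \<open>s 0, s 1, \<dots>\<close> is regarded as one tuple indexed by \<open>nat \<times> 'i\<close>.\<close>

definition Autf_fix :: "('s, 'f, 'r, 'm) fostruct \<Rightarrow> ('s, 'f, 'r, 'm, 'i) ptype
    \<Rightarrow> (('i \<Rightarrow> 'm) \<Rightarrow> ('i \<Rightarrow> 'm)) set" where
  "Autf_fix \<MM> p = act \<MM> p ` {\<sigma> \<in> aut \<MM>. \<forall>s :: nat \<Rightarrow> 'i \<Rightarrow> 'm. range s \<subseteq> realizations \<MM> p \<longrightarrow>
     lascar_equiv \<MM> (case_prod s) (\<sigma> \<circ> case_prod s)}"

definition Gal_fix :: "('s, 'f, 'r, 'm) fostruct \<Rightarrow> ('s, 'f, 'r, 'm, 'i) ptype
    \<Rightarrow> (('i \<Rightarrow> 'm) \<Rightarrow> ('i \<Rightarrow> 'm)) set monoid" where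
  "Gal_fix \<MM> p = Aut_real \<MM> p Mod Autf_fix \<MM> p"

section \<open>Topologies\<close>

definition quotient_topology :: "'a topology \<Rightarrow> ('a \<Rightarrow> 'b) \<Rightarrow> 'b topology" where
  "quotient_topology S q =
     topology (\<lambda>V. V \<subseteq> q ` topspace S \<and> openin S {x \<in> topspace S. q x \<in> V})"

text \<open>The Stone space of types over \<open>N\<close> of conjugates of \<open>M\<close>, the latter enumerated by itself.\<close>

definition stone_space :: "('s, 'f, 'r, 'm) fostruct \<Rightarrow> 'm set \<Rightarrow> 'm set
    \<Rightarrow> ('s, 'f, 'r, 'm, 'm) ptype topology" where
  "stone_space \<MM> M N = subtopology (topology_generated_by {{q. m \<in> q} | m. True})
     {tp \<MM> M \<sigma> N | \<sigma>. \<sigma> \<in> aut \<MM>}"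

definition nu :: "('s, 'f, 'r, 'm) fostruct \<Rightarrow> 'm set \<Rightarrow> 'm set
    \<Rightarrow> ('s, 'f, 'r, 'm, 'm) ptype \<Rightarrow> ('m \<Rightarrow> 'm) set" where
  "nu \<MM> M N q = Autf \<MM> #>\<^bsub>Aut \<MM>\<^esub> (SOME \<sigma>. \<sigma> \<in> aut \<MM> \<and> tp \<MM> M \<sigma> N = q)"

definition Gal_L_topology :: "('s, 'f, 'r, 'm) fostruct \<Rightarrow> 'm set \<Rightarrow> 'm set
    \<Rightarrow> ('m \<Rightarrow> 'm) set topology" where
  "Gal_L_topology \<MM> M N = quotient_topology (stone_space \<MM> M N) (nu \<MM> M N)"

definition Gal_L_to_fix :: "('s, 'f, 'r, 'm) fostruct \<Rightarrow> ('s, 'f, 'r, 'm, 'i) ptype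
    \<Rightarrow> ('m \<Rightarrow> 'm) set \<Rightarrow> (('i \<Rightarrow> 'm) \<Rightarrow> ('i \<Rightarrow> 'm)) set" where
  "Gal_L_to_fix \<MM> p Z = the_elem ((\<lambda>\<sigma>. Autf_fix \<MM> p #>\<^bsub>Aut_real \<MM> p\<^esub> act \<MM> p \<sigma>) ` Z)"

definition Gal_fix_topology :: "('s, 'f, 'r, 'm) fostruct \<Rightarrow> ('s, 'f, 'r, 'm, 'i) ptype \<Rightarrow> 'm set \<Rightarrow> 'm set
    \<Rightarrow> (('i \<Rightarrow> 'm) \<Rightarrow> ('i \<Rightarrow> 'm)) set topology" where
  "Gal_fix_topology \<MM> p M N = quotient_topology (Gal_L_topology \<MM> M N) (Gal_L_to_fix \<MM> p)"

definition topological_group :: "('a, 'b) monoid_scheme \<Rightarrow> 'a topology \<Rightarrow> bool" where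
  "topological_group G T \<longleftrightarrow> group G \<and> topspace T = carrier G \<and>
     continuous_map (prod_topology T T) T (\<lambda>(x, y). x \<otimes>\<^bsub>G\<^esub> y) \<and>
     continuous_map T T (\<lambda>x. inv\<^bsub>G\<^esub> x)"

section \<open>The maps onto the first homology group\<close>

definition psi :: "('s, 'f, 'r, 'm) fostruct \<Rightarrow> 'm indep \<Rightarrow> ('s, 'f, 'r, 'm, 'i) ptype \<Rightarrow> ('i \<Rightarrow> 'm)
    \<Rightarrow> (('i \<Rightarrow> 'm) \<Rightarrow> ('i \<Rightarrow> 'm)) \<Rightarrow> ('m cube \<Rightarrow>\<^sub>0 int) set" where
  "psi \<MM> R p a g = bracket \<MM> R p a (g a)"

definition Gal_L_to_H1 :: "('s, 'f, 'r, 'm) fostruct \<Rightarrow> 'm indep \<Rightarrow> ('s, 'f, 'r, 'm, 'i) ptype \<Rightarrow> ('i \<Rightarrow> 'm)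
    \<Rightarrow> ('m \<Rightarrow> 'm) set \<Rightarrow> ('m cube \<Rightarrow>\<^sub>0 int) set" where
  "Gal_L_to_H1 \<MM> R p a Z = the_elem ((\<lambda>\<sigma>. psi \<MM> R p a (act \<MM> p \<sigma>)) ` Z)"

definition Gal_fix_to_H1 :: "('s, 'f, 'r, 'm) fostruct \<Rightarrow> 'm indep \<Rightarrow> ('s, 'f, 'r, 'm, 'i) ptype \<Rightarrow> ('i \<Rightarrow> 'm)
    \<Rightarrow> (('i \<Rightarrow> 'm) \<Rightarrow> ('i \<Rightarrow> 'm)) set \<Rightarrow> ('m cube \<Rightarrow>\<^sub>0 int) set" where
  "Gal_fix_to_H1 \<MM> R p a Z = the_elem (psi \<MM> R p a ` Z)"

definition H1_topology :: "('s, 'f, 'r, 'm) fostruct \<Rightarrow> 'm indep \<Rightarrow> ('s, 'f, 'r, 'm, 'i) ptype \<Rightarrow> ('i \<Rightarrow> 'm)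
    \<Rightarrow> 'm set \<Rightarrow> 'm set \<Rightarrow> ('m cube \<Rightarrow>\<^sub>0 int) set topology" where
  "H1_topology \<MM> R p a M N = quotient_topology (Gal_L_topology \<MM> M N) (Gal_L_to_H1 \<MM> R p a)"

end

theory Submission
  imports Defs
begin

text \<open>Up to boundaries, a 1-simplex with ends \<open>b\<close> and \<open>c\<close> depends only on the type of \<open>(b, c)\<close>, and going from \<open>b\<close> to \<open>c\<close> through
  a point independent of both gives a class \<open>\<beta>(b, c)\<close> for every pair of realizations, independent or not. This \<open>\<beta>\<close> is an invariant
  cocycle, \<open>\<beta>(b, c) + \<beta>(c, d) = \<beta>(b, d)\<close>, and \<open>[b, c] = \<beta>(b, c)\<close>. Conversely, any invariant cocycle \<open>D\<close> with values in an abelian group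
  can be evaluated on 1-chains, kills boundaries, and takes the value \<open>D(b, c)\<close> on a shell with endpoint pair \<open>(b, c)\<close>.
  So if \<open>[a, \<sigma>a] = 0\<close> for one independence relation, evaluating the \<open>\<beta>\<close> of another one on a shell shows that \<open>[a, \<sigma>a] = 0\<close> for that
  relation, too. An automorphism \<open>\<sigma>\<close> fixing a model is in the kernel since some realization \<open>c\<close> has \<open>tp(ca) = tp(c\<sigma>a)\<close>, whence
  \<open>[a, \<sigma>a] = [c, c] = 0\<close>.

  The topology is that of a quotient of a compact Hausdorff type space, on which the group law is induced by the compact space
  of types of pairs; continuity of the multiplication follows from a tube argument, even if the quotient is not Hausdorff.\<close>

text \<open>A simplex gives its vertices only as sets \<open>acl(b)\<close>, whereas a cocycle needs
  realizations as arguments. One realization is therefore picked per vertex set; another pick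
  changes the value on an edge by terms attached to its two ends, and these cancel around a shell or
  in a cycle. The axioms yield independent realizations but no uniqueness of their types, so two
  auxiliary points need not be conjugate over the given ones. One is exchanged for the other by
  triangles through a third point, independent of everything in sight. Identities are stated as
  membership of a difference in a subgroup of the formal sums of cubes, rather than in the homology
  group. Simplices for all relations live in that one group, so a cocycle modulo the boundaries of
  one relation can be evaluated on the chains of another. By saturation an elementary map between
  small sets is the restriction of an automorphism. So a simplex is a cube of inclusions with each
  face moved by an automorphism, and the freedom in these automorphisms is what proves that \<beta>
  is invariant.\<close>

declare split_paired_All [simp del] split_paired_Ex [simp del]

section \<open>Definable predicates\<close>

lemma tm_val_cong: "(\<And>x. x \<in> tm_vars t \<Longrightarrow> v x = w x) \<Longrightarrow> tm_val M v t = tm_val M w t"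
proof (induction t)
  case (Fn f ts)
  then have "map (tm_val M v) ts = map (tm_val M w) ts" by auto
  then show ?case by (simp del: map_eq_conv)
qed auto

lemma sat_cong: "(\<And>x. x \<in> FV \<phi> \<Longrightarrow> v x = w x) \<Longrightarrow> sat M U v \<phi> = sat M U w \<phi>"
proof (induction \<phi> arbitrary: v w)
  case (Eq t u)
  then show ?case using tm_val_cong[of t v w M] tm_val_cong[of u v w M] by auto
next
  case (Rel r ts)
  then have "map (tm_val M v) ts = map (tm_val M w) ts"
    by (auto intro!: tm_val_cong)
  then show ?case by (simp del: map_eq_conv)
next
  case (Neg \<phi>)
  have "sat M U v \<phi> = sat M U w \<phi>" by (rule Neg.IH) (use Neg.prems in auto)
  then show ?case by simp
next
  case (And \<phi> \<psi>)
  have "sat M U v \<phi> = sat M U w \<phi>" by (rule And.IH) (use And.prems in auto)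
  moreover have "sat M U v \<psi> = sat M U w \<psi>" by (rule And.IH) (use And.prems in auto)
  ultimately show ?case by simp
next
  case (Ex x \<phi>)
  have "sat M U (v(x := y)) \<phi> = sat M U (w(x := y)) \<phi>" for y
    by (rule Ex.IH) (use Ex.prems in auto)
  then show ?case by simp
qed

lemma finite_tm_vars: "finite (tm_vars t)"
  by (induction t) auto

lemma finite_FV: "finite (FV \<phi>)"
  by (induction \<phi>) (auto simp: finite_tm_vars)

section \<open>Change of variables in formulas\<close>

primrec tm_ren :: "('s var \<Rightarrow> 's var) \<Rightarrow> ('s, 'f) tm \<Rightarrow> ('s, 'f) tm" where
  "tm_ren \<rho> (Var x) = Var (\<rho> x)"
| "tm_ren \<rho> (Fn f ts) = Fn f (map (tm_ren \<rho>) ts)"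

lemma tm_ren_sort: "(\<And>x. fst (\<rho> x) = fst x) \<Longrightarrow> tm_sort M (tm_ren \<rho> t) = tm_sort M t"
  by (cases t) auto

lemma tm_ren_ok: "(\<And>x. fst (\<rho> x) = fst x) \<Longrightarrow> tm_ok M (tm_ren \<rho> t) = tm_ok M t"
proof (induction t)
  case (Fn f ts)
  have "map (tm_sort M) (map (tm_ren \<rho>) ts) = map (tm_sort M) ts"
    using Fn.prems by (simp add: tm_ren_sort)
  with Fn show ?case by (auto simp del: map_eq_conv)
qed auto

lemma tm_ren_vars: "tm_vars (tm_ren \<rho> t) = \<rho> ` tm_vars t"
  by (induction t) auto

lemma tm_ren_val: "tm_val M v (tm_ren \<rho> t) = tm_val M (\<lambda>x. v (\<rho> x)) t"
proof (induction t)
  case (Fn f ts)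
  then have "map (tm_val M v) (map (tm_ren \<rho>) ts) = map (tm_val M (\<lambda>x. v (\<rho> x))) ts" by auto
  then show ?case by (simp del: map_eq_conv map_map)
qed auto

text \<open>Bound variables are renamed to fresh ones, so \<open>\<rho>\<close> need not be injective.\<close>

lemma fm_subst:
  assumes "\<And>x. fst (\<rho> x) = fst x" and "fm_ok M \<phi>"
  shows "\<exists>\<phi>'. fm_ok M \<phi>' \<and> FV \<phi>' = \<rho> ` FV \<phi> \<and> (\<forall>v U. sat M U v \<phi>' = sat M U (\<lambda>x. v (\<rho> x)) \<phi>)"
  using assms
proof (induction \<phi> arbitrary: \<rho>)
  case (Eq t u)
  then show ?case
    by (intro exI[of _ "Eq (tm_ren \<rho> t) (tm_ren \<rho> u)"])
      (auto simp: tm_ren_ok tm_ren_sort tm_ren_vars tm_ren_val)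
next
  case (Rel r ts)
  have 1: "tm_sort M \<circ> tm_ren \<rho> = tm_sort M"
    by (rule ext) (simp add: tm_ren_sort[OF Rel.prems(1)])
  have 2: "map (tm_val M v) (map (tm_ren \<rho>) ts) = map (tm_val M (\<lambda>x. v (\<rho> x))) ts" for v
    by (simp add: tm_ren_val)
  have "fm_ok M (Rel r (map (tm_ren \<rho>) ts))"
    using Rel.prems by (simp add: 1 tm_ren_ok)
  then show ?case
    using 2 by (intro exI[of _ "Rel r (map (tm_ren \<rho>) ts)"]) (auto simp: tm_ren_vars simp del: map_map map_eq_conv)
next
  case (Neg \<phi>)
  then obtain \<phi>' where "fm_ok M \<phi>'" "FV \<phi>' = \<rho> ` FV \<phi>" "\<And>v U. sat M U v \<phi>' = sat M U (\<lambda>x. v (\<rho> x)) \<phi>"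
    by (metis fm_ok.simps(3))
  then show ?case by (intro exI[of _ "Neg \<phi>'"]) auto
next
  case (And \<phi> \<psi>)
  then obtain \<phi>' where "fm_ok M \<phi>'" "FV \<phi>' = \<rho> ` FV \<phi>" "\<And>v U. sat M U v \<phi>' = sat M U (\<lambda>x. v (\<rho> x)) \<phi>"
    by (metis fm_ok.simps(4))
  moreover from And obtain \<psi>' where "fm_ok M \<psi>'" "FV \<psi>' = \<rho> ` FV \<psi>" "\<And>v U. sat M U v \<psi>' = sat M U (\<lambda>x. v (\<rho> x)) \<psi>"
    by (metis fm_ok.simps(4))
  ultimately show ?case by (intro exI[of _ "And \<phi>' \<psi>'"]) auto
next
  case (Ex x \<phi>)
  have "finite (snd ` \<rho> ` FV \<phi>)" by (simp add: finite_FV)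
  then obtain n where n: "n \<notin> snd ` \<rho> ` FV \<phi>" using ex_new_if_finite infinite_UNIV_nat by blast
  define x' where "x' = (fst x, n)"
  have x': "x' \<notin> \<rho> ` FV \<phi>"
  proof
    assume "x' \<in> \<rho> ` FV \<phi>"
    then have "snd x' \<in> snd ` \<rho> ` FV \<phi>" by (rule imageI)
    with n show False by (simp add: x'_def)
  qed
  have "\<And>y. fst ((\<rho>(x := x')) y) = fst y" using Ex.prems by (auto simp: x'_def)
  then obtain \<phi>' where \<phi>': "fm_ok M \<phi>'" "FV \<phi>' = \<rho>(x := x') ` FV \<phi>"
      "\<And>v U. sat M U v \<phi>' = sat M U (\<lambda>z. v ((\<rho>(x := x')) z)) \<phi>"
    using Ex.IH[of "\<rho>(x := x')"] Ex.prems by auto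
  have "FV (Ex x' \<phi>') = \<rho> ` FV (Ex x \<phi>)"
    using x' \<phi>'(2) by (auto simp: image_iff split: if_splits)
  moreover have "sat M U v (Ex x' \<phi>') = sat M U (\<lambda>x. v (\<rho> x)) (Ex x \<phi>)" for U v
  proof -
    have "sat M U (v(x' := y)) \<phi>' = sat M U ((\<lambda>z. v (\<rho> z))(x := y)) \<phi>" for y
      unfolding \<phi>'(3) by (rule sat_cong) (use x' in auto)
    then show ?thesis by (simp add: x'_def)
  qed
  ultimately show ?case using \<phi>'(1) by (intro exI[of _ "Ex x' \<phi>'"]) auto
qed

definition sorted_on :: "('s, 'f, 'r, 'm) fostruct \<Rightarrow> ('t \<Rightarrow> 's) \<Rightarrow> 't set \<Rightarrow> ('t \<Rightarrow> 'm) \<Rightarrow> bool" where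
  "sorted_on M s T u \<longleftrightarrow> (\<forall>t\<in>T. srt M (u t) = s t)"

text \<open>\<open>dfn M s T P\<close>: the predicate \<open>P\<close> on tuples \<open>u\<close>, whose entry number \<open>t\<close> has sort \<open>s t\<close>, is defined
  by a formula that mentions only entries in \<open>T\<close>. This replaces substitution of tuples into formulas.\<close>

definition dfn :: "('s, 'f, 'r, 'm) fostruct \<Rightarrow> ('t \<Rightarrow> 's) \<Rightarrow> 't set \<Rightarrow> (('t \<Rightarrow> 'm) \<Rightarrow> bool) \<Rightarrow> bool" where
  "dfn M s T P \<longleftrightarrow> (\<exists>\<phi> e. fm_ok M \<phi> \<and> (\<forall>x\<in>FV \<phi>. e x \<in> T \<and> s (e x) = fst x) \<and>
     (\<forall>u v. sorted_on M s T u \<longrightarrow> valuation M UNIV v \<longrightarrow> (\<forall>x\<in>FV \<phi>. v x = u (e x)) \<longrightarrow>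
        P u = sat M UNIV v \<phi>))"

lemma sorted_on_subset: "sorted_on M s T u \<Longrightarrow> T' \<subseteq> T \<Longrightarrow> sorted_on M s T' u"
  by (auto simp: sorted_on_def)

lemma valuation_upd: "valuation M U v \<Longrightarrow> y \<in> U \<Longrightarrow> srt M y = fst x \<Longrightarrow> valuation M U (v(x := y))"
  by (auto simp: valuation_def)

text \<open>Normal form: entry \<open>t\<close> is named by the variable
  \<open>(s t, code t)\<close>, so that the formulas of several predicates use the same names and
  can be combined under one valuation.\<close>

definition nform where
  "nform M s T P T0 code \<phi> \<longleftrightarrow> fm_ok M \<phi> \<and> FV \<phi> \<subseteq> (\<lambda>t. (s t, code t :: nat)) ` T0 \<and>
     (\<forall>u v. sorted_on M s T u \<longrightarrow> valuation M UNIV v \<longrightarrow> (\<forall>t\<in>T0. v (s t, code t) = u t) \<longrightarrow>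
        P u = sat M UNIV v \<phi>)"

text \<open>The finite support \<open>T0\<close> is found before \<open>code\<close> is given: two
  predicates can then be coded together, by one \<open>code\<close> that is injective on the union
  of their supports.\<close>

lemma dfn_normal:
  fixes s :: "'t \<Rightarrow> 's"
  assumes "dfn M s T P"
  shows "\<exists>T0. finite T0 \<and> T0 \<subseteq> T \<and> (\<forall>code. \<exists>\<phi>. nform M s T P T0 code \<phi>)"
proof -
  obtain \<phi> e where \<phi>: "fm_ok M \<phi>" "\<And>x. x \<in> FV \<phi> \<Longrightarrow> e x \<in> T \<and> s (e x) = fst x"
      "\<And>u v. sorted_on M s T u \<Longrightarrow> valuation M UNIV v \<Longrightarrow> (\<And>x. x \<in> FV \<phi> \<Longrightarrow> v x = u (e x)) \<Longrightarrow>
        P u = sat M UNIV v \<phi>"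
    using assms unfolding dfn_def by blast
  show ?thesis
  proof (intro exI[of _ "e ` FV \<phi>"] conjI allI)
    show "finite (e ` FV \<phi>)" by (simp add: finite_FV)
    show "e ` FV \<phi> \<subseteq> T" using \<phi> by auto
    fix code :: "'t \<Rightarrow> nat"
    define \<rho> where "\<rho> x = (if x \<in> FV \<phi> then (fst x, code (e x)) else x)" for x
    have \<rho>: "fst (\<rho> x) = fst x" for x by (simp add: \<rho>_def)
    obtain \<phi>' where \<phi>': "fm_ok M \<phi>'" "FV \<phi>' = \<rho> ` FV \<phi>" "\<And>v U. sat M U v \<phi>' = sat M U (\<lambda>x. v (\<rho> x)) \<phi>"
      using fm_subst[of \<rho> M \<phi>] \<rho> \<phi>(1) by blast
    have "FV \<phi>' \<subseteq> (\<lambda>t. (s t, code t)) ` e ` FV \<phi>"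
      unfolding \<phi>'(2)
    proof
      fix z assume "z \<in> \<rho> ` FV \<phi>"
      then obtain x where "x \<in> FV \<phi>" "z = (fst x, code (e x))" by (auto simp: \<rho>_def)
      then show "z \<in> (\<lambda>t. (s t, code t)) ` e ` FV \<phi>" using \<phi>(2)[of x] by force
    qed
    moreover have "P u = sat M UNIV v \<phi>'"
      if "sorted_on M s T u" "valuation M UNIV v" "\<forall>t\<in>e ` FV \<phi>. v (s t, code t) = u t" for u v
      unfolding \<phi>'(3)
    proof (rule \<phi>(3))
      show "valuation M UNIV (\<lambda>x. v (\<rho> x))" using that(2) \<rho> by (auto simp: valuation_def)
      show "v (\<rho> x) = u (e x)" if "x \<in> FV \<phi>" for x
        using \<open>\<forall>t\<in>e ` FV \<phi>. v (s t, code t) = u t\<close> that \<phi>(2)[OF that] by (auto simp: \<rho>_def)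
    qed fact
    ultimately show "\<exists>\<phi>'. nform M s T P (e ` FV \<phi>) code \<phi>'"
      using \<phi>'(1) unfolding nform_def by blast
  qed
qed

text \<open>Agreement of \<open>v\<close> with \<open>u\<close> is assumed only at the free
  variables of the formula, as \<open>dfn\<close> guarantees nothing at other variables.\<close>

lemma dfn_intro:
  fixes code :: "'t \<Rightarrow> nat"
  assumes "T0 \<subseteq> T" "inj_on code T0" "fm_ok M \<phi>" "FV \<phi> \<subseteq> (\<lambda>t. (s t, code t)) ` T0"
    and "\<And>u v. sorted_on M s T u \<Longrightarrow> valuation M UNIV v \<Longrightarrow>
           (\<And>t. t \<in> T0 \<Longrightarrow> (s t, code t) \<in> FV \<phi> \<Longrightarrow> v (s t, code t) = u t) \<Longrightarrow>
          P u = sat M UNIV v \<phi>"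
  shows "dfn M s T P"
proof -
  define c where "c t = (s t, code t)" for t
  define e where "e = inv_into T0 c"
  have inj: "inj_on c T0" using assms(2) by (auto simp: c_def inj_on_def)
  have e: "e (c t) = t" if "t \<in> T0" for t using that inj by (simp add: e_def)
  have FV: "\<exists>t\<in>T0. x = c t" if "x \<in> FV \<phi>" for x using assms(4) that by (auto simp: c_def)
  show ?thesis
    unfolding dfn_def
  proof (intro exI conjI ballI allI impI)
    fix x assume "x \<in> FV \<phi>"
    then obtain t where "t \<in> T0" "x = c t" using FV by blast
    then show "e x \<in> T" "s (e x) = fst x"
      using e assms(1) by (auto simp: c_def)
  next
    fix u v assume "sorted_on M s T u" "valuation M UNIV v" "\<forall>x\<in>FV \<phi>. v x = u (e x)"
    then show "P u = sat M UNIV v \<phi>"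
      using e by (intro assms(5)) (auto simp: c_def)
  qed fact
qed

lemma finite_code:
  assumes "finite T0"
  obtains code :: "'t \<Rightarrow> nat" where "inj_on code T0"
  using finite_imp_inj_to_nat_seg[OF assms] by blast

section \<open>Closure properties of definable predicates\<close>

lemma dfn_Not:
  assumes "dfn M s T P"
  shows "dfn M s T (\<lambda>u. \<not> P u)"
proof -
  obtain \<phi> e where "fm_ok M \<phi>" "\<forall>x\<in>FV \<phi>. e x \<in> T \<and> s (e x) = fst x"
      "\<forall>u v. sorted_on M s T u \<longrightarrow> valuation M UNIV v \<longrightarrow> (\<forall>x\<in>FV \<phi>. v x = u (e x)) \<longrightarrow> P u = sat M UNIV v \<phi>"
    using assms unfolding dfn_def by blast
  then show ?thesis
    unfolding dfn_def by (intro exI[of _ "Neg \<phi>"] exI[of _ e]) auto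
qed

lemma dfn_conj:
  fixes s :: "'t \<Rightarrow> 's"
  assumes P: "dfn M s T P" and Q: "dfn M s T Q"
  shows "dfn M s T (\<lambda>u. P u \<and> Q u)"
proof -
  obtain T0 where T0: "finite T0" "T0 \<subseteq> T" and
    P: "\<And>code. \<exists>\<phi>. nform M s T P T0 code \<phi>"
    using dfn_normal[OF P] by blast
  obtain T1 where T1: "finite T1" "T1 \<subseteq> T" and
    Q: "\<And>code. \<exists>\<phi>. nform M s T Q T1 code \<phi>"
    using dfn_normal[OF Q] by blast
  obtain code :: "'t \<Rightarrow> nat" where code: "inj_on code (T0 \<union> T1)"
    using finite_code[of "T0 \<union> T1"] T0 T1 by blast
  obtain \<phi> \<psi> where *: "fm_ok M \<phi>" "FV \<phi> \<subseteq> (\<lambda>t. (s t, code t)) ` T0"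
      "\<And>u v. sorted_on M s T u \<Longrightarrow> valuation M UNIV v \<Longrightarrow> (\<forall>t\<in>T0. v (s t, code t) = u t) \<Longrightarrow>
          P u = sat M UNIV v \<phi>"
      "fm_ok M \<psi>" "FV \<psi> \<subseteq> (\<lambda>t. (s t, code t)) ` T1"
      "\<And>u v. sorted_on M s T u \<Longrightarrow> valuation M UNIV v \<Longrightarrow> (\<forall>t\<in>T1. v (s t, code t) = u t) \<Longrightarrow>
          Q u = sat M UNIV v \<psi>"
    using P[of code] Q[of code] unfolding nform_def by blast
  show ?thesis
  proof (rule dfn_intro[of "T0 \<union> T1" _ code _ "And \<phi> \<psi>"])
    fix u v assume u: "sorted_on M s T u" and v: "valuation M UNIV v"
      and eq: "\<And>t. t \<in> T0 \<union> T1 \<Longrightarrow> (s t, code t) \<in> FV (And \<phi> \<psi>) \<Longrightarrow> v (s t, code t) = u t"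
    define c where "c t = (s t, code t)" for t
    have inj: "inj_on c (T0 \<union> T1)" using code by (auto simp: c_def inj_on_def)
    \<comment> \<open>\<open>v\<close> is known to agree with \<open>u\<close> only at free
      variables, but the two normal forms want agreement at all coded variables; \<open>w\<close> is
      \<open>v\<close> corrected at the others.\<close>
    define w where "w x = (if x \<in> c ` (T0 \<union> T1) then u (inv_into (T0 \<union> T1) c x) else v x)" for x
    have w: "w (c t) = u t" if "t \<in> T0 \<union> T1" for t using that inj by (auto simp: w_def)
    have "valuation M UNIV w"
    proof -
      have "srt M (w x) = fst x" for x
      proof (cases "x \<in> c ` (T0 \<union> T1)")
        case True
        then obtain t where t: "t \<in> T0 \<union> T1" "x = c t" by auto
        then have "w x = u t" using w by simp
        moreover have "srt M (u t) = s t"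
          using u t T0 T1 by (auto simp: sorted_on_def)
        ultimately show ?thesis using t by (simp add: c_def)
      next
        case False then show ?thesis using v by (simp add: w_def valuation_def)
      qed
      then show ?thesis by (simp add: valuation_def)
    qed
    moreover have "\<forall>t\<in>T0. w (s t, code t) = u t" "\<forall>t\<in>T1. w (s t, code t) = u t"
      using w by (auto simp: c_def)
    ultimately have "(P u \<and> Q u) = sat M UNIV w (And \<phi> \<psi>)"
      using *(3,6) u by auto
    also have "\<dots> = sat M UNIV v (And \<phi> \<psi>)"
    proof (rule sat_cong)
      fix x assume x: "x \<in> FV (And \<phi> \<psi>)"
      then obtain t where "t \<in> T0 \<union> T1" "x = c t" using *(2,5) by (auto simp: c_def)
      then show "w x = v x" using w eq x by (auto simp: c_def)
    qed
    finally show "(P u \<and> Q u) = sat M UNIV v (And \<phi> \<psi>)" .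
  qed (use * T0 T1 code in auto)
qed

lemma dfn_cong:
  assumes "dfn M s T P" "\<And>u. sorted_on M s T u \<Longrightarrow> P u = Q u"
  shows "dfn M s T Q"
  using assms unfolding dfn_def by (metis (no_types, lifting))

lemma dfn_reindex:
  assumes P: "dfn M s T P" and g: "\<And>t. t \<in> T \<Longrightarrow> g t \<in> T'" "\<And>t. t \<in> T \<Longrightarrow> s' (g t) = s t"
  shows "dfn M s' T' (\<lambda>u. P (\<lambda>t. u (g t)))"
proof -
  obtain \<phi> e where \<phi>: "fm_ok M \<phi>" "\<forall>x\<in>FV \<phi>. e x \<in> T \<and> s (e x) = fst x"
      "\<forall>u v. sorted_on M s T u \<longrightarrow> valuation M UNIV v \<longrightarrow> (\<forall>x\<in>FV \<phi>. v x = u (e x)) \<longrightarrow> P u = sat M UNIV v \<phi>"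
    using P unfolding dfn_def by blast
  show ?thesis
    unfolding dfn_def
  proof (intro exI[of _ \<phi>] exI[of _ "g \<circ> e"] conjI ballI allI impI)
    fix u v assume "sorted_on M s' T' u" "valuation M UNIV v" "\<forall>x\<in>FV \<phi>. v x = u ((g \<circ> e) x)"
    moreover from this g have "sorted_on M s T (\<lambda>t. u (g t))" by (auto simp: sorted_on_def)
    ultimately show "P (\<lambda>t. u (g t)) = sat M UNIV v \<phi>" using \<phi>(3) by auto
  qed (use \<phi> g in auto)
qed

lemma dfn_mono: "dfn M s T P \<Longrightarrow> T \<subseteq> T' \<Longrightarrow> dfn M s T' P"
  using dfn_reindex[of M s T P "\<lambda>t. t" T' s] by auto

lemma dfn_eq: "s t = s t' \<Longrightarrow> dfn M s {t, t'} (\<lambda>u. u t = u t')"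
  unfolding dfn_def
  by (intro exI[of _ "Eq (Var (s t, 0)) (Var (s t', 1))"] exI[of _ "\<lambda>x. if snd x = 0 then t else t'"]) auto

lemma dfn_ex:
  fixes s :: "'t \<Rightarrow> 's"
  assumes P: "dfn M s T P"
  shows "dfn M s (T - {t}) (\<lambda>u. \<exists>y. srt M y = s t \<and> P (u(t := y)))"
proof -
  obtain T0 where T0: "finite T0" "T0 \<subseteq> T" and
    P: "\<And>code. \<exists>\<phi>. nform M s T P T0 code \<phi>"
    using dfn_normal[OF P] by blast
  \<comment> \<open>\<open>t\<close> is included even if it does not belong to \<open>T0\<close>:
    the bound variable \<open>(s t, code t)\<close> must differ from the names of the other
    entries.\<close>
  obtain code :: "'t \<Rightarrow> nat" where code: "inj_on code (insert t T0)"
    using finite_code[of "insert t T0"] T0 by blast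
  obtain \<phi> where \<phi>: "fm_ok M \<phi>" "FV \<phi> \<subseteq> (\<lambda>t. (s t, code t)) ` T0"
      "\<And>u v. sorted_on M s T u \<Longrightarrow> valuation M UNIV v \<Longrightarrow> (\<forall>t\<in>T0. v (s t, code t) = u t) \<Longrightarrow>
          P u = sat M UNIV v \<phi>"
    using P[of code] unfolding nform_def by blast
  have FV: "FV (Ex (s t, code t) \<phi>) \<subseteq> (\<lambda>t. (s t, code t)) ` (T0 - {t})"
    using \<phi>(2) by auto
  show ?thesis
  proof (rule dfn_intro[of "T0 - {t}" _ code _ "Ex (s t, code t) \<phi>"])
    fix u v assume u: "sorted_on M s (T - {t}) u" and v: "valuation M UNIV v"
      and eq: "\<And>t'. t' \<in> T0 - {t} \<Longrightarrow> (s t', code t') \<in> FV (Ex (s t, code t) \<phi>) \<Longrightarrow> v (s t', code t') = u t'"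
    define c where "c t = (s t, code t)" for t
    have inj: "inj_on c (insert t T0)" using code by (auto simp: c_def inj_on_def)
    define w where "w x = (if x \<in> c ` (T0 - {t}) then u (inv_into (T0 - {t}) c x) else v x)" for x
    have w: "w (c t') = u t'" if "t' \<in> T0 - {t}" for t'
      using that inj by (auto simp: w_def inj_on_def intro!: inv_into_f_eq)
    have wv: "valuation M UNIV w"
    proof -
      have "srt M (w x) = fst x" for x
      proof (cases "x \<in> c ` (T0 - {t})")
        case True
        then obtain t' where t: "t' \<in> T0 - {t}" "x = c t'" by auto
        then have "w x = u t'" using w by simp
        moreover have "srt M (u t') = s t'"
          using u t T0 by (auto simp: sorted_on_def)
        ultimately show ?thesis using t by (simp add: c_def)
      next
        case False then show ?thesis using v by (simp add: w_def valuation_def)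
      qed
      then show ?thesis by (simp add: valuation_def)
    qed
    have "P (u(t := y)) = sat M UNIV (w(c t := y)) \<phi>" if y: "srt M y = s t" for y
    proof (rule \<phi>(3))
      show "sorted_on M s T (u(t := y))" using u y by (auto simp: sorted_on_def)
      show "valuation M UNIV (w(c t := y))" using wv y by (auto simp: valuation_def c_def)
      show "\<forall>t'\<in>T0. (w(c t := y)) (s t', code t') = (u(t := y)) t'"
        using w inj by (auto simp: c_def[symmetric] inj_on_def)
    qed
    then have "(\<exists>y. srt M y = s t \<and> P (u(t := y))) = sat M UNIV w (Ex (s t, code t) \<phi>)"
      by (auto simp: c_def)
    also have "\<dots> = sat M UNIV v (Ex (s t, code t) \<phi>)"
    proof (rule sat_cong)
      fix x assume x: "x \<in> FV (Ex (s t, code t) \<phi>)"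
      then obtain t' where "t' \<in> T0 - {t}" "x = c t'" using FV by (force simp: c_def)
      then show "w x = v x" using w eq x by (auto simp: c_def)
    qed
    finally show "(\<exists>y. srt M y = s t \<and> P (u(t := y))) = sat M UNIV v (Ex (s t, code t) \<phi>)" .
  qed (use \<phi>(1) FV T0 in \<open>auto intro: inj_on_subset[OF code]\<close>)
qed

text \<open>\<open>T\<close> may be empty, so the tautology has to be a closed formula.\<close>

lemma dfn_True: "dfn M s T (\<lambda>u. True)"
  unfolding dfn_def
  by (intro exI[of _ "Neg (And (Ex x (Eq (Var x) (Var x))) (Neg (Ex x (Eq (Var x) (Var x)))))"] exI) auto

lemma dfn_Ball: "finite F \<Longrightarrow> (\<And>P. P \<in> F \<Longrightarrow> dfn M s T P) \<Longrightarrow> dfn M s T (\<lambda>u. \<forall>P\<in>F. P u)"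
proof (induction rule: finite_induct)
  case empty
  then show ?case by (simp add: dfn_True)
next
  case (insert P F)
  then have "dfn M s T (\<lambda>u. P u \<and> (\<forall>P\<in>F. P u))" by (intro dfn_conj) auto
  then show ?case by simp
qed

lemma dfn_iff:
  assumes "dfn M s T P" "dfn M s T Q"
  shows "dfn M s T (\<lambda>u. P u \<longleftrightarrow> Q u)"
proof -
  have "dfn M s T (\<lambda>u. \<not> (P u \<and> \<not> Q u) \<and> \<not> (Q u \<and> \<not> P u))"
    by (intro dfn_conj dfn_Not assms)
  then show ?thesis by (rule dfn_cong) auto
qed

section \<open>Saturation and homogeneity\<close>

locale monster_model =
  fixes \<MM> :: "('s, 'f, 'r, 'm) fostruct"
  assumes monster: "monster \<MM>"
begin

lemma wf: "wf_struct \<MM>"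
  using monster by (simp add: monster_def)

lemma valuation_extend:
  assumes "\<And>x. x \<in> X \<Longrightarrow> srt \<MM> (g x) = fst x"
  obtains v where "valuation \<MM> UNIV v" "\<And>x. x \<in> X \<Longrightarrow> v x = g x"
proof -
  have "\<exists>y. srt \<MM> y = s" for s using wf by (auto simp: wf_struct_def)
  then have "valuation \<MM> UNIV (\<lambda>x. if x \<in> X then g x else SOME y. srt \<MM> y = fst x)"
    unfolding valuation_def using assms by (auto intro: someI_ex)
  then show thesis by (rule that) auto
qed

text \<open>A formula mentions finitely many entries. \<open>P\<close> itself is tied to its formula
  only on tuples sorted on all of \<open>T\<close>; hence it is replaced by the predicate
  \<open>P'\<close> read off from the formula, which makes sense for tuples sorted on the finite
  support only.\<close>

lemma dfn_support:
  assumes "dfn \<MM> s T P"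
  obtains T0 P' where "finite T0" "T0 \<subseteq> T" "dfn \<MM> s T0 P'" "\<And>u. sorted_on \<MM> s T u \<Longrightarrow> P u = P' u"
proof -
  obtain \<phi> e where \<phi>: "fm_ok \<MM> \<phi>" "\<forall>x\<in>FV \<phi>. e x \<in> T \<and> s (e x) = fst x"
      "\<forall>u v. sorted_on \<MM> s T u \<longrightarrow> valuation \<MM> UNIV v \<longrightarrow> (\<forall>x\<in>FV \<phi>. v x = u (e x)) \<longrightarrow> P u = sat \<MM> UNIV v \<phi>"
    using assms unfolding dfn_def by blast
  define P' where "P' u = (\<exists>v. valuation \<MM> UNIV v \<and> (\<forall>x\<in>FV \<phi>. v x = u (e x)) \<and> sat \<MM> UNIV v \<phi>)" for u
  have same: "sat \<MM> UNIV v \<phi> = sat \<MM> UNIV w \<phi>" if "\<forall>x\<in>FV \<phi>. v x = w x" for v w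
    using that by (intro sat_cong) auto
  have "dfn \<MM> s (e ` FV \<phi>) P'"
    unfolding dfn_def
  proof (intro exI[of _ \<phi>] exI[of _ e] conjI allI impI)
    fix u v assume v: "valuation \<MM> UNIV v" "\<forall>x\<in>FV \<phi>. v x = u (e x)"
    have "sat \<MM> UNIV w \<phi> = sat \<MM> UNIV v \<phi>" if "\<forall>x\<in>FV \<phi>. w x = u (e x)" for w
      using that v by (intro same) simp
    then show "P' u = sat \<MM> UNIV v \<phi>" unfolding P'_def using v by blast
  qed (use \<phi> in auto)
  moreover have "P u = P' u" if u: "sorted_on \<MM> s T u" for u
  proof -
    obtain v where v: "valuation \<MM> UNIV v" "\<And>x. x \<in> FV \<phi> \<Longrightarrow> v x = u (e x)"
    proof (rule valuation_extend[of "FV \<phi>" "\<lambda>x. u (e x)"])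
      show "srt \<MM> (u (e x)) = fst x" if "x \<in> FV \<phi>" for x
        using u \<phi>(2) that by (simp add: sorted_on_def)
    qed blast
    have "sat \<MM> UNIV w \<phi> = sat \<MM> UNIV v \<phi>" if "\<forall>x\<in>FV \<phi>. w x = u (e x)" for w
      using that v by (intro same) simp
    then have "P' u = sat \<MM> UNIV v \<phi>" unfolding P'_def using v by blast
    moreover have "P u = sat \<MM> UNIV v \<phi>" using \<phi>(3) u v by blast
    ultimately show ?thesis by simp
  qed
  ultimately show thesis using \<phi>(2) finite_FV[of \<phi>] by (intro that[of "e ` FV \<phi>" P']) auto
qed

lemma infinite_fm: "infinite (UNIV :: ('s, 'f, 'r) fm set)"
proof
  assume fin: "finite (UNIV :: ('s, 'f, 'r) fm set)"
  have "inj (Neg :: ('s, 'f, 'r) fm \<Rightarrow> _)" by (simp add: inj_def)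
  then have "surj (Neg :: ('s, 'f, 'r) fm \<Rightarrow> _)" using fin finite_UNIV_inj_surj by blast
  then obtain \<phi> :: "('s, 'f, 'r) fm" where "Eq (Var undefined) (Var undefined) = Neg \<phi>"
    by (meson surjD)
  then show False by simp
qed

lemma card_fm: "|UNIV :: ('s, 'f, 'r) fm set| <o |UNIV :: 'm set|"
  using monster by (simp add: monster_def)

lemma infinite_UNIV_m: "infinite (UNIV :: 'm set)"
  using card_fm infinite_fm card_of_ordLeq_infinite ordLess_imp_ordLeq by blast

lemma card_finite: "finite A \<Longrightarrow> |A| <o |UNIV :: 'm set|"
  using infinite_UNIV_m finite_ordLess_infinite2 by blast

lemma card_image: "|A| <o |UNIV :: 'm set| \<Longrightarrow> |f ` A| <o |UNIV :: 'm set|"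
  using card_of_image ordLeq_ordLess_trans by blast

lemma card_Un: "|A| <o |UNIV :: 'm set| \<Longrightarrow> |B| <o |UNIV :: 'm set| \<Longrightarrow> |A \<union> B| <o |UNIV :: 'm set|"
  using infinite_UNIV_m card_of_Un_ordLess_infinite by blast

lemma card_subset: "|B| <o |UNIV :: 'm set| \<Longrightarrow> A \<subseteq> B \<Longrightarrow> |A| <o |UNIV :: 'm set|"
  using card_of_mono1 ordLeq_ordLess_trans by blast

text \<open>Turns a predicate with all entries but one fixed into a formula with parameters, the
  shape in which saturation and algebraic closure are defined.\<close>

lemma dfn_one_variable:
  fixes s :: "'t \<Rightarrow> 's"
  assumes u: "sorted_on \<MM> s A u" and P: "dfn \<MM> s (insert t A) P" and t: "t \<notin> A"
  obtains \<phi> v where "fm_ok \<MM> \<phi>" "valuation \<MM> UNIV v" "v ` (FV \<phi> - {(s t, 0)}) \<subseteq> u ` A"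
    "\<And>y. srt \<MM> y = s t \<Longrightarrow> P (u(t := y)) = sat \<MM> UNIV (v((s t, 0) := y)) \<phi>"
proof -
  define z where "z = (s t, 0 :: nat)"
  obtain T0 where T0: "finite T0" "T0 \<subseteq> insert t A" "\<And>code. \<exists>\<phi>. nform \<MM> s (insert t A) P T0 code \<phi>"
    using dfn_normal[OF P] by blast
  obtain c0 :: "'t \<Rightarrow> nat" where c0: "inj_on c0 T0" using finite_code[OF T0(1)] by blast
  define code where "code t' = (if t' = t then 0 else Suc (c0 t'))" for t'
  obtain \<phi> where \<phi>: "fm_ok \<MM> \<phi>" "FV \<phi> \<subseteq> (\<lambda>t. (s t, code t)) ` T0"
    "\<And>u v. sorted_on \<MM> s (insert t A) u \<Longrightarrow> valuation \<MM> UNIV v \<Longrightarrow> (\<forall>t\<in>T0. v (s t, code t) = u t) \<Longrightarrow>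
      P u = sat \<MM> UNIV v \<phi>"
    using T0(3)[of code] unfolding nform_def by blast
  define c where "c t = (s t, code t)" for t
  have c: "inj_on c (insert t T0)" using c0 by (auto simp: inj_on_def c_def code_def)
  obtain v where v: "valuation \<MM> UNIV v"
    "\<And>x. x \<in> c ` (T0 - {t}) \<Longrightarrow> v x = u (inv_into (insert t T0) c x)"
  proof (rule valuation_extend[of "c ` (T0 - {t})" "\<lambda>x. u (inv_into (insert t T0) c x)"])
    fix x assume "x \<in> c ` (T0 - {t})"
    then obtain t' where t': "t' \<in> T0 - {t}" "x = c t'" by blast
    then have "inv_into (insert t T0) c x = t'" using c by simp
    then show "srt \<MM> (u (inv_into (insert t T0) c x)) = fst x"
      using u t' T0(2) by (auto simp: sorted_on_def c_def)
  qed blast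
  have v': "v (c t') = u t'" if "t' \<in> T0 - {t}" for t' using v(2) c that by auto
  show thesis
  proof (rule that[of \<phi> v, folded z_def])
    show "v ` (FV \<phi> - {z}) \<subseteq> u ` A"
    proof
      fix y assume "y \<in> v ` (FV \<phi> - {z})"
      then obtain x where x: "x \<in> FV \<phi>" "x \<noteq> z" "y = v x" by blast
      then obtain t' where t': "t' \<in> T0" "x = c t'" using \<phi>(2) by (auto simp: c_def)
      then have "t' \<noteq> t" using x by (auto simp: c_def z_def code_def)
      then show "y \<in> u ` A" using x t' v' T0(2) by auto
    qed
    fix y assume y: "srt \<MM> y = s t"
    show "P (u(t := y)) = sat \<MM> UNIV (v(z := y)) \<phi>"
    proof (rule \<phi>(3))
      show "sorted_on \<MM> s (insert t A) (u(t := y))" using u y by (auto simp: sorted_on_def)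
      show "valuation \<MM> UNIV (v(z := y))" using v(1) y by (auto simp: valuation_def z_def)
      show "\<forall>t'\<in>T0. (v(z := y)) (s t', code t') = (u(t := y)) t'"
      proof
        fix t' assume "t' \<in> T0"
        then show "(v(z := y)) (s t', code t') = (u(t := y)) t'"
          using v'[of t'] by (cases "t' = t") (auto simp: z_def c_def code_def)
      qed
    qed
  qed (use \<phi> v in auto)
qed

text \<open>The entries in \<open>A\<close> serve as parameters. It is the set of their values, not
  the index set \<open>A\<close>, that has to be small.\<close>

lemma saturation:
  fixes s :: "'t \<Rightarrow> 's"
  assumes u: "sorted_on \<MM> s A u" and A: "small (u ` A)" and t: "t \<notin> A"
    and dfn: "\<And>P. P \<in> \<P> \<Longrightarrow> dfn \<MM> s (insert t A) P"
    and fin: "\<And>F. finite F \<Longrightarrow> F \<subseteq> \<P> \<Longrightarrow> \<exists>y. srt \<MM> y = s t \<and> (\<forall>P\<in>F. P (u(t := y)))"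
  shows "\<exists>y. srt \<MM> y = s t \<and> (\<forall>P\<in>\<P>. P (u(t := y)))"
proof -
  define z where "z = (s t, 0 :: nat)"
  define good where "good P \<phi> v \<longleftrightarrow> fm_ok \<MM> \<phi> \<and> valuation \<MM> UNIV v \<and> v ` (FV \<phi> - {z}) \<subseteq> u ` A \<and>
    (\<forall>y. srt \<MM> y = s t \<longrightarrow> P (u(t := y)) = sat \<MM> UNIV (v(z := y)) \<phi>)" for P \<phi> v
  have ex: "\<exists>\<phi> v. good P \<phi> v" if P: "P \<in> \<P>" for P
    unfolding good_def z_def by (rule dfn_one_variable[OF u dfn[OF P] t]) blast
  define \<Sigma> where "\<Sigma> = {(\<phi>, v). \<exists>P\<in>\<P>. good P \<phi> v}"
  have sat: "saturated \<MM>" using monster by (simp add: monster_def)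
  have "\<exists>x. srt \<MM> x = fst z \<and> (\<forall>(\<phi>, v)\<in>\<Sigma>. sat \<MM> UNIV (v(z := x)) \<phi>)"
  proof (rule sat[unfolded saturated_def, rule_format, of "u ` A" \<Sigma> z], intro conjI allI impI)
    show "small (u ` A)" by fact
    show "\<forall>(\<phi>, v)\<in>\<Sigma>. fm_ok \<MM> \<phi> \<and> valuation \<MM> UNIV v \<and> v ` (FV \<phi> - {z}) \<subseteq> u ` A"
      by (auto simp: \<Sigma>_def good_def)
    fix F assume F: "finite F \<and> F \<subseteq> \<Sigma>"
    have "\<forall>q\<in>F. \<exists>P. P \<in> \<P> \<and> good P (fst q) (snd q)"
    proof
      fix q assume "q \<in> F"
      with F have "q \<in> \<Sigma>" by blast
      then show "\<exists>P. P \<in> \<P> \<and> good P (fst q) (snd q)"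
        unfolding \<Sigma>_def by (cases q) (simp add: Bex_def)
    qed
    from bchoice[OF this] obtain Q where Q: "\<And>q. q \<in> F \<Longrightarrow> Q q \<in> \<P> \<and> good (Q q) (fst q) (snd q)" by blast
    have "finite (Q ` F)" "Q ` F \<subseteq> \<P>" using F Q by auto
    from fin[OF this] obtain y where y: "srt \<MM> y = s t" "\<And>q. q \<in> F \<Longrightarrow> (Q q) (u(t := y))" by blast
    have "sat \<MM> UNIV ((snd q)(z := y)) (fst q)" if "q \<in> F" for q
      using Q[OF that] y that unfolding good_def by blast
    then show "\<exists>x. srt \<MM> x = fst z \<and> (\<forall>(\<phi>, v)\<in>F. sat \<MM> UNIV (v(z := x)) \<phi>)"
      using y(1) by (intro exI[of _ y]) (auto simp: z_def)
  qed
  then obtain y where y: "srt \<MM> y = s t" "\<And>\<phi> v. (\<phi>, v) \<in> \<Sigma> \<Longrightarrow> sat \<MM> UNIV (v(z := y)) \<phi>"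
    by (auto simp: z_def)
  have "P (u(t := y))" if P: "P \<in> \<P>" for P
  proof -
    obtain \<phi> v where g: "good P \<phi> v" using ex[OF P] by blast
    with P have "(\<phi>, v) \<in> \<Sigma>" by (auto simp: \<Sigma>_def)
    then show ?thesis using y g unfolding good_def by blast
  qed
  with y(1) show ?thesis by blast
qed

section \<open>Equality of types of indexed tuples\<close>

definition eqtp :: "('t \<Rightarrow> 's) \<Rightarrow> 't set \<Rightarrow> ('t \<Rightarrow> 'm) \<Rightarrow> ('t \<Rightarrow> 'm) \<Rightarrow> bool" where
  "eqtp s T u w \<longleftrightarrow> sorted_on \<MM> s T u \<and> sorted_on \<MM> s T w \<and> (\<forall>P. dfn \<MM> s T P \<longrightarrow> P u = P w)"

text \<open>The map \<open>g\<close> need not be injective, so repetitions can be added or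
  removed.\<close>

lemma eqtp_reindex:
  assumes "eqtp s T u w" "\<And>t. t \<in> T' \<Longrightarrow> g t \<in> T" "\<And>t. t \<in> T' \<Longrightarrow> s (g t) = s' t"
    "\<And>t. t \<in> T' \<Longrightarrow> u' t = u (g t)" "\<And>t. t \<in> T' \<Longrightarrow> w' t = w (g t)"
  shows "eqtp s' T' u' w'"
  unfolding eqtp_def
proof (intro conjI allI impI)
  show s: "sorted_on \<MM> s' T' u'" "sorted_on \<MM> s' T' w'"
    using assms by (auto simp: eqtp_def sorted_on_def)
  fix P assume P: "dfn \<MM> s' T' P"
  obtain \<phi> e where \<phi>: "fm_ok \<MM> \<phi>" "\<And>x. x \<in> FV \<phi> \<Longrightarrow> e x \<in> T' \<and> s' (e x) = fst x"
      "\<And>u v. sorted_on \<MM> s' T' u \<Longrightarrow> valuation \<MM> UNIV v \<Longrightarrow> (\<forall>x\<in>FV \<phi>. v x = u (e x)) \<Longrightarrow> P u = sat \<MM> UNIV v \<phi>"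
    using P unfolding dfn_def by blast
  \<comment> \<open>As a function, \<open>P\<close> may inspect entries outside \<open>T'\<close>;
    its value at a sorted tuple does not depend on them because a formula defines it.\<close>
  have val: "P f = P f'" if f: "sorted_on \<MM> s' T' f" "\<And>t. t \<in> T' \<Longrightarrow> f t = f' t" for f f'
  proof -
    have f': "sorted_on \<MM> s' T' f'" using f by (auto simp: sorted_on_def)
    obtain v where v: "valuation \<MM> UNIV v" "\<And>x. x \<in> FV \<phi> \<Longrightarrow> v x = f (e x)"
    proof (rule valuation_extend[of "FV \<phi>" "\<lambda>x. f (e x)"])
      show "srt \<MM> (f (e x)) = fst x" if "x \<in> FV \<phi>" for x
        using f(1) \<phi>(2)[OF that] by (simp add: sorted_on_def)
    qed blast
    have "P f = sat \<MM> UNIV v \<phi>" using \<phi>(3)[OF f(1) v(1)] v(2) by blast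
    moreover have "P f' = sat \<MM> UNIV v \<phi>" using \<phi>(2) by (intro \<phi>(3)[OF f' v(1)]) (simp add: v(2) f(2))
    ultimately show ?thesis by simp
  qed
  have "dfn \<MM> s T (\<lambda>u. P (\<lambda>t. u (g t)))"
    using dfn_reindex[OF P] assms(2,3) by blast
  then have "P (\<lambda>t. u (g t)) = P (\<lambda>t. w (g t))" using assms(1) unfolding eqtp_def by blast
  moreover have "P u' = P (\<lambda>t. u (g t))" "P w' = P (\<lambda>t. w (g t))"
    using s assms(4,5) by (auto intro!: val)
  ultimately show "P u' = P w'" by simp
qed

lemma dfn_val_cong:
  assumes "dfn \<MM> s T P" "sorted_on \<MM> s T u" "\<And>t. t \<in> T \<Longrightarrow> u t = w t"
  shows "P u = P w"
proof -
  have "eqtp s T u u" using assms by (simp add: eqtp_def)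
  then have "eqtp s T u w" by (rule eqtp_reindex[of _ _ _ _ _ "\<lambda>t. t"]) (use assms in auto)
  then show ?thesis using assms by (auto simp: eqtp_def)
qed

text \<open>A finite part of the type of \<open>u t\<close> over the other entries becomes, once the
  new entry is quantified, a definable property of \<open>u\<close>, and therefore holds of
  \<open>w\<close>; saturation then realizes the whole type over \<open>w\<close>.\<close>

lemma eqtp_extend:
  assumes eq: "eqtp s A u w" and A: "small (w ` A)" and t: "t \<notin> A" "srt \<MM> (u t) = s t"
  obtains y where "eqtp s (insert t A) u (w(t := y))"
proof -
  define \<P> where "\<P> = {P. dfn \<MM> s (insert t A) P \<and> P u}"
  have "\<exists>y. srt \<MM> y = s t \<and> (\<forall>P\<in>\<P>. P (w(t := y)))"
  proof (rule saturation[OF _ A t(1)])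
    show "sorted_on \<MM> s A w" using eq by (simp add: eqtp_def)
    show "dfn \<MM> s (insert t A) P" if "P \<in> \<P>" for P using that by (simp add: \<P>_def)
    fix F assume F: "finite F" "F \<subseteq> \<P>"
    define R where "R u \<longleftrightarrow> (\<exists>y. srt \<MM> y = s t \<and> (\<forall>P\<in>F. P (u(t := y))))" for u
    have "dfn \<MM> s (insert t A) (\<lambda>u. \<forall>P\<in>F. P u)"
      using F by (intro dfn_Ball) (auto simp: \<P>_def)
    from dfn_ex[OF this, of t] have "dfn \<MM> s A R"
      unfolding R_def using t(1) by simp
    moreover have "R u" unfolding R_def
      by (rule exI[of _ "u t"]) (use t F in \<open>auto simp: \<P>_def\<close>)
    ultimately have "R w" using eq unfolding eqtp_def by blast
    then show "\<exists>y. srt \<MM> y = s t \<and> (\<forall>P\<in>F. P (w(t := y)))" unfolding R_def .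
  qed
  then obtain y where y: "srt \<MM> y = s t" "\<And>P. P \<in> \<P> \<Longrightarrow> P (w(t := y))" by blast
  have "P u = P (w(t := y))" if P: "dfn \<MM> s (insert t A) P" for P
    using y(2)[of P] y(2)[of "\<lambda>u. \<not> P u"] P dfn_Not[OF P] by (auto simp: \<P>_def)
  then have "eqtp s (insert t A) u (w(t := y))"
    using eq y(1) t(2) by (auto simp: eqtp_def sorted_on_def)
  then show thesis by (rule that)
qed

lemma eqtp_finite:
  assumes u: "sorted_on \<MM> s T u" and w: "sorted_on \<MM> s T w"
    and fin: "\<And>T0. finite T0 \<Longrightarrow> T0 \<subseteq> T \<Longrightarrow> eqtp s T0 u w"
  shows "eqtp s T u w"
  unfolding eqtp_def
proof (intro conjI allI impI)
  fix P assume "dfn \<MM> s T P"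
  then obtain T0 P' where "finite T0" "T0 \<subseteq> T" "dfn \<MM> s T0 P'" "\<And>u. sorted_on \<MM> s T u \<Longrightarrow> P u = P' u"
    using dfn_support by blast
  then show "P u = P w" using fin[of T0] u w by (simp add: eqtp_def)
qed fact+

lemma eqtp_subset: "eqtp s T u w \<Longrightarrow> T' \<subseteq> T \<Longrightarrow> eqtp s T' u w"
  by (rule eqtp_reindex[of s T u w T' "\<lambda>t. t"]) auto

text \<open>A partial elementary map, given by its graph. The pairs themselves are the indices, with
  \<open>fst\<close> and \<open>snd\<close> as the two tuples, so that inverses, restrictions and
  unions of chains are set operations. Being a function and being injective are not demanded; both
  follow because equality is preserved.\<close>

definition elem_rel :: "('m \<times> 'm) set \<Rightarrow> bool" where
  "elem_rel G \<longleftrightarrow> eqtp (\<lambda>q. srt \<MM> (fst q)) G fst snd"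

lemma elem_rel_converse: "elem_rel G \<Longrightarrow> elem_rel (G\<inverse>)"
proof -
  assume G: "elem_rel G"
  then have G': "eqtp (\<lambda>q. srt \<MM> (fst q)) G snd fst" by (auto simp: elem_rel_def eqtp_def)
  then have "srt \<MM> (snd q) = srt \<MM> (fst q)" if "q \<in> G" for q
    using that unfolding eqtp_def sorted_on_def by blast
  then show ?thesis
    unfolding elem_rel_def by (intro eqtp_reindex[OF G', where g = prod.swap]) auto
qed

lemma elem_rel_subset: "elem_rel G \<Longrightarrow> G' \<subseteq> G \<Longrightarrow> elem_rel G'"
  unfolding elem_rel_def by (rule eqtp_subset)

lemma elem_rel_finite:
  assumes "\<And>G0. finite G0 \<Longrightarrow> G0 \<subseteq> G \<Longrightarrow> elem_rel G0"
  shows "elem_rel G"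
proof -
  have "srt \<MM> (snd q) = srt \<MM> (fst q)" if "q \<in> G" for q
    using assms[of "{q}"] that by (auto simp: elem_rel_def eqtp_def sorted_on_def)
  then have "sorted_on \<MM> (\<lambda>q. srt \<MM> (fst q)) G snd"
    by (simp add: sorted_on_def)
  moreover have "sorted_on \<MM> (\<lambda>q. srt \<MM> (fst q)) G fst"
    by (simp add: sorted_on_def)
  ultimately show ?thesis
    unfolding elem_rel_def using assms[unfolded elem_rel_def] eqtp_finite by blast
qed

lemma elem_rel_extend:
  assumes G: "elem_rel G" and "|G| <o |UNIV :: 'm set|"
  obtains y where "elem_rel (insert (x, y) G)"
proof -
  \<comment> \<open>\<open>Some\<close> makes room for one fresh index, \<open>None\<close>, which
    carries the new pair.\<close>
  define s where "s = case_option (srt \<MM> x) (\<lambda>q :: 'm \<times> 'm. srt \<MM> (fst q))"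
  define u where "u = case_option x (fst :: 'm \<times> 'm \<Rightarrow> 'm)"
  define w where "w = case_option x (snd :: 'm \<times> 'm \<Rightarrow> 'm)"
  have "eqtp s (Some ` G) u w"
    by (rule eqtp_reindex[OF G[unfolded elem_rel_def], where g = the]) (auto simp: s_def u_def w_def)
  moreover have "small (w ` Some ` G)" unfolding small_def using assms(2) by (intro card_image)
  ultimately obtain y where y: "eqtp s (insert None (Some ` G)) u (w(None := y))"
    by (rule eqtp_extend) (auto simp: s_def u_def)
  have "elem_rel (insert (x, y) G)"
    unfolding elem_rel_def
    by (rule eqtp_reindex[OF y, where g = "\<lambda>q. if q = (x, y) then None else Some q"])
      (auto simp: s_def u_def w_def)
  then show thesis by (rule that)
qed

lemma converse_eq_swap: "G\<inverse> = prod.swap ` G"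
  by force

lemma elem_rel_extend_back:
  assumes G: "elem_rel G" and "|G| <o |UNIV :: 'm set|"
  obtains x where "elem_rel (insert (x, y) G)"
proof -
  have "|G\<inverse>| <o |UNIV :: 'm set|"
    using card_image[OF assms(2), of prod.swap] by (simp add: converse_eq_swap)
  then obtain x where "elem_rel (insert (y, x) (G\<inverse>))"
    using elem_rel_extend[OF elem_rel_converse[OF G]] by blast
  then have "elem_rel ((insert (y, x) (G\<inverse>))\<inverse>)" by (rule elem_rel_converse)
  moreover have "(insert (y, x) (G\<inverse>))\<inverse> = insert (x, y) G" by auto
  ultimately show thesis using that by simp
qed

end

lemma map_nth_upt: "map (\<lambda>i. f (xs ! i)) [0..<length xs] = map f xs"
  by (rule nth_equalityI) simp_all

abbreviation ainv :: "('m \<Rightarrow> 'm) \<Rightarrow> 'm \<Rightarrow> 'm" where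
  "ainv \<equiv> inv_into UNIV"

context monster_model
begin

text \<open>Transfinite back and forth along a well-order of the model of minimal length. Stage
  \<open>x\<close> adds both an image and a preimage of \<open>x\<close>, so the union is total in
  both directions.\<close>

lemma elem_rel_back_and_forth:
  assumes G0: "elem_rel G0" "|G0| <o |UNIV :: 'm set|"
  obtains G where "elem_rel G" "G0 \<subseteq> G" "\<And>x. \<exists>y. (x, y) \<in> G" "\<And>y. \<exists>x. (x, y) \<in> G"
proof -
  \<comment> \<open>A cardinal order: the set of earlier stages is always smaller than the model, as
    saturation requires.\<close>
  define r where "r = |UNIV :: 'm set|"
  have r: "Well_order r" "Card_order r" "Field r = UNIV"
    unfolding r_def by (auto simp: card_of_Well_order card_of_Card_order Field_card_of)
  have wf: "wf (r - Id)" using r(1) by (simp add: well_order_on_def)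
  have tr: "trans r" and tot: "total_on UNIV r" and anti: "antisym r"
    using r unfolding well_order_on_def linear_order_on_def partial_order_on_def preorder_on_def by auto
  \<comment> \<open>The chosen pair consists of an image of \<open>x\<close> and of a preimage of
    \<open>x\<close>.\<close>
  define step :: "('m \<Rightarrow> 'm \<times> 'm) \<Rightarrow> 'm \<Rightarrow> 'm \<times> 'm" where "step e x = (SOME q. elem_rel (insert (snd q, x) (insert (x, fst q)
      (G0 \<union> (\<Union>w\<in>underS r x. {(w, fst (e w)), (snd (e w), w)})))))" for e x
  define e where "e = wfrec (r - Id) step"
  define K where "K w = {(w, fst (e w)), (snd (e w), w)}" for w
  define H where "H W = G0 \<union> (\<Union>w\<in>W. K w)" for W
  have e: "e x = (SOME q. elem_rel (insert (snd q, x) (insert (x, fst q) (H (underS r x)))))" for x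
  proof -
    have "e x = step (cut e (r - Id) x) x" unfolding e_def by (rule wfrec[OF wf])
    moreover have "cut e (r - Id) x w = e w" if "w \<in> underS r x" for w
      using that by (auto simp: cut_def underS_def)
    ultimately show ?thesis by (simp add: step_def H_def K_def)
  qed
  have HK: "H (insert x (underS r x)) = insert (snd (e x), x) (insert (x, fst (e x)) (H (underS r x)))" for x
    by (auto simp: H_def K_def)
  \<comment> \<open>At a limit there is nothing to choose: being elementary is of finite character,
    and the stages form a chain.\<close>
  have union: "elem_rel (H W)" if W: "\<And>w. w \<in> W \<Longrightarrow> elem_rel (H (insert w (underS r w)))" for W
  proof (rule elem_rel_finite)
    fix T assume T: "finite T" "T \<subseteq> H W"
    define \<B> where "\<B> = insert G0 ((\<lambda>w. H (insert w (underS r w))) ` W)"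
    have mono: "H (insert v (underS r v)) \<subseteq> H (insert w (underS r w))" if "(v, w) \<in> r" for v w
    proof -
      have "insert v (underS r v) \<subseteq> insert w (underS r w)"
        using that tr anti unfolding underS_def by (auto dest: transD antisymD)
      then show ?thesis unfolding H_def by blast
    qed
    have "subset.chain UNIV \<B>"
    proof -
      have "A \<subseteq> B \<or> B \<subseteq> A" if AB: "A \<in> \<B>" "B \<in> \<B>" for A B
      proof (cases "A = G0 \<or> B = G0")
        case True
        have "G0 \<subseteq> C" if "C \<in> \<B>" for C using that by (auto simp: \<B>_def H_def)
        then show ?thesis using True AB by blast
      next
        case False
        then obtain v w where vw: "A = H (insert v (underS r v))" "B = H (insert w (underS r w))"
          using AB by (auto simp: \<B>_def)
        show ?thesis
        proof (cases "v = w")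
          case True then show ?thesis using vw by simp
        next
          case False
          then have "(v, w) \<in> r \<or> (w, v) \<in> r" using tot by (simp add: total_on_def)
          then show ?thesis using mono vw by blast
        qed
      qed
      then show ?thesis by (auto simp: subset_chain_def)
    qed
    moreover have "T \<subseteq> \<Union> \<B>" using T(2) by (auto simp: \<B>_def H_def)
    moreover have "\<B> \<noteq> {}" by (simp add: \<B>_def)
    ultimately obtain B where B: "B \<in> \<B>" "T \<subseteq> B"
      using finite_subset_Union_chain[OF T(1)] by metis
    then have "elem_rel B" using W G0 by (auto simp: \<B>_def)
    then show "elem_rel T" using B elem_rel_subset by blast
  qed
  have all: "elem_rel (H (insert x (underS r x)))" for x
    using wf
  proof (induction x rule: wf_induct_rule)
    case (less x)
    have "elem_rel (H (underS r x))"
      by (rule union) (use less in \<open>auto simp: underS_def\<close>)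
    have cu: "|underS r x| <o |UNIV :: 'm set|"
      using card_of_underS[OF r(2)] r(3) unfolding r_def by auto
    have "H (underS r x) = G0 \<union> ((\<lambda>w. (w, fst (e w))) ` underS r x \<union> (\<lambda>w. (snd (e w), w)) ` underS r x)"
      by (auto simp: H_def K_def)
    then have cH: "|H (underS r x)| <o |UNIV :: 'm set|"
      using cu G0(2) by (simp add: card_Un card_image)
    obtain y where y: "elem_rel (insert (x, y) (H (underS r x)))"
      using elem_rel_extend[OF \<open>elem_rel (H (underS r x))\<close> cH] by blast
    have "|{(x, y)} \<union> H (underS r x)| <o |UNIV :: 'm set|"
      by (rule card_Un[OF card_finite cH]) simp
    then have "|insert (x, y) (H (underS r x))| <o |UNIV :: 'm set|" by simp
    then obtain z where "elem_rel (insert (z, x) (insert (x, y) (H (underS r x))))"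
      using elem_rel_extend_back[OF y] by blast
    then have "\<exists>q. elem_rel (insert (snd q, x) (insert (x, fst q) (H (underS r x))))"
      by (intro exI[of _ "(y, z)"]) simp
    then show ?case unfolding HK e by (rule someI_ex)
  qed
  show thesis
  proof (rule that[of "H UNIV"])
    show "elem_rel (H UNIV)" by (rule union) (rule all)
    show "\<exists>y. (x, y) \<in> H UNIV" for x by (auto simp: H_def K_def)
    show "\<exists>x. (x, y) \<in> H UNIV" for y unfolding H_def K_def by blast
  qed (simp add: H_def)
qed

text \<open>Preservation of equality makes the relation a bijection; preservation of relation
  symbols and of the graphs of function symbols makes it an automorphism.\<close>

lemma elem_rel_total_aut:
  assumes G: "elem_rel G" "\<And>x. \<exists>y. (x, y) \<in> G" "\<And>y. \<exists>x. (x, y) \<in> G"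
  obtains \<sigma> where "\<sigma> \<in> aut \<MM>" "\<And>x y. (x, y) \<in> G \<Longrightarrow> y = \<sigma> x"
proof -
  have val: "P fst = P snd" if "dfn \<MM> (\<lambda>q. srt \<MM> (fst q)) G P" for P
    using G(1) that unfolding elem_rel_def eqtp_def by blast
  have srt: "srt \<MM> y = srt \<MM> x" if "(x, y) \<in> G" for x y
    using G(1) that by (auto simp: elem_rel_def eqtp_def sorted_on_def)
  have uniq: "y = y' \<longleftrightarrow> x = x'" if "(x, y) \<in> G" "(x', y') \<in> G" for x y x' y'
  proof (cases "srt \<MM> x = srt \<MM> x'")
    case True
    have "dfn \<MM> (\<lambda>q. srt \<MM> (fst q)) G (\<lambda>u. u (x, y) = u (x', y'))"
      by (rule dfn_mono[OF dfn_eq]) (use that True in auto)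
    from val[OF this] show ?thesis by auto
  next
    case False
    then show ?thesis using srt[OF that(1)] srt[OF that(2)] by auto
  qed
  obtain \<sigma> where \<sigma>: "\<And>x. (x, \<sigma> x) \<in> G" using G(2) by metis
  have eq: "y = \<sigma> x" if "(x, y) \<in> G" for x y using uniq[OF that \<sigma>[of x]] by simp
  have "\<sigma> \<in> aut \<MM>"
    unfolding aut_def
  proof (intro CollectI conjI allI impI)
    show "bij \<sigma>"
    proof (rule bijI)
      show "inj \<sigma>" using uniq \<sigma> by (metis injI)
      show "surj \<sigma>" using G(3) eq by (metis surjI surj_def)
    qed
    show "srt \<MM> (\<sigma> x) = srt \<MM> x" for x using srt[OF \<sigma>] .
  next
    fix f xs assume xs: "map (srt \<MM>) xs = fdom \<MM> f"
    \<comment> \<open>Variables are numbered by positions in \<open>xs\<close>, in which an element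
      may occur several times; number \<open>n\<close> stands for the value.\<close>
    define n where "n = length xs"
    define q where "q i = (xs ! i, \<sigma> (xs ! i))" for i
    define c where "c = fI \<MM> f xs"
    have c: "srt \<MM> c = fcod \<MM> f" using wf xs by (simp add: wf_struct_def c_def)
    have srt_xs: "map (\<lambda>i. srt \<MM> (xs ! i)) [0..<n] = fdom \<MM> f"
      unfolding n_def map_nth_upt by (rule xs)
    have "dfn \<MM> (\<lambda>q. srt \<MM> (fst q)) G (\<lambda>u. fI \<MM> f (map (\<lambda>i. u (q i)) [0..<n]) = u (c, \<sigma> c))"
      unfolding dfn_def
    proof (intro exI conjI ballI allI impI)
      let ?\<phi> = "Eq (Fn f (map (\<lambda>i. Var (srt \<MM> (xs ! i), i)) [0..<n])) (Var (fcod \<MM> f, n))"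
      let ?e = "\<lambda>x :: 's var. if snd x < n then q (snd x) else (c, \<sigma> c)"
      show "fm_ok \<MM> ?\<phi>" using srt_xs by (auto simp: o_def)
      show "?e x \<in> G" "srt \<MM> (fst (?e x)) = fst x" if "x \<in> FV ?\<phi>" for x
        using that \<sigma> c by (auto simp: q_def)
      fix u :: "'m \<times> 'm \<Rightarrow> 'm" and v :: "'s var \<Rightarrow> 'm" assume uv: "\<forall>x\<in>FV ?\<phi>. v x = u (?e x)"
      then have "map (\<lambda>i. v (srt \<MM> (xs ! i), i)) [0..<n] = map (\<lambda>i. u (q i)) [0..<n]"
        by auto
      moreover have "v (fcod \<MM> f, n) = u (c, \<sigma> c)" using uv by auto
      ultimately show "(fI \<MM> f (map (\<lambda>i. u (q i)) [0..<n]) = u (c, \<sigma> c)) = sat \<MM> UNIV v ?\<phi>"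
        by (simp add: o_def del: map_eq_conv)
    qed
    from val[OF this] have "(fI \<MM> f (map (\<lambda>i. xs ! i) [0..<n]) = c) = (fI \<MM> f (map (\<lambda>i. \<sigma> (xs ! i)) [0..<n]) = \<sigma> c)"
      by (simp add: q_def)
    moreover have "map (\<lambda>i. xs ! i) [0..<n] = xs" by (simp add: n_def map_nth)
    moreover have "map (\<lambda>i. \<sigma> (xs ! i)) [0..<n] = map \<sigma> xs" by (simp add: n_def map_nth_upt)
    ultimately show "\<sigma> (fI \<MM> f xs) = fI \<MM> f (map \<sigma> xs)" by (simp add: c_def)
  next
    fix f xs assume xs: "map (srt \<MM>) xs = rdom \<MM> f"
    define n where "n = length xs"
    define q where "q i = (xs ! i, \<sigma> (xs ! i))" for i
    have srt_xs: "map (\<lambda>i. srt \<MM> (xs ! i)) [0..<n] = rdom \<MM> f"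
      unfolding n_def map_nth_upt by (rule xs)
    have "dfn \<MM> (\<lambda>q. srt \<MM> (fst q)) G (\<lambda>u. rI \<MM> f (map (\<lambda>i. u (q i)) [0..<n]))"
      unfolding dfn_def
    proof (intro exI conjI ballI allI impI)
      let ?\<phi> = "Rel f (map (\<lambda>i. Var (srt \<MM> (xs ! i), i)) [0..<n])"
      let ?e = "\<lambda>x :: 's var. q (snd x)"
      show "fm_ok \<MM> ?\<phi>" using srt_xs by (auto simp: o_def)
      show "?e x \<in> G" "srt \<MM> (fst (?e x)) = fst x" if "x \<in> FV ?\<phi>" for x
        using that \<sigma> by (auto simp: q_def)
      fix u :: "'m \<times> 'm \<Rightarrow> 'm" and v :: "'s var \<Rightarrow> 'm" assume uv: "\<forall>x\<in>FV ?\<phi>. v x = u (?e x)"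
      then have "map (\<lambda>i. v (srt \<MM> (xs ! i), i)) [0..<n] = map (\<lambda>i. u (q i)) [0..<n]"
        by auto
      then show "rI \<MM> f (map (\<lambda>i. u (q i)) [0..<n]) = sat \<MM> UNIV v ?\<phi>"
        by (simp add: o_def del: map_eq_conv)
    qed
    from val[OF this] have "rI \<MM> f (map (\<lambda>i. xs ! i) [0..<n]) = rI \<MM> f (map (\<lambda>i. \<sigma> (xs ! i)) [0..<n])"
      by (simp add: q_def)
    moreover have "map (\<lambda>i. xs ! i) [0..<n] = xs" by (simp add: n_def map_nth)
    moreover have "map (\<lambda>i. \<sigma> (xs ! i)) [0..<n] = map \<sigma> xs" by (simp add: n_def map_nth_upt)
    ultimately show "rI \<MM> f (map \<sigma> xs) = rI \<MM> f xs" by simp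
  qed
  with eq that show thesis by blast
qed

text \<open>The back and forth starts from the set of pairs \<open>(u t, w t)\<close>, which is a
  partial elementary map whether or not the tuples have repetitions.\<close>

lemma homogeneity:
  assumes eq: "eqtp s T u w" and T: "|T| <o |UNIV :: 'm set|"
  obtains \<sigma> where "\<sigma> \<in> aut \<MM>" "\<And>t. t \<in> T \<Longrightarrow> w t = \<sigma> (u t)"
proof -
  define g where "g t = (u t, w t)" for t
  have "elem_rel (g ` T)"
    unfolding elem_rel_def
  proof (rule eqtp_reindex[OF eq, where g = "inv_into T g"])
    fix q assume "q \<in> g ` T"
    then have "inv_into T g q \<in> T" "g (inv_into T g q) = q" by (auto intro: inv_into_into f_inv_into_f)
    moreover from this have "srt \<MM> (u (inv_into T g q)) = s (inv_into T g q)"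
      using eq by (auto simp: eqtp_def sorted_on_def)
    ultimately show "inv_into T g q \<in> T" "s (inv_into T g q) = srt \<MM> (fst q)"
      "fst q = u (inv_into T g q)" "snd q = w (inv_into T g q)"
      by (auto simp: g_def prod_eq_iff)
  qed
  then obtain G where "elem_rel G" "g ` T \<subseteq> G" "\<And>x. \<exists>y. (x, y) \<in> G" "\<And>y. \<exists>x. (x, y) \<in> G"
    using elem_rel_back_and_forth[of "g ` T"] card_image[OF T] by metis
  then obtain \<sigma> where "\<sigma> \<in> aut \<MM>" "\<And>x y. (x, y) \<in> G \<Longrightarrow> y = \<sigma> x"
    using elem_rel_total_aut by blast
  with \<open>g ` T \<subseteq> G\<close> show thesis by (intro that[of \<sigma>]) (auto simp: g_def)
qed

section \<open>Automorphisms and types\<close>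

lemma autD:
  assumes "\<sigma> \<in> aut \<MM>"
  shows "bij \<sigma>" "srt \<MM> (\<sigma> x) = srt \<MM> x"
    "map (srt \<MM>) xs = fdom \<MM> f \<Longrightarrow> \<sigma> (fI \<MM> f xs) = fI \<MM> f (map \<sigma> xs)"
    "map (srt \<MM>) xs = rdom \<MM> r \<Longrightarrow> rI \<MM> r (map \<sigma> xs) = rI \<MM> r xs"
  using assms by (auto simp: aut_def)

lemma id_aut: "id \<in> aut \<MM>"
  by (auto simp: aut_def)

lemma comp_aut:
  assumes \<sigma>: "\<sigma> \<in> aut \<MM>" and \<tau>: "\<tau> \<in> aut \<MM>"
  shows "\<sigma> \<circ> \<tau> \<in> aut \<MM>"
  unfolding aut_def
proof (intro CollectI conjI allI impI)
  show "bij (\<sigma> \<circ> \<tau>)" using autD(1)[OF \<sigma>] autD(1)[OF \<tau>] by (simp add: bij_comp)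
  show "srt \<MM> ((\<sigma> \<circ> \<tau>) x) = srt \<MM> x" for x using autD(2)[OF \<sigma>] autD(2)[OF \<tau>] by simp
  have s: "map (srt \<MM>) (map \<tau> xs) = map (srt \<MM>) xs" for xs using autD(2)[OF \<tau>] by simp
  show "(\<sigma> \<circ> \<tau>) (fI \<MM> f xs) = fI \<MM> f (map (\<sigma> \<circ> \<tau>) xs)" if "map (srt \<MM>) xs = fdom \<MM> f" for f xs
    using autD(3)[OF \<sigma>, of "map \<tau> xs" f] autD(3)[OF \<tau> that] that unfolding s by simp
  show "rI \<MM> r (map (\<sigma> \<circ> \<tau>) xs) = rI \<MM> r xs" if "map (srt \<MM>) xs = rdom \<MM> r" for r xs
    using autD(4)[OF \<sigma>, of "map \<tau> xs" r] autD(4)[OF \<tau> that] that unfolding s by simp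
qed

lemma aut_inv_simps [simp]:
  assumes "\<sigma> \<in> aut \<MM>"
  shows "ainv \<sigma> (\<sigma> x) = x" "\<sigma> (ainv \<sigma> x) = x" "ainv \<sigma> \<circ> \<sigma> = id" "\<sigma> \<circ> ainv \<sigma> = id"
  using autD(1)[OF assms] by (auto simp: bij_is_inj bij_is_surj surj_f_inv_f fun_eq_iff)

lemma inv_aut:
  assumes \<sigma>: "\<sigma> \<in> aut \<MM>"
  shows "ainv \<sigma> \<in> aut \<MM>"
  unfolding aut_def
proof (intro CollectI conjI allI impI)
  show "bij (ainv \<sigma>)" using autD(1)[OF \<sigma>] by (rule bij_imp_bij_inv)
  show srt: "srt \<MM> (ainv \<sigma> x) = srt \<MM> x" for x
    using autD(2)[OF \<sigma>, of "ainv \<sigma> x"] \<sigma> by simp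
  have m: "map \<sigma> (map (ainv \<sigma>) xs) = xs" for xs using \<sigma> by (simp add: o_def)
  have s: "map (srt \<MM>) (map (ainv \<sigma>) xs) = map (srt \<MM>) xs" for xs using srt by simp
  show "ainv \<sigma> (fI \<MM> f xs) = fI \<MM> f (map (ainv \<sigma>) xs)" if "map (srt \<MM>) xs = fdom \<MM> f" for f xs
    using autD(3)[OF \<sigma>, of "map (ainv \<sigma>) xs" f] that unfolding s m by (metis \<sigma> aut_inv_simps(1))
  show "rI \<MM> r (map (ainv \<sigma>) xs) = rI \<MM> r xs" if "map (srt \<MM>) xs = rdom \<MM> r" for r xs
    using autD(4)[OF \<sigma>, of "map (ainv \<sigma>) xs" r] that unfolding s m by simp
qed

text \<open>The sort of the value is carried along because \<open>aut\<close> promises compatibility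
  with a function symbol only for arguments of the declared sorts.\<close>

lemma aut_tm_val:
  assumes \<sigma>: "\<sigma> \<in> aut \<MM>" and v: "valuation \<MM> UNIV v"
  shows "tm_ok \<MM> t \<Longrightarrow> tm_val \<MM> (\<lambda>x. \<sigma> (v x)) t = \<sigma> (tm_val \<MM> v t) \<and> srt \<MM> (tm_val \<MM> v t) = tm_sort \<MM> t"
proof (induction t)
  case (Var x)
  then show ?case using v by (simp add: valuation_def)
next
  case (Fn f ts)
  then have 1: "map (tm_val \<MM> (\<lambda>x. \<sigma> (v x))) ts = map \<sigma> (map (tm_val \<MM> v) ts)" by auto
  have "map (srt \<MM>) (map (tm_val \<MM> v) ts) = map (tm_sort \<MM>) ts"
    unfolding map_map using Fn by (intro map_cong) auto
  then have 2: "map (srt \<MM>) (map (tm_val \<MM> v) ts) = fdom \<MM> f" using Fn.prems by (simp only: tm_ok.simps)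
  show ?case
    using autD(3)[OF \<sigma> 2] 1 wf[unfolded wf_struct_def] 2 by (simp del: map_map)
qed

lemma aut_sat:
  assumes \<sigma>: "\<sigma> \<in> aut \<MM>"
  shows "fm_ok \<MM> \<phi> \<Longrightarrow> valuation \<MM> UNIV v \<Longrightarrow> sat \<MM> UNIV (\<lambda>x. \<sigma> (v x)) \<phi> = sat \<MM> UNIV v \<phi>"
proof (induction \<phi> arbitrary: v)
  case (Eq t u)
  then show ?case
    using aut_tm_val[OF \<sigma>, of v t] aut_tm_val[OF \<sigma>, of v u] autD(1)[OF \<sigma>]
    by (auto simp: bij_def inj_eq)
next
  case (Rel r ts)
  then have 1: "map (tm_val \<MM> (\<lambda>x. \<sigma> (v x))) ts = map \<sigma> (map (tm_val \<MM> v) ts)"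
    using aut_tm_val[OF \<sigma>, of v] by auto
  have "map (srt \<MM>) (map (tm_val \<MM> v) ts) = map (tm_sort \<MM>) ts"
    unfolding map_map using Rel aut_tm_val[OF \<sigma>, of v] by (intro map_cong) auto
  then have 2: "map (srt \<MM>) (map (tm_val \<MM> v) ts) = rdom \<MM> r" using Rel by (simp only: fm_ok.simps)
  show ?case using autD(4)[OF \<sigma> 2] 1 by (simp del: map_map)
next
  case (Ex x \<phi>)
  have "sat \<MM> UNIV ((\<lambda>z. \<sigma> (v z))(x := \<sigma> y)) \<phi> = sat \<MM> UNIV (v(x := y)) \<phi>" if "srt \<MM> y = fst x" for y
  proof -
    have "(\<lambda>z. \<sigma> (v z))(x := \<sigma> y) = (\<lambda>z. \<sigma> ((v(x := y)) z))" by auto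
    moreover have "valuation \<MM> UNIV (v(x := y))" using Ex.prems that by (intro valuation_upd) auto
    ultimately show ?thesis using Ex.IH[of "v(x := y)"] Ex.prems by (simp only: fm_ok.simps)
  qed
  then show ?case
    using autD(2)[OF \<sigma>] \<sigma> by simp (metis aut_inv_simps(2))
qed auto

lemma eqtp_aut:
  assumes \<sigma>: "\<sigma> \<in> aut \<MM>" and u: "sorted_on \<MM> s T u"
  shows "eqtp s T u (\<lambda>t. \<sigma> (u t))"
  unfolding eqtp_def
proof (intro conjI allI impI)
  show s: "sorted_on \<MM> s T (\<lambda>t. \<sigma> (u t))" using u autD(2)[OF \<sigma>] by (simp add: sorted_on_def)
  fix P assume "dfn \<MM> s T P"
  then obtain \<phi> e where \<phi>: "fm_ok \<MM> \<phi>" "\<forall>x\<in>FV \<phi>. e x \<in> T \<and> s (e x) = fst x"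
      "\<And>u v. sorted_on \<MM> s T u \<Longrightarrow> valuation \<MM> UNIV v \<Longrightarrow> (\<forall>x\<in>FV \<phi>. v x = u (e x)) \<Longrightarrow> P u = sat \<MM> UNIV v \<phi>"
    unfolding dfn_def by blast
  obtain v where v: "valuation \<MM> UNIV v" "\<And>x. x \<in> FV \<phi> \<Longrightarrow> v x = u (e x)"
  proof (rule valuation_extend[of "FV \<phi>" "\<lambda>x. u (e x)"])
    show "srt \<MM> (u (e x)) = fst x" if "x \<in> FV \<phi>" for x
      using u \<phi>(2) that by (simp add: sorted_on_def)
  qed blast
  have v': "valuation \<MM> UNIV (\<lambda>x. \<sigma> (v x))" using v(1) autD(2)[OF \<sigma>] by (simp add: valuation_def)
  have "P u = sat \<MM> UNIV v \<phi>" using \<phi>(3)[OF u v(1)] v(2) by blast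
  also have "\<dots> = sat \<MM> UNIV (\<lambda>x. \<sigma> (v x)) \<phi>" using aut_sat[OF \<sigma> \<phi>(1) v(1)] by simp
  also have "\<dots> = P (\<lambda>t. \<sigma> (u t))" using \<phi>(3)[OF s v'] v(2) by simp
  finally show "P u = P (\<lambda>t. \<sigma> (u t))" .
qed fact

section \<open>Complete types and conjugacy\<close>

lemma tp_subset_aut:
  assumes \<sigma>: "\<sigma> \<in> aut \<MM>" "\<And>c. c \<in> C \<Longrightarrow> \<sigma> c = c" "\<And>i. i \<in> I \<Longrightarrow> w i = \<sigma> (u i)"
  shows "tp \<MM> I u C \<subseteq> tp \<MM> I w C"
proof
  fix q assume "q \<in> tp \<MM> I u C"
  then obtain \<phi> e v where q: "q = (\<phi>, e)" "fm_ok \<MM> \<phi>"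
    "\<And>x. x \<in> FV \<phi> \<Longrightarrow> e x \<in> Inl ` I \<union> Inr ` C \<and> srt \<MM> (case_sum u id (e x)) = fst x"
    "valuation \<MM> UNIV v" "\<And>x. x \<in> FV \<phi> \<Longrightarrow> v x = case_sum u id (e x)" "sat \<MM> UNIV v \<phi>"
    unfolding tp_def by blast
  have e: "case_sum w id (e x) = \<sigma> (case_sum u id (e x))" if "x \<in> FV \<phi>" for x
    using q(3)[OF that] \<sigma> by auto
  have "valuation \<MM> UNIV (\<lambda>x. \<sigma> (v x))" using q(4) autD(2)[OF \<sigma>(1)] by (simp add: valuation_def)
  moreover have "\<forall>x\<in>FV \<phi>. \<sigma> (v x) = case_sum w id (e x)" using e q(5) by simp
  moreover have "sat \<MM> UNIV (\<lambda>x. \<sigma> (v x)) \<phi>" using aut_sat[OF \<sigma>(1) q(2,4)] q(6) by simp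
  moreover have "\<forall>x\<in>FV \<phi>. e x \<in> Inl ` I \<union> Inr ` C \<and> srt \<MM> (case_sum w id (e x)) = fst x"
    using e q(3) autD(2)[OF \<sigma>(1)] by simp
  ultimately show "q \<in> tp \<MM> I w C" unfolding tp_def q(1) using q(2) by blast
qed

lemma tp_aut:
  assumes \<sigma>: "\<sigma> \<in> aut \<MM>" "\<And>c. c \<in> C \<Longrightarrow> \<sigma> c = c" "\<And>i. i \<in> I \<Longrightarrow> w i = \<sigma> (u i)"
  shows "tp \<MM> I u C = tp \<MM> I w C"
proof
  show "tp \<MM> I u C \<subseteq> tp \<MM> I w C" using assms by (rule tp_subset_aut)
  have "ainv \<sigma> c = c" if "c \<in> C" for c using \<sigma>(2)[OF that] \<sigma>(1) by (metis aut_inv_simps(1))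
  then show "tp \<MM> I w C \<subseteq> tp \<MM> I u C"
    using \<sigma> by (intro tp_subset_aut[OF inv_aut[OF \<sigma>(1)]]) auto
qed

text \<open>A type is defined through the existence of a valuation; as satisfaction depends only on
  free variables, any valuation with the right values there decides membership.\<close>

lemma tp_mem_dfn:
  assumes "fm_ok \<MM> \<phi>" "\<And>x. x \<in> FV \<phi> \<Longrightarrow> e x \<in> Inl ` I \<union> Inr ` C \<and> s (e x) = fst x"
    and u: "sorted_on \<MM> s (Inl ` I \<union> Inr ` C) (case_sum u id)" "valuation \<MM> UNIV v"
      "\<And>x. x \<in> FV \<phi> \<Longrightarrow> v x = case_sum u id (e x)"
  shows "(\<phi>, e) \<in> tp \<MM> I u C \<longleftrightarrow> sat \<MM> UNIV v \<phi>"
proof -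
  define val where "val x = case_sum u id (e x)" for x
  have same: "sat \<MM> UNIV w \<phi> = sat \<MM> UNIV v \<phi>" if "\<And>x. x \<in> FV \<phi> \<Longrightarrow> w x = val x" for w
    by (rule sat_cong) (simp add: that u(3) val_def)
  have v: "v x = val x" if "x \<in> FV \<phi>" for x using u(3)[OF that] by (simp add: val_def)
  have "srt \<MM> (val x) = fst x" if "x \<in> FV \<phi>" for x
    using v[OF that] u(2) by (metis valuation_def)
  then have *: "(\<phi>, e) \<in> tp \<MM> I u C \<longleftrightarrow>
      (\<exists>w. valuation \<MM> UNIV w \<and> (\<forall>x\<in>FV \<phi>. w x = val x) \<and> sat \<MM> UNIV w \<phi>)"
    using assms(1) conjunct1[OF assms(2)] unfolding tp_def val_def by simp
  show ?thesis
  proof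
    assume "sat \<MM> UNIV v \<phi>"
    then show "(\<phi>, e) \<in> tp \<MM> I u C" unfolding * using u(2) v by (intro exI[of _ v]) simp
  next
    assume "(\<phi>, e) \<in> tp \<MM> I u C"
    then obtain w where "\<forall>x\<in>FV \<phi>. w x = val x" "sat \<MM> UNIV w \<phi>" unfolding * by blast
    then show "sat \<MM> UNIV v \<phi>" using same[of w] by simp
  qed
qed

text \<open>The formula \<open>x = x\<close>, with \<open>x\<close> of the sort of
  \<open>u i\<close>, is in the type, so a type knows the sorts of its entries.\<close>

lemma tp_eq_sorts:
  assumes eq: "tp \<MM> I u C = tp \<MM> I w C" and i: "i \<in> I"
  shows "srt \<MM> (w i) = srt \<MM> (u i)"
proof -
  define x where "x = (srt \<MM> (u i), 0 :: nat)"
  obtain v where "valuation \<MM> UNIV v" "\<And>y. y \<in> {x} \<Longrightarrow> v y = u i"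
    using valuation_extend[of "{x}" "\<lambda>_. u i"] by (auto simp: x_def)
  then have "(Eq (Var x) (Var x), \<lambda>_. Inl i) \<in> tp \<MM> I u C"
    unfolding tp_def using i by (auto simp: x_def)
  then have "(Eq (Var x) (Var x), \<lambda>_. Inl i) \<in> tp \<MM> I w C" unfolding eq .
  then show ?thesis unfolding tp_def by (auto simp: x_def)
qed

text \<open>The parameters become entries of the tuple, with index \<open>Inr c\<close>; fixing them
  is then part of having the same type.\<close>

lemma tp_eq_eqtp:
  assumes eq: "tp \<MM> I u C = tp \<MM> I w C"
  shows "eqtp (\<lambda>t. srt \<MM> (case_sum u id t)) (Inl ` I \<union> Inr ` C) (case_sum u id) (case_sum w id)"
  unfolding eqtp_def
proof (intro conjI allI impI)
  let ?s = "\<lambda>t. srt \<MM> (case_sum u id t)" and ?T = "Inl ` I \<union> Inr ` C"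
  show u: "sorted_on \<MM> ?s ?T (case_sum u id)" by (simp add: sorted_on_def)
  show w: "sorted_on \<MM> ?s ?T (case_sum w id)"
    using tp_eq_sorts[OF eq] by (auto simp: sorted_on_def)
  fix P assume "dfn \<MM> ?s ?T P"
  then obtain \<phi> e where \<phi>: "fm_ok \<MM> \<phi>" "\<And>x. x \<in> FV \<phi> \<Longrightarrow> e x \<in> ?T \<and> ?s (e x) = fst x"
      "\<And>u v. sorted_on \<MM> ?s ?T u \<Longrightarrow> valuation \<MM> UNIV v \<Longrightarrow> (\<forall>x\<in>FV \<phi>. v x = u (e x)) \<Longrightarrow> P u = sat \<MM> UNIV v \<phi>"
    unfolding dfn_def by blast
  have "P (case_sum f id) \<longleftrightarrow> (\<phi>, e) \<in> tp \<MM> I f C" if f: "sorted_on \<MM> ?s ?T (case_sum f id)" for f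
  proof -
    obtain v where v: "valuation \<MM> UNIV v" "\<And>x. x \<in> FV \<phi> \<Longrightarrow> v x = case_sum f id (e x)"
    proof (rule valuation_extend[of "FV \<phi>" "\<lambda>x. case_sum f id (e x)"])
      show "srt \<MM> (case_sum f id (e x)) = fst x" if "x \<in> FV \<phi>" for x
        using f \<phi>(2)[OF that] unfolding sorted_on_def by metis
    qed blast
    have "P (case_sum f id) \<longleftrightarrow> sat \<MM> UNIV v \<phi>" using \<phi>(3)[OF f v(1)] v(2) by blast
    also have "\<dots> \<longleftrightarrow> (\<phi>, e) \<in> tp \<MM> I f C" by (rule tp_mem_dfn[symmetric, OF \<phi>(1,2) f v]) 
    finally show ?thesis .
  qed
  from this[OF u] this[OF w] show "P (case_sum u id) = P (case_sum w id)" using eq by simp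
qed

text \<open>Conjugacy replaces syntax: elementary maps, equal types of pairs and the realizations of
  \<open>p\<close> are all handled through this equivalence.\<close>

theorem tp_eq_iff:
  assumes I: "|I| <o |UNIV :: 'm set|" and C: "small C"
  shows "tp \<MM> I u C = tp \<MM> I w C \<longleftrightarrow>
    (\<exists>\<sigma>\<in>aut \<MM>. (\<forall>c\<in>C. \<sigma> c = c) \<and> (\<forall>i\<in>I. w i = \<sigma> (u i)))"
proof
  assume "tp \<MM> I u C = tp \<MM> I w C"
  from tp_eq_eqtp[OF this] obtain \<sigma> where \<sigma>: "\<sigma> \<in> aut \<MM>"
    "\<And>t. t \<in> Inl ` I \<union> Inr ` C \<Longrightarrow> case_sum w id t = \<sigma> (case_sum u id t)"
    by (rule homogeneity) (use I C in \<open>auto intro!: card_Un card_image simp: small_def\<close>)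
  have "\<sigma> c = c" if "c \<in> C" for c using \<sigma>(2)[of "Inr c"] that by simp
  moreover have "w i = \<sigma> (u i)" if "i \<in> I" for i using \<sigma>(2)[of "Inl i"] that by simp
  ultimately show "\<exists>\<sigma>\<in>aut \<MM>. (\<forall>c\<in>C. \<sigma> c = c) \<and> (\<forall>i\<in>I. w i = \<sigma> (u i))" using \<sigma>(1) by blast
next
  assume "\<exists>\<sigma>\<in>aut \<MM>. (\<forall>c\<in>C. \<sigma> c = c) \<and> (\<forall>i\<in>I. w i = \<sigma> (u i))"
  then obtain \<sigma> where \<sigma>: "\<sigma> \<in> aut \<MM>" "\<And>c. c \<in> C \<Longrightarrow> \<sigma> c = c" "\<And>i. i \<in> I \<Longrightarrow> w i = \<sigma> (u i)" by blast
  show "tp \<MM> I u C = tp \<MM> I w C" by (rule tp_aut) (rule \<sigma>; assumption)+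
qed

end

section \<open>Algebraic closure\<close>

context monster_model
begin

lemma acl_mono: "A \<subseteq> A' \<Longrightarrow> acl \<MM> A \<subseteq> acl \<MM> A'"
  unfolding acl_def by blast

lemma acl_superset: "A \<subseteq> acl \<MM> A"
proof
  fix x assume x: "x \<in> A"
  define z w where "z = (srt \<MM> x, 0 :: nat)" and "w = (srt \<MM> x, 1 :: nat)"
  obtain v where v: "valuation \<MM> UNIV v" "\<And>y. y \<in> {z, w} \<Longrightarrow> v y = x"
    by (rule valuation_extend[of "{z, w}" "\<lambda>_. x"]) (auto simp: z_def w_def)
  have "{y. srt \<MM> y = fst z \<and> sat \<MM> UNIV (v(z := y)) (Eq (Var z) (Var w))} = {x}"
    using v(2)[of w] by (auto simp: z_def w_def)
  moreover have "v ` (FV (Eq (Var z) (Var w)) - {z}) \<subseteq> A"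
    using v(2)[of w] x by auto
  moreover have "sat \<MM> UNIV (v(z := x)) (Eq (Var z) (Var w))"
    using v(2)[of w] by (auto simp: z_def w_def)
  ultimately show "x \<in> acl \<MM> A"
    unfolding acl_def using v(1)
    by (intro CollectI exI[of _ "Eq (Var z) (Var w)"] exI[of _ z] exI[of _ v]) (auto simp: z_def w_def)
qed

lemma acl_finite_support:
  assumes "x \<in> acl \<MM> A"
  obtains D where "finite D" "D \<subseteq> A" "x \<in> acl \<MM> D"
proof -
  obtain \<phi> z v where "fm_ok \<MM> \<phi>" "fst z = srt \<MM> x" "valuation \<MM> UNIV v" "v ` (FV \<phi> - {z}) \<subseteq> A"
      "sat \<MM> UNIV (v(z := x)) \<phi>" "finite {y. srt \<MM> y = fst z \<and> sat \<MM> UNIV (v(z := y)) \<phi>}"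
    using assms unfolding acl_def by blast
  then have "x \<in> acl \<MM> (v ` (FV \<phi> - {z}))" unfolding acl_def by blast
  then show thesis
    by (rule that[rotated 2]) (use \<open>v ` (FV \<phi> - {z}) \<subseteq> A\<close> in \<open>auto simp: finite_FV\<close>)
qed

lemma aut_fix_sat:
  assumes \<sigma>: "\<sigma> \<in> aut \<MM>" "\<And>c. c \<in> A \<Longrightarrow> \<sigma> c = c"
    and \<phi>: "fm_ok \<MM> \<phi>" "valuation \<MM> UNIV v" "v ` (FV \<phi> - {z}) \<subseteq> A" "srt \<MM> x = fst z"
  shows "sat \<MM> UNIV (v(z := \<sigma> x)) \<phi> = sat \<MM> UNIV (v(z := x)) \<phi>"
proof -
  have "sat \<MM> UNIV (v(z := \<sigma> x)) \<phi> = sat \<MM> UNIV (\<lambda>y. \<sigma> ((v(z := x)) y)) \<phi>"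
    by (rule sat_cong) (use \<sigma>(2) \<phi>(3) in auto)
  also have "\<dots> = sat \<MM> UNIV (v(z := x)) \<phi>"
    by (rule aut_sat[OF \<sigma>(1) \<phi>(1)]) (rule valuation_upd[OF \<phi>(2) UNIV_I \<phi>(4)])
  finally show ?thesis .
qed

text \<open>For small \<open>A\<close> a finite orbit characterizes algebraicity, which makes the
  closure properties of \<open>acl\<close> a matter of counting conjugates.\<close>

definition orbit :: "'m set \<Rightarrow> 'm \<Rightarrow> 'm set" where
  "orbit A x = {\<sigma> x | \<sigma>. \<sigma> \<in> aut \<MM> \<and> (\<forall>c\<in>A. \<sigma> c = c)}"

lemma acl_imp_finite_orbit:
  assumes "x \<in> acl \<MM> A"
  shows "finite (orbit A x)"
proof -
  obtain \<phi> z v where *: "fm_ok \<MM> \<phi>" "fst z = srt \<MM> x" "valuation \<MM> UNIV v" "v ` (FV \<phi> - {z}) \<subseteq> A"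
      "sat \<MM> UNIV (v(z := x)) \<phi>" "finite {y. srt \<MM> y = fst z \<and> sat \<MM> UNIV (v(z := y)) \<phi>}"
    using assms unfolding acl_def by blast
  have "orbit A x \<subseteq> {y. srt \<MM> y = fst z \<and> sat \<MM> UNIV (v(z := y)) \<phi>}"
    using aut_fix_sat[OF _ _ *(1,3,4)] *(2,5) autD(2) by (auto simp: orbit_def)
  then show ?thesis using *(6) by (rule finite_subset)
qed

lemma dcl_fixed:
  assumes x: "x \<in> dcl \<MM> A" and \<sigma>: "\<sigma> \<in> aut \<MM>" "\<And>c. c \<in> A \<Longrightarrow> \<sigma> c = c"
  shows "\<sigma> x = x"
proof -
  obtain \<phi> z v where *: "fm_ok \<MM> \<phi>" "fst z = srt \<MM> x" "valuation \<MM> UNIV v" "v ` (FV \<phi> - {z}) \<subseteq> A"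
      "{y. srt \<MM> y = fst z \<and> sat \<MM> UNIV (v(z := y)) \<phi>} = {x}"
    using x unfolding dcl_def by blast
  then have "sat \<MM> UNIV (v(z := \<sigma> x)) \<phi>"
    using aut_fix_sat[OF \<sigma> *(1,3,4), of x] by auto
  then have "\<sigma> x \<in> {y. srt \<MM> y = fst z \<and> sat \<MM> UNIV (v(z := y)) \<phi>}"
    using *(2) autD(2)[OF \<sigma>(1)] by simp
  then show ?thesis unfolding *(5) by simp
qed

text \<open>If \<open>x\<close> is not algebraic, every formula over \<open>A\<close> true of
  \<open>x\<close> has infinitely many solutions, so saturation realizes the type of
  \<open>x\<close> outside the finite orbit; but by homogeneity this realization lies in the
  orbit.\<close>

lemma finite_orbit_imp_acl:
  assumes A: "small A" and fin: "finite (orbit A x)"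
  shows "x \<in> acl \<MM> A"
proof (rule ccontr)
  assume x: "x \<notin> acl \<MM> A"
  define s where "s = case_option (srt \<MM> x) (srt \<MM>)"
  define u where "u = case_option x (\<lambda>y :: 'm. y)"
  define T where "T = insert None (Some ` A)"
  \<comment> \<open>\<open>\<P>1\<close> is the type of \<open>x\<close> over \<open>A\<close>, and
    \<open>\<P>2\<close> excludes the finitely many conjugates.\<close>
  define \<P>1 where "\<P>1 = {P. dfn \<MM> s T P \<and> P u}"
  define \<P>2 where "\<P>2 = (\<lambda>y (f :: 'm option \<Rightarrow> 'm). f None \<noteq> f (Some y)) ` orbit A x"
  have orb: "srt \<MM> y = srt \<MM> x" if "y \<in> orbit A x" for y
    using that autD(2) by (auto simp: orbit_def)
  have su: "sorted_on \<MM> s B u" for B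
    by (auto simp: sorted_on_def s_def u_def split: option.split)
  have inf: "infinite {y. srt \<MM> y = srt \<MM> x \<and> Q (u(None := y))}" if Q: "dfn \<MM> s T Q" "Q u" for Q
  proof
    assume fin: "finite {y. srt \<MM> y = srt \<MM> x \<and> Q (u(None := y))}"
    obtain \<phi> v where \<phi>: "fm_ok \<MM> \<phi>" "valuation \<MM> UNIV v" "v ` (FV \<phi> - {(s None, 0)}) \<subseteq> u ` Some ` A"
      "\<And>y. srt \<MM> y = s None \<Longrightarrow> Q (u(None := y)) = sat \<MM> UNIV (v((s None, 0) := y)) \<phi>"
      by (rule dfn_one_variable[OF su Q(1)[unfolded T_def]]) auto
    have s: "s None = srt \<MM> x" by (simp add: s_def)
    have "u ` Some ` A = A" by (auto simp: u_def image_image)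
    moreover have "u(None := x) = u" by (auto simp: u_def split: option.split)
    moreover have "{y. srt \<MM> y = srt \<MM> x \<and> sat \<MM> UNIV (v((srt \<MM> x, 0) := y)) \<phi>}
      = {y. srt \<MM> y = srt \<MM> x \<and> Q (u(None := y))}"
      using \<phi>(4) by (auto simp: s)
    ultimately have "x \<in> acl \<MM> A"
      unfolding acl_def using \<phi> Q(2) fin
      by (intro CollectI exI[of _ \<phi>] exI[of _ "(srt \<MM> x, 0)"] exI[of _ v]) (auto simp: s)
    then show False using x by blast
  qed
  have "\<exists>y. srt \<MM> y = s None \<and> (\<forall>P\<in>\<P>1 \<union> \<P>2. P (u(None := y)))"
  proof (rule saturation[where A = "Some ` (A \<union> orbit A x)"])
    have "u ` Some ` (A \<union> orbit A x) = A \<union> orbit A x" by (auto simp: u_def image_image)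
    then show "small (u ` Some ` (A \<union> orbit A x))"
      unfolding small_def using A fin by (simp add: card_Un card_finite small_def)
    fix P assume "P \<in> \<P>1 \<union> \<P>2"
    then consider "P \<in> \<P>1" | "P \<in> \<P>2" by blast
    then show "dfn \<MM> s (insert None (Some ` (A \<union> orbit A x))) P"
    proof cases
      case 1
      then have "dfn \<MM> s T P" by (simp add: \<P>1_def)
      then show ?thesis by (rule dfn_mono) (auto simp: T_def)
    next
      case 2
      then obtain y where y: "y \<in> orbit A x" "P = (\<lambda>f. f None \<noteq> f (Some y))" by (auto simp: \<P>2_def)
      have "dfn \<MM> s {None, Some y} P"
        unfolding y(2) by (intro dfn_Not dfn_eq) (simp add: s_def orb[OF y(1)])
      then show ?thesis by (rule dfn_mono) (use y(1) in auto)
    qed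
  next
    fix F assume F: "finite F" "F \<subseteq> \<P>1 \<union> \<P>2"
    define Q where "Q f = (\<forall>P\<in>F \<inter> \<P>1. P f)" for f
    have "dfn \<MM> s T Q" unfolding Q_def using F(1) by (intro dfn_Ball) (auto simp: \<P>1_def)
    moreover have "Q u" by (auto simp: Q_def \<P>1_def)
    ultimately have "infinite {y. srt \<MM> y = srt \<MM> x \<and> Q (u(None := y))}" by (rule inf)
    then have "\<not> {y. srt \<MM> y = srt \<MM> x \<and> Q (u(None := y))} \<subseteq> orbit A x"
      using finite_subset[OF _ fin] by blast
    then obtain y where y: "srt \<MM> y = srt \<MM> x" "Q (u(None := y))" "y \<notin> orbit A x" by blast
    have "P (u(None := y))" if PF: "P \<in> F" for P
    proof (cases "P \<in> \<P>1")
      case True then show ?thesis using y(2) PF unfolding Q_def by blast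
    next
      case False
      then obtain y' where "y' \<in> orbit A x" "P = (\<lambda>f. f None \<noteq> f (Some y'))"
        using PF F(2) unfolding \<P>2_def by blast
      then show ?thesis using y(3) by (auto simp: u_def)
    qed
    then show "\<exists>y. srt \<MM> y = s None \<and> (\<forall>P\<in>F. P (u(None := y)))"
      using y(1) by (auto simp: s_def)
  qed (use su in auto)
  then obtain y where y: "srt \<MM> y = srt \<MM> x" "\<And>P. P \<in> \<P>1 \<union> \<P>2 \<Longrightarrow> P (u(None := y))"
    by (auto simp: s_def)
  have "eqtp s T u (u(None := y))"
    unfolding eqtp_def
  proof (intro conjI allI impI)
    show "sorted_on \<MM> s T (u(None := y))" using y(1) su[of T] by (auto simp: sorted_on_def s_def)
    fix P assume P: "dfn \<MM> s T P"
    show "P u = P (u(None := y))"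
    proof (cases "P u")
      case True
      then show ?thesis using y(2)[of P] P by (simp add: \<P>1_def)
    next
      case False
      then have "(\<lambda>f. \<not> P f) \<in> \<P>1" using dfn_Not[OF P] by (simp add: \<P>1_def)
      then show ?thesis using y(2)[of "\<lambda>f. \<not> P f"] False by simp
    qed
  qed (rule su)
  moreover have "|T| <o |UNIV :: 'm set|"
    using card_Un[OF card_finite[of "{None}"] card_image[OF A[unfolded small_def], of Some]] by (simp add: T_def)
  ultimately obtain \<sigma> where \<sigma>: "\<sigma> \<in> aut \<MM>" "\<And>t. t \<in> T \<Longrightarrow> (u(None := y)) t = \<sigma> (u t)"
    by (rule homogeneity) blast
  have "\<sigma> c = c" if "c \<in> A" for c using \<sigma>(2)[of "Some c"] that by (simp add: T_def u_def)
  moreover have "\<sigma> x = y" using \<sigma>(2)[of None] by (simp add: T_def u_def)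
  ultimately have o: "y \<in> orbit A x" using \<sigma>(1) by (auto simp: orbit_def)
  then have "(\<lambda>f. f None \<noteq> f (Some y)) \<in> \<P>2" by (simp add: \<P>2_def)
  then show False using y(2) by (fastforce simp: u_def)
qed

section \<open>Smallness and idempotence of algebraic closure\<close>

lemma small_finite: "finite A \<Longrightarrow> small (A :: 'm set)"
  by (simp add: small_def card_finite)

lemma small_subset: "small (B :: 'm set) \<Longrightarrow> A \<subseteq> B \<Longrightarrow> small A"
  unfolding small_def by (rule card_subset)

lemma small_Un: "small (A :: 'm set) \<Longrightarrow> small B \<Longrightarrow> small (A \<union> B)"
  unfolding small_def by (rule card_Un)

lemma small_image: "small (A :: 'm set) \<Longrightarrow> small ((f :: 'm \<Rightarrow> 'm) ` A)"
  unfolding small_def by (rule card_image)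

lemma small_UN_finite: "finite I \<Longrightarrow> (\<And>i. i \<in> I \<Longrightarrow> small (X i)) \<Longrightarrow> small (\<Union>i\<in>I. X i :: 'm set)"
  by (induction rule: finite_induct) (auto simp: small_finite small_Un)

text \<open>An image of \<open>x\<close> over \<open>A\<close> is determined up to finitely many
  choices by what the automorphism does on a finite support \<open>D\<close> of \<open>x\<close>,
  and \<open>D\<close> itself has only finitely many images over \<open>A\<close>.\<close>

lemma acl_acl:
  assumes A: "small A"
  shows "acl \<MM> (acl \<MM> A) = acl \<MM> A"
proof
  show "acl \<MM> A \<subseteq> acl \<MM> (acl \<MM> A)" by (rule acl_superset)
  show "acl \<MM> (acl \<MM> A) \<subseteq> acl \<MM> A"
  proof
    fix x assume "x \<in> acl \<MM> (acl \<MM> A)"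
    then obtain D where D: "finite D" "D \<subseteq> acl \<MM> A" "x \<in> acl \<MM> D" by (rule acl_finite_support)
    \<comment> \<open>The possible images of \<open>x\<close> once the automorphism is prescribed on
      \<open>D\<close>: either none, or contained in a translate of the orbit over
      \<open>D\<close>.\<close>
    define X where "X h = {\<sigma> x | \<sigma>. \<sigma> \<in> aut \<MM> \<and> (\<forall>d\<in>D. \<sigma> d = h d)}" for h :: "'m \<Rightarrow> 'm"
    have fin: "finite (X h)" for h
    proof (cases "X h = {}")
      case False
      then obtain \<tau> where \<tau>: "\<tau> \<in> aut \<MM>" "\<forall>d\<in>D. \<tau> d = h d" by (auto simp: X_def)
      have "X h \<subseteq> \<tau> ` orbit D x"
      proof
        fix y assume "y \<in> X h"
        then obtain \<sigma> where \<sigma>: "\<sigma> \<in> aut \<MM>" "\<forall>d\<in>D. \<sigma> d = h d" "y = \<sigma> x" by (auto simp: X_def)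
        have "ainv \<tau> \<circ> \<sigma> \<in> aut \<MM>" using \<sigma> \<tau> by (intro comp_aut inv_aut)
        moreover have "\<forall>d\<in>D. (ainv \<tau> \<circ> \<sigma>) d = d" using \<sigma> \<tau> by (metis aut_inv_simps(1) comp_apply)
        ultimately have "(ainv \<tau> \<circ> \<sigma>) x \<in> orbit D x" unfolding orbit_def by blast
        moreover have "y = \<tau> ((ainv \<tau> \<circ> \<sigma>) x)" using \<sigma>(3) \<tau>(1) by simp
        ultimately show "y \<in> \<tau> ` orbit D x" by blast
      qed
      then show ?thesis using acl_imp_finite_orbit[OF D(3)] finite_surj by blast
    qed simp
    have "orbit A x \<subseteq> (\<Union>h \<in> (\<Pi>\<^sub>E d\<in>D. orbit A d). X h)"
    proof
      fix y assume "y \<in> orbit A x"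
      then obtain \<sigma> where \<sigma>: "\<sigma> \<in> aut \<MM>" "\<forall>c\<in>A. \<sigma> c = c" "y = \<sigma> x" by (auto simp: orbit_def)
      then have "restrict \<sigma> D \<in> (\<Pi>\<^sub>E d\<in>D. orbit A d)" by (auto simp: orbit_def)
      moreover have "y \<in> X (restrict \<sigma> D)" using \<sigma> by (auto simp: X_def)
      ultimately show "y \<in> (\<Union>h \<in> (\<Pi>\<^sub>E d\<in>D. orbit A d). X h)" by blast
    qed
    moreover have "finite (\<Pi>\<^sub>E d\<in>D. orbit A d)"
      using D acl_imp_finite_orbit by (intro finite_PiE) auto
    ultimately have "finite (orbit A x)" using fin by (meson finite_UN finite_subset)
    then show "x \<in> acl \<MM> A" using A by (rule finite_orbit_imp_acl[rotated])
  qed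
qed

lemma acl_image_subset:
  assumes A: "small A" and \<sigma>: "\<sigma> \<in> aut \<MM>"
  shows "\<sigma> ` acl \<MM> A \<subseteq> acl \<MM> (\<sigma> ` A)"
proof
  fix y assume "y \<in> \<sigma> ` acl \<MM> A"
  then obtain x where x: "x \<in> acl \<MM> A" "y = \<sigma> x" by blast
  have "orbit (\<sigma> ` A) y \<subseteq> \<sigma> ` orbit A x"
  proof
    fix z assume "z \<in> orbit (\<sigma> ` A) y"
    then obtain \<tau> where \<tau>: "\<tau> \<in> aut \<MM>" "\<forall>c\<in>\<sigma> ` A. \<tau> c = c" "z = \<tau> y" by (auto simp: orbit_def)
    have "ainv \<sigma> \<circ> \<tau> \<circ> \<sigma> \<in> aut \<MM>" using \<sigma> \<tau> by (intro comp_aut inv_aut)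
    moreover have "\<forall>c\<in>A. (ainv \<sigma> \<circ> \<tau> \<circ> \<sigma>) c = c" using \<sigma> \<tau> by auto
    ultimately have "(ainv \<sigma> \<circ> \<tau> \<circ> \<sigma>) x \<in> orbit A x" unfolding orbit_def by blast
    moreover have "z = \<sigma> ((ainv \<sigma> \<circ> \<tau> \<circ> \<sigma>) x)" using \<sigma> \<tau>(3) x(2) by simp
    ultimately show "z \<in> \<sigma> ` orbit A x" by blast
  qed
  then have "finite (orbit (\<sigma> ` A) y)"
    using acl_imp_finite_orbit[OF x(1)] finite_surj by blast
  then show "y \<in> acl \<MM> (\<sigma> ` A)" using A by (intro finite_orbit_imp_acl small_image)
qed

lemma acl_image:
  assumes A: "small A" and \<sigma>: "\<sigma> \<in> aut \<MM>"
  shows "\<sigma> ` acl \<MM> A = acl \<MM> (\<sigma> ` A)"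
proof
  show "\<sigma> ` acl \<MM> A \<subseteq> acl \<MM> (\<sigma> ` A)" using assms by (rule acl_image_subset)
  have "ainv \<sigma> ` acl \<MM> (\<sigma> ` A) \<subseteq> acl \<MM> (ainv \<sigma> ` \<sigma> ` A)"
    using assms by (intro acl_image_subset small_image inv_aut)
  also have "ainv \<sigma> ` \<sigma> ` A = A" using \<sigma> by (auto simp: image_image)
  finally have "\<sigma> ` ainv \<sigma> ` acl \<MM> (\<sigma> ` A) \<subseteq> \<sigma> ` acl \<MM> A" by blast
  then show "acl \<MM> (\<sigma> ` A) \<subseteq> \<sigma> ` acl \<MM> A" using \<sigma> by (simp add: image_image)
qed

lemma card_Times: "|A| <o |UNIV :: 'm set| \<Longrightarrow> |B| <o |UNIV :: 'm set| \<Longrightarrow> |A \<times> B| <o |UNIV :: 'm set|"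
  using infinite_UNIV_m card_of_Times_ordLess_infinite by blast

text \<open>Each algebraic element lies in a finite set given by a formula, a variable and a list of
  parameters; there are fewer such data than elements of the model.\<close>

lemma small_acl:
  assumes A: "small A"
  shows "small (acl \<MM> A)"
proof -
  \<comment> \<open>The formulas are thrown in to make \<open>B\<close> infinite even for finite
    \<open>A\<close>; passing to lists does not increase the cardinality of an infinite set.\<close>
  define B where "B = Inl ` A \<union> range (Inr :: ('s, 'f, 'r) fm \<Rightarrow> 'm + ('s, 'f, 'r) fm)"
  define X where "X = (UNIV :: ('s, 'f, 'r) fm set) \<times> (UNIV :: 's var set) \<times> lists B"
  define xs where "xs \<phi> z = (SOME xs. set xs = FV \<phi> - {z})" for \<phi> :: "('s, 'f, 'r) fm" and z
  define S where "S = (\<lambda>(\<phi>, z, l). {y. \<exists>v. valuation \<MM> UNIV v \<and> map (\<lambda>x. Inl (v x) :: 'm + ('s, 'f, 'r) fm) (xs \<phi> z) = l \<and>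
     srt \<MM> y = fst z \<and> sat \<MM> UNIV (v(z := y)) \<phi>})"
  define X' where "X' = {q \<in> X. finite (S q)}"
  have xs: "set (xs \<phi> z) = FV \<phi> - {z}" for \<phi> z
    unfolding xs_def by (rule someI_ex) (use finite_list[of "FV \<phi> - {z}"] in \<open>auto simp: finite_FV\<close>)
  have B: "|B| <o |UNIV :: 'm set|"
    unfolding B_def using A card_fm by (intro card_Un card_image) (auto simp: small_def)
  have "infinite B"
    unfolding B_def using infinite_fm by (simp add: finite_image_iff)
  then have "|lists B| =o |B|" by (rule card_of_lists_infinite)
  then have L: "|lists B| <o |UNIV :: 'm set|" using B ordIso_ordLess_trans by blast
  have "inj (\<lambda>x :: 's var. Eq (Var x) (Var x) :: ('s, 'f, 'r) fm)" by (simp add: inj_def)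
  then have "|UNIV :: 's var set| \<le>o |UNIV :: ('s, 'f, 'r) fm set|" using card_of_ordLeq by blast
  then have "|UNIV :: 's var set| <o |UNIV :: 'm set|" using card_fm ordLeq_ordLess_trans by blast
  then have X: "|X| <o |UNIV :: 'm set|" unfolding X_def using card_fm L by (intro card_Times)
  have "infinite X" unfolding X_def using infinite_fm by (auto simp: finite_cartesian_product_iff)
  moreover have "|X'| \<le>o |X|" unfolding X'_def by (intro card_of_mono1) auto
  moreover have "|S q| \<le>o |X|" if "q \<in> X'" for q
    using that \<open>infinite X\<close> finite_ordLess_infinite2 ordLess_imp_ordLeq unfolding X'_def by blast
  ultimately have U: "|\<Union>q\<in>X'. S q| \<le>o |X|" by (intro card_of_UNION_ordLeq_infinite) auto
  have "acl \<MM> A \<subseteq> (\<Union>q\<in>X'. S q)"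
  proof
    fix x assume "x \<in> acl \<MM> A"
    then obtain \<phi> z v where *: "fm_ok \<MM> \<phi>" "fst z = srt \<MM> x" "valuation \<MM> UNIV v" "v ` (FV \<phi> - {z}) \<subseteq> A"
        "sat \<MM> UNIV (v(z := x)) \<phi>" "finite {y. srt \<MM> y = fst z \<and> sat \<MM> UNIV (v(z := y)) \<phi>}"
      unfolding acl_def by blast
    define l where "l = map (\<lambda>x. Inl (v x) :: 'm + ('s, 'f, 'r) fm) (xs \<phi> z)"
    have "sat \<MM> UNIV (w(z := y)) \<phi> = sat \<MM> UNIV (v(z := y)) \<phi>" if "map (\<lambda>x. Inl (w x)) (xs \<phi> z) = l" for w y
    proof (rule sat_cong)
      have "\<forall>x\<in>FV \<phi> - {z}. w x = v x" using that unfolding l_def map_eq_conv xs by simp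
      then show "(w(z := y)) x = (v(z := y)) x" if "x \<in> FV \<phi>" for x using that by simp
    qed
    then have "S (\<phi>, z, l) = {y. srt \<MM> y = fst z \<and> sat \<MM> UNIV (v(z := y)) \<phi>}"
      unfolding S_def prod.case using *(3) l_def by blast
    moreover have "l \<in> lists B"
      using *(4) xs[of \<phi> z] by (auto simp: l_def B_def in_lists_conv_set)
    ultimately show "x \<in> (\<Union>q\<in>X'. S q)"
      using * by (intro UN_I[of "(\<phi>, z, l)"]) (auto simp: X'_def X_def)
  qed
  then have "|acl \<MM> A| \<le>o |\<Union>q\<in>X'. S q|" by (rule card_of_mono1)
  from ordLeq_ordLess_trans[OF ordLeq_transitive[OF this U] X] show ?thesis
    unfolding small_def .
qed

end

section \<open>Compactness for small tuples\<close>

context monster_model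
begin

lemma sort_inhabited: "\<exists>y. srt \<MM> y = s"
  using wf by (auto simp: wf_struct_def)

lemma dfn_ex_finite:
  fixes s :: "'t \<Rightarrow> 's"
  assumes "finite V" "dfn \<MM> s T P"
  shows "dfn \<MM> s (T - V) (\<lambda>u. \<exists>u'. (\<forall>t. t \<notin> V \<longrightarrow> u' t = u t) \<and> (\<forall>t\<in>V. srt \<MM> (u' t) = s t) \<and> P u')"
  using assms
proof (induction V rule: finite_induct)
  case empty
  have "(\<lambda>u. \<exists>u'. (\<forall>t. t \<notin> {} \<longrightarrow> u' t = u t) \<and> (\<forall>t\<in>{}. srt \<MM> (u' t) = s t) \<and> P u') = P"
    by (auto simp: fun_eq_iff[symmetric])
  then show ?case using empty by simp
next
  case (insert x V)
  define E where "E u = (\<exists>u'. (\<forall>t. t \<notin> V \<longrightarrow> u' t = u t) \<and> (\<forall>t\<in>V. srt \<MM> (u' t) = s t) \<and> P u')" for u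
  have "dfn \<MM> s (T - V) E" using insert unfolding E_def by blast
  then have "dfn \<MM> s (T - V - {x}) (\<lambda>u. \<exists>y. srt \<MM> y = s x \<and> E (u(x := y)))" by (rule dfn_ex)
  moreover have "(\<exists>y. srt \<MM> y = s x \<and> E (u(x := y))) =
    (\<exists>u'. (\<forall>t. t \<notin> insert x V \<longrightarrow> u' t = u t) \<and> (\<forall>t\<in>insert x V. srt \<MM> (u' t) = s t) \<and> P u')" for u
  proof
    assume "\<exists>y. srt \<MM> y = s x \<and> E (u(x := y))"
    then obtain y u' where *: "srt \<MM> y = s x" "\<And>t. t \<notin> V \<Longrightarrow> u' t = (u(x := y)) t"
      "\<And>t. t \<in> V \<Longrightarrow> srt \<MM> (u' t) = s t" "P u'" unfolding E_def by blast
    show "\<exists>u'. (\<forall>t. t \<notin> insert x V \<longrightarrow> u' t = u t) \<and> (\<forall>t\<in>insert x V. srt \<MM> (u' t) = s t) \<and> P u'"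
      by (rule exI[of _ u']) (use * insert(2) in auto)
  next
    assume "\<exists>u'. (\<forall>t. t \<notin> insert x V \<longrightarrow> u' t = u t) \<and> (\<forall>t\<in>insert x V. srt \<MM> (u' t) = s t) \<and> P u'"
    then obtain u' where *: "\<And>t. t \<notin> insert x V \<Longrightarrow> u' t = u t"
      "\<And>t. t \<in> insert x V \<Longrightarrow> srt \<MM> (u' t) = s t" "P u'" by blast
    have "E (u(x := u' x))" unfolding E_def by (rule exI[of _ u']) (use * in auto)
    then show "\<exists>y. srt \<MM> y = s x \<and> E (u(x := y))" using * by blast
  qed
  moreover have "T - V - {x} = T - insert x V" by blast
  ultimately show ?case by simp
qed

text \<open>Saturation supplies one entry at a time. A maximal finitely consistent partial
  assignment exists by Zorn's lemma, and saturation shows that it leaves no entry of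
  \<open>I\<close> open.\<close>

lemma compactness:
  fixes s :: "'t \<Rightarrow> 's"
  assumes I: "|I| <o |UNIV :: 'm set|" and A: "|A| <o |UNIV :: 'm set|" and disj: "I \<inter> A = {}"
    and u0: "sorted_on \<MM> s A u0"
    and dfn: "\<And>P. P \<in> \<P> \<Longrightarrow> dfn \<MM> s (I \<union> A) P"
    and fin: "\<And>F. finite F \<Longrightarrow> F \<subseteq> \<P> \<Longrightarrow> \<exists>u. sorted_on \<MM> s (I \<union> A) u \<and> (\<forall>t\<in>A. u t = u0 t) \<and> (\<forall>P\<in>F. P u)"
  shows "\<exists>u. sorted_on \<MM> s (I \<union> A) u \<and> (\<forall>t\<in>A. u t = u0 t) \<and> (\<forall>P\<in>\<P>. P u)"
proof -
  \<comment> \<open>\<open>G\<close> is the graph of a partial assignment to the entries in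
    \<open>I\<close>. Only finite parts of \<open>G\<close> are tested, which makes the condition
    pass to unions of chains.\<close>
  define cons where "cons G \<longleftrightarrow> G \<subseteq> I \<times> UNIV \<and> (\<forall>F G0. finite F \<longrightarrow> F \<subseteq> \<P> \<longrightarrow> finite G0 \<longrightarrow> G0 \<subseteq> G \<longrightarrow>
     (\<exists>u. sorted_on \<MM> s (I \<union> A) u \<and> (\<forall>t\<in>A. u t = u0 t) \<and> (\<forall>q\<in>G0. u (fst q) = snd q) \<and> (\<forall>P\<in>F. P u)))"
    for G :: "('t \<times> 'm) set"
  have "\<exists>G\<in>Collect cons. \<forall>X\<in>Collect cons. G \<subseteq> X \<longrightarrow> X = G"
  proof (rule subset_Zorn_nonempty)
    have "cons {}" unfolding cons_def using fin by auto
    then show "Collect cons \<noteq> {}" by blast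
    fix \<C> assume C: "\<C> \<noteq> {}" "subset.chain (Collect cons) \<C>"
    have "cons (\<Union>\<C>)"
      unfolding cons_def
    proof (intro conjI allI impI)
      show "\<Union>\<C> \<subseteq> I \<times> UNIV" using C(2) unfolding subset_chain_def cons_def by blast
      fix F G0 assume *: "finite F" "F \<subseteq> \<P>" "finite G0" "G0 \<subseteq> \<Union>\<C>"
      then obtain G where G: "G \<in> \<C>" "G0 \<subseteq> G"
        using finite_subset_Union_chain[OF *(3,4) C] by blast
      then have "cons G" using C(2) unfolding subset_chain_def by blast
      then show "\<exists>u. sorted_on \<MM> s (I \<union> A) u \<and> (\<forall>t\<in>A. u t = u0 t) \<and> (\<forall>q\<in>G0. u (fst q) = snd q) \<and> (\<forall>P\<in>F. P u)"
        unfolding cons_def using * G(2) by blast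
    qed
    then show "\<Union>\<C> \<in> Collect cons" by simp
  qed
  then obtain G where G: "cons G" and max: "\<And>X. cons X \<Longrightarrow> G \<subseteq> X \<Longrightarrow> X = G" by blast
  have GI: "G \<subseteq> I \<times> UNIV" using G by (simp add: cons_def)
  have consD: "\<exists>u. sorted_on \<MM> s (I \<union> A) u \<and> (\<forall>t\<in>A. u t = u0 t) \<and> (\<forall>q\<in>G0. u (fst q) = snd q) \<and> (\<forall>P\<in>F. P u)"
    if "finite F" "F \<subseteq> \<P>" "finite G0" "G0 \<subseteq> G" for F G0
    using G that unfolding cons_def by blast
  define J where "J = Domain G"
  have JI: "J \<subseteq> I" using GI by (auto simp: J_def)
  have uniq: "y = y'" if "(t, y) \<in> G" "(t, y') \<in> G" for t y y'
    using consD[of "{}" "{(t, y), (t, y')}"] that by auto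
  define u1 where "u1 t = (if t \<in> J then THE y. (t, y) \<in> G else u0 t)" for t
  have u1G: "u1 t = y" if "(t, y) \<in> G" for t y
    using that uniq by (auto simp: u1_def J_def)
  have u1A: "u1 t = u0 t" if "t \<in> A" for t using that JI disj by (auto simp: u1_def)
  have u1s: "sorted_on \<MM> s (J \<union> A) u1"
    unfolding sorted_on_def
  proof
    fix t assume "t \<in> J \<union> A"
    then show "srt \<MM> (u1 t) = s t"
    proof
      assume "t \<in> J"
      then obtain y where y: "(t, y) \<in> G" by (auto simp: J_def)
      then obtain u where u: "sorted_on \<MM> s (I \<union> A) u" "u t = y" using consD[of "{}" "{(t, y)}"] by auto
      then have "srt \<MM> (u t) = s t" using \<open>t \<in> J\<close> JI unfolding sorted_on_def by blast
      then show ?thesis using u(2) u1G[OF y] by simp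
    next
      assume "t \<in> A"
      then show ?thesis using u1A u0 by (simp add: sorted_on_def)
    qed
  qed
  \<comment> \<open>A finite part of \<open>\<P>\<close> is consistent with all of \<open>G\<close>
    at once, since a formula sees only finitely many values.\<close>
  have ext: "\<exists>u. sorted_on \<MM> s (I \<union> A) u \<and> (\<forall>t\<in>J \<union> A. u t = u1 t) \<and> (\<forall>P\<in>F. P u)"
    if F: "finite F" "F \<subseteq> \<P>" for F
  proof -
    have "dfn \<MM> s (I \<union> A) (\<lambda>u. \<forall>P\<in>F. P u)" using F dfn by (intro dfn_Ball) auto
    then obtain T Q where T: "finite T" "T \<subseteq> I \<union> A" "dfn \<MM> s T Q"
      "\<And>u. sorted_on \<MM> s (I \<union> A) u \<Longrightarrow> (\<forall>P\<in>F. P u) = Q u"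
      using dfn_support by blast
    define G0 where "G0 = (\<lambda>t. (t, u1 t)) ` (T \<inter> J)"
    have "G0 \<subseteq> G" using u1G by (auto simp: G0_def J_def)
    moreover have "finite G0" using T(1) by (simp add: G0_def)
    ultimately obtain u where u: "sorted_on \<MM> s (I \<union> A) u" "\<forall>t\<in>A. u t = u0 t"
      "\<forall>q\<in>G0. u (fst q) = snd q" "\<forall>P\<in>F. P u" using consD[OF F] by blast
    define w where "w t = (if t \<in> J then u1 t else u t)" for t
    have w: "sorted_on \<MM> s (I \<union> A) w"
      using u(1) u1s by (auto simp: sorted_on_def w_def)
    have "u t = w t" if "t \<in> T" for t
      using u(3) that by (auto simp: w_def G0_def)
    then have "Q u = Q w" by (intro dfn_val_cong[OF T(3)] sorted_on_subset[OF u(1) T(2)])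
    then have "\<forall>P\<in>F. P w" using T(4)[OF w] T(4)[OF u(1)] u(4) by blast
    moreover have "\<forall>t\<in>J \<union> A. w t = u1 t" using u(2) u1A by (auto simp: w_def)
    ultimately show ?thesis using w by blast
  qed
  have "J = I"
  proof (rule ccontr)
    assume "J \<noteq> I"
    then obtain t where t: "t \<in> I" "t \<notin> J" using JI by blast
    then have tA: "t \<notin> J \<union> A" using disj by blast
    \<comment> \<open>\<open>E F\<close> says that the value at \<open>t\<close> and the values
      assigned so far extend to a solution of \<open>F\<close>. Together these predicates form the
      type that a value at \<open>t\<close> has to realize.\<close>
    define E where "E F u \<longleftrightarrow> (\<exists>u'. sorted_on \<MM> s (I \<union> A) u' \<and> (\<forall>t'\<in>insert t (J \<union> A). u' t' = u t') \<and> (\<forall>P\<in>F. P u'))" for F u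
    have "\<exists>y. srt \<MM> y = s t \<and> (\<forall>P\<in>E ` {F. finite F \<and> F \<subseteq> \<P>}. P (u1(t := y)))"
    proof (rule saturation[OF u1s _ tA])
      have "|J \<union> A| <o |UNIV :: 'm set|" using card_Un[OF card_subset[OF I JI] A] .
      then show "small (u1 ` (J \<union> A))" unfolding small_def by (rule card_image)
    next
      fix P assume "P \<in> E ` {F. finite F \<and> F \<subseteq> \<P>}"
      then obtain F where F: "finite F" "F \<subseteq> \<P>" "P = E F" by blast
      have "dfn \<MM> s (I \<union> A) (\<lambda>u. \<forall>P\<in>F. P u)" using F dfn by (intro dfn_Ball) auto
      then obtain T Q where T: "finite T" "T \<subseteq> I \<union> A" "dfn \<MM> s T Q"
        "\<And>u. sorted_on \<MM> s (I \<union> A) u \<Longrightarrow> (\<forall>P\<in>F. P u) = Q u"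
        using dfn_support by blast
      \<comment> \<open>The unassigned entries that the formula mentions; only these finitely many
        have to be quantified.\<close>
      define V where "V = T - insert t (J \<union> A)"
      have "dfn \<MM> s (T - V) (\<lambda>u. \<exists>u'. (\<forall>t. t \<notin> V \<longrightarrow> u' t = u t) \<and> (\<forall>t\<in>V. srt \<MM> (u' t) = s t) \<and> Q u')"
        by (rule dfn_ex_finite) (use T in \<open>auto simp: V_def\<close>)
      then have "dfn \<MM> s (insert t (J \<union> A)) (\<lambda>u. \<exists>u'. (\<forall>t. t \<notin> V \<longrightarrow> u' t = u t) \<and> (\<forall>t\<in>V. srt \<MM> (u' t) = s t) \<and> Q u')"
        by (rule dfn_mono) (auto simp: V_def)
      then show "dfn \<MM> s (insert t (J \<union> A)) P"
        unfolding F(3)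
      proof (rule dfn_cong)
        fix u assume u: "sorted_on \<MM> s (insert t (J \<union> A)) u"
        show "(\<exists>u'. (\<forall>t. t \<notin> V \<longrightarrow> u' t = u t) \<and> (\<forall>t\<in>V. srt \<MM> (u' t) = s t) \<and> Q u') = E F u"
        proof
          assume "\<exists>u'. (\<forall>t. t \<notin> V \<longrightarrow> u' t = u t) \<and> (\<forall>t\<in>V. srt \<MM> (u' t) = s t) \<and> Q u'"
          then obtain u' where u': "\<And>t. t \<notin> V \<Longrightarrow> u' t = u t" "\<And>t. t \<in> V \<Longrightarrow> srt \<MM> (u' t) = s t" "Q u'" by blast
          \<comment> \<open>\<open>u'\<close> may have wrong sorts at entries that neither the
            formula nor the assignment touches; elements of the right sort are put there.\<close>
          define w where "w t' = (if t' \<in> T \<union> insert t (J \<union> A) then u' t' else SOME y. srt \<MM> y = s t')" for t'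
          have s': "srt \<MM> (u' t') = s t'" if "t' \<in> T \<union> insert t (J \<union> A)" for t'
          proof (cases "t' \<in> V")
            case False
            then have "t' \<in> insert t (J \<union> A)" using that by (auto simp: V_def)
            then have "srt \<MM> (u t') = s t'" using u unfolding sorted_on_def by blast
            then show ?thesis using u'(1)[OF False] by simp
          next
            case True
            then show ?thesis by (rule u'(2))
          qed
          have "srt \<MM> (w t') = s t'" for t'
            using s'[of t'] someI_ex[OF sort_inhabited[of "s t'"]] by (simp add: w_def)
          then have w: "sorted_on \<MM> s K w" for K by (simp add: sorted_on_def)
          have "Q w = Q u'"
            by (rule dfn_val_cong[OF T(3) w]) (simp add: w_def)
          then have "\<forall>P\<in>F. P w" using T(4)[OF w] u'(3) by blast
          moreover have "\<forall>t'\<in>insert t (J \<union> A). w t' = u t'"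
            using u'(1) by (auto simp: w_def V_def)
          ultimately show "E F u" unfolding E_def using w by blast
        next
          assume "E F u"
          then obtain u' where u': "sorted_on \<MM> s (I \<union> A) u'" "\<forall>t'\<in>insert t (J \<union> A). u' t' = u t'" "\<forall>P\<in>F. P u'"
            unfolding E_def by blast
          define w where "w t' = (if t' \<in> V then u' t' else u t')" for t'
          have "Q u' = Q w"
          proof (rule dfn_val_cong[OF T(3)])
            show "sorted_on \<MM> s T u'" using sorted_on_subset[OF u'(1) T(2)] .
            show "u' t' = w t'" if "t' \<in> T" for t'
              using u'(2) that by (auto simp: w_def V_def)
          qed
          then have "Q w" using u' T(4) by blast
          moreover have "srt \<MM> (w t') = s t'" if "t' \<in> V" for t'
            using that u'(1) T(2) by (auto simp: w_def V_def sorted_on_def)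
          moreover have "w t' = u t'" if "t' \<notin> V" for t' using that by (simp add: w_def)
          ultimately show "\<exists>u'. (\<forall>t. t \<notin> V \<longrightarrow> u' t = u t) \<and> (\<forall>t\<in>V. srt \<MM> (u' t) = s t) \<and> Q u'" by blast
        qed
      qed
    next
      fix \<F> assume \<F>: "finite \<F>" "\<F> \<subseteq> E ` {F. finite F \<and> F \<subseteq> \<P>}"
      then obtain \<G> where \<G>: "finite \<G>" "\<G> \<subseteq> {F. finite F \<and> F \<subseteq> \<P>}" "\<F> = E ` \<G>"
        using finite_subset_image[OF \<F>] by blast
      have "finite (\<Union>\<G>)" "\<Union>\<G> \<subseteq> \<P>" using \<G>(1,2) by auto
      from ext[OF this] obtain u where u: "sorted_on \<MM> s (I \<union> A) u" "\<forall>t\<in>J \<union> A. u t = u1 t" "\<forall>P\<in>\<Union>\<G>. P u"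
        by (elim exE conjE)
      have "E F (u1(t := u t))" if "F \<in> \<G>" for F
        unfolding E_def
      proof (intro exI[of _ u] conjI)
        show "\<forall>t'\<in>insert t (J \<union> A). u t' = (u1(t := u t)) t'" using u(2) by auto
        show "\<forall>P\<in>F. P u" using u(3) that by blast
      qed (rule u(1))
      moreover have "srt \<MM> (u t) = s t" using u(1) t(1) by (simp add: sorted_on_def)
      ultimately show "\<exists>y. srt \<MM> y = s t \<and> (\<forall>P\<in>\<F>. P (u1(t := y)))"
        unfolding \<G>(3) by blast
    qed
    then obtain y where y: "srt \<MM> y = s t" "\<And>F. finite F \<Longrightarrow> F \<subseteq> \<P> \<Longrightarrow> E F (u1(t := y))" by blast
    have "cons (insert (t, y) G)"
      unfolding cons_def
    proof (intro conjI allI impI)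
      show "insert (t, y) G \<subseteq> I \<times> UNIV" using GI t by auto
      fix F G0 assume *: "finite F" "F \<subseteq> \<P>" "finite G0" "G0 \<subseteq> insert (t, y) G"
      from y(2)[OF *(1,2)] obtain u where u: "sorted_on \<MM> s (I \<union> A) u"
        "\<And>t'. t' \<in> insert t (J \<union> A) \<Longrightarrow> u t' = (u1(t := y)) t'" "\<forall>P\<in>F. P u"
        unfolding E_def by blast
      have "u (fst q) = snd q" if "q \<in> G0" for q
      proof (cases "q = (t, y)")
        case True then show ?thesis using u(2)[of t] by simp
      next
        case False
        then have q: "(fst q, snd q) \<in> G" using that *(4) by auto
        then have "fst q \<in> J" unfolding J_def by (rule DomainI)
        then show ?thesis using u(2)[of "fst q"] u1G[OF q] t(2) by auto
      qed
      moreover have "u t' = u0 t'" if "t' \<in> A" for t'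
        using u(2)[of t'] u1A[OF that] that tA by auto
      ultimately show "\<exists>u. sorted_on \<MM> s (I \<union> A) u \<and> (\<forall>t\<in>A. u t = u0 t) \<and> (\<forall>q\<in>G0. u (fst q) = snd q) \<and> (\<forall>P\<in>F. P u)"
        using u(1,3) by blast
    qed
    then have "insert (t, y) G = G" by (rule max) blast
    then have "(t, y) \<in> G" by blast
    then show False using t(2) by (auto simp: J_def)
  qed
  have "P u1" if P: "P \<in> \<P>" for P
  proof -
    obtain u where u: "sorted_on \<MM> s (I \<union> A) u" "\<forall>t\<in>J \<union> A. u t = u1 t" "P u"
      using ext[of "{P}"] P by auto
    have "P u = P u1"
      by (rule dfn_val_cong[OF dfn[OF P] u(1)]) (use u(2) \<open>J = I\<close> in auto)
    then show ?thesis using u(3) by simp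
  qed
  then show ?thesis using u1s u1A \<open>J = I\<close> by (intro exI[of _ u1]) auto
qed

section \<open>Automorphisms fixing a model\<close>

text \<open>Induction on a finite set containing the free variables. Quantifying \<open>x\<close>
  removes one of them, and elementarity turns the existential statement into one about
  \<open>U\<close>.\<close>

lemma elem_substructure_witness:
  assumes U: "elem_substructure \<MM> U"
  shows "finite V \<Longrightarrow> fm_ok \<MM> \<phi> \<Longrightarrow> FV \<phi> \<subseteq> V \<Longrightarrow> valuation \<MM> UNIV v \<Longrightarrow> sat \<MM> UNIV v \<phi> \<Longrightarrow>
    \<exists>w. valuation \<MM> U w \<and> sat \<MM> UNIV w \<phi>"
proof (induction V arbitrary: \<phi> v rule: finite_induct)
  case empty
  have "\<And>s. \<exists>x\<in>U. srt \<MM> x = s" using U by (simp add: elem_substructure_def)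
  then obtain f where "\<And>s. f s \<in> U \<and> srt \<MM> (f s) = s" by metis
  then have "valuation \<MM> U (\<lambda>x. f (fst x))" by (simp add: valuation_def)
  moreover have "sat \<MM> UNIV (\<lambda>x. f (fst x)) \<phi> = sat \<MM> UNIV v \<phi>" by (rule sat_cong) (use empty in auto)
  ultimately show ?case using empty by blast
next
  case (insert x V)
  have "sat \<MM> UNIV v (Ex x \<phi>)"
    using insert.prems by (auto intro!: bexI[of _ "v x"] simp: valuation_def)
  then obtain w where w: "valuation \<MM> U w" "sat \<MM> UNIV w (Ex x \<phi>)"
    using insert.IH[of "Ex x \<phi>" v] insert.prems by auto
  have el: "sat \<MM> U f \<psi> = sat \<MM> UNIV f \<psi>" if "fm_ok \<MM> \<psi>" "valuation \<MM> U f" for f \<psi>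
    using U that by (simp add: elem_substructure_def)
  have "sat \<MM> U w (Ex x \<phi>)" using el[OF _ w(1), of "Ex x \<phi>"] w(2) insert.prems(1) by simp
  then obtain y where y: "y \<in> U" "srt \<MM> y = fst x" "sat \<MM> U (w(x := y)) \<phi>" by auto
  then have "valuation \<MM> U (w(x := y))" using w(1) by (intro valuation_upd)
  then show ?case using el[OF insert.prems(1)] y(3) by blast
qed

lemma dfn_realized_in_model:
  fixes s :: "'t \<Rightarrow> 's"
  assumes U: "elem_substructure \<MM> U" and Q: "dfn \<MM> s T Q" and u: "sorted_on \<MM> s T u" "Q u"
  obtains w where "\<And>t. w t \<in> U" "\<And>t. srt \<MM> (w t) = s t" "Q w"
proof -
  obtain T0 where T0: "finite T0" "T0 \<subseteq> T" "\<And>code. \<exists>\<phi>. nform \<MM> s T Q T0 code \<phi>"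
    using dfn_normal[OF Q] by blast
  obtain code :: "'t \<Rightarrow> nat" where code: "inj_on code T0" using finite_code[OF T0(1)] by blast
  obtain \<phi> where \<phi>: "fm_ok \<MM> \<phi>"
    "\<And>u v. sorted_on \<MM> s T u \<Longrightarrow> valuation \<MM> UNIV v \<Longrightarrow> (\<forall>t\<in>T0. v (s t, code t) = u t) \<Longrightarrow>
        Q u = sat \<MM> UNIV v \<phi>"
    using T0(3)[of code] unfolding nform_def by blast
  define c where "c t = (s t, code t)" for t
  have c: "inj_on c T0" using code by (auto simp: inj_on_def c_def)
  obtain v where v: "valuation \<MM> UNIV v" "\<And>x. x \<in> c ` T0 \<Longrightarrow> v x = u (inv_into T0 c x)"
  proof (rule valuation_extend[of "c ` T0" "\<lambda>x. u (inv_into T0 c x)"])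
    fix x assume "x \<in> c ` T0"
    then obtain t where t: "t \<in> T0" "x = c t" by blast
    then have "inv_into T0 c x = t" using c by simp
    then show "srt \<MM> (u (inv_into T0 c x)) = fst x"
      using u(1) T0(2) t by (auto simp: c_def sorted_on_def)
  qed blast
  have "\<forall>t\<in>T0. v (s t, code t) = u t" using v(2) c by (simp add: c_def[symmetric])
  then have "sat \<MM> UNIV v \<phi>" using \<phi>(2)[OF u(1) v(1)] u(2) by blast
  then obtain w where w: "valuation \<MM> U w" "sat \<MM> UNIV w \<phi>"
    using elem_substructure_witness[OF U finite_FV \<phi>(1) subset_refl v(1)] by blast
  have w': "valuation \<MM> UNIV w" using w(1) by (simp add: valuation_def)
  show thesis
  proof (rule that[of "\<lambda>t. w (c t)"])
    show "w (c t) \<in> U" "srt \<MM> (w (c t)) = s t" for t using w(1) by (auto simp: valuation_def c_def)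
    then have "sorted_on \<MM> s T (\<lambda>t. w (c t))" by (simp add: sorted_on_def)
    then show "Q (\<lambda>t. w (c t))" using \<phi>(2)[OF _ w'] w(2) by (simp add: c_def)
  qed
qed

text \<open>The type of \<open>c\<close> over the entries of \<open>b\<close> and \<open>\<sigma> b\<close> is finitely satisfiable in \<open>U\<close>, and \<open>\<sigma>\<close> fixes \<open>U\<close>;
  hence \<open>b\<close> and \<open>\<sigma> b\<close> have the same type over \<open>c\<close>.\<close>

lemma model_fixing_automorphism:
  fixes b :: "'i \<Rightarrow> 'm"
  assumes U: "elem_substructure \<MM> U" and \<sigma>: "\<sigma> \<in> aut \<MM>" "\<And>x. x \<in> U \<Longrightarrow> \<sigma> x = x"
    and i: "|UNIV :: 'i set| <o |UNIV :: 'm set|"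
  obtains c \<rho> \<tau> where "\<rho> \<in> aut \<MM>" "c = \<rho> \<circ> b" "\<tau> \<in> aut \<MM>" "\<tau> \<circ> c = c" "\<tau> \<circ> b = \<sigma> \<circ> b"
proof -
  define s1 where "s1 i = srt \<MM> (b i)" for i
  define s2 where "s2 = case_sum s1 s1"
  define s3 where "s3 = case_sum s1 s2"
  define u0 where "u0 = case_sum b (case_sum b (\<sigma> \<circ> b))"
  define I where "I = range (Inl :: 'i \<Rightarrow> 'i + ('i + 'i))"
  define A where "A = range (Inr :: ('i + 'i) \<Rightarrow> 'i + ('i + 'i))"
  have IA: "I \<union> A = UNIV" by (auto simp: I_def A_def) (metis old.sum.exhaust rangeI)
  have s\<sigma>: "srt \<MM> (\<sigma> x) = srt \<MM> x" for x using \<sigma>(1) autD(2) by blast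
  \<comment> \<open>Of the three blocks of entries, the first is the unknown \<open>c\<close>, and
    the other two are \<open>b\<close> and \<open>\<sigma> \<circ> b\<close>. \<open>\<P>1\<close>
    says that \<open>c\<close> realizes the type of \<open>b\<close>, and \<open>\<P>2\<close> that
    \<open>b\<close> and \<open>\<sigma> \<circ> b\<close> have the same type over
    \<open>c\<close>.\<close>
  define \<P>1 where "\<P>1 = (\<lambda>Q (u :: 'i + ('i + 'i) \<Rightarrow> 'm). Q (\<lambda>i. u (Inl i))) ` {Q. dfn \<MM> s1 UNIV Q \<and> Q b}"
  define \<P>2 where "\<P>2 = (\<lambda>R u. R (case_sum (\<lambda>i. u (Inl i)) (\<lambda>i. u (Inr (Inl i)))) \<longleftrightarrow>
     R (case_sum (\<lambda>i. u (Inl i)) (\<lambda>i. u (Inr (Inr i))))) ` {R. dfn \<MM> s2 UNIV R}"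
  have i2: "|UNIV :: ('i + 'i) set| <o |UNIV :: 'm set|"
    using card_Un[OF card_image[OF i, of Inl] card_image[OF i, of Inr]] by (simp add: UNIV_sum)
  have "\<exists>u. sorted_on \<MM> s3 (I \<union> A) u \<and> (\<forall>t\<in>A. u t = u0 t) \<and> (\<forall>P\<in>\<P>1 \<union> \<P>2. P u)"
  proof (rule compactness)
    show "|I| <o |UNIV :: 'm set|" unfolding I_def using i by (rule card_image)
    show "|A| <o |UNIV :: 'm set|" unfolding A_def using i2 by (rule card_image)
    show "I \<inter> A = {}" by (auto simp: I_def A_def)
    show "sorted_on \<MM> s3 A u0"
      by (auto simp: sorted_on_def A_def s3_def s2_def s1_def u0_def s\<sigma> split: sum.split)
    fix P assume "P \<in> \<P>1 \<union> \<P>2"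
    then show "dfn \<MM> s3 (I \<union> A) P"
    proof
      assume "P \<in> \<P>1"
      then obtain Q where "dfn \<MM> s1 UNIV Q" "P = (\<lambda>u. Q (\<lambda>i. u (Inl i)))" by (auto simp: \<P>1_def)
      then show ?thesis unfolding IA by (auto intro: dfn_reindex simp: s3_def)
    next
      assume "P \<in> \<P>2"
      then obtain R where R: "dfn \<MM> s2 UNIV R" and P: "P = (\<lambda>u. R (case_sum (\<lambda>i. u (Inl i)) (\<lambda>i. u (Inr (Inl i)))) \<longleftrightarrow>
         R (case_sum (\<lambda>i. u (Inl i)) (\<lambda>i. u (Inr (Inr i)))))" by (auto simp: \<P>2_def)
      have "dfn \<MM> s3 UNIV (\<lambda>u. R (case_sum (\<lambda>i. u (Inl i)) (\<lambda>i. u (f i))))"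
        if f: "\<And>i. s3 (f i) = s1 i" for f :: "'i \<Rightarrow> 'i + ('i + 'i)"
      proof -
        have "s3 (Inl i) = s1 i" for i by (simp add: s3_def)
        then have "s3 (case_sum Inl f t) = s2 t" for t by (cases t) (simp_all add: f s2_def)
        then have "dfn \<MM> s3 UNIV (\<lambda>u. R (\<lambda>t. u (case_sum Inl f t)))"
          by (intro dfn_reindex[OF R]) auto
        moreover have "(\<lambda>t. u (case_sum Inl f t)) = case_sum (\<lambda>i. u (Inl i)) (\<lambda>i. u (f i))"
          for u :: "'i + ('i + 'i) \<Rightarrow> 'm"
          by (rule ext) (simp split: sum.split)
        ultimately show ?thesis by simp
      qed
      from this[of "\<lambda>i. Inr (Inl i)"] this[of "\<lambda>i. Inr (Inr i)"] show ?thesis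
        unfolding P IA by (intro dfn_iff) (simp_all add: s3_def s2_def)
    qed
  next
    fix F assume F: "finite F" "F \<subseteq> \<P>1 \<union> \<P>2"
    \<comment> \<open>The members of \<open>\<P>1\<close> look only at the first block, so
      \<open>b\<close> serves as a filler in the other two.\<close>
    define Q where "Q w \<longleftrightarrow> (\<forall>P\<in>F \<inter> \<P>1. P (case_sum w (case_sum b b)))" for w
    have "dfn \<MM> s1 UNIV (\<lambda>w. \<forall>P\<in>(\<lambda>P w. P (case_sum w (case_sum b b))) ` (F \<inter> \<P>1). P w)"
      using F(1) by (intro dfn_Ball) (auto simp: \<P>1_def)
    then have "dfn \<MM> s1 UNIV Q" unfolding Q_def by simp
    moreover have "Q b" by (auto simp: Q_def \<P>1_def)
    moreover have "sorted_on \<MM> s1 UNIV b" by (simp add: sorted_on_def s1_def)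
    ultimately obtain w where w: "\<And>t. w t \<in> U" "\<And>t. srt \<MM> (w t) = s1 t" "Q w"
      using dfn_realized_in_model[OF U] by metis
    define u where "u = case_sum w (case_sum b (\<sigma> \<circ> b))"
    have "P u" if "P \<in> F" for P
    proof (cases "P \<in> \<P>1")
      case True
      then have "P (case_sum w (case_sum b b))" using w(3) that unfolding Q_def by blast
      then show ?thesis using True by (auto simp: \<P>1_def u_def)
    next
      case False
      then have "P \<in> \<P>2" using F(2) \<open>P \<in> F\<close> by blast
      then obtain R where R: "dfn \<MM> s2 UNIV R" and P: "P = (\<lambda>u. R (case_sum (\<lambda>i. u (Inl i)) (\<lambda>i. u (Inr (Inl i)))) \<longleftrightarrow>
         R (case_sum (\<lambda>i. u (Inl i)) (\<lambda>i. u (Inr (Inr i)))))" by (auto simp: \<P>2_def)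
      have "sorted_on \<MM> s2 UNIV (case_sum w b)"
        using w(2) by (auto simp: sorted_on_def s2_def s1_def split: sum.split)
      from eqtp_aut[OF \<sigma>(1) this] have "R (case_sum w b) = R (\<lambda>t. \<sigma> (case_sum w b t))"
        using R unfolding eqtp_def by blast
      moreover have "(\<lambda>t. \<sigma> (case_sum w b t)) = case_sum w (\<sigma> \<circ> b)"
        using \<sigma>(2)[OF w(1)] by (auto simp: fun_eq_iff split: sum.split)
      ultimately show ?thesis by (simp add: P u_def o_def)
    qed
    moreover have "sorted_on \<MM> s3 (I \<union> A) u"
      using w(2) by (auto simp: sorted_on_def s3_def s2_def s1_def u_def s\<sigma> split: sum.split)
    moreover have "\<forall>t\<in>A. u t = u0 t" by (auto simp: A_def u_def u0_def)
    ultimately show "\<exists>u. sorted_on \<MM> s3 (I \<union> A) u \<and> (\<forall>t\<in>A. u t = u0 t) \<and> (\<forall>P\<in>F. P u)" by blast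
  qed
  then obtain u where u: "sorted_on \<MM> s3 UNIV u" "\<And>t. t \<in> A \<Longrightarrow> u t = u0 t"
    "\<And>P. P \<in> \<P>1 \<Longrightarrow> P u" "\<And>P. P \<in> \<P>2 \<Longrightarrow> P u" unfolding IA by blast
  define c where "c i = u (Inl i)" for i
  have ub: "(\<lambda>i. u (Inr (Inl i))) = b" "(\<lambda>i. u (Inr (Inr i))) = \<sigma> \<circ> b"
    using u(2) by (auto simp: A_def u0_def)
  have sc: "srt \<MM> (c i) = s1 i" for i using u(1) by (auto simp: sorted_on_def c_def s3_def dest: spec[of _ "Inl i"])
  have "eqtp s1 UNIV b c"
    unfolding eqtp_def
  proof (intro conjI allI impI)
    show "sorted_on \<MM> s1 UNIV b" "sorted_on \<MM> s1 UNIV c" by (auto simp: sorted_on_def s1_def sc)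
    have *: "Q c" if "dfn \<MM> s1 UNIV Q" "Q b" for Q
      using u(3)[of "\<lambda>u. Q (\<lambda>i. u (Inl i))"] that unfolding \<P>1_def c_def by blast
    fix Q assume "dfn \<MM> s1 UNIV Q"
    then show "Q b = Q c" using *[of Q] *[of "\<lambda>u. \<not> Q u"] dfn_Not[of \<MM> s1 UNIV Q] by blast
  qed
  then obtain \<rho> where \<rho>: "\<rho> \<in> aut \<MM>" "\<And>i. i \<in> UNIV \<Longrightarrow> c i = \<rho> (b i)" using i by (rule homogeneity) blast
  have "eqtp s2 UNIV (case_sum c b) (case_sum c (\<sigma> \<circ> b))"
    unfolding eqtp_def
  proof (intro conjI allI impI)
    show "sorted_on \<MM> s2 UNIV (case_sum c b)" "sorted_on \<MM> s2 UNIV (case_sum c (\<sigma> \<circ> b))"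
      by (auto simp: sorted_on_def s2_def s1_def sc s\<sigma> split: sum.split)
    fix R assume "dfn \<MM> s2 UNIV R"
    then have "(\<lambda>u. R (case_sum (\<lambda>i. u (Inl i)) (\<lambda>i. u (Inr (Inl i)))) \<longleftrightarrow>
         R (case_sum (\<lambda>i. u (Inl i)) (\<lambda>i. u (Inr (Inr i))))) \<in> \<P>2" unfolding \<P>2_def by blast
    from u(4)[OF this] show "R (case_sum c b) = R (case_sum c (\<sigma> \<circ> b))"
      unfolding ub c_def .
  qed
  then obtain \<tau> where \<tau>: "\<tau> \<in> aut \<MM>" "\<And>t. t \<in> UNIV \<Longrightarrow> case_sum c (\<sigma> \<circ> b) t = \<tau> (case_sum c b t)"
    using i2 by (rule homogeneity) blast
  have "\<tau> \<circ> c = c"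
  proof
    fix i show "(\<tau> \<circ> c) i = c i" using \<tau>(2)[of "Inl i"] by simp
  qed
  moreover have "\<tau> \<circ> b = \<sigma> \<circ> b"
  proof
    fix i show "(\<tau> \<circ> b) i = (\<sigma> \<circ> b) i" using \<tau>(2)[of "Inr i"] by simp
  qed
  moreover have "c = \<rho> \<circ> b" using \<rho>(2) by auto
  ultimately show thesis using that \<rho>(1) \<tau>(1) by blast
qed

end

section \<open>Realizations of the type\<close>

locale type_setup = monster_model \<MM>
  for \<MM> :: "('s, 'f, 'r, 'm) fostruct" +
  fixes a :: "'i \<Rightarrow> 'm" and p :: "('s, 'f, 'r, 'm, 'i) ptype"
  assumes acl_dcl: "acl \<MM> {} = dcl \<MM> {}"
    and card_index: "|UNIV :: 'i set| <o |UNIV :: 'm set|"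
    and p_def: "p = tp \<MM> UNIV a {}"
    and acl_a: "range a = acl \<MM> (range a) \<or> acl \<MM> (range a) = dcl \<MM> (range a)"
begin

abbreviation real where "real \<equiv> realizations \<MM> p"

abbreviation ac :: "('i \<Rightarrow> 'm) \<Rightarrow> 'm set" where "ac b \<equiv> acl \<MM> (range b)"

abbreviation acl0 :: "'m set" where "acl0 \<equiv> acl \<MM> {}"

lemma real_iff: "b \<in> real \<longleftrightarrow> (\<exists>\<sigma>\<in>aut \<MM>. b = \<sigma> \<circ> a)"
proof -
  have "b \<in> real \<longleftrightarrow> tp \<MM> UNIV a {} = tp \<MM> UNIV b {}"
    unfolding realizations_def p_def by auto
  also have "\<dots> \<longleftrightarrow> (\<exists>\<sigma>\<in>aut \<MM>. (\<forall>c\<in>{}. \<sigma> c = c) \<and> (\<forall>i\<in>UNIV. b i = \<sigma> (a i)))"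
    by (rule tp_eq_iff[OF card_index small_finite[OF finite.emptyI]])
  finally show ?thesis by (auto simp: fun_eq_iff)
qed

lemma a_real: "a \<in> real"
  unfolding real_iff using id_aut by (intro bexI[of _ id]) auto

lemma real_aut: "b \<in> real \<Longrightarrow> \<sigma> \<in> aut \<MM> \<Longrightarrow> \<sigma> \<circ> b \<in> real"
  unfolding real_iff by (metis comp_assoc comp_aut)

lemma real_trans:
  assumes "b \<in> real" "c \<in> real"
  obtains \<sigma> where "\<sigma> \<in> aut \<MM>" "\<sigma> \<circ> b = c"
proof -
  obtain \<tau> \<rho> where *: "\<tau> \<in> aut \<MM>" "b = \<tau> \<circ> a" "\<rho> \<in> aut \<MM>" "c = \<rho> \<circ> a" using assms by (auto simp: real_iff)
  show thesis
    by (rule that[of "\<rho> \<circ> ainv \<tau>"]) (use * in \<open>auto simp: comp_aut inv_aut\<close>)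
qed

lemma small_range: "small (range (b :: 'i \<Rightarrow> 'm))"
  unfolding small_def using card_index by (rule card_image)

lemma small_ac: "small (ac b)"
  by (intro small_acl small_range)

lemma small_acl0: "small acl0"
  by (intro small_acl small_finite) simp

lemma aut_acl0: "\<sigma> \<in> aut \<MM> \<Longrightarrow> x \<in> acl0 \<Longrightarrow> \<sigma> x = x"
  unfolding acl_dcl by (rule dcl_fixed) auto

lemma aut_image_acl0: "\<sigma> \<in> aut \<MM> \<Longrightarrow> \<sigma> ` acl0 = acl0"
  by (auto simp: aut_acl0)

lemma ac_image: "\<sigma> \<in> aut \<MM> \<Longrightarrow> \<sigma> ` ac b = ac (\<sigma> \<circ> b)"
  by (simp add: acl_image small_range image_comp)

text \<open>This is where the assumption on \<open>acl (range a)\<close> enters.\<close>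

lemma aut_eq_on_ac:
  assumes b: "b \<in> real" and \<sigma>: "\<sigma> \<in> aut \<MM>" and \<tau>: "\<tau> \<in> aut \<MM>" and eq: "\<sigma> \<circ> b = \<tau> \<circ> b" and x: "x \<in> ac b"
  shows "\<sigma> x = \<tau> x"
proof -
  obtain \<rho> where \<rho>: "\<rho> \<in> aut \<MM>" "b = \<rho> \<circ> a" using b by (auto simp: real_iff)
  then have "x \<in> \<rho> ` ac a" using x by (simp add: ac_image)
  then obtain y where y: "y \<in> ac a" "x = \<rho> y" by blast
  define \<theta> where "\<theta> = ainv (\<tau> \<circ> \<rho>) \<circ> (\<sigma> \<circ> \<rho>)"
  have tr: "\<tau> \<circ> \<rho> \<in> aut \<MM>" using \<tau> \<rho> by (intro comp_aut)
  have \<theta>: "\<theta> \<in> aut \<MM>" unfolding \<theta>_def using \<sigma> \<rho> \<tau> by (intro comp_aut inv_aut) auto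
  have "\<theta> (a i) = a i" for i
  proof -
    have "\<sigma> (\<rho> (a i)) = (\<tau> \<circ> \<rho>) (a i)" using fun_cong[OF eq, of i] \<rho>(2) by simp
    then show ?thesis unfolding \<theta>_def using tr by (metis aut_inv_simps(1) comp_apply)
  qed
  then have fix_a: "\<theta> c = c" if "c \<in> range a" for c using that by auto
  have "\<theta> y = y" using acl_a
  proof
    assume "range a = ac a" then show ?thesis using fix_a y by blast
  next
    assume "ac a = dcl \<MM> (range a)" then show ?thesis using dcl_fixed[OF _ \<theta> fix_a] y by blast
  qed
  then have "(\<tau> \<circ> \<rho>) (ainv (\<tau> \<circ> \<rho>) (\<sigma> (\<rho> y))) = (\<tau> \<circ> \<rho>) y" by (simp add: \<theta>_def)
  then show ?thesis unfolding aut_inv_simps(2)[OF tr] using y(2) by simp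
qed

text \<open>Every automorphism fixes \<open>acl0\<close> pointwise, because \<open>acl0\<close> is
  the definable closure of the empty set.\<close>

lemma elementary_over_iff:
  assumes A: "small A"
  shows "elementary_over \<MM> acl0 A h \<longleftrightarrow> (\<exists>\<sigma>\<in>aut \<MM>. \<forall>x\<in>A. h x = \<sigma> x)"
proof -
  have "elementary_over \<MM> acl0 A h \<longleftrightarrow> tp \<MM> A id acl0 = tp \<MM> A h acl0"
    unfolding elementary_over_def by (rule eq_commute)
  also have "\<dots> \<longleftrightarrow> (\<exists>\<sigma>\<in>aut \<MM>. (\<forall>c\<in>acl0. \<sigma> c = c) \<and> (\<forall>i\<in>A. h i = \<sigma> (id i)))"
    by (rule tp_eq_iff[OF A[unfolded small_def] small_acl0])
  also have "\<dots> \<longleftrightarrow> (\<exists>\<sigma>\<in>aut \<MM>. \<forall>x\<in>A. h x = \<sigma> x)"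
    using aut_acl0 by (intro bex_cong) simp_all
  finally show ?thesis .
qed

lemma same_type_pair_iff:
  "same_type_pair \<MM> b c b' c' \<longleftrightarrow> (\<exists>\<sigma>\<in>aut \<MM>. b' = \<sigma> \<circ> b \<and> c' = \<sigma> \<circ> c)"
  for b c b' c' :: "'i \<Rightarrow> 'm"
proof -
  have i2: "|UNIV :: ('i + 'i) set| <o |UNIV :: 'm set|"
    using card_Un[OF card_image[OF card_index, of Inl] card_image[OF card_index, of Inr]] by (simp add: UNIV_sum)
  have "same_type_pair \<MM> b c b' c' \<longleftrightarrow>
      (\<exists>\<sigma>\<in>aut \<MM>. (\<forall>c\<in>{}. \<sigma> c = c) \<and> (\<forall>i\<in>UNIV. case_sum b' c' i = \<sigma> (case_sum b c i)))"
    unfolding same_type_pair_def by (rule tp_eq_iff[OF i2 small_finite[OF finite.emptyI]])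
  also have "\<dots> \<longleftrightarrow> (\<exists>\<sigma>\<in>aut \<MM>. b' = \<sigma> \<circ> b \<and> c' = \<sigma> \<circ> c)"
    by (auto simp: fun_eq_iff split: sum.splits)
  finally show ?thesis .
qed

lemma acl_UN:
  assumes "finite u" "\<And>i. i \<in> u \<Longrightarrow> small (X i)"
  shows "acl \<MM> (\<Union>i\<in>u. acl \<MM> (X i)) = acl \<MM> (\<Union>i\<in>u. X i)"
proof
  have s: "small (\<Union>i\<in>u. X i)" using assms by (rule small_UN_finite)
  have "(\<Union>i\<in>u. acl \<MM> (X i)) \<subseteq> acl \<MM> (\<Union>i\<in>u. X i)"
    using acl_mono[of "X _" "\<Union>i\<in>u. X i"] by blast
  then have "acl \<MM> (\<Union>i\<in>u. acl \<MM> (X i)) \<subseteq> acl \<MM> (acl \<MM> (\<Union>i\<in>u. X i))" by (rule acl_mono)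
  then show "acl \<MM> (\<Union>i\<in>u. acl \<MM> (X i)) \<subseteq> acl \<MM> (\<Union>i\<in>u. X i)" using acl_acl[OF s] by simp
  show "acl \<MM> (\<Union>i\<in>u. X i) \<subseteq> acl \<MM> (\<Union>i\<in>u. acl \<MM> (X i))"
    by (intro acl_mono UN_mono subset_refl acl_superset)
qed

section \<open>Cubes in standard form\<close>

definition face_set :: "(nat \<Rightarrow> 'i \<Rightarrow> 'm) \<Rightarrow> nat set \<Rightarrow> 'm set" where
  "face_set b u = acl \<MM> (\<Union>i\<in>u. range (b i))"

text \<open>The cube of the inclusions between the sets \<open>acl (\<Union>i\<in>u. range (b i))\<close>, with its face number \<open>u\<close>
  transported along the automorphism \<open>\<tau> u\<close>. Every simplex arises in this way.\<close>

definition cube_of :: "nat set \<Rightarrow> (nat \<Rightarrow> 'i \<Rightarrow> 'm) \<Rightarrow> (nat set \<Rightarrow> 'm \<Rightarrow> 'm) \<Rightarrow> 'm cube" where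
  "cube_of s b \<tau> = \<lparr>spt = s, obj = (\<lambda>u\<in>Pow s. ainv (\<tau> u) ` face_set b u),
     mor = (\<lambda>u v. if u \<subseteq> v \<and> v \<subseteq> s then (\<lambda>x\<in>ainv (\<tau> u) ` face_set b u. ainv (\<tau> v) (\<tau> u x)) else undefined)\<rparr>"

lemma cube_of_simps [simp]:
  "spt (cube_of s b \<tau>) = s"
  "u \<subseteq> s \<Longrightarrow> obj (cube_of s b \<tau>) u = ainv (\<tau> u) ` face_set b u"
  "u \<subseteq> v \<Longrightarrow> v \<subseteq> s \<Longrightarrow> mor (cube_of s b \<tau>) u v = (\<lambda>x\<in>ainv (\<tau> u) ` face_set b u. ainv (\<tau> v) (\<tau> u x))"
  by (auto simp: cube_of_def)

lemma small_face_set: "finite u \<Longrightarrow> small (face_set b u)"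
  unfolding face_set_def by (intro small_acl small_UN_finite small_range)

lemma face_set_empty [simp]: "face_set b {} = acl0"
  by (simp add: face_set_def)

lemma face_set_single [simp]: "face_set b {i} = ac (b i)"
  by (simp add: face_set_def)

lemma face_set_mono: "u \<subseteq> v \<Longrightarrow> face_set b u \<subseteq> face_set b v"
  unfolding face_set_def by (intro acl_mono UN_mono) auto

lemma restrict_cube_of: "t \<subseteq> s \<Longrightarrow> restrict_cube (cube_of s b \<tau>) t = cube_of t b \<tau>"
  by (auto simp: restrict_cube_def cube_of_def fun_eq_iff restrict_def)

text \<open>A cube in standard form depends only on the maps \<open>ainv (\<tau> u)\<close> on the
  sets \<open>face_set b u\<close>, so moving \<open>b\<close> by \<open>\<sigma>\<close> can be
  undone by changing the automorphisms. This is how differently presented simplices are recognized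
  as equal.\<close>

lemma cube_of_eqI:
  assumes s: "finite s" and \<tau>: "\<And>u. u \<subseteq> s \<Longrightarrow> \<tau> u \<in> aut \<MM>" "\<And>u. u \<subseteq> s \<Longrightarrow> \<tau>' u \<in> aut \<MM>"
    and \<sigma>: "\<sigma> \<in> aut \<MM>" and b: "\<And>i. i \<in> s \<Longrightarrow> b' i = \<sigma> \<circ> b i"
    and eq: "\<And>u x. u \<subseteq> s \<Longrightarrow> x \<in> face_set b u \<Longrightarrow> ainv (\<tau>' u) (\<sigma> x) = ainv (\<tau> u) x"
  shows "cube_of s b' \<tau>' = cube_of s b \<tau>"
proof -
  have fs: "face_set b' u = \<sigma> ` face_set b u" if "u \<subseteq> s" for u
  proof -
    have "range (b' i) = \<sigma> ` range (b i)" if "i \<in> u" for i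
    proof -
      have "b' i = \<sigma> \<circ> b i" using b that \<open>u \<subseteq> s\<close> by blast
      then show ?thesis by (simp add: image_comp)
    qed
    then have "(\<Union>i\<in>u. range (b' i)) = \<sigma> ` (\<Union>i\<in>u. range (b i))"
      unfolding image_UN by (intro SUP_cong refl)
    moreover have "small (\<Union>i\<in>u. range (b i))"
      using that s by (intro small_UN_finite small_range) (rule finite_subset)
    ultimately show ?thesis unfolding face_set_def by (simp add: acl_image \<sigma>)
  qed
  have o: "ainv (\<tau>' u) ` face_set b' u = ainv (\<tau> u) ` face_set b u" if "u \<subseteq> s" for u
    unfolding fs[OF that] image_image by (rule image_cong) (auto simp: eq that)
  have m: "ainv (\<tau>' v) (\<tau>' u x) = ainv (\<tau> v) (\<tau> u x)"
    if uv: "u \<subseteq> v" "v \<subseteq> s" and x: "x \<in> ainv (\<tau> u) ` face_set b u" for u v x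
  proof -
    obtain y where y: "y \<in> face_set b u" "x = ainv (\<tau> u) y" using x by blast
    have us: "u \<subseteq> s" using uv by blast
    have "y \<in> face_set b v" using y(1) face_set_mono[OF uv(1)] by blast
    then show ?thesis
      using eq[OF us y(1)] eq[OF uv(2), of y] \<tau>(1)[OF us] \<tau>(2)[OF us] y(2)
      by (metis aut_inv_simps(2))
  qed
  have O: "(\<lambda>u\<in>Pow s. ainv (\<tau>' u) ` face_set b' u) = (\<lambda>u\<in>Pow s. ainv (\<tau> u) ` face_set b u)"
    by (rule restrict_ext) (use o in auto)
  have M: "(\<lambda>u v. if u \<subseteq> v \<and> v \<subseteq> s then \<lambda>x\<in>ainv (\<tau>' u) ` face_set b' u. ainv (\<tau>' v) (\<tau>' u x) else undefined) =
          (\<lambda>u v. if u \<subseteq> v \<and> v \<subseteq> s then \<lambda>x\<in>ainv (\<tau> u) ` face_set b u. ainv (\<tau> v) (\<tau> u x) else undefined)"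
  proof (rule ext, rule ext)
    fix u v
    show "(if u \<subseteq> v \<and> v \<subseteq> s then \<lambda>x\<in>ainv (\<tau>' u) ` face_set b' u. ainv (\<tau>' v) (\<tau>' u x) else undefined) =
          (if u \<subseteq> v \<and> v \<subseteq> s then \<lambda>x\<in>ainv (\<tau> u) ` face_set b u. ainv (\<tau> v) (\<tau> u x) else undefined)"
    proof (cases "u \<subseteq> v \<and> v \<subseteq> s")
      case True
      then have ou: "ainv (\<tau>' u) ` face_set b' u = ainv (\<tau> u) ` face_set b u" by (intro o) blast
      have "(\<lambda>x\<in>ainv (\<tau> u) ` face_set b u. ainv (\<tau>' v) (\<tau>' u x)) =
        (\<lambda>x\<in>ainv (\<tau> u) ` face_set b u. ainv (\<tau> v) (\<tau> u x))"
        using m True by (intro restrict_ext) blast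
      then show ?thesis using True ou by simp
    next
      case False
      then show ?thesis by (simp only: if_False)
    qed
  qed
  show ?thesis unfolding cube_of_def by (simp only: O M)
qed

lemma cube_of_functor:
  assumes s: "finite s" and \<tau>: "\<And>u. u \<subseteq> s \<Longrightarrow> \<tau> u \<in> aut \<MM>"
  shows "cube_functor \<MM> (cube_of s b \<tau>)"
  unfolding cube_functor_def
proof (intro conjI allI impI)
  fix u assume u: "u \<subseteq> spt (cube_of s b \<tau>)"
  then have u': "u \<subseteq> s" by simp
  have sm: "small (face_set b u)" using u' s by (intro small_face_set) (rule finite_subset)
  show "small (obj (cube_of s b \<tau>) u)" using u' sm by (simp add: small_image)
  have "acl0 \<subseteq> face_set b u" unfolding face_set_def by (intro acl_mono) simp
  then have "ainv (\<tau> u) ` acl0 \<subseteq> ainv (\<tau> u) ` face_set b u" by blast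
  then show "acl0 \<subseteq> obj (cube_of s b \<tau>) u" using u' aut_image_acl0[OF inv_aut[OF \<tau>[OF u']]] by simp
  show "\<forall>x\<in>obj (cube_of s b \<tau>) u. mor (cube_of s b \<tau>) u u x = x"
    using u' \<tau>[OF u'] by simp
next
  fix u v assume uv: "u \<subseteq> v \<and> v \<subseteq> spt (cube_of s b \<tau>)"
  then have uv': "u \<subseteq> v" "v \<subseteq> s" "u \<subseteq> s" by auto
  have fm: "face_set b u \<subseteq> face_set b v" using uv' by (intro face_set_mono)
  show "mor (cube_of s b \<tau>) u v \<in> obj (cube_of s b \<tau>) u \<rightarrow>\<^sub>E obj (cube_of s b \<tau>) v"
    using uv' \<tau> fm by auto
  have "small (face_set b u)" using uv' s by (intro small_face_set) (rule finite_subset)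
  then have "small (obj (cube_of s b \<tau>) u)" using uv' by (simp add: small_image)
  moreover have "ainv (\<tau> v) \<circ> \<tau> u \<in> aut \<MM>" using \<tau> uv' by (intro comp_aut inv_aut)
  ultimately show "elementary_over \<MM> acl0 (obj (cube_of s b \<tau>) u) (mor (cube_of s b \<tau>) u v)"
    using uv' by (subst elementary_over_iff) (auto intro!: bexI[of _ "ainv (\<tau> v) \<circ> \<tau> u"])
  have "acl0 \<subseteq> face_set b u" unfolding face_set_def by (intro acl_mono) simp
  then have "ainv (\<tau> u) ` acl0 \<subseteq> ainv (\<tau> u) ` face_set b u" by blast
  then have "acl0 \<subseteq> ainv (\<tau> u) ` face_set b u" using aut_image_acl0[OF inv_aut[OF \<tau>[OF uv'(3)]]] by simp
  then show "\<forall>x\<in>acl0. mor (cube_of s b \<tau>) u v x = x"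
    using uv' aut_acl0[OF \<tau>[OF uv'(3)]] aut_acl0[OF inv_aut[OF \<tau>[OF uv'(2)]]]
    by (metis (no_types, lifting) cube_of_simps(3) restrict_apply' subsetD)
next
  fix u v w assume uvw: "u \<subseteq> v \<and> v \<subseteq> w \<and> w \<subseteq> spt (cube_of s b \<tau>)"
  then have *: "u \<subseteq> v" "v \<subseteq> w" "u \<subseteq> w" "w \<subseteq> s" "v \<subseteq> s" "u \<subseteq> s" by auto
  have fm: "face_set b u \<subseteq> face_set b v" using * by (intro face_set_mono)
  show "\<forall>x\<in>obj (cube_of s b \<tau>) u. mor (cube_of s b \<tau>) u w x = mor (cube_of s b \<tau>) v w (mor (cube_of s b \<tau>) u v x)"
    using * \<tau>[OF *(5)] \<tau>[OF *(6)] fm by auto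
next
  fix u v assume "\<not> (u \<subseteq> v \<and> v \<subseteq> spt (cube_of s b \<tau>))"
  then show "mor (cube_of s b \<tau>) u v = undefined" by (auto simp: cube_of_def)
next
  show "obj (cube_of s b \<tau>) \<in> extensional (Pow (spt (cube_of s b \<tau>)))" by (simp add: cube_of_def)
  show "finite (spt (cube_of s b \<tau>))" using s by simp
qed

lemma vertex_cube_of:
  assumes \<tau>: "\<tau> {i} \<in> aut \<MM>" and i: "i \<in> u" "u \<subseteq> s"
  shows "vertex (cube_of s b \<tau>) u i = ainv (\<tau> u) ` ac (b i)"
proof -
  have "{i} \<subseteq> u" "{i} \<subseteq> s" using i by auto
  then show ?thesis unfolding vertex_def using i \<tau> by (auto simp: image_image)
qed

lemma obj_cube_of:
  assumes s: "finite s" and \<tau>: "\<And>u. u \<subseteq> s \<Longrightarrow> \<tau> u \<in> aut \<MM>" and u: "u \<subseteq> s"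
  shows "obj (cube_of s b \<tau>) u = acl \<MM> (\<Union>i\<in>u. vertex (cube_of s b \<tau>) u i)"
proof -
  have fu: "finite u" using u s by (rule finite_subset)
  have "(\<Union>i\<in>u. vertex (cube_of s b \<tau>) u i) = (\<Union>i\<in>u. ainv (\<tau> u) ` ac (b i))"
    using vertex_cube_of[OF \<tau> _ u] u by (intro SUP_cong) auto
  also have "\<dots> = ainv (\<tau> u) ` (\<Union>i\<in>u. ac (b i))" by blast
  finally have "acl \<MM> (\<Union>i\<in>u. vertex (cube_of s b \<tau>) u i) = ainv (\<tau> u) ` acl \<MM> (\<Union>i\<in>u. ac (b i))"
    using fu \<tau>[OF u] by (simp add: acl_image inv_aut small_UN_finite small_ac)
  also have "\<dots> = ainv (\<tau> u) ` face_set b u"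
    using acl_UN[OF fu small_range, of b] by (simp add: face_set_def)
  finally show ?thesis using u by simp
qed

end

section \<open>Simplices in standard form\<close>

locale indep_setup = type_setup \<MM> a p
  for \<MM> :: "('s, 'f, 'r, 'm) fostruct" and a :: "'i \<Rightarrow> 'm" and p +
  fixes R :: "'m indep"
  assumes indep_rel: "indep_relation \<MM> R"
begin

section \<open>Calculus of independence\<close>

lemmas R_axioms =
  indep_rel[unfolded indep_relation_def, THEN conjunct1]
  indep_rel[unfolded indep_relation_def, THEN conjunct2, THEN conjunct1]
  indep_rel[unfolded indep_relation_def, THEN conjunct2, THEN conjunct2, THEN conjunct1]
  indep_rel[unfolded indep_relation_def, THEN conjunct2, THEN conjunct2, THEN conjunct2, THEN conjunct1]
  indep_rel[unfolded indep_relation_def, THEN conjunct2, THEN conjunct2, THEN conjunct2, THEN conjunct2, THEN conjunct1]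
  indep_rel[unfolded indep_relation_def, THEN conjunct2, THEN conjunct2, THEN conjunct2, THEN conjunct2, THEN conjunct2]

lemma R_aut: "\<sigma> \<in> aut \<MM> \<Longrightarrow> small A \<Longrightarrow> small C \<Longrightarrow> small D \<Longrightarrow> R (\<sigma> ` A) (\<sigma> ` C) (\<sigma> ` D) = R A C D"
  using R_axioms(1) by blast

lemma R_finite: "small A \<Longrightarrow> small C \<Longrightarrow> small D \<Longrightarrow>
    R A C D = (\<forall>A0 D0. finite A0 \<and> A0 \<subseteq> A \<and> finite D0 \<and> D0 \<subseteq> D \<longrightarrow> R A0 C D0)"
  using R_axioms(2) by blast

text \<open>Monotonicity is contained in finite character: finite subsets of the smaller sets are
  among those of the larger ones.\<close>

lemma R_mono:
  assumes "R A C D" "A' \<subseteq> A" "D' \<subseteq> D" "small A" "small C" "small D"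
  shows "R A' C D'"
proof -
  have sm: "small A'" "small D'" using small_subset[OF assms(4,2)] small_subset[OF assms(6,3)] .
  show ?thesis
    unfolding R_finite[OF sm(1) assms(5) sm(2)]
  proof (intro allI impI)
    fix A0 D0 assume "finite A0 \<and> A0 \<subseteq> A' \<and> finite D0 \<and> D0 \<subseteq> D'"
    then have "finite A0 \<and> A0 \<subseteq> A \<and> finite D0 \<and> D0 \<subseteq> D" using assms(2,3) by blast
    then show "R A0 C D0" using assms(1)[unfolded R_finite[OF assms(4-6)]] by simp
  qed
qed

lemma R_normal: "small A \<Longrightarrow> small C \<Longrightarrow> small D \<Longrightarrow> R A C D \<Longrightarrow> R A C (acl \<MM> (D \<union> C))"
  using R_axioms(3) by blast

lemma R_sym: "small A \<Longrightarrow> small C \<Longrightarrow> small D \<Longrightarrow> R A C D \<Longrightarrow> R D C A"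
  using R_axioms(4) by blast

lemma R_trans: "small A \<Longrightarrow> small D \<Longrightarrow> E \<subseteq> C \<Longrightarrow> C \<subseteq> D \<Longrightarrow> R A E D \<longleftrightarrow> R A E C \<and> R A C D"
  using R_axioms(5)[rule_format, of A D E C] by blast

text \<open>\<open>acl0\<close> is added to \<open>D\<close> because the extension axiom wants the
  base inside the set; monotonicity removes it again. Homogeneity turns the elementary map into an
  automorphism.\<close>

lemma R_extension:
  assumes "small A" "small D"
  obtains \<sigma> where "\<sigma> \<in> aut \<MM>" "R (\<sigma> ` A) acl0 D"
proof -
  have C: "small (D \<union> acl0)" using assms by (intro small_Un small_acl0)
  have "\<exists>h. elementary_over \<MM> acl0 A h \<and> R (h ` A) acl0 (D \<union> acl0)"
    using R_axioms(6)[rule_format, of A "D \<union> acl0" acl0] assms(1) C by blast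
  then obtain h where h: "elementary_over \<MM> acl0 A h" "R (h ` A) acl0 (D \<union> acl0)" by blast
  then obtain \<sigma> where \<sigma>: "\<sigma> \<in> aut \<MM>" "\<forall>x\<in>A. h x = \<sigma> x" using elementary_over_iff[OF assms(1)] by blast
  have "h ` A = \<sigma> ` A" using \<sigma>(2) by auto
  then have "R (\<sigma> ` A) acl0 D"
    using R_mono[OF h(2)] assms C by (metis Un_upper1 small_acl0 small_image subset_refl)
  with \<sigma>(1) show thesis by (rule that)
qed

text \<open>Let \<open>Y'\<close> be the closure of \<open>Y\<close>. Independence of
  \<open>Z\<close> from \<open>X \<union> Y\<close> makes \<open>Z\<close> independent from
  \<open>X\<close> over \<open>Y'\<close>; by symmetry \<open>X\<close> is independent from
  \<open>Z\<close> over \<open>Y'\<close>, and transitivity combines this with independence of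
  \<open>X\<close> from \<open>Y'\<close>.\<close>

lemma R_triple:
  assumes sm: "small X" "small Y" "small Z" and XY: "R X acl0 Y" and Z: "R Z acl0 (X \<union> Y)"
  shows "R X acl0 (Y \<union> Z)"
proof -
  define Y' where "Y' = acl \<MM> (Y \<union> acl0)"
  define D where "D = acl \<MM> (X \<union> Y \<union> acl0)"
  have s: "small Y'" "small D" "small acl0" "small (acl \<MM> (Z \<union> Y'))" "small (X \<union> Y)"
    unfolding Y'_def D_def using sm by (auto intro!: small_acl small_Un small_acl0)
  have YD: "Y' \<subseteq> D" unfolding Y'_def D_def by (intro acl_mono) auto
  have BY: "acl0 \<subseteq> Y'" unfolding Y'_def using acl_superset[of "Y \<union> acl0"] by blast
  have XD: "X \<subseteq> D" unfolding D_def using acl_superset[of "X \<union> Y \<union> acl0"] by blast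
  have YY: "Y \<subseteq> Y'" unfolding Y'_def using acl_superset[of "Y \<union> acl0"] by blast
  have "R Z acl0 D" unfolding D_def using R_normal[OF sm(3) s(3) s(5) Z] .
  then have "R Z Y' D" using R_trans[OF sm(3) s(2) BY YD] by blast
  then have "R D Y' Z" using R_sym sm s by blast
  then have "R X Y' Z" using XD sm s by (intro R_mono[of D Y' Z X Z]) auto
  then have 1: "R X Y' (acl \<MM> (Z \<union> Y'))" using R_normal sm s by blast
  have 2: "R X acl0 Y'" unfolding Y'_def using R_normal[OF sm(1) s(3) sm(2) XY] .
  have sub: "Z \<union> Y' \<subseteq> acl \<MM> (Z \<union> Y')" by (rule acl_superset)
  then have "R X acl0 (acl \<MM> (Z \<union> Y'))" using R_trans[OF sm(1) s(4) BY] 1 2 by blast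
  then show ?thesis
    by (rule R_mono) (use sub YY sm s in auto)
qed

section \<open>Independent realizations and standard form of simplices\<close>

definition ind :: "('i \<Rightarrow> 'm) \<Rightarrow> ('i \<Rightarrow> 'm) \<Rightarrow> bool" where
  "ind b c \<longleftrightarrow> R (ac b) acl0 (ac c)"

definition ind2 :: "('i \<Rightarrow> 'm) \<Rightarrow> ('i \<Rightarrow> 'm) \<Rightarrow> ('i \<Rightarrow> 'm) \<Rightarrow> bool" where
  "ind2 d b c \<longleftrightarrow> R (ac d) acl0 (ac b \<union> ac c)"

lemma ind_sym: "ind b c \<Longrightarrow> ind c b"
  unfolding ind_def by (rule R_sym[OF small_ac small_acl0 small_ac])

lemma ind2_ind:
  assumes "ind2 d b c"
  shows "ind b d" "ind c d"
proof -
  have "R (ac d) acl0 (ac b)" "R (ac d) acl0 (ac c)"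
    using R_mono[OF assms[unfolded ind2_def] subset_refl _ small_ac small_acl0 small_Un[OF small_ac small_ac]] by auto
  then show "ind b d" "ind c d" unfolding ind_def by (auto intro: R_sym[OF small_ac small_acl0 small_ac])
qed

lemma ind2_aut: "\<sigma> \<in> aut \<MM> \<Longrightarrow> ind2 d b c \<Longrightarrow> ind2 (\<sigma> \<circ> d) (\<sigma> \<circ> b) (\<sigma> \<circ> c)"
  unfolding ind2_def using R_aut[of \<sigma> "ac d" acl0 "ac b \<union> ac c"]
  by (simp add: small_ac small_acl0 ac_image aut_image_acl0 small_Un image_Un)

lemma independent_realization:
  assumes "small D"
  obtains d where "d \<in> real" "R (ac d) acl0 D"
proof -
  obtain \<sigma> where "\<sigma> \<in> aut \<MM>" "R (\<sigma> ` ac a) acl0 D" using R_extension[OF small_ac assms] by blast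
  then show thesis using that[of "\<sigma> \<circ> a"] real_aut[OF a_real] by (simp add: ac_image)
qed

lemma independent_realization2:
  obtains d where "d \<in> real" "ind2 d b c"
proof -
  obtain d where "d \<in> real" "R (ac d) acl0 (ac b \<union> ac c)"
    by (rule independent_realization[OF small_Un[OF small_ac[of b] small_ac[of c]]])
  then show thesis by (intro that[of d]) (simp_all add: ind2_def)
qed

lemma indep_family_subset:
  assumes "finite s" "u \<subseteq> s" "indep_family R acl0 s F" "\<And>i. i \<in> s \<Longrightarrow> small (F i)"
  shows "indep_family R acl0 u F"
  unfolding indep_family_def
proof
  fix i assume i: "i \<in> u"
  then have i_s: "i \<in> s" using assms(2) by blast
  have "R (F i) acl0 (\<Union>j\<in>s - {i}. F j)" using assms(3) i_s unfolding indep_family_def by blast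
  moreover have "(\<Union>j\<in>u - {i}. F j) \<subseteq> (\<Union>j\<in>s - {i}. F j)" using assms(2) by blast
  moreover have "small (\<Union>j\<in>s - {i}. F j)" using assms(1,4) by (intro small_UN_finite) auto
  ultimately show "R (F i) acl0 (\<Union>j\<in>u - {i}. F j)"
    using R_mono[OF _ subset_refl _ assms(4)[OF i_s] small_acl0] by blast
qed

lemma cube_of_simplex:
  assumes s: "finite s" "card s = n + 1" and b: "\<And>i. i \<in> s \<Longrightarrow> b i \<in> real"
    and \<tau>: "\<And>u. u \<subseteq> s \<Longrightarrow> \<tau> u \<in> aut \<MM>" and ind: "indep_family R acl0 s (\<lambda>i. ac (b i))"
  shows "cube_of s b \<tau> \<in> simplices \<MM> R p n"
  unfolding simplices_def
proof (intro CollectI conjI allI impI ballI)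
  show "cube_functor \<MM> (cube_of s b \<tau>)" using s(1) \<tau> by (rule cube_of_functor)
  show "card (spt (cube_of s b \<tau>)) = n + 1" using s by simp
  show "obj (cube_of s b \<tau>) {} = acl0" using \<tau>[of "{}"] by (simp add: aut_image_acl0 inv_aut)
  show "\<exists>b'\<in>real. obj (cube_of s b \<tau>) {i} = ac b'" if "i \<in> spt (cube_of s b \<tau>)" for i
  proof -
    have i: "i \<in> s" using that by simp
    have t: "ainv (\<tau> {i}) \<in> aut \<MM>" using i \<tau> by (intro inv_aut) auto
    show ?thesis
      using i t real_aut[OF b[OF i] t] by (intro bexI[of _ "ainv (\<tau> {i}) \<circ> b i"]) (simp_all add: ac_image)
  qed
  fix u assume "u \<noteq> {} \<and> u \<subseteq> spt (cube_of s b \<tau>)"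
  then have u: "u \<subseteq> s" by simp
  show "obj (cube_of s b \<tau>) u = acl \<MM> (\<Union>i\<in>u. vertex (cube_of s b \<tau>) u i)"
    using s(1) \<tau> u by (rule obj_cube_of)
  have fu: "finite u" using u s(1) by (rule finite_subset)
  have iu: "ainv (\<tau> u) \<in> aut \<MM>" using \<tau>[OF u] by (rule inv_aut)
  have v: "vertex (cube_of s b \<tau>) u i = ainv (\<tau> u) ` ac (b i)" if "i \<in> u" for i
    using that u \<tau> by (intro vertex_cube_of) auto
  have ind: "indep_family R acl0 u (\<lambda>i. ac (b i))"
    using indep_family_subset[OF s(1) u ind] small_ac by blast
  show "indep_family R acl0 u (vertex (cube_of s b \<tau>) u)"
    unfolding indep_family_def
  proof
    fix i assume i: "i \<in> u"
    have "R (ac (b i)) acl0 (\<Union>j\<in>u - {i}. ac (b j))" using ind i unfolding indep_family_def by blast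
    then have "R (ainv (\<tau> u) ` ac (b i)) (ainv (\<tau> u) ` acl0) (ainv (\<tau> u) ` (\<Union>j\<in>u - {i}. ac (b j)))"
      using R_aut[OF iu small_ac small_acl0 small_UN_finite[OF _ small_ac]] fu by blast
    then have "R (ainv (\<tau> u) ` ac (b i)) acl0 (\<Union>j\<in>u - {i}. ainv (\<tau> u) ` ac (b j))"
      unfolding aut_image_acl0[OF iu] image_UN .
    moreover have "(\<Union>j\<in>u - {i}. vertex (cube_of s b \<tau>) u j) = (\<Union>j\<in>u - {i}. ainv (\<tau> u) ` ac (b j))"
      by (intro SUP_cong refl v) auto
    ultimately show "R (vertex (cube_of s b \<tau>) u i) acl0 (\<Union>j\<in>u - {i}. vertex (cube_of s b \<tau>) u j)"
      using v[OF i] by simp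
  qed
qed

text \<open>\<open>\<tau> u\<close> is an automorphism extending the map from the face
  \<open>u\<close> to the top face. Functoriality forces the map from \<open>u\<close> to
  \<open>v\<close> to be \<open>\<tau> u\<close> followed by the inverse of \<open>\<tau> v\<close>,
  so these automorphisms carry the whole functor.\<close>

lemma simplex_standard_form:
  assumes f: "f \<in> simplices \<MM> R p n"
    and e: "\<And>i. i \<in> spt f \<Longrightarrow> e i \<in> real" "\<And>i. i \<in> spt f \<Longrightarrow> obj f {i} = ac (e i)"
  obtains \<tau> where "\<And>u. u \<subseteq> spt f \<Longrightarrow> \<tau> u \<in> aut \<MM>" "\<tau> (spt f) = id"
    "\<And>u x. u \<subseteq> spt f \<Longrightarrow> x \<in> obj f u \<Longrightarrow> mor f u (spt f) x = \<tau> u x"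
    "f = cube_of (spt f) (\<lambda>i. \<tau> {i} \<circ> e i) \<tau>"
    "indep_family R acl0 (spt f) (\<lambda>i. ac (\<tau> {i} \<circ> e i))"
proof -
  define s where "s = spt f"
  have cf: "cube_functor \<MM> f" and oe: "obj f {} = acl0"
    and ou: "\<And>u. u \<noteq> {} \<Longrightarrow> u \<subseteq> s \<Longrightarrow> obj f u = acl \<MM> (\<Union>i\<in>u. vertex f u i)"
    and iu: "\<And>u. u \<noteq> {} \<Longrightarrow> u \<subseteq> s \<Longrightarrow> indep_family R acl0 u (vertex f u)"
    and cs: "card s = n + 1"
    using f unfolding simplices_def s_def by auto
  have fs: "finite s" and obj_ext: "obj f \<in> extensional (Pow s)"
    and und: "\<And>u v. \<not> (u \<subseteq> v \<and> v \<subseteq> s) \<Longrightarrow> mor f u v = undefined"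
    and sm: "\<And>u. u \<subseteq> s \<Longrightarrow> small (obj f u)"
    and mp: "\<And>u v. u \<subseteq> v \<Longrightarrow> v \<subseteq> s \<Longrightarrow> mor f u v \<in> obj f u \<rightarrow>\<^sub>E obj f v"
    and me: "\<And>u v. u \<subseteq> v \<Longrightarrow> v \<subseteq> s \<Longrightarrow> elementary_over \<MM> acl0 (obj f u) (mor f u v)"
    and mi: "\<And>u x. u \<subseteq> s \<Longrightarrow> x \<in> obj f u \<Longrightarrow> mor f u u x = x"
    and mc: "\<And>u v w x. u \<subseteq> v \<Longrightarrow> v \<subseteq> w \<Longrightarrow> w \<subseteq> s \<Longrightarrow> x \<in> obj f u \<Longrightarrow> mor f u w x = mor f v w (mor f u v x)"
    using cf unfolding cube_functor_def s_def by (simp_all del: split_paired_All)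
  have "\<exists>\<sigma>\<in>aut \<MM>. (\<forall>x\<in>obj f u. mor f u s x = \<sigma> x) \<and> (u = s \<longrightarrow> \<sigma> = id)" if u: "u \<subseteq> s" for u
  proof (cases "u = s")
    case True
    then show ?thesis using mi id_aut by (intro bexI[of _ id]) auto
  next
    case False
    then show ?thesis using me[OF u] elementary_over_iff[OF sm[OF u]] by blast
  qed
  then obtain \<tau> where \<tau>: "\<And>u. u \<subseteq> s \<Longrightarrow> \<tau> u \<in> aut \<MM> \<and> (\<forall>x\<in>obj f u. mor f u s x = \<tau> u x) \<and> (u = s \<longrightarrow> \<tau> u = id)"
    by metis
  have \<tau>a: "\<And>u. u \<subseteq> s \<Longrightarrow> \<tau> u \<in> aut \<MM>" and \<tau>m: "\<And>u x. u \<subseteq> s \<Longrightarrow> x \<in> obj f u \<Longrightarrow> mor f u s x = \<tau> u x"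
    using \<tau> by blast+
  define b where "b i = \<tau> {i} \<circ> e i" for i
  have vs: "\<tau> u ` vertex f u i = ac (b i)" if "i \<in> u" "u \<subseteq> s" for u i
  proof -
    have i: "{i} \<subseteq> u" "{i} \<subseteq> s" "i \<in> s" using that by auto
    have "\<tau> u ` vertex f u i = mor f {i} s ` obj f {i}"
      unfolding vertex_def image_image
    proof (rule image_cong[OF refl])
      fix x assume x: "x \<in> obj f {i}"
      then have "mor f {i} u x \<in> obj f u" using mp[OF i(1) that(2)] by blast
      then show "\<tau> u (mor f {i} u x) = mor f {i} s x"
        using \<tau>m[OF that(2)] mc[OF i(1) that(2) subset_refl x] by simp
    qed
    also have "\<dots> = \<tau> {i} ` ac (e i)" using \<tau>m[OF i(2)] e(2)[of i] i(3) by (simp add: s_def)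
    also have "\<dots> = ac (b i)" unfolding b_def using \<tau>a[OF i(2)] by (rule ac_image)
    finally show ?thesis .
  qed
  have small_v: "small (vertex f u i)" if "i \<in> u" "u \<subseteq> s" for u i
    unfolding vertex_def using sm[of "{i}"] that by (intro small_image) auto
  have ob: "\<tau> u ` obj f u = face_set b u" if u: "u \<subseteq> s" for u
  proof (cases "u = {}")
    case True
    then show ?thesis using oe aut_image_acl0[OF \<tau>a[OF u]] by simp
  next
    case False
    have fu: "finite u" using u fs by (rule finite_subset)
    have "\<tau> u ` obj f u = acl \<MM> (\<tau> u ` (\<Union>i\<in>u. vertex f u i))"
      unfolding ou[OF False u] using small_v[OF _ u] fu \<tau>a[OF u] by (intro acl_image small_UN_finite)
    also have "\<tau> u ` (\<Union>i\<in>u. vertex f u i) = (\<Union>i\<in>u. ac (b i))"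
      unfolding image_UN by (intro SUP_cong refl vs u)
    also have "acl \<MM> \<dots> = face_set b u" unfolding face_set_def by (intro acl_UN fu small_range)
    finally show ?thesis .
  qed
  have ob': "obj f u = ainv (\<tau> u) ` face_set b u" if u: "u \<subseteq> s" for u
    unfolding ob[OF u, symmetric] image_image using \<tau>a[OF u] by simp
  have O: "obj f = (\<lambda>u\<in>Pow s. ainv (\<tau> u) ` face_set b u)"
    using ob' by (intro extensionalityI[OF obj_ext restrict_extensional]) simp
  have Mo: "mor f u v = (\<lambda>x\<in>ainv (\<tau> u) ` face_set b u. ainv (\<tau> v) (\<tau> u x))" if uv: "u \<subseteq> v" "v \<subseteq> s" for u v
  proof (rule extensionalityI[OF _ restrict_extensional])
    have us: "u \<subseteq> s" using uv by blast
    show "mor f u v \<in> extensional (ainv (\<tau> u) ` face_set b u)"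
      using mp[OF uv] ob'[OF us] by (simp add: PiE_def)
    fix x assume x: "x \<in> ainv (\<tau> u) ` face_set b u"
    then have x': "x \<in> obj f u" using ob'[OF us] by simp
    then have "mor f u v x \<in> obj f v" using mp[OF uv] by blast
    then have "\<tau> v (mor f u v x) = \<tau> u x"
      using \<tau>m[OF uv(2)] \<tau>m[OF us x'] mc[OF uv subset_refl x'] by simp
    then show "mor f u v x = (\<lambda>x\<in>ainv (\<tau> u) ` face_set b u. ainv (\<tau> v) (\<tau> u x)) x"
      using x \<tau>a[OF uv(2)] by (metis aut_inv_simps(1) restrict_apply')
  qed
  have M: "mor f = (\<lambda>u v. if u \<subseteq> v \<and> v \<subseteq> s then (\<lambda>x\<in>ainv (\<tau> u) ` face_set b u. ainv (\<tau> v) (\<tau> u x)) else undefined)"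
  proof (rule ext, rule ext)
    fix u v
    show "mor f u v = (if u \<subseteq> v \<and> v \<subseteq> s then (\<lambda>x\<in>ainv (\<tau> u) ` face_set b u. ainv (\<tau> v) (\<tau> u x)) else undefined)"
      by (cases "u \<subseteq> v \<and> v \<subseteq> s") (simp_all only: Mo und if_True if_False simp_thms)
  qed
  have f: "f = cube_of s b \<tau>"
    unfolding cube_of_def using O M by (intro cube.equality) (simp_all add: s_def)
  have sne: "s \<noteq> {}" using cs by auto
  have "indep_family R acl0 s (\<lambda>i. ac (b i))"
    using iu[OF sne subset_refl]
    unfolding indep_family_def
  proof (intro ballI)
    fix i assume *: "\<forall>i\<in>s. R (vertex f s i) acl0 (\<Union>j\<in>s - {i}. vertex f s j)" and i: "i \<in> s"
    have "\<tau> s = id" using \<tau>[of s] by simp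
    then have v: "vertex f s j = ac (b j)" if "j \<in> s" for j using vs[OF that subset_refl] by simp
    have "(\<Union>j\<in>s - {i}. vertex f s j) = (\<Union>j\<in>s - {i}. ac (b j))" by (intro SUP_cong refl v) auto
    then show "R (ac (b i)) acl0 (\<Union>j\<in>s - {i}. ac (b j))" using * i v by metis
  qed
  then show thesis
    using that[of \<tau>] \<tau> f unfolding s_def b_def by blast
qed

text \<open>The choice is a function of the vertex set alone, so simplices with a common vertex use
  the same realization there; this makes the vertex terms cancel.\<close>

definition pick :: "'m set \<Rightarrow> 'i \<Rightarrow> 'm" where
  "pick X = (SOME e. e \<in> real \<and> X = ac e)"

lemma pick:
  assumes "f \<in> simplices \<MM> R p n" "i \<in> spt f"
  shows "pick (obj f {i}) \<in> real" "obj f {i} = ac (pick (obj f {i}))"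
proof -
  have "\<forall>i\<in>spt f. \<exists>b\<in>real. obj f {i} = ac b" using assms(1) unfolding simplices_def by blast
  then have "\<exists>e. e \<in> real \<and> obj f {i} = ac e" using assms(2) by blast
  from someI_ex[OF this] show "pick (obj f {i}) \<in> real" "obj f {i} = ac (pick (obj f {i}))"
    unfolding pick_def by auto
qed

end

section \<open>Boundaries of triangles\<close>

definition add_subgroup :: "'g::ab_group_add set \<Rightarrow> bool" where
  "add_subgroup S \<longleftrightarrow> 0 \<in> S \<and> (\<forall>x\<in>S. \<forall>y\<in>S. x - y \<in> S)"

lemma add_subgroupD:
  assumes "add_subgroup S"
  shows "0 \<in> S" "x \<in> S \<Longrightarrow> y \<in> S \<Longrightarrow> x - y \<in> S" "x \<in> S \<Longrightarrow> - x \<in> S" "x \<in> S \<Longrightarrow> y \<in> S \<Longrightarrow> x + y \<in> S"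
proof -
  show 0: "0 \<in> S" and d: "\<And>x y. x \<in> S \<Longrightarrow> y \<in> S \<Longrightarrow> x - y \<in> S" using assms by (auto simp: add_subgroup_def)
  show m: "- x \<in> S" if "x \<in> S" for x using d[OF 0 that] by simp
  show "x + y \<in> S" if "x \<in> S" "y \<in> S" for x y using d[OF that(1) m[OF that(2)]] by simp
qed

lemma sorted_list_of_set_2: "i < j \<Longrightarrow> sorted_list_of_set {i, j :: nat} = [i, j]"
  using sorted_list_of_set.idem_if_sorted_distinct[of "[i, j]"] by simp

lemma sorted_list_of_set_3: "i < j \<Longrightarrow> j < k \<Longrightarrow> sorted_list_of_set {i, j, k :: nat} = [i, j, k]"
  using sorted_list_of_set.idem_if_sorted_distinct[of "[i, j, k]"] by simp

lemma boundary_add: "boundary n (c + d) = boundary n c + boundary n d"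
  by (simp add: boundary_def frag_extend_add)

lemma boundary_diff: "boundary n (c - d) = boundary n c - boundary n d"
  by (simp add: boundary_def frag_extend_diff)

lemma boundary_1_of: "boundary 1 (frag_of f) = frag_of (face 0 f) - frag_of (face 1 f)"
  by (simp add: boundary_def)

lemma boundary_2_of: "boundary 2 (frag_of f) = frag_of (face 0 f) - frag_of (face 1 f) + frag_of (face 2 f)"
  by (simp add: boundary_def numeral_2_eq_2)

context indep_setup
begin

abbreviation S where "S \<equiv> boundaries \<MM> R p 1"

lemma S_alt: "S = boundary 2 ` {c. Poly_Mapping.keys c \<subseteq> simplices \<MM> R p 2}"
proof -
  have "carrier (chains \<MM> R p (Suc 1)) = {c. Poly_Mapping.keys c \<subseteq> simplices \<MM> R p 2}"
    by (auto simp: chains_def numeral_2_eq_2)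
  then show ?thesis unfolding boundaries_def by (simp add: numeral_2_eq_2)
qed

lemma S_subgroup: "add_subgroup S"
  unfolding add_subgroup_def
proof (intro conjI ballI)
  show "0 \<in> S" unfolding S_alt by (rule image_eqI[of _ _ 0]) (auto simp: boundary_def)
  fix x y assume "x \<in> S" "y \<in> S"
  then obtain c d where cd: "x = boundary 2 c" "y = boundary 2 d" "Poly_Mapping.keys c \<subseteq> simplices \<MM> R p 2"
    "Poly_Mapping.keys d \<subseteq> simplices \<MM> R p 2" unfolding S_alt by blast
  then have "Poly_Mapping.keys (c - d) \<subseteq> simplices \<MM> R p 2" using keys_diff[of c d] by blast
  then show "x - y \<in> S" unfolding S_alt cd(1,2) boundary_diff[symmetric] by blast
qed

lemmas S_rules = add_subgroupD[OF S_subgroup]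

lemma face_cube_of_2:
  assumes "i < j"
  shows "face 0 (cube_of {i, j} b \<tau>) = cube_of {j} b \<tau>" "face 1 (cube_of {i, j} b \<tau>) = cube_of {i} b \<tau>"
proof -
  have "{i, j} - {i} = {j}" "{i, j} - {j} = {i}" using assms by auto
  then show "face 0 (cube_of {i, j} b \<tau>) = cube_of {j} b \<tau>" "face 1 (cube_of {i, j} b \<tau>) = cube_of {i} b \<tau>"
    using assms by (simp_all add: face_def sorted_list_of_set_2 restrict_cube_of)
qed

lemma face_cube_of_3:
  assumes "i < j" "j < k"
  shows "face 0 (cube_of {i, j, k} b \<tau>) = cube_of {j, k} b \<tau>" "face 1 (cube_of {i, j, k} b \<tau>) = cube_of {i, k} b \<tau>"
    "face 2 (cube_of {i, j, k} b \<tau>) = cube_of {i, j} b \<tau>"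
proof -
  have "{i, j, k} - {i} = {j, k}" "{i, j, k} - {j} = {i, k}" "{i, j, k} - {k} = {i, j}" using assms by auto
  then show "face 0 (cube_of {i, j, k} b \<tau>) = cube_of {j, k} b \<tau>" "face 1 (cube_of {i, j, k} b \<tau>) = cube_of {i, k} b \<tau>"
    "face 2 (cube_of {i, j, k} b \<tau>) = cube_of {i, j} b \<tau>"
    using assms by (simp_all add: face_def sorted_list_of_set_3 restrict_cube_of subset_insertI2)
qed

lemma boundary_triangle:
  assumes "i < j" "j < k"
  shows "boundary 2 (frag_of (cube_of {i, j, k} b \<tau>)) =
    frag_of (cube_of {j, k} b \<tau>) - frag_of (cube_of {i, k} b \<tau>) + frag_of (cube_of {i, j} b \<tau>)"
  unfolding boundary_2_of face_cube_of_3[OF assms] ..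

lemma cube_of_cong:
  assumes "\<And>i. i \<in> s \<Longrightarrow> b' i = b i" "\<And>u. u \<subseteq> s \<Longrightarrow> \<tau>' u = \<tau> u"
  shows "cube_of s b' \<tau>' = cube_of s b \<tau>"
proof -
  have f: "face_set b' u = face_set b u" if "u \<subseteq> s" for u
  proof -
    have "(\<Union>i\<in>u. range (b' i)) = (\<Union>i\<in>u. range (b i))" using assms(1) that by (intro SUP_cong) auto
    then show ?thesis by (simp add: face_set_def)
  qed
  have O: "(\<lambda>u\<in>Pow s. ainv (\<tau>' u) ` face_set b' u) = (\<lambda>u\<in>Pow s. ainv (\<tau> u) ` face_set b u)"
    by (rule restrict_ext) (simp add: f assms(2))
  have M: "(\<lambda>u v. if u \<subseteq> v \<and> v \<subseteq> s then (\<lambda>x\<in>ainv (\<tau>' u) ` face_set b' u. ainv (\<tau>' v) (\<tau>' u x)) else undefined) =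
     (\<lambda>u v. if u \<subseteq> v \<and> v \<subseteq> s then (\<lambda>x\<in>ainv (\<tau> u) ` face_set b u. ainv (\<tau> v) (\<tau> u x)) else undefined)"
  proof (rule ext, rule ext, rule if_cong[OF refl _ refl])
    fix u v assume uv: "u \<subseteq> v \<and> v \<subseteq> s"
    then have "u \<subseteq> s" "v \<subseteq> s" by auto
    then show "(\<lambda>x\<in>ainv (\<tau>' u) ` face_set b' u. ainv (\<tau>' v) (\<tau>' u x)) = (\<lambda>x\<in>ainv (\<tau> u) ` face_set b u. ainv (\<tau> v) (\<tau> u x))"
      by (simp only: f assms(2))
  qed
  show ?thesis unfolding cube_of_def by (simp only: O M)
qed

lemma subset_pair_cases: "u \<subseteq> {i, j} \<Longrightarrow> u = {} \<or> u = {i} \<or> u = {j} \<or> u = {i, j}"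
  using Pow_iff[of u "{i, j}"] by (auto simp: Pow_insert)

lemma cube_of_pair_cong:
  assumes "b' i = b i" "b' j = b j" "\<tau>' {} = \<tau> {}" "\<tau>' {i} = \<tau> {i}" "\<tau>' {j} = \<tau> {j}" "\<tau>' {i, j} = \<tau> {i, j}"
  shows "cube_of {i, j} b' \<tau>' = cube_of {i, j} b \<tau>"
proof (rule cube_of_cong)
  show "b' l = b l" if "l \<in> {i, j}" for l using that assms(1,2) by auto
  show "\<tau>' u = \<tau> u" if "u \<subseteq> {i, j}" for u using subset_pair_cases[OF that] assms(3-6) by (elim disjE) simp_all
qed

text \<open>It suffices to build the vertices one after the other, each independent from the
  previous ones; \<open>R_triple\<close> restores the symmetry between them.\<close>

lemma triangle_family:
  assumes "i \<noteq> j" "j \<noteq> k" "i \<noteq> k" "ind (b i) (b j)" "ind2 (b k) (b i) (b j)"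
  shows "indep_family R acl0 {i, j, k} (\<lambda>l. ac (b l))"
proof -
  have 1: "R (ac (b i)) acl0 (ac (b j) \<union> ac (b k))"
    by (rule R_triple[OF small_ac small_ac small_ac assms(4,5)[unfolded ind_def ind2_def]])
  have 2: "R (ac (b j)) acl0 (ac (b i) \<union> ac (b k))"
    by (rule R_triple[OF small_ac small_ac small_ac ind_sym[OF assms(4), unfolded ind_def]
          assms(5)[unfolded ind2_def Un_commute[of "ac (b i)"]]])
  have "{i, j, k} - {i} = {j, k}" "{i, j, k} - {j} = {i, k}" "{i, j, k} - {k} = {i, j}" using assms(1-3) by auto
  then show ?thesis
    unfolding indep_family_def using 1 2 assms(5)[unfolded ind2_def] by simp
qed

lemma pair_family:
  assumes "i \<noteq> j" "ind (b i) (b j)"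
  shows "indep_family R acl0 {i, j} (\<lambda>l. ac (b l))"
proof -
  have "{i, j} - {i} = {j}" "{i, j} - {j} = {i}" using assms(1) by auto
  then show ?thesis
    unfolding indep_family_def using assms(2) ind_sym[OF assms(2)] by (simp add: ind_def)
qed

text \<open>The automorphisms on the faces are left arbitrary. Varying one of them while the others
  stay fixed is the device that shows edges to be invariant.\<close>

lemma triangle_in_S:
  assumes "i < j" "j < k" "b i \<in> real" "b j \<in> real" "b k \<in> real" "ind (b i) (b j)" "ind2 (b k) (b i) (b j)"
    and \<tau>: "\<And>u. \<tau> u \<in> aut \<MM>"
  shows "frag_of (cube_of {j, k} b \<tau>) - frag_of (cube_of {i, k} b \<tau>) + frag_of (cube_of {i, j} b \<tau>) \<in> S"
proof -
  have "cube_of {i, j, k} b \<tau> \<in> simplices \<MM> R p 2"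
  proof (rule cube_of_simplex)
    show "indep_family R acl0 {i, j, k} (\<lambda>l. ac (b l))" using assms by (intro triangle_family) auto
  qed (use assms in auto)
  then have "boundary 2 (frag_of (cube_of {i, j, k} b \<tau>)) \<in> S" unfolding S_alt by (intro imageI) simp
  then show ?thesis unfolding boundary_triangle[OF assms(1,2)] .
qed

section \<open>Edges\<close>

text \<open>There is no canonical automorphism taking \<open>x\<close> to \<open>b\<close>, but any
  two candidates agree on \<open>acl x\<close>, which is all that enters a simplex.\<close>

definition mv :: "('i \<Rightarrow> 'm) \<Rightarrow> ('i \<Rightarrow> 'm) \<Rightarrow> 'm \<Rightarrow> 'm" where
  "mv x b = (SOME \<sigma>. \<sigma> \<in> aut \<MM> \<and> (x \<in> real \<longrightarrow> b \<in> real \<longrightarrow> \<sigma> \<circ> x = b))"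

lemma mv: "mv x b \<in> aut \<MM>" "x \<in> real \<Longrightarrow> b \<in> real \<Longrightarrow> mv x b \<circ> x = b"
proof -
  have "\<exists>\<sigma>. \<sigma> \<in> aut \<MM> \<and> (x \<in> real \<longrightarrow> b \<in> real \<longrightarrow> \<sigma> \<circ> x = b)"
  proof (cases "x \<in> real \<and> b \<in> real")
    case True
    then obtain \<sigma> where "\<sigma> \<in> aut \<MM>" "\<sigma> \<circ> x = b" using real_trans[of x b] by blast
    then show ?thesis by blast
  next
    case False
    then show ?thesis using id_aut by blast
  qed
  from someI_ex[OF this] show "mv x b \<in> aut \<MM>" "x \<in> real \<Longrightarrow> b \<in> real \<Longrightarrow> mv x b \<circ> x = b"
    unfolding mv_def by blast+
qed

text \<open>The \<open>1\<close>-simplex with vertices \<open>acl x\<close> at \<open>i\<close> and \<open>acl y\<close> at \<open>j\<close>, embedded by \<open>x \<mapsto> b\<close> and \<open>y \<mapsto> c\<close>.\<close>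

definition edge :: "nat \<Rightarrow> ('i \<Rightarrow> 'm) \<Rightarrow> nat \<Rightarrow> ('i \<Rightarrow> 'm) \<Rightarrow> ('i \<Rightarrow> 'm) \<Rightarrow> ('i \<Rightarrow> 'm) \<Rightarrow> 'm cube" where
  "edge i x j y b c = cube_of {i, j} (\<lambda>l. if l = i then b else c)
     (\<lambda>u. if u = {i} then mv x b else if u = {j} then mv y c else id)"

abbreviation E where "E i x j y b c \<equiv> frag_of (edge i x j y b c)"

lemma edge_simplex:
  assumes "i < j" "b \<in> real" "c \<in> real" "ind b c"
  shows "edge i x j y b c \<in> simplices \<MM> R p 1"
  unfolding edge_def
proof (rule cube_of_simplex)
  show "indep_family R acl0 {i, j} (\<lambda>l. ac (if l = i then b else c))"
    using assms by (intro pair_family) auto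
qed (use assms mv(1) id_aut in auto)

lemma edge_triangle:
  assumes "i < j" "j < k" "b \<in> real" "c \<in> real" "d \<in> real" "ind b c" "ind2 d b c"
  shows "E j y k z c d - E i x k z b d + E i x j y b c \<in> S"
proof -
  define bb where "bb l = (if l = i then b else if l = j then c else d)" for l
  define \<tau> where "\<tau> u = (if u = {i} then mv x b else if u = {j} then mv y c else if u = {k} then mv z d else id)" for u
  have *: "frag_of (cube_of {j, k} bb \<tau>) - frag_of (cube_of {i, k} bb \<tau>) + frag_of (cube_of {i, j} bb \<tau>) \<in> S"
    by (rule triangle_in_S) (use assms mv(1) id_aut in \<open>auto simp: bb_def \<tau>_def\<close>)
  have "cube_of {j, k} bb \<tau> = edge j y k z c d" "cube_of {i, k} bb \<tau> = edge i x k z b d" "cube_of {i, j} bb \<tau> = edge i x j y b c"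
    unfolding edge_def using assms(1,2) by - (rule cube_of_pair_cong; auto simp: bb_def \<tau>_def)+
  with * show ?thesis by simp
qed

text \<open>Two triangles on \<open>b\<close>, \<open>c\<close> and an independent \<open>d\<close>
  differ only in the automorphism on the face \<open>{i, j}\<close>. Subtracting their boundaries
  leaves a difference of two edges, and twisting this face by the inverse of \<open>\<sigma>\<close>
  produces the edge from \<open>\<sigma> \<circ> b\<close> to
  \<open>\<sigma> \<circ> c\<close>.\<close>

lemma edge_aut:
  assumes ij: "i < j" and x: "x \<in> real" and y: "y \<in> real" and b: "b \<in> real" and c: "c \<in> real"
    and bc: "ind b c" and \<sigma>: "\<sigma> \<in> aut \<MM>"
  shows "E i x j y (\<sigma> \<circ> b) (\<sigma> \<circ> c) - E i x j y b c \<in> S"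
proof -
  obtain d where d: "d \<in> real" "ind2 d b c" by (rule independent_realization2)
  define k where "k = Suc j"
  define bb where "bb l = (if l = i then b else if l = j then c else d)" for l
  define \<tau> where "\<tau> \<rho> u = (if u = {i} then mv x b else if u = {j} then mv y c else if u = {k} then id else if u = {i, j} then \<rho> else id)"
    for u and \<rho> :: "'m \<Rightarrow> 'm"
  have jk: "j < k" by (simp add: k_def)
  have *: "frag_of (cube_of {j, k} bb (\<tau> \<rho>)) - frag_of (cube_of {i, k} bb (\<tau> \<rho>)) + frag_of (cube_of {i, j} bb (\<tau> \<rho>)) \<in> S"
    if "\<rho> \<in> aut \<MM>" for \<rho>
    by (rule triangle_in_S) (use ij jk b c bc d mv(1) id_aut that in \<open>auto simp: bb_def \<tau>_def\<close>)
  have "cube_of {j, k} bb (\<tau> (ainv \<sigma>)) = cube_of {j, k} bb (\<tau> id)" "cube_of {i, k} bb (\<tau> (ainv \<sigma>)) = cube_of {i, k} bb (\<tau> id)"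
    using ij jk by - (rule cube_of_pair_cong; auto simp: \<tau>_def)+
  then have **: "frag_of (cube_of {i, j} bb (\<tau> (ainv \<sigma>))) - frag_of (cube_of {i, j} bb (\<tau> id)) \<in> S"
    using S_rules(2)[OF *[OF inv_aut[OF \<sigma>]] *[OF id_aut]] by simp
  have e1: "cube_of {i, j} bb (\<tau> id) = edge i x j y b c"
    unfolding edge_def using ij jk by - (rule cube_of_pair_cong; auto simp: bb_def \<tau>_def)
  \<comment> \<open>The two embeddings of \<open>acl w\<close> differ by \<open>\<sigma>\<close>
    although \<open>mv\<close> makes unrelated choices: on \<open>acl w\<close> an automorphism is
    determined by the image of \<open>w\<close>.\<close>
  have mve: "ainv (mv w (\<sigma> \<circ> v)) (\<sigma> t) = ainv (mv w v) t" if w: "w \<in> real" "v \<in> real" and t: "t \<in> ac v" for w v t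
  proof -
    have "t \<in> mv w v ` ac w" using t mv[of w v] w by (simp add: ac_image)
    then obtain q where q: "q \<in> ac w" "t = mv w v q" by blast
    have "\<sigma> \<circ> v \<in> real" using w(2) \<sigma> by (rule real_aut)
    then have "(\<sigma> \<circ> mv w v) \<circ> w = mv w (\<sigma> \<circ> v) \<circ> w"
      using mv(2)[OF w] mv(2)[OF w(1), of "\<sigma> \<circ> v"] by (simp add: comp_assoc)
    then have "(\<sigma> \<circ> mv w v) q = mv w (\<sigma> \<circ> v) q"
      using aut_eq_on_ac[OF w(1) comp_aut[OF \<sigma> mv(1)] mv(1) _ q(1)] by blast
    then have "ainv (mv w (\<sigma> \<circ> v)) (\<sigma> t) = q" using q(2) mv(1) by simp
    moreover have "ainv (mv w v) t = q" using q(2) mv(1) by simp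
    ultimately show ?thesis by simp
  qed
  have e2: "edge i x j y (\<sigma> \<circ> b) (\<sigma> \<circ> c) = cube_of {i, j} bb (\<tau> (ainv \<sigma>))"
    unfolding edge_def
  proof (rule cube_of_eqI[where \<sigma> = \<sigma>])
    show "(if u = {i} then mv x (\<sigma> \<circ> b) else if u = {j} then mv y (\<sigma> \<circ> c) else id) \<in> aut \<MM>" for u
      using mv(1) id_aut by simp
    show "\<tau> (ainv \<sigma>) u \<in> aut \<MM>" for u using mv(1) id_aut inv_aut[OF \<sigma>] by (simp add: \<tau>_def)
    show "(if l = i then \<sigma> \<circ> b else \<sigma> \<circ> c) = \<sigma> \<circ> bb l" if "l \<in> {i, j}" for l
      using that ij by (auto simp: bb_def)
    fix u t assume u: "u \<subseteq> {i, j}" and t: "t \<in> face_set bb u"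
    consider "u = {}" | "u = {i}" | "u = {j}" | "u = {i, j}" using subset_pair_cases[OF u] by blast
    then show "ainv (if u = {i} then mv x (\<sigma> \<circ> b) else if u = {j} then mv y (\<sigma> \<circ> c) else id) (\<sigma> t) = ainv (\<tau> (ainv \<sigma>) u) t"
    proof cases
      case 1
      then show ?thesis using t aut_acl0[OF \<sigma>] by (simp add: \<tau>_def)
    next
      case 2
      then show ?thesis using t mve[OF x b] by (simp add: \<tau>_def bb_def)
    next
      case 3
      then show ?thesis using t mve[OF y c] ij by (simp add: \<tau>_def bb_def)
    next
      case 4
      have "ainv (ainv \<sigma>) t = \<sigma> t" using autD(1)[OF \<sigma>] by (simp add: inv_inv_eq)
      moreover have "{i, j} \<noteq> {i}" "{i, j} \<noteq> {j}" "{i, j} \<noteq> {k}" "j \<noteq> k" using ij jk by auto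
      ultimately show ?thesis using 4 by (simp add: \<tau>_def)
    qed
  qed (use \<sigma> in auto)
  show ?thesis using ** unfolding e1 e2 .
qed

section \<open>The difference cocycle\<close>

text \<open>\<open>N\<close> extends the class of \<open>edge i x j y b c\<close> to pairs \<open>b, c\<close> that need not be independent (and to \<open>i \<ge> j\<close>):
  go from \<open>b\<close> to a point \<open>d\<close> independent of both, and back to \<open>c\<close>.\<close>

definition N :: "nat \<Rightarrow> ('i \<Rightarrow> 'm) \<Rightarrow> nat \<Rightarrow> ('i \<Rightarrow> 'm) \<Rightarrow> ('i \<Rightarrow> 'm) \<Rightarrow> ('i \<Rightarrow> 'm) \<Rightarrow> ('m cube \<Rightarrow>\<^sub>0 int)" where
  "N i x j y b c = (let k = Suc (max i j); d = (SOME d. d \<in> real \<and> ind2 d b c) in E i x k a b d - E j y k a c d)"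

lemma ind2_mono: "R (ac d) acl0 X \<Longrightarrow> ac b \<union> ac c \<subseteq> X \<Longrightarrow> small X \<Longrightarrow> ind2 d b c"
  unfolding ind2_def using R_mono[OF _ subset_refl _ small_ac small_acl0] by blast

text \<open>The triangles on \<open>b, d, d'\<close> and on \<open>c, d, d'\<close> share the edge
  from \<open>d\<close> to \<open>d'\<close>, which cancels in the difference.\<close>

lemma N_step:
  assumes "i < k" "j < k" "k < k'" "b \<in> real" "c \<in> real" "d \<in> real" "d' \<in> real"
    and d: "ind2 d b c" and d': "R (ac d') acl0 X" "ac b \<union> ac c \<union> ac d \<subseteq> X" "small X"
  shows "(E i x k z b d - E j y k z c d) - (E i x k' z' b d' - E j y k' z' c d') \<in> S"
proof -
  have 1: "E k z k' z' d d' - E i x k' z' b d' + E i x k z b d \<in> S"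
    by (rule edge_triangle) (use assms ind2_ind[OF d] ind2_mono[OF d'(1)] in auto)
  have 2: "E k z k' z' d d' - E j y k' z' c d' + E j y k z c d \<in> S"
    by (rule edge_triangle) (use assms ind2_ind[OF d] ind2_mono[OF d'(1)] in auto)
  show ?thesis using S_rules(2)[OF 1 2] by (simp add: algebra_simps)
qed

text \<open>Two auxiliary points \<open>d\<close> and \<open>d1\<close> need not be independent from
  each other, so both are compared with a third one that is independent of everything.\<close>

lemma N_any:
  assumes "i < k" "j < k" "b \<in> real" "c \<in> real" "d \<in> real" "ind2 d b c"
  shows "N i x j y b c - (E i x k z b d - E j y k z c d) \<in> S"
proof -
  define d1 where "d1 = (SOME d. d \<in> real \<and> ind2 d b c)"
  define k1 where "k1 = Suc (max i j)"
  have "\<exists>d. d \<in> real \<and> ind2 d b c" using assms(5,6) by blast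
  from someI_ex[OF this] have d1: "d1 \<in> real" "ind2 d1 b c" unfolding d1_def by blast+
  have N: "N i x j y b c = E i x k1 a b d1 - E j y k1 a c d1" by (simp add: N_def k1_def d1_def Let_def)
  define X where "X = ac b \<union> ac c \<union> ac d \<union> ac d1"
  have X: "small X" unfolding X_def by (intro small_Un small_ac)
  then obtain d2 where d2: "d2 \<in> real" "R (ac d2) acl0 X" by (rule independent_realization)
  \<comment> \<open>A position beyond all others, as \<open>N_step\<close> moves the auxiliary point
    to a larger position.\<close>
  define k2 where "k2 = Suc (max k k1)"
  have 1: "(E i x k1 a b d1 - E j y k1 a c d1) - (E i x k2 a b d2 - E j y k2 a c d2) \<in> S"
    by (rule N_step[OF _ _ _ _ _ _ _ _ d2(2) _ X]) (use assms d1 d2 in \<open>auto simp: k1_def k2_def X_def\<close>)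
  have 2: "(E i x k z b d - E j y k z c d) - (E i x k2 a b d2 - E j y k2 a c d2) \<in> S"
    by (rule N_step[OF _ _ _ _ _ _ _ _ d2(2) _ X]) (use assms d1 d2 in \<open>auto simp: k1_def k2_def X_def\<close>)
  show ?thesis unfolding N using S_rules(2)[OF 1 2] by (simp add: algebra_simps)
qed

text \<open>With one auxiliary point for all three pairs the sum telescopes.\<close>

lemma N_cocycle:
  assumes "b \<in> real" "c \<in> real" "d \<in> real"
  shows "N i x j y b c + N j y l w c d - N i x l w b d \<in> S"
proof -
  define X where "X = ac b \<union> ac c \<union> ac d"
  have X: "small X" unfolding X_def by (intro small_Un small_ac)
  then obtain e where e: "e \<in> real" "R (ac e) acl0 X" by (rule independent_realization)
  define k where "k = Suc (max i (max j l))"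
  have 1: "N i x j y b c - (E i x k a b e - E j y k a c e) \<in> S"
    by (rule N_any) (use assms e ind2_mono[OF e(2) _ X] in \<open>auto simp: k_def X_def\<close>)
  have 2: "N j y l w c d - (E j y k a c e - E l w k a d e) \<in> S"
    by (rule N_any) (use assms e ind2_mono[OF e(2) _ X] in \<open>auto simp: k_def X_def\<close>)
  have 3: "N i x l w b d - (E i x k a b e - E l w k a d e) \<in> S"
    by (rule N_any) (use assms e ind2_mono[OF e(2) _ X] in \<open>auto simp: k_def X_def\<close>)
  show ?thesis using S_rules(2)[OF S_rules(4)[OF 1 2] 3] by (simp add: algebra_simps)
qed

text \<open>The auxiliary point is moved along with the pair; both edges of the detour join
  independent points, where \<open>edge_aut\<close> applies.\<close>

lemma N_aut:
  assumes "x \<in> real" "y \<in> real" "b \<in> real" "c \<in> real" "\<sigma> \<in> aut \<MM>"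
  shows "N i x j y (\<sigma> \<circ> b) (\<sigma> \<circ> c) - N i x j y b c \<in> S"
proof -
  obtain d where d: "d \<in> real" "ind2 d b c" by (rule independent_realization2)
  define k where "k = Suc (max i j)"
  have k: "i < k" "j < k" by (auto simp: k_def)
  have 1: "N i x j y b c - (E i x k a b d - E j y k a c d) \<in> S"
    by (rule N_any) (use k assms d in auto)
  have 2: "N i x j y (\<sigma> \<circ> b) (\<sigma> \<circ> c) - (E i x k a (\<sigma> \<circ> b) (\<sigma> \<circ> d) - E j y k a (\<sigma> \<circ> c) (\<sigma> \<circ> d)) \<in> S"
    by (rule N_any) (use k assms d real_aut ind2_aut in auto)
  have 3: "E i x k a (\<sigma> \<circ> b) (\<sigma> \<circ> d) - E i x k a b d \<in> S"
    by (rule edge_aut) (use k assms d ind2_ind[OF d(2)] a_real in auto)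
  have 4: "E j y k a (\<sigma> \<circ> c) (\<sigma> \<circ> d) - E j y k a c d \<in> S"
    by (rule edge_aut) (use k assms d ind2_ind[OF d(2)] a_real in auto)
  show ?thesis using S_rules(4)[OF S_rules(2)[OF 2 1] S_rules(2)[OF 3 4]] by (simp add: algebra_simps)
qed

text \<open>For an independent pair the edge and the detour through \<open>d\<close> bound a single
  triangle.\<close>

lemma N_edge:
  assumes "i < j" "b \<in> real" "c \<in> real" "ind b c"
  shows "E i x j y b c - N i x j y b c \<in> S"
proof -
  obtain d where d: "d \<in> real" "ind2 d b c" by (rule independent_realization2)
  define k where "k = Suc j"
  have 1: "N i x j y b c - (E i x k a b d - E j y k a c d) \<in> S"
    by (rule N_any) (use assms d in \<open>auto simp: k_def\<close>)
  have 2: "E j y k a c d - E i x k a b d + E i x j y b c \<in> S"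
    by (rule edge_triangle) (use assms d in \<open>auto simp: k_def\<close>)
  show ?thesis using S_rules(2)[OF 2 1] by (simp add: algebra_simps)
qed

text \<open>Both ends sit at position 0 with vertex set \<open>acl a\<close>, so the two edges of
  the detour have the same faces and \<open>beta b c\<close> is a cycle.\<close>

definition beta :: "('i \<Rightarrow> 'm) \<Rightarrow> ('i \<Rightarrow> 'm) \<Rightarrow> ('m cube \<Rightarrow>\<^sub>0 int)" where
  "beta b c = N 0 a 0 a b c"

lemma N_diagonal:
  assumes "x \<in> real" "y \<in> real" "b \<in> real" "c \<in> real"
  shows "N i x j y b b - N i x j y c c \<in> S"
proof -
  obtain \<sigma> where \<sigma>: "\<sigma> \<in> aut \<MM>" "\<sigma> \<circ> c = b" by (rule real_trans[OF assms(4,3)])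
  show ?thesis using N_aut[OF assms(1,2,4,4) \<sigma>(1), of i j] \<sigma>(2) by simp
qed

text \<open>Moving the end \<open>(i, x)\<close> to the standard vertex \<open>(0, a)\<close> costs
  a degenerate pair \<open>b, b\<close>, whose class does not depend on \<open>b\<close>. So the
  correction is one term for each end, and the rest is \<open>beta\<close>.\<close>

lemma edge_formula:
  assumes "i < j" "x \<in> real" "y \<in> real" "b \<in> real" "c \<in> real" "ind b c"
  shows "E i x j y b c - (beta b c + N i x 0 a a a - N j y 0 a a a) \<in> S"
proof -
  note r = assms(2-5) a_real
  have 1: "E i x j y b c - N i x j y b c \<in> S" using assms by (intro N_edge)
  have 2: "N i x 0 a b b + N 0 a j y b c - N i x j y b c \<in> S" using r by (intro N_cocycle)
  have 3: "N i x 0 a b b - N i x 0 a a a \<in> S" using r by (intro N_diagonal)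
  have 4: "N 0 a 0 a b c + N 0 a j y c c - N 0 a j y b c \<in> S" using r by (intro N_cocycle)
  have 5: "N 0 a j y c c - N 0 a j y a a \<in> S" using r by (intro N_diagonal)
  have 6: "N 0 a j y a a + N j y 0 a a a - N 0 a 0 a a a \<in> S" using r by (intro N_cocycle)
  have 7: "N 0 a 0 a a a + N 0 a 0 a a a - N 0 a 0 a a a \<in> S" using r by (intro N_cocycle)
  have "E i x j y b c - (beta b c + N i x 0 a a a - N j y 0 a a a) =
    (E i x j y b c - N i x j y b c) - (N i x 0 a b b + N 0 a j y b c - N i x j y b c)
    + (N i x 0 a b b - N i x 0 a a a) - (N 0 a 0 a b c + N 0 a j y c c - N 0 a j y b c)
    + (N 0 a j y c c - N 0 a j y a a) + (N 0 a j y a a + N j y 0 a a a - N 0 a 0 a a a)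
    + (N 0 a 0 a a a + N 0 a 0 a a a - N 0 a 0 a a a)"
    by (simp add: beta_def)
  then show ?thesis using 1 2 3 4 5 6 7 by (simp only: S_rules)
qed

lemma beta_cocycle:
  assumes "b \<in> real" "c \<in> real" "d \<in> real"
  shows "beta b c + beta c d - beta b d \<in> S"
  unfolding beta_def using assms by (rule N_cocycle)

lemma beta_aut:
  assumes "b \<in> real" "c \<in> real" "\<sigma> \<in> aut \<MM>"
  shows "beta (\<sigma> \<circ> b) (\<sigma> \<circ> c) - beta b c \<in> S"
  unfolding beta_def using assms a_real by (intro N_aut)

lemma beta_refl: "b \<in> real \<Longrightarrow> beta b b \<in> S"
  using beta_cocycle[of b b b] by simp

end

declare One_nat_def [simp del]

section \<open>Evaluating cocycles on chains\<close>

context indep_setup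
begin

definition vert :: "nat \<Rightarrow> ('i \<Rightarrow> 'm) \<Rightarrow> 'm cube" where
  "vert j y = cube_of {j} (\<lambda>_. y) (\<lambda>_. id)"

text \<open>For a single vertex the automorphism on it can be absorbed by moving the base back along
  it; hence the faces of an edge forget how its ends were embedded.\<close>

lemma cube_of_single:
  assumes \<tau>: "\<And>u. u \<subseteq> {j} \<Longrightarrow> \<tau> u \<in> aut \<MM>" and y: "\<tau> {j} \<circ> y = b j"
  shows "cube_of {j} b \<tau> = vert j y"
proof -
  have tj: "\<tau> {j} \<in> aut \<MM>" using \<tau> by blast
  have "vert j y = cube_of {j} b \<tau>"
    unfolding vert_def
  proof (rule cube_of_eqI[where \<sigma> = "ainv (\<tau> {j})"])
    have "ainv (\<tau> {j}) \<circ> (\<tau> {j} \<circ> y) = y" using tj by (simp add: fun_eq_iff)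
    then show "y = ainv (\<tau> {j}) \<circ> b l" if "l \<in> {j}" for l
      using that y by simp
    fix u x assume u: "u \<subseteq> {j}" and x: "x \<in> face_set b u"
    have "u = {} \<or> u = {j}" using u by (simp add: subset_singleton_iff)
    then show "ainv id (ainv (\<tau> {j}) x) = ainv (\<tau> u) x"
    proof
      assume "u = {}"
      then have "x \<in> acl0" "\<tau> {} \<in> aut \<MM>" using x \<tau>[of "{}"] by simp_all
      then show ?thesis using \<open>u = {}\<close> tj by (simp add: aut_acl0 inv_aut)
    qed simp
  qed (use \<tau> id_aut inv_aut tj in auto)
  then show ?thesis by simp
qed

lemma edge_faces:
  assumes "i < j" "x \<in> real" "y \<in> real" "b \<in> real" "c \<in> real"
  shows "face 0 (edge i x j y b c) = vert j y" "face 1 (edge i x j y b c) = vert i x"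
  unfolding edge_def face_cube_of_2[OF assms(1)]
  using assms mv(1) mv(2)[OF assms(3,5)] mv(2)[OF assms(2,4)] id_aut by (auto intro!: cube_of_single)

lemma simplex_1_support:
  assumes "f \<in> simplices \<MM> R p 1"
  obtains i j where "i < j" "spt f = {i, j}"
proof -
  have "card (spt f) = 2" using assms by (auto simp: simplices_def)
  then obtain i j where ij: "spt f = {i, j}" "i \<noteq> j" by (auto simp: card_2_iff)
  show thesis
  proof (cases "i < j")
    case True then show ?thesis using that ij by blast
  next
    case False
    then have "j < i" using ij(2) by simp
    then show ?thesis using that[of j i] ij(1) by (simp add: insert_commute)
  qed
qed

lemma simplex_2_support:
  assumes "f \<in> simplices \<MM> R p 2"
  obtains i j k where "i < j" "j < k" "spt f = {i, j, k}"
proof -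
  have c: "card (spt f) = 3" and fin: "finite (spt f)"
    using assms by (auto simp: simplices_def cube_functor_def)
  define xs where "xs = sorted_list_of_set (spt f)"
  have xs: "length xs = 3" "sorted xs" "distinct xs" "set xs = spt f" using c fin by (auto simp: xs_def)
  then obtain i j k where "xs = [i, j, k]" by (auto simp: numeral_3_eq_3 length_Suc_conv)
  then show thesis using xs that[of i j k] by auto
qed

lemma simplex_edge:
  assumes f: "f \<in> simplices \<MM> R p 1" and ij: "i < j" "spt f = {i, j}" and xy: "x \<in> real" "y \<in> real"
    and o: "obj f {i} = ac x" "obj f {j} = ac y"
  obtains \<tau>i \<tau>j where "\<tau>i \<in> aut \<MM>" "\<tau>j \<in> aut \<MM>"
    "\<And>t. t \<in> obj f {i} \<Longrightarrow> mor f {i} {i, j} t = \<tau>i t" "\<And>t. t \<in> obj f {j} \<Longrightarrow> mor f {j} {i, j} t = \<tau>j t"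
    "f = edge i x j y (\<tau>i \<circ> x) (\<tau>j \<circ> y)" "ind (\<tau>i \<circ> x) (\<tau>j \<circ> y)"
proof -
  define e where "e l = (if l = i then x else y)" for l
  obtain \<tau> where \<tau>: "\<And>u. u \<subseteq> {i, j} \<Longrightarrow> \<tau> u \<in> aut \<MM>" "\<tau> {i, j} = id"
    "\<And>u t. u \<subseteq> {i, j} \<Longrightarrow> t \<in> obj f u \<Longrightarrow> mor f u {i, j} t = \<tau> u t"
    "f = cube_of {i, j} (\<lambda>i. \<tau> {i} \<circ> e i) \<tau>"
    "indep_family R acl0 {i, j} (\<lambda>i. ac (\<tau> {i} \<circ> e i))"
  proof (rule simplex_standard_form[OF f, of e, unfolded ij(2)])
    show "e l \<in> real" if "l \<in> {i, j}" for l using xy by (simp add: e_def)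
    show "obj f {l} = ac (e l)" if "l \<in> {i, j}" for l using that o by (auto simp: e_def)
  qed blast
  have ti: "\<tau> {i} \<in> aut \<MM>" "\<tau> {j} \<in> aut \<MM>" "\<tau> {} \<in> aut \<MM>" using \<tau>(1) by auto
  have ei: "e i = x" "e j = y" using ij(1) by (auto simp: e_def)
  define b c where "b = \<tau> {i} \<circ> x" and "c = \<tau> {j} \<circ> y"
  have bc: "b \<in> real" "c \<in> real" using xy ti by (auto simp: b_def c_def real_aut)
  have agree: "ainv (mv w (\<theta> \<circ> w)) t = ainv \<theta> t" if "w \<in> real" "\<theta> \<in> aut \<MM>" "t \<in> ac (\<theta> \<circ> w)" for w \<theta> t
  proof -
    have "t \<in> \<theta> ` ac w" using that(2,3) by (simp add: ac_image)
    then obtain q where q: "q \<in> ac w" "t = \<theta> q" by blast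
    have "mv w (\<theta> \<circ> w) q = \<theta> q"
      by (rule aut_eq_on_ac[OF that(1) mv(1) that(2) _ q(1)]) (rule mv(2)[OF that(1) real_aut[OF that(1,2)]])
    then show ?thesis using q(2) that(2) mv(1) by (metis aut_inv_simps(1))
  qed
  have "edge i x j y b c = cube_of {i, j} (\<lambda>i. \<tau> {i} \<circ> e i) \<tau>"
    unfolding edge_def
  proof (rule cube_of_eqI[where \<sigma> = id])
    show "(if u = {i} then mv x b else if u = {j} then mv y c else id) \<in> aut \<MM>" for u
      using mv(1) id_aut by simp
    show "(if l = i then b else c) = id \<circ> (\<tau> {l} \<circ> e l)" if "l \<in> {i, j}" for l
      using that ei ij(1) by (auto simp: b_def c_def)
    fix u t assume u: "u \<subseteq> {i, j}" and t: "t \<in> face_set (\<lambda>i. \<tau> {i} \<circ> e i) u"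
    consider "u = {}" | "u = {i}" | "u = {j}" | "u = {i, j}" using subset_pair_cases[OF u] by blast
    then show "ainv (if u = {i} then mv x b else if u = {j} then mv y c else id) (id t) = ainv (\<tau> u) t"
    proof cases
      case 1
      then show ?thesis using t aut_acl0[OF inv_aut[OF ti(3)]] by simp
    next
      case 2
      then show ?thesis using t agree[OF xy(1) ti(1)] by (simp add: ei b_def)
    next
      case 3
      then show ?thesis using t agree[OF xy(2) ti(2)] ij(1) by (simp add: ei c_def)
    next
      case 4
      moreover have "{i, j} \<noteq> {i}" "{i, j} \<noteq> {j}" using ij(1) by auto
      ultimately show ?thesis by (simp add: \<tau>(2))
    qed
  qed (use \<tau>(1) id_aut in auto)
  then have f': "f = edge i x j y b c" using \<tau>(4) by simp
  have "{i, j} - {i} = {j}" using ij(1) by auto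
  then have "ind b c"
    using \<tau>(5) unfolding indep_family_def ind_def b_def c_def by (simp add: ei)
  then show thesis
    using that[of "\<tau> {i}" "\<tau> {j}"] ti \<tau>(3)[of "{i}"] \<tau>(3)[of "{j}"] f' unfolding b_def c_def by simp
qed

text \<open>The edge is read from its smaller to its larger vertex, inside its top face. Values are
  formal sums because the cocycles to be evaluated are the \<open>beta\<close> of this or of another
  relation.\<close>

definition hat :: "(('i \<Rightarrow> 'm) \<Rightarrow> ('i \<Rightarrow> 'm) \<Rightarrow> ('m cube \<Rightarrow>\<^sub>0 int)) \<Rightarrow> 'm cube \<Rightarrow> ('m cube \<Rightarrow>\<^sub>0 int)" where
  "hat D f = D (mor f {Min (spt f)} (spt f) \<circ> pick (obj f {Min (spt f)}))
               (mor f {Max (spt f)} (spt f) \<circ> pick (obj f {Max (spt f)}))"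

lemma hat_pair:
  "spt f = {i, j} \<Longrightarrow> i < j \<Longrightarrow>
    hat D f = D (mor f {i} {i, j} \<circ> pick (obj f {i})) (mor f {j} {i, j} \<circ> pick (obj f {j}))"
  by (simp add: hat_def)

text \<open>The correction term of \<open>edge_formula\<close> as a 0-cochain; an edge sees it
  through its boundary.\<close>

definition nu0 :: "'m cube \<Rightarrow> ('m cube \<Rightarrow>\<^sub>0 int)" where
  "nu0 g = N (the_elem (spt g)) (pick (obj g {the_elem (spt g)})) 0 a a a"

lemma comp_mor:
  assumes "\<And>t. t \<in> X \<Longrightarrow> h t = \<tau> t" "ac x = X"
  shows "h \<circ> x = \<tau> \<circ> x"
proof
  fix l
  have "x l \<in> X" using acl_superset[of "range x"] assms(2) by blast
  then show "(h \<circ> x) l = (\<tau> \<circ> x) l" using assms(1) by simp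
qed

lemma simplex_formula:
  assumes f: "f \<in> simplices \<MM> R p 1"
  shows "frag_of f - (hat beta f - frag_extend nu0 (boundary 1 (frag_of f))) \<in> S"
proof -
  obtain i j where ij: "i < j" "spt f = {i, j}" using simplex_1_support[OF f] .
  define x y where "x = pick (obj f {i})" and "y = pick (obj f {j})"
  have x: "x \<in> real" "obj f {i} = ac x" and y: "y \<in> real" "obj f {j} = ac y"
    unfolding x_def y_def using pick[OF f] ij(2) by simp_all
  obtain \<tau>i \<tau>j where \<tau>: "\<tau>i \<in> aut \<MM>" "\<tau>j \<in> aut \<MM>"
    "\<And>t. t \<in> obj f {i} \<Longrightarrow> mor f {i} {i, j} t = \<tau>i t" "\<And>t. t \<in> obj f {j} \<Longrightarrow> mor f {j} {i, j} t = \<tau>j t"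
    "f = edge i x j y (\<tau>i \<circ> x) (\<tau>j \<circ> y)" "ind (\<tau>i \<circ> x) (\<tau>j \<circ> y)"
    by (rule simplex_edge[OF f ij x(1) y(1) x(2) y(2)]) blast
  have bc: "\<tau>i \<circ> x \<in> real" "\<tau>j \<circ> y \<in> real" using x y \<tau> real_aut by auto
  have h: "hat beta f = beta (\<tau>i \<circ> x) (\<tau>j \<circ> y)"
    unfolding hat_pair[OF ij(2,1)] x_def[symmetric] y_def[symmetric]
    using comp_mor[OF \<tau>(3) x(2)[symmetric]] comp_mor[OF \<tau>(4) y(2)[symmetric]] by simp
  have "boundary 1 (frag_of f) = frag_of (vert j y) - frag_of (vert i x)"
    unfolding boundary_1_of by (subst (1 2) \<tau>(5)) (simp only: edge_faces[OF ij(1) x(1) y(1) bc])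
  moreover have "nu0 (vert l (pick X)) = N l (pick X) 0 a a a" if "ac (pick X) = X" for l X
    using that by (simp add: nu0_def vert_def)
  ultimately have b: "frag_extend nu0 (boundary 1 (frag_of f)) = N j y 0 a a a - N i x 0 a a a"
    using x(2) y(2) unfolding x_def y_def by (simp add: frag_extend_diff)
  have "frag_of f - (beta (\<tau>i \<circ> x) (\<tau>j \<circ> y) + N i x 0 a a a - N j y 0 a a a) \<in> S"
    by (subst \<tau>(5)) (rule edge_formula[OF ij(1) x(1) y(1) bc \<tau>(6)])
  then show ?thesis unfolding h b by (simp add: algebra_simps)
qed

text \<open>For a cycle the boundary term vanishes, so that its class is the value of
  \<open>beta\<close> on it.\<close>

lemma chain_formula:
  assumes "Poly_Mapping.keys c \<subseteq> simplices \<MM> R p 1"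
  shows "c - (frag_extend (hat beta) c - frag_extend nu0 (boundary 1 c)) \<in> S"
  using assms
proof (induction c rule: frag_induction)
  case zero
  then show ?case using S_rules(1) by (simp add: boundary_def)
next
  case (one f)
  then show ?case using simplex_formula by simp
next
  case (diff c d)
  show ?case using S_rules(2)[OF diff] by (simp add: frag_extend_diff boundary_diff algebra_simps)
qed

text \<open>\<open>S'\<close> is any subgroup of the formal sums, unrelated to \<open>R\<close>: in
  the comparison of two relations it consists of the boundaries of the other one.\<close>

definition inv_cocycle :: "('m cube \<Rightarrow>\<^sub>0 int) set \<Rightarrow> (('i \<Rightarrow> 'm) \<Rightarrow> ('i \<Rightarrow> 'm) \<Rightarrow> ('m cube \<Rightarrow>\<^sub>0 int)) \<Rightarrow> bool" where
  "inv_cocycle S' D \<longleftrightarrow> add_subgroup S' \<and>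
     (\<forall>b\<in>real. \<forall>c\<in>real. \<forall>\<sigma>\<in>aut \<MM>. D (\<sigma> \<circ> b) (\<sigma> \<circ> c) - D b c \<in> S') \<and>
     (\<forall>b\<in>real. \<forall>c\<in>real. \<forall>d\<in>real. D b c + D c d - D b d \<in> S')"

lemma beta_inv_cocycle: "inv_cocycle S beta"
  unfolding inv_cocycle_def using S_subgroup beta_aut beta_cocycle by blast

lemma inv_cocycleD:
  assumes "inv_cocycle S' D"
  shows "add_subgroup S'" "b \<in> real \<Longrightarrow> c \<in> real \<Longrightarrow> \<sigma> \<in> aut \<MM> \<Longrightarrow> D (\<sigma> \<circ> b) (\<sigma> \<circ> c) - D b c \<in> S'"
    "b \<in> real \<Longrightarrow> c \<in> real \<Longrightarrow> d \<in> real \<Longrightarrow> D b c + D c d - D b d \<in> S'"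
  using assms unfolding inv_cocycle_def by blast+

text \<open>Replacing the picked realizations by \<open>x\<close> and \<open>y\<close> moves each
  end inside its own vertex set; by invariance the error at an end does not depend on the
  edge.\<close>

lemma hat_change:
  assumes D: "inv_cocycle S' D" and f: "f \<in> simplices \<MM> R p 1" and ij: "i < j" "spt f = {i, j}"
    and x: "x \<in> real" "obj f {i} = ac x" and y: "y \<in> real" "obj f {j} = ac y"
  shows "D (mor f {i} {i, j} \<circ> x) (mor f {j} {i, j} \<circ> y) -
    (hat D f + D x (pick (obj f {i})) - D y (pick (obj f {j}))) \<in> S'"
proof -
  note D1 = inv_cocycleD(2)[OF D] and D2 = inv_cocycleD(3)[OF D] and S' = add_subgroupD[OF inv_cocycleD(1)[OF D]]
  define px py where "px = pick (obj f {i})" and "py = pick (obj f {j})"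
  have px: "px \<in> real" "obj f {i} = ac px" and py: "py \<in> real" "obj f {j} = ac py"
    unfolding px_def py_def using pick[OF f] ij(2) by simp_all
  obtain \<tau>i \<tau>j where \<tau>: "\<tau>i \<in> aut \<MM>" "\<tau>j \<in> aut \<MM>"
    "\<And>t. t \<in> obj f {i} \<Longrightarrow> mor f {i} {i, j} t = \<tau>i t" "\<And>t. t \<in> obj f {j} \<Longrightarrow> mor f {j} {i, j} t = \<tau>j t"
    by (rule simplex_edge[OF f ij x(1) y(1) x(2) y(2)]) blast
  have h: "hat D f = D (\<tau>i \<circ> px) (\<tau>j \<circ> py)"
    unfolding hat_pair[OF ij(2,1)] px_def[symmetric] py_def[symmetric]
    using comp_mor[OF \<tau>(3) px(2)[symmetric]] comp_mor[OF \<tau>(4) py(2)[symmetric]] by simp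
  have m: "mor f {i} {i, j} \<circ> x = \<tau>i \<circ> x" "mor f {j} {i, j} \<circ> y = \<tau>j \<circ> y"
    using comp_mor[OF \<tau>(3) x(2)[symmetric]] comp_mor[OF \<tau>(4) y(2)[symmetric]] by simp_all
  note r = x(1) y(1) px(1) py(1) real_aut[OF x(1) \<tau>(1)] real_aut[OF px(1) \<tau>(1)] real_aut[OF y(1) \<tau>(2)] real_aut[OF py(1) \<tau>(2)]
  have 1: "D (\<tau>i \<circ> x) (\<tau>i \<circ> px) + D (\<tau>i \<circ> px) (\<tau>j \<circ> py) - D (\<tau>i \<circ> x) (\<tau>j \<circ> py) \<in> S'" by (rule D2[OF r(5,6,8)])
  have 2: "D (\<tau>i \<circ> x) (\<tau>j \<circ> y) + D (\<tau>j \<circ> y) (\<tau>j \<circ> py) - D (\<tau>i \<circ> x) (\<tau>j \<circ> py) \<in> S'" by (rule D2[OF r(5,7,8)])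
  have 3: "D (\<tau>i \<circ> x) (\<tau>i \<circ> px) - D x px \<in> S'" by (rule D1[OF r(1,3) \<tau>(1)])
  have 4: "D (\<tau>j \<circ> y) (\<tau>j \<circ> py) - D y py \<in> S'" by (rule D1[OF r(2,4) \<tau>(2)])
  have "D (\<tau>i \<circ> x) (\<tau>j \<circ> y) - (hat D f + D x px - D y py) =
    (D (\<tau>i \<circ> x) (\<tau>j \<circ> y) + D (\<tau>j \<circ> y) (\<tau>j \<circ> py) - D (\<tau>i \<circ> x) (\<tau>j \<circ> py))
    - (D (\<tau>i \<circ> x) (\<tau>i \<circ> px) + D (\<tau>i \<circ> px) (\<tau>j \<circ> py) - D (\<tau>i \<circ> x) (\<tau>j \<circ> py))
    + (D (\<tau>i \<circ> x) (\<tau>i \<circ> px) - D x px) - (D (\<tau>j \<circ> y) (\<tau>j \<circ> py) - D y py)"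
    unfolding h by (simp add: algebra_simps)
  then show ?thesis unfolding m px_def[symmetric] py_def[symmetric] using 1 2 3 4 by (simp only: S')
qed

text \<open>A face of a triangle has its own top, reached from that of the triangle by the inverse
  of \<open>\<tau> {l, m}\<close>; invariance removes this automorphism.\<close>

lemma hat_face:
  assumes D: "inv_cocycle S' D" and lm: "l < m" "{l, m} \<subseteq> s"
    and \<tau>: "\<And>u. u \<subseteq> s \<Longrightarrow> \<tau> u \<in> aut \<MM>" and b: "\<And>i. i \<in> s \<Longrightarrow> b i = \<tau> {i} \<circ> e i" and e: "\<And>i. i \<in> s \<Longrightarrow> e i \<in> real"
    and pe: "\<And>i. i \<in> s \<Longrightarrow> pick (ac (e i)) = e i"
  shows "hat D (cube_of {l, m} b \<tau>) - D (b l) (b m) \<in> S'"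
proof -
  define \<theta> where "\<theta> = ainv (\<tau> {l, m})"
  have \<theta>: "\<theta> \<in> aut \<MM>" unfolding \<theta>_def using \<tau> lm(2) by (intro inv_aut) blast
  have o: "obj (cube_of {l, m} b \<tau>) {i} = ac (e i)" and mo: "mor (cube_of {l, m} b \<tau>) {i} {l, m} \<circ> e i = \<theta> \<circ> b i" and br: "b i \<in> real"
    if i: "i \<in> {l, m}" for i
  proof -
    have i_s: "i \<in> s" "{i} \<subseteq> s" "{i} \<subseteq> {l, m}" using i lm(2) by auto
    have t: "\<tau> {i} \<in> aut \<MM>" using \<tau> i_s(2) by blast
    have bi: "ac (b i) = \<tau> {i} ` ac (e i)" unfolding b[OF i_s(1)] using ac_image[OF t] by simp
    have fs: "ainv (\<tau> {i}) ` face_set b {i} = ac (e i)"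
      unfolding face_set_single bi using t by (simp add: image_image)
    show "obj (cube_of {l, m} b \<tau>) {i} = ac (e i)" using i_s(3) fs by simp
    have "mor (cube_of {l, m} b \<tau>) {i} {l, m} = (\<lambda>x\<in>ac (e i). \<theta> (\<tau> {i} x))"
      using i_s(3) fs by (simp add: \<theta>_def)
    then have "mor (cube_of {l, m} b \<tau>) {i} {l, m} \<circ> e i = (\<theta> \<circ> \<tau> {i}) \<circ> e i"
      by (intro comp_mor[where X = "ac (e i)"]) simp_all
    then show "mor (cube_of {l, m} b \<tau>) {i} {l, m} \<circ> e i = \<theta> \<circ> b i" unfolding b[OF i_s(1)] by (simp add: comp_assoc)
    show "b i \<in> real" unfolding b[OF i_s(1)] using e[OF i_s(1)] t by (rule real_aut)
  qed
  have s: "l \<in> s" "m \<in> s" using lm(2) by auto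
  have "hat D (cube_of {l, m} b \<tau>) = D (\<theta> \<circ> b l) (\<theta> \<circ> b m)"
    using hat_pair[of "cube_of {l, m} b \<tau>" l m D] lm(1) o mo pe s by simp
  then show ?thesis using inv_cocycleD(2)[OF D br br \<theta>, of l m] by simp
qed

text \<open>Inside the top face of a triangle the three edges join the same three realizations, so
  the cocycle identity kills the alternating sum.\<close>

lemma hat_boundary:
  assumes D: "inv_cocycle S' D" and c: "c \<in> S"
  shows "frag_extend (hat D) c \<in> S'"
proof -
  note S' = add_subgroupD[OF inv_cocycleD(1)[OF D]]
  have tri: "frag_extend (hat D) (boundary 2 (frag_of g)) \<in> S'" if g: "g \<in> simplices \<MM> R p 2" for g
  proof -
    obtain i j k where ijk: "i < j" "j < k" "spt g = {i, j, k}" using simplex_2_support[OF g] .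
    define e where "e l = pick (obj g {l})" for l
    have e: "e l \<in> real" "obj g {l} = ac (e l)" if "l \<in> {i, j, k}" for l
      using pick[OF g, of l] that ijk(3) by (simp_all add: e_def)
    obtain \<tau> where \<tau>: "\<And>u. u \<subseteq> {i, j, k} \<Longrightarrow> \<tau> u \<in> aut \<MM>"
      "g = cube_of {i, j, k} (\<lambda>i. \<tau> {i} \<circ> e i) \<tau>"
      by (rule simplex_standard_form[OF g, of e, unfolded ijk(3)]) (use e in blast)+
    define b where "b l = \<tau> {l} \<circ> e l" for l
    have pe: "pick (ac (e l)) = e l" if "l \<in> {i, j, k}" for l using e(2)[OF that] by (simp add: e_def)
    have br: "b l \<in> real" if "l \<in> {i, j, k}" for l
      unfolding b_def using e(1)[OF that] \<tau>(1)[of "{l}"] that by (intro real_aut) auto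
    have h: "hat D (cube_of {l, m} b \<tau>) - D (b l) (b m) \<in> S'" if "l < m" "{l, m} \<subseteq> {i, j, k}" for l m
      by (rule hat_face[OF D that \<tau>(1), where b = b and e = e]) (use e pe in \<open>auto simp: b_def\<close>)
    have *: "boundary 2 (frag_of g) = frag_of (cube_of {j, k} b \<tau>) - frag_of (cube_of {i, k} b \<tau>) + frag_of (cube_of {i, j} b \<tau>)"
      unfolding \<tau>(2) boundary_triangle[OF ijk(1,2)] b_def ..
    have 1: "hat D (cube_of {j, k} b \<tau>) - D (b j) (b k) \<in> S'" using ijk by (intro h) auto
    have 2: "hat D (cube_of {i, k} b \<tau>) - D (b i) (b k) \<in> S'" using ijk by (intro h) auto
    have 3: "hat D (cube_of {i, j} b \<tau>) - D (b i) (b j) \<in> S'" using ijk by (intro h) auto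
    have 4: "D (b i) (b j) + D (b j) (b k) - D (b i) (b k) \<in> S'"
      by (rule inv_cocycleD(3)[OF D]) (use br in auto)
    have "frag_extend (hat D) (boundary 2 (frag_of g)) =
      (hat D (cube_of {j, k} b \<tau>) - D (b j) (b k)) - (hat D (cube_of {i, k} b \<tau>) - D (b i) (b k))
      + (hat D (cube_of {i, j} b \<tau>) - D (b i) (b j)) + (D (b i) (b j) + D (b j) (b k) - D (b i) (b k))"
      unfolding * by (simp add: frag_extend_add frag_extend_diff)
    then show ?thesis using 1 2 3 4 by (simp only: S')
  qed
  obtain d where d: "c = boundary 2 d" "Poly_Mapping.keys d \<subseteq> simplices \<MM> R p 2"
    using c unfolding S_alt by blast
  have "frag_extend (hat D) (boundary 2 d) \<in> S'"
    using d(2)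
  proof (induction d rule: frag_induction)
    case zero
    then show ?case using S'(1) by (simp add: boundary_def)
  next
    case (one g)
    then show ?case by (rule tri)
  next
    case (diff x y)
    then show ?case using S'(2) by (simp add: boundary_diff frag_extend_diff)
  qed
  then show ?thesis by (simp add: d(1))
qed

section \<open>Shells\<close>

text \<open>Each vertex error occurs twice around the shell, with opposite signs. What remains
  telescopes along \<open>b, a1, a2, c\<close>, where the last piece is traversed backwards.\<close>

lemma shell_hat:
  assumes D: "inv_cocycle S' D" and s: "shell1 \<MM> R p f12 f02 f01" and ep: "endpoint_pair \<MM> p f12 f02 f01 b c"
  shows "frag_extend (hat D) (shell_chain f12 f02 f01) - D b c \<in> S'" "b \<in> real" "c \<in> real"
proof -
  note D1 = inv_cocycleD(2)[OF D] and D2 = inv_cocycleD(3)[OF D] and S' = add_subgroupD[OF inv_cocycleD(1)[OF D]]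
  have f: "f12 \<in> simplices \<MM> R p 1" "f02 \<in> simplices \<MM> R p 1" "f01 \<in> simplices \<MM> R p 1"
    using s by (auto simp: shell1_def)
  obtain a1 a2 n0 n1 n2 e0 e1 e2 where r: "{b, a1, a2, c} \<subseteq> real" and n: "n0 < n1" "n1 < n2"
    and spt: "spt f12 = {n1, n2}" "spt f02 = {n0, n2}" "spt f01 = {n0, n1}" and e: "{e0, e1, e2} \<subseteq> real"
    and o: "ac e0 = obj f01 {n0}" "ac e0 = obj f02 {n0}" "ac e1 = obj f01 {n1}" "ac e1 = obj f12 {n1}"
      "ac e2 = obj f12 {n2}" "ac e2 = obj f02 {n2}"
    and t: "same_type_pair \<MM> b a1 (mor f01 {n0} {n0, n1} \<circ> e0) (mor f01 {n1} {n0, n1} \<circ> e1)"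
      "same_type_pair \<MM> a1 a2 (mor f12 {n1} {n1, n2} \<circ> e1) (mor f12 {n2} {n1, n2} \<circ> e2)"
      "same_type_pair \<MM> c a2 (mor f02 {n0} {n0, n2} \<circ> e0) (mor f02 {n2} {n0, n2} \<circ> e2)"
    using ep unfolding endpoint_pair_def shell_rep_def by (elim exE conjE) blast
  have r': "b \<in> real" "a1 \<in> real" "a2 \<in> real" "c \<in> real" "e0 \<in> real" "e1 \<in> real" "e2 \<in> real" using r e by auto
  then show "b \<in> real" "c \<in> real" by auto
  have st: "D v' w' - D v w \<in> S'" if vw: "v \<in> real" "w \<in> real" and st: "same_type_pair \<MM> v w v' w'" for v w v' w'
  proof -
    obtain \<sigma> where "\<sigma> \<in> aut \<MM>" "v' = \<sigma> \<circ> v" "w' = \<sigma> \<circ> w" using st unfolding same_type_pair_iff by blast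
    then show ?thesis using D1[OF vw] by simp
  qed
  have n02: "n0 < n2" using n by simp
  define p0 p1 p2 where "p0 = D e0 (pick (ac e0))" and "p1 = D e1 (pick (ac e1))" and "p2 = D e2 (pick (ac e2))"
  define m01 m12 m02 where "m01 = D (mor f01 {n0} {n0, n1} \<circ> e0) (mor f01 {n1} {n0, n1} \<circ> e1)"
    and "m12 = D (mor f12 {n1} {n1, n2} \<circ> e1) (mor f12 {n2} {n1, n2} \<circ> e2)"
    and "m02 = D (mor f02 {n0} {n0, n2} \<circ> e0) (mor f02 {n2} {n0, n2} \<circ> e2)"
  have 1: "m01 - (hat D f01 + p0 - p1) \<in> S'"
    using hat_change[OF D f(3) n(1) spt(3) r'(5) o(1)[symmetric] r'(6) o(3)[symmetric]]
    unfolding m01_def p0_def p1_def o(1)[symmetric] o(3)[symmetric] .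
  have 2: "m12 - (hat D f12 + p1 - p2) \<in> S'"
    using hat_change[OF D f(1) n(2) spt(1) r'(6) o(4)[symmetric] r'(7) o(5)[symmetric]]
    unfolding m12_def p1_def p2_def o(4)[symmetric] o(5)[symmetric] .
  have 3: "m02 - (hat D f02 + p0 - p2) \<in> S'"
    using hat_change[OF D f(2) n02 spt(2) r'(5) o(2)[symmetric] r'(7) o(6)[symmetric]]
    unfolding m02_def p0_def p2_def o(2)[symmetric] o(6)[symmetric] .
  have 4: "m01 - D b a1 \<in> S'" unfolding m01_def by (rule st[OF r'(1,2) t(1)])
  have 5: "m12 - D a1 a2 \<in> S'" unfolding m12_def by (rule st[OF r'(2,3) t(2)])
  have 6: "m02 - D c a2 \<in> S'" unfolding m02_def by (rule st[OF r'(4,3) t(3)])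
  have 7: "D b a1 + D a1 a2 - D b a2 \<in> S'" by (rule D2[OF r'(1,2,3)])
  have 8: "D b c + D c a2 - D b a2 \<in> S'" by (rule D2[OF r'(1,4,3)])
  have eq: "frag_extend (hat D) (shell_chain f12 f02 f01) - D b c =
    (- (m01 - (hat D f01 + p0 - p1))) - (m12 - (hat D f12 + p1 - p2)) + (m02 - (hat D f02 + p0 - p2))
    + (m01 - D b a1) + (m12 - D a1 a2) - (m02 - D c a2) + (D b a1 + D a1 a2 - D b a2) - (D b c + D c a2 - D b a2)"
    unfolding shell_chain_def by (simp add: frag_extend_add frag_extend_diff)
  show "frag_extend (hat D) (shell_chain f12 f02 f01) - D b c \<in> S'"
    unfolding eq using 1 2 3 4 5 6 7 8 by (simp only: S')
qed

lemma shell_cycle: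
  assumes "shell1 \<MM> R p f12 f02 f01"
  shows "boundary 1 (shell_chain f12 f02 f01) = 0" "Poly_Mapping.keys (shell_chain f12 f02 f01) \<subseteq> simplices \<MM> R p 1"
proof -
  have *: "{f12, f02, f01} \<subseteq> simplices \<MM> R p 1" "face 0 f02 = face 0 f12" "face 0 f01 = face 1 f12" "face 1 f01 = face 1 f02"
    using assms by (auto simp: shell1_def)
  show "boundary 1 (shell_chain f12 f02 f01) = 0"
    unfolding shell_chain_def boundary_add boundary_diff boundary_1_of using * by simp
  have "Poly_Mapping.keys (shell_chain f12 f02 f01) \<subseteq> {f12, f02, f01}"
    unfolding shell_chain_def
    using keys_add[of "frag_of f12 - frag_of f02" "frag_of f01"] keys_diff[of "frag_of f12" "frag_of f02"] by auto
  with *(1) show "Poly_Mapping.keys (shell_chain f12 f02 f01) \<subseteq> simplices \<MM> R p 1" by blast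
qed

text \<open>A shell is a cycle, so its class is its \<open>beta\<close> value, which
  \<open>shell_hat\<close> computes from the end points alone; this makes the bracket well
  defined.\<close>

lemma shell_class:
  assumes s: "shell1 \<MM> R p f12 f02 f01" and ep: "endpoint_pair \<MM> p f12 f02 f01 b c"
  shows "shell_chain f12 f02 f01 - beta b c \<in> S"
  using S_rules(4)[OF chain_formula[OF shell_cycle(2)[OF s]] shell_hat(1)[OF beta_inv_cocycle s ep]]
  by (simp add: shell_cycle(1)[OF s])

text \<open>\<open>b\<close> and \<open>c\<close> may be dependent; the detour through
  \<open>a1\<close> and \<open>a2\<close> uses only independent pairs.\<close>

lemma shell_exists:
  assumes b: "b \<in> real" and c: "c \<in> real"
  obtains f12 f02 f01 where "shell1 \<MM> R p f12 f02 f01" "spt f12 \<union> spt f02 \<union> spt f01 = {0, 1, 2}"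
    "endpoint_pair \<MM> p f12 f02 f01 b c"
proof -
  \<comment> \<open>Only independence from \<open>b\<close> is wanted, hence the repeated
    argument.\<close>
  obtain a1 where a1: "a1 \<in> real" "ind2 a1 b b" by (rule independent_realization2)
  define X where "X = ac b \<union> ac c \<union> ac a1"
  have X: "small X" unfolding X_def by (intro small_Un small_ac)
  then obtain a2 where a2: "a2 \<in> real" "R (ac a2) acl0 X" by (rule independent_realization)
  have i: "ind b a1" "ind a1 a2" "ind c a2"
    using ind2_ind[OF a1(2)] ind2_ind[OF ind2_mono[OF a2(2) _ X, of a1 c]] by (auto simp: X_def)
  have n: "(0::nat) < 1" "(1::nat) < 2" "(0::nat) < 2" by auto
  define f01 f12 f02 where "f01 = edge 0 a 1 a b a1" and "f12 = edge 1 a 2 a a1 a2" and "f02 = edge 0 a 2 a c a2"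
  have f: "f01 \<in> simplices \<MM> R p 1" "f12 \<in> simplices \<MM> R p 1" "f02 \<in> simplices \<MM> R p 1"
    unfolding f01_def f12_def f02_def using b c a1 a2 i n by (auto intro!: edge_simplex)
  have spt: "spt f12 = {1, 2}" "spt f02 = {0, 2}" "spt f01 = {0, 1}" by (auto simp: f01_def f12_def f02_def edge_def)
  have mv_ac: "ainv (mv a v) ` ac v = ac a" if "v \<in> real" for v
    using ac_image[OF mv(1)[of a v], of a] mv(2)[OF a_real that] mv(1)[of a v]
    by (metis (no_types, lifting) aut_inv_simps(1) image_comp image_ident image_cong comp_apply)
  have ob: "obj (edge l a m a v w) {l} = ac a" "obj (edge l a m a v w) {m} = ac a"
    and mo: "mor (edge l a m a v w) {l} {l, m} \<circ> a = v" "mor (edge l a m a v w) {m} {l, m} \<circ> a = w"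
    if lm: "l < m" and vw: "v \<in> real" "w \<in> real" for l m v w
  proof -
    have ne: "{l, m} \<noteq> {l}" "{l, m} \<noteq> {m}" "{m} \<noteq> {l}" "m \<noteq> l" using lm by auto
    show "obj (edge l a m a v w) {l} = ac a" "obj (edge l a m a v w) {m} = ac a"
      unfolding edge_def using ne mv_ac vw by simp_all
    have "mor (edge l a m a v w) {l} {l, m} = (\<lambda>x\<in>ac a. mv a v x)" "mor (edge l a m a v w) {m} {l, m} = (\<lambda>x\<in>ac a. mv a w x)"
      unfolding edge_def using ne mv_ac vw by simp_all
    then have "mor (edge l a m a v w) {l} {l, m} \<circ> a = mv a v \<circ> a" "mor (edge l a m a v w) {m} {l, m} \<circ> a = mv a w \<circ> a"
      by (auto intro!: comp_mor[where X = "ac a"])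
    then show "mor (edge l a m a v w) {l} {l, m} \<circ> a = v" "mor (edge l a m a v w) {m} {l, m} \<circ> a = w"
      using mv(2)[OF a_real] vw by simp_all
  qed
  have refl: "same_type_pair \<MM> v w v w" for v w :: "'i \<Rightarrow> 'm" by (simp add: same_type_pair_def)
  have "shell1 \<MM> R p f12 f02 f01"
    unfolding shell1_def using f unfolding f01_def f12_def f02_def
    by (simp add: edge_faces a_real b c a1(1) a2(1))
  moreover have "shell_rep \<MM> p f12 f02 f01 b a1 a2 c"
    unfolding shell_rep_def
    apply (rule conjI)
    subgoal using b c a1 a2 by simp
    apply (rule exI[of _ 0], rule exI[of _ 1], rule exI[of _ 2], rule exI[of _ a], rule exI[of _ a], rule exI[of _ a])
    apply (intro conjI)
    apply (simp_all only: spt n a_real refl insert_subset empty_subsetI simp_thms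
        ob[OF n(1) b a1(1), folded f01_def] ob[OF n(2) a1(1) a2(1), folded f12_def] ob[OF n(3) c a2(1), folded f02_def]
        mo[OF n(1) b a1(1), folded f01_def] mo[OF n(2) a1(1) a2(1), folded f12_def] mo[OF n(3) c a2(1), folded f02_def])
    done
  then have "endpoint_pair \<MM> p f12 f02 f01 b c" unfolding endpoint_pair_def by blast
  moreover have "spt f12 \<union> spt f02 \<union> spt f01 = {0, 1, 2}" unfolding spt by auto
  ultimately show thesis using that by blast
qed

section \<open>Brackets as cosets of the boundaries\<close>

definition cos :: "('m cube \<Rightarrow>\<^sub>0 int) \<Rightarrow> ('m cube \<Rightarrow>\<^sub>0 int) set" where
  "cos x = boundaries \<MM> R p 1 #>\<^bsub>cycles \<MM> R p 1\<^esub> x"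

lemma cos_alt: "cos x = (\<lambda>h. h + x) ` S"
  unfolding cos_def r_coset_def by (auto simp: cycles_def chains_def free_Abelian_group_def)

lemma cos_eq_iff: "cos x = cos y \<longleftrightarrow> x - y \<in> S"
proof
  assume "cos x = cos y"
  moreover have "0 + x \<in> cos x" unfolding cos_alt using S_rules(1) by blast
  ultimately obtain h where "h \<in> S" "0 + x = h + y" unfolding cos_alt by blast
  then show "x - y \<in> S" by (simp add: algebra_simps)
next
  assume xy: "x - y \<in> S"
  have "h + x \<in> cos y" if "h \<in> S" for h
    unfolding cos_alt by (rule image_eqI[of _ _ "h + (x - y)"]) (simp_all add: S_rules(4) that xy)
  moreover have "h + y \<in> cos x" if "h \<in> S" for h
    unfolding cos_alt by (rule image_eqI[of _ _ "h - (x - y)"]) (simp_all add: S_rules(2) that xy)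
  ultimately show "cos x = cos y" unfolding cos_alt[of x] cos_alt[of y] by (metis (no_types, lifting) cos_alt image_subset_iff subset_antisym)
qed

theorem bracket_eq:
  assumes "b \<in> real" "c \<in> real"
  shows "bracket \<MM> R p b c = cos (beta b c)"
  unfolding bracket_def
proof (rule the_equality)
  obtain f12 f02 f01 where *: "shell1 \<MM> R p f12 f02 f01" "spt f12 \<union> spt f02 \<union> spt f01 = {0, 1, 2}"
    "endpoint_pair \<MM> p f12 f02 f01 b c" using shell_exists[OF assms] .
  have "cos (beta b c) = cos (shell_chain f12 f02 f01)"
    using shell_class[OF *(1,3)] cos_eq_iff by metis
  with * show "\<exists>f12 f02 f01. shell1 \<MM> R p f12 f02 f01 \<and> spt f12 \<union> spt f02 \<union> spt f01 = {0, 1, 2} \<and>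
      endpoint_pair \<MM> p f12 f02 f01 b c \<and> cos (beta b c) = S #>\<^bsub>cycles \<MM> R p 1\<^esub> shell_chain f12 f02 f01"
    unfolding cos_def by blast
next
  fix Z assume "\<exists>f12 f02 f01. shell1 \<MM> R p f12 f02 f01 \<and> spt f12 \<union> spt f02 \<union> spt f01 = {0, 1, 2} \<and>
      endpoint_pair \<MM> p f12 f02 f01 b c \<and> Z = S #>\<^bsub>cycles \<MM> R p 1\<^esub> shell_chain f12 f02 f01"
  then obtain f12 f02 f01 where *: "shell1 \<MM> R p f12 f02 f01" "endpoint_pair \<MM> p f12 f02 f01 b c"
    "Z = cos (shell_chain f12 f02 f01)" unfolding cos_def by blast
  then show "Z = cos (beta b c)" using shell_class[OF *(1,2)] cos_eq_iff by metis
qed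

end

section \<open>Automorphism groups and Lascar groups\<close>

lemma factor_hom:
  assumes h: "group_hom G H h" and N: "N \<lhd> G" and triv: "\<And>n. n \<in> N \<Longrightarrow> h n = \<one>\<^bsub>H\<^esub>"
  defines "F \<equiv> \<lambda>Z. the_elem (h ` Z)"
  shows "\<And>g. g \<in> carrier G \<Longrightarrow> F (N #>\<^bsub>G\<^esub> g) = h g"
    and "group_hom (G Mod N) H F"
    and "h ` carrier G = carrier H \<Longrightarrow> F \<in> epi (G Mod N) H"
proof -
  interpret h: group_hom G H h by fact
  interpret N: normal N G by fact
  show val: "F (N #>\<^bsub>G\<^esub> g) = h g" if g: "g \<in> carrier G" for g
  proof -
    have "h ` (N #>\<^bsub>G\<^esub> g) = {h g}"
    proof
      show "h ` (N #>\<^bsub>G\<^esub> g) \<subseteq> {h g}"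
      proof
        fix y assume "y \<in> h ` (N #>\<^bsub>G\<^esub> g)"
        then obtain n where n: "n \<in> N" "y = h (n \<otimes>\<^bsub>G\<^esub> g)" by (auto simp: r_coset_def)
        then show "y \<in> {h g}" using triv[OF n(1)] g N.mem_carrier[OF n(1)] by simp
      qed
      have "g \<in> N #>\<^bsub>G\<^esub> g" by (rule h.G.rcos_self[OF g N.subgroup_axioms])
      then show "{h g} \<subseteq> h ` (N #>\<^bsub>G\<^esub> g)" by blast
    qed
    then show ?thesis by (simp add: F_def)
  qed
  have car: "\<exists>g\<in>carrier G. Z = N #>\<^bsub>G\<^esub> g" if "Z \<in> carrier (G Mod N)" for Z
    using that by (auto simp: FactGroup_def RCOSETS_def)
  have hom: "F \<in> hom (G Mod N) H"
  proof (rule homI)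
    show "F Z \<in> carrier H" if "Z \<in> carrier (G Mod N)" for Z
      using car[OF that] val by auto
    fix Y Z assume "Y \<in> carrier (G Mod N)" "Z \<in> carrier (G Mod N)"
    then obtain g g' where g: "g \<in> carrier G" "Y = N #>\<^bsub>G\<^esub> g" "g' \<in> carrier G" "Z = N #>\<^bsub>G\<^esub> g'" using car by metis
    have "Y \<otimes>\<^bsub>G Mod N\<^esub> Z = N #>\<^bsub>G\<^esub> (g \<otimes>\<^bsub>G\<^esub> g')"
      using g N.rcos_sum by (simp add: FactGroup_def)
    then show "F (Y \<otimes>\<^bsub>G Mod N\<^esub> Z) = F Y \<otimes>\<^bsub>H\<^esub> F Z" using g val by simp
  qed
  then show "group_hom (G Mod N) H F"
    using N.factorgroup_is_group h.H.group_axioms by (simp add: group_hom_def group_hom_axioms_def)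
  show "F \<in> epi (G Mod N) H" if onto: "h ` carrier G = carrier H"
    unfolding epi_iff_subset
  proof (intro conjI hom subsetI)
    fix y assume "y \<in> carrier H"
    then obtain g where g: "g \<in> carrier G" "y = h g" using onto by blast
    have "N #>\<^bsub>G\<^esub> g \<in> carrier (G Mod N)" using g(1) by (auto simp: FactGroup_def RCOSETS_def)
    then show "y \<in> F ` carrier (G Mod N)" using val[OF g(1)] g(2) by (metis image_eqI)
  qed
qed

section \<open>The automorphism group and its Lascar subgroup\<close>

context monster_model
begin

lemma Aut_simps: "carrier (Aut \<MM>) = aut \<MM>" "\<one>\<^bsub>Aut \<MM>\<^esub> = id"
  by (auto simp: Aut_def BijGroup_def)

lemma Aut_mult: "\<sigma> \<in> aut \<MM> \<Longrightarrow> \<tau> \<in> aut \<MM> \<Longrightarrow> \<sigma> \<otimes>\<^bsub>Aut \<MM>\<^esub> \<tau> = \<sigma> \<circ> \<tau>"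
proof -
  assume "\<sigma> \<in> aut \<MM>" "\<tau> \<in> aut \<MM>"
  then have "\<sigma> \<in> Bij UNIV" "\<tau> \<in> Bij UNIV" using autD(1) by (auto simp: Bij_def)
  then show ?thesis by (simp add: Aut_def BijGroup_def compose_def restrict_def o_def)
qed

lemma group_Aut: "group (Aut \<MM>)"
proof (rule groupI; unfold Aut_simps)
  show "\<sigma> \<otimes>\<^bsub>Aut \<MM>\<^esub> \<tau> \<in> aut \<MM>" if "\<sigma> \<in> aut \<MM>" "\<tau> \<in> aut \<MM>" for \<sigma> \<tau>
    using that by (simp add: Aut_mult comp_aut)
  show "\<sigma> \<otimes>\<^bsub>Aut \<MM>\<^esub> \<tau> \<otimes>\<^bsub>Aut \<MM>\<^esub> \<rho> = \<sigma> \<otimes>\<^bsub>Aut \<MM>\<^esub> (\<tau> \<otimes>\<^bsub>Aut \<MM>\<^esub> \<rho>)"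
    if "\<sigma> \<in> aut \<MM>" "\<tau> \<in> aut \<MM>" "\<rho> \<in> aut \<MM>" for \<sigma> \<tau> \<rho>
    using that by (simp add: Aut_mult comp_aut comp_assoc)
  show "id \<in> aut \<MM>" by (rule id_aut)
  show "id \<otimes>\<^bsub>Aut \<MM>\<^esub> \<sigma> = \<sigma>" if "\<sigma> \<in> aut \<MM>" for \<sigma> using that by (simp add: Aut_mult id_aut)
  show "\<exists>\<tau>\<in>aut \<MM>. \<tau> \<otimes>\<^bsub>Aut \<MM>\<^esub> \<sigma> = id" if "\<sigma> \<in> aut \<MM>" for \<sigma>
    using that inv_aut by (intro bexI[of _ "ainv \<sigma>"]) (simp_all add: Aut_mult)
qed

lemma Aut_inv: "\<sigma> \<in> aut \<MM> \<Longrightarrow> m_inv (Aut \<MM>) \<sigma> = ainv \<sigma>"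
  using group.inv_equality[OF group_Aut, of "ainv \<sigma>" \<sigma>] by (simp add: Aut_simps Aut_mult inv_aut)

text \<open>It is enough to conjugate generators: if \<open>h\<close> fixes the model
  \<open>U\<close>, its conjugate by \<open>g\<close> fixes the image of \<open>U\<close> under
  \<open>g\<close>, which is again a small elementary submodel.\<close>

lemma Autf_normal: "Autf \<MM> \<lhd> Aut \<MM>"
  unfolding Autf_def
proof (rule group.normal_generateI[OF group_Aut])
  show "{\<sigma> \<in> aut \<MM>. \<exists>U. small U \<and> elem_substructure \<MM> U \<and> (\<forall>x\<in>U. \<sigma> x = x)} \<subseteq> carrier (Aut \<MM>)"
    by (auto simp: Aut_simps)
  fix h g assume h: "h \<in> {\<sigma> \<in> aut \<MM>. \<exists>U. small U \<and> elem_substructure \<MM> U \<and> (\<forall>x\<in>U. \<sigma> x = x)}"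
    and "g \<in> carrier (Aut \<MM>)"
  then have g: "g \<in> aut \<MM>" by (simp add: Aut_simps)
  obtain U where U: "h \<in> aut \<MM>" "small U" "elem_substructure \<MM> U" "\<forall>x\<in>U. h x = x" using h by blast
  have eq: "g \<otimes>\<^bsub>Aut \<MM>\<^esub> h \<otimes>\<^bsub>Aut \<MM>\<^esub> m_inv (Aut \<MM>) g = g \<circ> h \<circ> ainv g"
    using g U by (simp add: Aut_inv Aut_mult comp_aut inv_aut)
  have "elem_substructure \<MM> (g ` U)"
  proof -
    note U3 = U(3)[unfolded elem_substructure_def]
    have 1: "\<exists>x\<in>U. srt \<MM> x = s" for s using U3[THEN conjunct1] by simp
    have 2: "fI \<MM> f xs \<in> U" if "set xs \<subseteq> U" "map (srt \<MM>) xs = fdom \<MM> f" for f xs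
      using U3[THEN conjunct2, THEN conjunct1] that by simp
    have 3: "sat \<MM> U v \<phi> = sat \<MM> UNIV v \<phi>" if "fm_ok \<MM> \<phi>" "valuation \<MM> U v" for v \<phi>
      using U3[THEN conjunct2, THEN conjunct2] that by simp
    have vback: "valuation \<MM> U (\<lambda>x. ainv g (v x))" if v: "valuation \<MM> (g ` U) v" for v
      unfolding valuation_def
    proof (intro allI conjI)
      fix x
      have "v x \<in> g ` U" using v unfolding valuation_def by blast
      then obtain y where y: "y \<in> U" "v x = g y" by blast
      then show "ainv g (v x) \<in> U" using g by simp
      show "srt \<MM> (ainv g (v x)) = fst x" using v autD(2)[OF inv_aut[OF g]] unfolding valuation_def by simp
    qed
    \<comment> \<open>\<open>aut_sat\<close> covers satisfaction in the whole model; here the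
      quantifiers range over \<open>U\<close> and over its image.\<close>
    have satg: "sat \<MM> (g ` U) (\<lambda>x. g (v x)) \<phi> = sat \<MM> U v \<phi>" if "fm_ok \<MM> \<phi>" "valuation \<MM> U v" for v \<phi>
      using that
    proof (induction \<phi> arbitrary: v)
      case (Eq t u)
      have v: "valuation \<MM> UNIV v" using Eq.prems(2) by (auto simp: valuation_def)
      have "tm_ok \<MM> t" "tm_ok \<MM> u" using Eq.prems by auto
      then show ?case
        using aut_tm_val[OF g v, of t] aut_tm_val[OF g v, of u] autD(1)[OF g] by (simp add: bij_def inj_eq)
    next
      case (Rel r ts)
      have v: "valuation \<MM> UNIV v" using Rel.prems(2) by (auto simp: valuation_def)
      then show ?case using aut_sat[OF g Rel.prems(1) v] by simp
    next
      case (Ex x \<phi>)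
      have "sat \<MM> (g ` U) ((\<lambda>z. g (v z))(x := g y)) \<phi> = sat \<MM> U (v(x := y)) \<phi>" if y: "srt \<MM> y = fst x" "y \<in> U" for y
      proof -
        have e: "(\<lambda>z. g (v z))(x := g y) = (\<lambda>z. g ((v(x := y)) z))" by auto
        have ok: "fm_ok \<MM> \<phi>" using Ex.prems(1) by simp
        have "valuation \<MM> U (v(x := y))" using Ex.prems(2) y by (intro valuation_upd)
        from Ex.IH[OF ok this] show ?thesis unfolding e .
      qed
      then show ?case using autD(2)[OF g] by auto
    qed auto
    show ?thesis
      unfolding elem_substructure_def
    proof (intro conjI allI impI)
      show "\<exists>x\<in>g ` U. srt \<MM> x = s" for s using 1[of s] autD(2)[OF g] by auto
      fix f xs assume xs: "set xs \<subseteq> g ` U \<and> map (srt \<MM>) xs = fdom \<MM> f"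
      define ys where "ys = map (ainv g) xs"
      have yx: "map g ys = xs" using g by (simp add: ys_def o_def)
      have "set ys \<subseteq> U" using xs g by (auto simp: ys_def)
      moreover have s: "map (srt \<MM>) ys = fdom \<MM> f"
        using xs autD(2)[OF inv_aut[OF g]] by (simp add: ys_def o_def)
      ultimately have "fI \<MM> f ys \<in> U" using 2 by blast
      moreover have "g (fI \<MM> f ys) = fI \<MM> f xs" using autD(3)[OF g s] yx by simp
      ultimately show "fI \<MM> f xs \<in> g ` U" by (metis image_eqI)
    next
      fix \<phi> v assume pv: "fm_ok \<MM> \<phi> \<and> valuation \<MM> (g ` U) v"
      define w where "w x = ainv g (v x)" for x
      have w: "valuation \<MM> U w" unfolding w_def using vback[of v] pv by simp
      have vw: "v = (\<lambda>x. g (w x))" using g by (simp add: w_def)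
      have wU: "valuation \<MM> UNIV w" using w by (auto simp: valuation_def)
      show "sat \<MM> (g ` U) v \<phi> = sat \<MM> UNIV v \<phi>"
        unfolding vw using satg[of \<phi> w] 3[of \<phi> w] aut_sat[OF g, of \<phi> w] pv w wU by simp
    qed
  qed
  moreover have "\<forall>x\<in>g ` U. (g \<circ> h \<circ> ainv g) x = x" using U(4) g by simp
  moreover have "g \<circ> h \<circ> ainv g \<in> aut \<MM>" using g U by (intro comp_aut inv_aut)
  ultimately show "g \<otimes>\<^bsub>Aut \<MM>\<^esub> h \<otimes>\<^bsub>Aut \<MM>\<^esub> m_inv (Aut \<MM>) g
      \<in> {\<sigma> \<in> aut \<MM>. \<exists>U. small U \<and> elem_substructure \<MM> U \<and> (\<forall>x\<in>U. \<sigma> x = x)}"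
    unfolding eq using small_image[OF U(2)] by blast
qed

lemma Autf_subgroup: "subgroup (Autf \<MM>) (Aut \<MM>)"
  using Autf_normal by (rule normal_imp_subgroup)

lemma Autf_aut: "\<sigma> \<in> Autf \<MM> \<Longrightarrow> \<sigma> \<in> aut \<MM>"
  using subgroup.mem_carrier[OF Autf_subgroup] by (simp add: Aut_simps)

lemma Autf_comp: "\<sigma> \<in> Autf \<MM> \<Longrightarrow> \<tau> \<in> Autf \<MM> \<Longrightarrow> \<sigma> \<circ> \<tau> \<in> Autf \<MM>"
  using subgroup.m_closed[OF Autf_subgroup, of \<sigma> \<tau>] by (simp add: Aut_mult Autf_aut)

lemma Autf_inv: "\<sigma> \<in> Autf \<MM> \<Longrightarrow> ainv \<sigma> \<in> Autf \<MM>"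
  using subgroup.m_inv_closed[OF Autf_subgroup, of \<sigma>] by (simp add: Aut_inv Autf_aut)

lemma Autf_id: "id \<in> Autf \<MM>"
  using subgroup.one_closed[OF Autf_subgroup] by (simp add: Aut_simps)

lemma Autf_conj: "\<sigma> \<in> Autf \<MM> \<Longrightarrow> \<tau> \<in> aut \<MM> \<Longrightarrow> \<tau> \<circ> \<sigma> \<circ> ainv \<tau> \<in> Autf \<MM>"
  using normal.inv_op_closed2[OF Autf_normal, of \<tau> \<sigma>]
  by (simp add: Aut_simps Aut_inv Aut_mult Autf_aut comp_aut inv_aut)

end

section \<open>The action on the realizations\<close>

context type_setup
begin

abbreviation act' where "act' \<equiv> act \<MM> p"

lemma act_apply: "b \<in> real \<Longrightarrow> act' \<sigma> b = \<sigma> \<circ> b"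
  by (simp add: act_def)

lemma act_Bij:
  assumes \<sigma>: "\<sigma> \<in> aut \<MM>"
  shows "act' \<sigma> \<in> Bij real"
  unfolding Bij_def
proof
  show "act' \<sigma> \<in> extensional real" by (simp add: act_def)
  have "bij_betw (act' \<sigma>) real real"
  proof (rule bij_betw_byWitness[where f' = "act' (ainv \<sigma>)"])
    show "\<forall>b\<in>real. act' (ainv \<sigma>) (act' \<sigma> b) = b"
      using \<sigma> real_aut by (simp add: act_apply comp_assoc[symmetric])
    show "\<forall>b\<in>real. act' \<sigma> (act' (ainv \<sigma>) b) = b"
      using \<sigma> inv_aut[OF \<sigma>] real_aut by (simp add: act_apply comp_assoc[symmetric])
    show "act' \<sigma> ` real \<subseteq> real" "act' (ainv \<sigma>) ` real \<subseteq> real"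
      using \<sigma> inv_aut[OF \<sigma>] real_aut by (auto simp: act_apply)
  qed
  then show "act' \<sigma> \<in> {f. bij_betw f real real}" by simp
qed

lemma Aut_real_simps: "carrier (Aut_real \<MM> p) = act' ` aut \<MM>" "\<one>\<^bsub>Aut_real \<MM> p\<^esub> = act' id"
  by (auto simp: Aut_real_def BijGroup_def act_def)

lemma Aut_real_mult:
  assumes "\<sigma> \<in> aut \<MM>" "\<tau> \<in> aut \<MM>"
  shows "act' \<sigma> \<otimes>\<^bsub>Aut_real \<MM> p\<^esub> act' \<tau> = act' (\<sigma> \<circ> \<tau>)"
proof -
  have "compose real (act' \<sigma>) (act' \<tau>) = act' (\<sigma> \<circ> \<tau>)"
    unfolding compose_def by (rule ext) (use assms real_aut in \<open>auto simp: act_def comp_assoc\<close>)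
  then show ?thesis using act_Bij assms by (simp add: Aut_real_def BijGroup_def)
qed

lemma group_Aut_real: "group (Aut_real \<MM> p)"
proof (rule groupI; unfold Aut_real_simps)
  show "act' id \<in> act' ` aut \<MM>" using id_aut by blast
  show "g \<otimes>\<^bsub>Aut_real \<MM> p\<^esub> h \<in> act' ` aut \<MM>" if "g \<in> act' ` aut \<MM>" "h \<in> act' ` aut \<MM>" for g h
    using that comp_aut by (auto simp: Aut_real_mult)
  show "g \<otimes>\<^bsub>Aut_real \<MM> p\<^esub> h \<otimes>\<^bsub>Aut_real \<MM> p\<^esub> k = g \<otimes>\<^bsub>Aut_real \<MM> p\<^esub> (h \<otimes>\<^bsub>Aut_real \<MM> p\<^esub> k)"
    if "g \<in> act' ` aut \<MM>" "h \<in> act' ` aut \<MM>" "k \<in> act' ` aut \<MM>" for g h k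
    using that by (auto simp: Aut_real_mult comp_aut comp_assoc)
  show "act' id \<otimes>\<^bsub>Aut_real \<MM> p\<^esub> g = g" if "g \<in> act' ` aut \<MM>" for g
    using that by (auto simp: Aut_real_mult id_aut)
  show "\<exists>h\<in>act' ` aut \<MM>. h \<otimes>\<^bsub>Aut_real \<MM> p\<^esub> g = act' id" if g: "g \<in> act' ` aut \<MM>" for g
  proof -
    obtain \<sigma> where \<sigma>: "\<sigma> \<in> aut \<MM>" "g = act' \<sigma>" using g by blast
    then have "act' (ainv \<sigma>) \<otimes>\<^bsub>Aut_real \<MM> p\<^esub> g = act' id" by (simp add: Aut_real_mult inv_aut)
    then show ?thesis using inv_aut[OF \<sigma>(1)] by blast
  qed
qed

lemma Aut_real_inv: "\<sigma> \<in> aut \<MM> \<Longrightarrow> m_inv (Aut_real \<MM> p) (act' \<sigma>) = act' (ainv \<sigma>)"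
  using group.inv_equality[OF group_Aut_real, of "act' (ainv \<sigma>)" "act' \<sigma>"]
  by (simp add: Aut_real_simps Aut_real_mult inv_aut)

text \<open>The lift of \<open>Autf_fix\<close> to automorphisms of the model, where closure under
  the group operations can be checked pointwise.\<close>

definition LF :: "('m \<Rightarrow> 'm) set" where
  "LF = {\<sigma> \<in> aut \<MM>. \<forall>s :: nat \<Rightarrow> 'i \<Rightarrow> 'm. range s \<subseteq> real \<longrightarrow> lascar_equiv \<MM> (case_prod s) (\<sigma> \<circ> case_prod s)}"

lemma LF_iff: "\<sigma> \<in> LF \<longleftrightarrow> \<sigma> \<in> aut \<MM> \<and> (\<forall>s :: nat \<Rightarrow> 'i \<Rightarrow> 'm. range s \<subseteq> real \<longrightarrow> (\<exists>\<rho>\<in>Autf \<MM>. \<forall>n i. \<sigma> (s n i) = \<rho> (s n i)))"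
proof -
  have "(\<sigma> \<circ> case_prod s = \<rho> \<circ> case_prod s) \<longleftrightarrow> (\<forall>n i. \<sigma> (s n i) = \<rho> (s n i))" for \<rho> and s :: "nat \<Rightarrow> 'i \<Rightarrow> 'm"
    by (simp add: fun_eq_iff split_paired_All)
  then show ?thesis unfolding LF_def lascar_equiv_def by simp
qed

text \<open>The Lascar condition at a translated sequence, as products, inverses and conjugates
  require.\<close>

lemma LF_D:
  assumes "\<sigma> \<in> LF" "\<tau> \<in> aut \<MM>" "range (s :: nat \<Rightarrow> 'i \<Rightarrow> 'm) \<subseteq> real"
  obtains \<rho> where "\<rho> \<in> Autf \<MM>" "\<And>n i. \<sigma> (\<tau> (s n i)) = \<rho> (\<tau> (s n i))"
proof -
  have "range (\<lambda>n. \<tau> \<circ> s n) \<subseteq> real" using assms(2,3) real_aut by auto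
  then show thesis using assms(1) that unfolding LF_iff by (metis comp_apply)
qed

lemma LF_aut: "\<sigma> \<in> LF \<Longrightarrow> \<sigma> \<in> aut \<MM>"
  by (simp add: LF_iff)

lemma Autf_LF: "\<sigma> \<in> Autf \<MM> \<Longrightarrow> \<sigma> \<in> LF"
  unfolding LF_iff using Autf_aut by blast

lemma LF_comp:
  assumes "\<sigma> \<in> LF" "\<tau> \<in> LF"
  shows "\<sigma> \<circ> \<tau> \<in> LF"
  unfolding LF_iff
proof (intro conjI allI impI)
  show "\<sigma> \<circ> \<tau> \<in> aut \<MM>" using assms LF_aut comp_aut by blast
  fix s :: "nat \<Rightarrow> 'i \<Rightarrow> 'm" assume s: "range s \<subseteq> real"
  obtain \<rho> where \<rho>: "\<rho> \<in> Autf \<MM>" "\<And>n i. \<sigma> (\<tau> (s n i)) = \<rho> (\<tau> (s n i))" using LF_D[OF assms(1) LF_aut[OF assms(2)] s] by blast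
  obtain \<rho>' where \<rho>': "\<rho>' \<in> Autf \<MM>" "\<And>n i. \<tau> (id (s n i)) = \<rho>' (id (s n i))" using LF_D[OF assms(2) id_aut s] by blast
  show "\<exists>\<rho>\<in>Autf \<MM>. \<forall>n i. (\<sigma> \<circ> \<tau>) (s n i) = \<rho> (s n i)"
    using \<rho> \<rho>' by (intro bexI[of _ "\<rho> \<circ> \<rho>'"] Autf_comp) simp_all
qed

lemma LF_inv:
  assumes "\<sigma> \<in> LF"
  shows "ainv \<sigma> \<in> LF"
  unfolding LF_iff
proof (intro conjI allI impI)
  have \<sigma>: "\<sigma> \<in> aut \<MM>" using assms LF_aut by blast
  then show "ainv \<sigma> \<in> aut \<MM>" by (rule inv_aut)
  fix s :: "nat \<Rightarrow> 'i \<Rightarrow> 'm" assume s: "range s \<subseteq> real"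
  obtain \<rho> where \<rho>: "\<rho> \<in> Autf \<MM>" "\<And>n i. \<sigma> (ainv \<sigma> (s n i)) = \<rho> (ainv \<sigma> (s n i))" using LF_D[OF assms inv_aut[OF \<sigma>] s] by blast
  have "ainv \<sigma> (s n i) = ainv \<rho> (s n i)" for n i
  proof -
    have "s n i = \<rho> (ainv \<sigma> (s n i))" using \<rho>(2)[of n i] \<sigma> by simp
    then show ?thesis using Autf_aut[OF \<rho>(1)] by (metis aut_inv_simps(1))
  qed
  then show "\<exists>\<rho>\<in>Autf \<MM>. \<forall>n i. ainv \<sigma> (s n i) = \<rho> (s n i)" using Autf_inv[OF \<rho>(1)] by blast
qed

lemma LF_conj:
  assumes "\<sigma> \<in> LF" and \<tau>: "\<tau> \<in> aut \<MM>"
  shows "\<tau> \<circ> \<sigma> \<circ> ainv \<tau> \<in> LF"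
  unfolding LF_iff
proof (intro conjI allI impI)
  show "\<tau> \<circ> \<sigma> \<circ> ainv \<tau> \<in> aut \<MM>" using assms LF_aut by (intro comp_aut inv_aut)
  fix s :: "nat \<Rightarrow> 'i \<Rightarrow> 'm" assume s: "range s \<subseteq> real"
  obtain \<rho> where \<rho>: "\<rho> \<in> Autf \<MM>" "\<And>n i. \<sigma> (ainv \<tau> (s n i)) = \<rho> (ainv \<tau> (s n i))" using LF_D[OF assms(1) inv_aut[OF \<tau>] s] by blast
  show "\<exists>\<rho>\<in>Autf \<MM>. \<forall>n i. (\<tau> \<circ> \<sigma> \<circ> ainv \<tau>) (s n i) = \<rho> (s n i)"
    using \<rho>(2) by (intro bexI[OF _ Autf_conj[OF \<rho>(1) \<tau>]]) simp
qed

lemma Autf_fix_LF: "Autf_fix \<MM> p = act' ` LF"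
  by (simp add: Autf_fix_def LF_def)

lemma Autf_fix_normal: "Autf_fix \<MM> p \<lhd> Aut_real \<MM> p"
proof (rule group.normal_invI[OF group_Aut_real])
  show "subgroup (Autf_fix \<MM> p) (Aut_real \<MM> p)"
  proof (rule group.subgroupI[OF group_Aut_real])
    show "Autf_fix \<MM> p \<subseteq> carrier (Aut_real \<MM> p)"
      unfolding Autf_fix_LF Aut_real_simps using LF_aut by blast
    show "Autf_fix \<MM> p \<noteq> {}" unfolding Autf_fix_LF using Autf_LF[OF Autf_id] by blast
    show "m_inv (Aut_real \<MM> p) g \<in> Autf_fix \<MM> p" if "g \<in> Autf_fix \<MM> p" for g
    proof -
      obtain \<sigma> where "\<sigma> \<in> LF" "g = act' \<sigma>" using \<open>g \<in> Autf_fix \<MM> p\<close> unfolding Autf_fix_LF by blast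
      then show ?thesis unfolding Autf_fix_LF using LF_inv LF_aut by (simp add: Aut_real_inv)
    qed
    show "g \<otimes>\<^bsub>Aut_real \<MM> p\<^esub> h \<in> Autf_fix \<MM> p" if gh: "g \<in> Autf_fix \<MM> p" "h \<in> Autf_fix \<MM> p" for g h
    proof -
      obtain \<sigma> \<tau> where "\<sigma> \<in> LF" "g = act' \<sigma>" "\<tau> \<in> LF" "h = act' \<tau>" using gh unfolding Autf_fix_LF by blast
      then show ?thesis unfolding Autf_fix_LF using LF_comp LF_aut by (simp add: Aut_real_mult)
    qed
  qed
  fix g h assume "g \<in> carrier (Aut_real \<MM> p)" "h \<in> Autf_fix \<MM> p"
  then obtain \<tau> \<sigma> where *: "\<tau> \<in> aut \<MM>" "g = act' \<tau>" "\<sigma> \<in> LF" "h = act' \<sigma>" unfolding Autf_fix_LF Aut_real_simps by blast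
  then have "g \<otimes>\<^bsub>Aut_real \<MM> p\<^esub> h \<otimes>\<^bsub>Aut_real \<MM> p\<^esub> m_inv (Aut_real \<MM> p) g = act' (\<tau> \<circ> \<sigma> \<circ> ainv \<tau>)"
    using LF_aut[OF *(3)] by (simp add: Aut_real_inv Aut_real_mult comp_aut inv_aut)
  then show "g \<otimes>\<^bsub>Aut_real \<MM> p\<^esub> h \<otimes>\<^bsub>Aut_real \<MM> p\<^esub> m_inv (Aut_real \<MM> p) g \<in> Autf_fix \<MM> p"
    unfolding Autf_fix_LF using LF_conj[OF *(3,1)] by simp
qed

lemma act_hom: "group_hom (Aut \<MM>) (Aut_real \<MM> p) act'"
  unfolding group_hom_def group_hom_axioms_def
  using group_Aut group_Aut_real by (auto intro!: homI simp: Aut_simps Aut_real_simps Aut_mult Aut_real_mult)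

lemma Gal_fix_quotient:
  "group_hom (Aut \<MM>) (Gal_fix \<MM> p) (\<lambda>\<sigma>. Autf_fix \<MM> p #>\<^bsub>Aut_real \<MM> p\<^esub> act' \<sigma>)"
  "\<And>\<sigma>. \<sigma> \<in> Autf \<MM> \<Longrightarrow> Autf_fix \<MM> p #>\<^bsub>Aut_real \<MM> p\<^esub> act' \<sigma> = \<one>\<^bsub>Gal_fix \<MM> p\<^esub>"
  "(\<lambda>\<sigma>. Autf_fix \<MM> p #>\<^bsub>Aut_real \<MM> p\<^esub> act' \<sigma>) ` aut \<MM> = carrier (Gal_fix \<MM> p)"
proof -
  interpret Nn: normal "Autf_fix \<MM> p" "Aut_real \<MM> p" by (rule Autf_fix_normal)
  have "(\<lambda>g. Autf_fix \<MM> p #>\<^bsub>Aut_real \<MM> p\<^esub> g) \<circ> act' \<in> hom (Aut \<MM>) (Gal_fix \<MM> p)"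
    unfolding Gal_fix_def using group_hom.homh[OF act_hom] Nn.r_coset_hom_Mod by (rule hom_compose)
  then show "group_hom (Aut \<MM>) (Gal_fix \<MM> p) (\<lambda>\<sigma>. Autf_fix \<MM> p #>\<^bsub>Aut_real \<MM> p\<^esub> act' \<sigma>)"
    using group_Aut Nn.factorgroup_is_group by (simp add: group_hom_def group_hom_axioms_def o_def Gal_fix_def)
  show "Autf_fix \<MM> p #>\<^bsub>Aut_real \<MM> p\<^esub> act' \<sigma> = \<one>\<^bsub>Gal_fix \<MM> p\<^esub>" if "\<sigma> \<in> Autf \<MM>" for \<sigma>
  proof -
    have "act' \<sigma> \<in> Autf_fix \<MM> p" unfolding Autf_fix_LF using Autf_LF[OF that] by blast
    then have "Autf_fix \<MM> p #>\<^bsub>Aut_real \<MM> p\<^esub> act' \<sigma> = Autf_fix \<MM> p"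
      using Nn.coset_join2[OF _ Nn.subgroup_axioms] Nn.mem_carrier by blast
    then show ?thesis by (simp add: Gal_fix_def FactGroup_def)
  qed
  show "(\<lambda>\<sigma>. Autf_fix \<MM> p #>\<^bsub>Aut_real \<MM> p\<^esub> act' \<sigma>) ` aut \<MM> = carrier (Gal_fix \<MM> p)"
    by (auto simp: Gal_fix_def FactGroup_def RCOSETS_def Aut_real_simps)
qed

lemma Gal_L_to_fix_eq: "\<sigma> \<in> aut \<MM> \<Longrightarrow>
    Gal_L_to_fix \<MM> p (Autf \<MM> #>\<^bsub>Aut \<MM>\<^esub> \<sigma>) = Autf_fix \<MM> p #>\<^bsub>Aut_real \<MM> p\<^esub> act' \<sigma>"
  unfolding Gal_L_to_fix_def
  using factor_hom(1)[OF Gal_fix_quotient(1) Autf_normal Gal_fix_quotient(2)] by (simp add: Aut_simps)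

end

section \<open>The first homology group as a quotient\<close>

context indep_setup
begin

abbreviation H1 where "H1 \<equiv> homology \<MM> R p 1"

lemma cycles_simps: "carrier (cycles \<MM> R p 1) = {c. Poly_Mapping.keys c \<subseteq> simplices \<MM> R p 1 \<and> boundary 1 c = 0}"
  "x \<otimes>\<^bsub>cycles \<MM> R p 1\<^esub> y = x + y" "\<one>\<^bsub>cycles \<MM> R p 1\<^esub> = 0"
  by (auto simp: cycles_def chains_def free_Abelian_group_def)

lemma boundary_minus: "boundary n (- c) = - boundary n c"
  by (simp add: boundary_def frag_extend_minus)

lemma comm_group_cycles: "comm_group (cycles \<MM> R p 1)"
proof (rule comm_groupI; unfold cycles_simps)
  show "x + y \<in> {c. Poly_Mapping.keys c \<subseteq> simplices \<MM> R p 1 \<and> boundary 1 c = 0}"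
    if "x \<in> {c. Poly_Mapping.keys c \<subseteq> simplices \<MM> R p 1 \<and> boundary 1 c = 0}"
      "y \<in> {c. Poly_Mapping.keys c \<subseteq> simplices \<MM> R p 1 \<and> boundary 1 c = 0}" for x y
    using that keys_add[of x y] by (auto simp: boundary_add)
  show "\<exists>y\<in>{c. Poly_Mapping.keys c \<subseteq> simplices \<MM> R p 1 \<and> boundary 1 c = 0}. y + x = 0"
    if "x \<in> {c. Poly_Mapping.keys c \<subseteq> simplices \<MM> R p 1 \<and> boundary 1 c = 0}" for x
    using that by (intro bexI[of _ "- x"]) (simp_all add: boundary_minus)
qed (auto simp: boundary_def add.commute add.assoc)

text \<open>A 2-simplex in standard form has faces in standard form with the same data, so its
  boundary consists of 1-simplices whose vertices cancel in pairs.\<close>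

lemma S_subset_cycles: "S \<subseteq> carrier (cycles \<MM> R p 1)"
proof
  fix c assume "c \<in> S"
  then obtain d where d: "c = boundary 2 d" "Poly_Mapping.keys d \<subseteq> simplices \<MM> R p 2" unfolding S_alt by blast
  have "Poly_Mapping.keys (boundary 2 d) \<subseteq> simplices \<MM> R p 1 \<and> boundary 1 (boundary 2 d) = 0"
    using d(2)
  proof (induction d rule: frag_induction)
    case zero
    then show ?case by (simp add: boundary_def)
  next
    case (one g)
    obtain i j k where ijk: "i < j" "j < k" "spt g = {i, j, k}" using simplex_2_support[OF one] .
    define e where "e l = pick (obj g {l})" for l
    have e: "e l \<in> real" "obj g {l} = ac (e l)" if "l \<in> {i, j, k}" for l
      using pick[OF one, of l] that ijk(3) by (simp_all add: e_def)
    obtain \<tau> where \<tau>: "\<And>u. u \<subseteq> {i, j, k} \<Longrightarrow> \<tau> u \<in> aut \<MM>"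
      "g = cube_of {i, j, k} (\<lambda>i. \<tau> {i} \<circ> e i) \<tau>" "indep_family R acl0 {i, j, k} (\<lambda>i. ac (\<tau> {i} \<circ> e i))"
      by (rule simplex_standard_form[OF one, of e, unfolded ijk(3)]) (use e in blast)+
    define b where "b l = \<tau> {l} \<circ> e l" for l
    have br: "b l \<in> real" if "l \<in> {i, j, k}" for l
      unfolding b_def using e(1)[OF that] \<tau>(1)[of "{l}"] that by (intro real_aut) auto
    have sub: "cube_of {l, m} b \<tau> \<in> simplices \<MM> R p 1" if lm: "l < m" "{l, m} \<subseteq> {i, j, k}" for l m
    proof (rule cube_of_simplex)
      show "card {l, m} = 1 + 1" using lm(1) by simp
      show "indep_family R acl0 {l, m} (\<lambda>i. ac (b i))"
        by (rule indep_family_subset[OF _ lm(2)]) (use \<tau>(3) small_ac in \<open>simp_all add: b_def\<close>)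
      show "b x \<in> real" if "x \<in> {l, m}" for x using br lm(2) that by blast
      show "\<tau> u \<in> aut \<MM>" if "u \<subseteq> {l, m}" for u using \<tau>(1) lm(2) that by blast
    qed simp
    have ik: "i < k" using ijk by simp
    have s: "cube_of {j, k} b \<tau> \<in> simplices \<MM> R p 1" "cube_of {i, k} b \<tau> \<in> simplices \<MM> R p 1" "cube_of {i, j} b \<tau> \<in> simplices \<MM> R p 1"
      using sub[OF ijk(2)] sub[OF ik] sub[OF ijk(1)] by simp_all
    have *: "boundary 2 (frag_of g) = frag_of (cube_of {j, k} b \<tau>) - frag_of (cube_of {i, k} b \<tau>) + frag_of (cube_of {i, j} b \<tau>)"
      unfolding \<tau>(2) boundary_triangle[OF ijk(1,2)] b_def ..
    have "Poly_Mapping.keys (boundary 2 (frag_of g)) \<subseteq> {cube_of {j, k} b \<tau>, cube_of {i, k} b \<tau>, cube_of {i, j} b \<tau>}"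
      unfolding * using keys_add[of "frag_of (cube_of {j, k} b \<tau>) - frag_of (cube_of {i, k} b \<tau>)" "frag_of (cube_of {i, j} b \<tau>)"]
        keys_diff[of "frag_of (cube_of {j, k} b \<tau>)" "frag_of (cube_of {i, k} b \<tau>)"] by auto
    moreover have "boundary 1 (boundary 2 (frag_of g)) = 0"
      unfolding * boundary_add boundary_diff boundary_1_of
        face_cube_of_2[OF ijk(1)] face_cube_of_2[OF ijk(2)] face_cube_of_2[OF ik] by simp
    ultimately show ?case using s by blast
  next
    case (diff x y)
    then show ?case using keys_diff[of "boundary 2 x" "boundary 2 y"] by (auto simp: boundary_diff)
  qed
  then show "c \<in> carrier (cycles \<MM> R p 1)" unfolding d(1) cycles_simps by blast
qed

lemma S_normal: "S \<lhd> cycles \<MM> R p 1"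
proof -
  interpret C: comm_group "cycles \<MM> R p 1" by (rule comm_group_cycles)
  have "subgroup S (cycles \<MM> R p 1)"
  proof (rule C.subgroupI[OF S_subset_cycles])
    show "S \<noteq> {}" using S_rules(1) by blast
    show "x \<otimes>\<^bsub>cycles \<MM> R p 1\<^esub> y \<in> S" if "x \<in> S" "y \<in> S" for x y using S_rules(4) that by (simp add: cycles_simps)
    fix x assume x: "x \<in> S"
    have "m_inv (cycles \<MM> R p 1) x = - x"
    proof (rule C.inv_equality)
      show "- x \<otimes>\<^bsub>cycles \<MM> R p 1\<^esub> x = \<one>\<^bsub>cycles \<MM> R p 1\<^esub>" by (simp add: cycles_simps)
      show "x \<in> carrier (cycles \<MM> R p 1)" "- x \<in> carrier (cycles \<MM> R p 1)" using x S_rules(3)[OF x] S_subset_cycles by blast+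
    qed
    then show "m_inv (cycles \<MM> R p 1) x \<in> S" using S_rules(3)[OF x] by simp
  qed
  then show ?thesis by (rule C.subgroup_imp_normal)
qed

lemma H1_simps: "carrier H1 = cos ` carrier (cycles \<MM> R p 1)" "\<one>\<^bsub>H1\<^esub> = cos 0"
  "\<And>x y. x \<in> carrier (cycles \<MM> R p 1) \<Longrightarrow> y \<in> carrier (cycles \<MM> R p 1) \<Longrightarrow> cos x \<otimes>\<^bsub>H1\<^esub> cos y = cos (x + y)"
proof -
  interpret S: normal S "cycles \<MM> R p 1" by (rule S_normal)
  show "carrier H1 = cos ` carrier (cycles \<MM> R p 1)"
    by (auto simp: homology_def FactGroup_def RCOSETS_def cos_def)
  show "\<one>\<^bsub>H1\<^esub> = cos 0" by (simp add: homology_def FactGroup_def cos_alt)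
  show "cos x \<otimes>\<^bsub>H1\<^esub> cos y = cos (x + y)" if "x \<in> carrier (cycles \<MM> R p 1)" "y \<in> carrier (cycles \<MM> R p 1)" for x y
    using S.rcos_sum[OF that] by (simp add: homology_def FactGroup_def cos_def cycles_simps)
qed

lemma comm_group_H1: "comm_group H1"
  unfolding homology_def
  using comm_group.abelian_FactGroup[OF comm_group_cycles normal_imp_subgroup[OF S_normal]] .

section \<open>The homomorphism from the automorphism group onto homology\<close>

lemma beta_cycle:
  assumes "b \<in> real" "c \<in> real"
  shows "beta b c \<in> carrier (cycles \<MM> R p 1)"
proof -
  define d where "d = (SOME d. d \<in> real \<and> ind2 d b c)"
  have "\<exists>d. d \<in> real \<and> ind2 d b c" using independent_realization2 by metis
  from someI_ex[OF this] have d: "d \<in> real" "ind2 d b c" unfolding d_def by blast+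
  have N: "beta b c = E 0 a 1 a b d - E 0 a 1 a c d" by (simp add: beta_def N_def d_def Let_def One_nat_def)
  have i: "ind b d" "ind c d" using ind2_ind[OF d(2)] by auto
  have lt: "(0::nat) < 1" by simp
  have "edge 0 a 1 a b d \<in> simplices \<MM> R p 1" "edge 0 a 1 a c d \<in> simplices \<MM> R p 1"
    using edge_simplex[OF lt] assms d(1) i by auto
  then have "Poly_Mapping.keys (beta b c) \<subseteq> simplices \<MM> R p 1"
    unfolding N using keys_diff[of "E 0 a 1 a b d" "E 0 a 1 a c d"] by auto
  moreover have "boundary 1 (beta b c) = 0"
    unfolding N boundary_diff boundary_1_of
    by (simp add: edge_faces[OF lt a_real a_real assms(1) d(1)] edge_faces[OF lt a_real a_real assms(2) d(1)])
  ultimately show ?thesis by (simp add: cycles_simps)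
qed

text \<open>The lift of \<open>psi\<close> to automorphisms of the model. It depends only on
  \<open>\<sigma> \<circ> a\<close>, and it descends to \<open>Aut_real\<close>,
  \<open>Gal_L\<close> and \<open>Gal_fix\<close>.\<close>

definition q :: "('m \<Rightarrow> 'm) \<Rightarrow> ('m cube \<Rightarrow>\<^sub>0 int) set" where
  "q \<sigma> = cos (beta a (\<sigma> \<circ> a))"

text \<open>In the square with corners \<open>a\<close>, \<open>b\<close> and their images under
  \<open>\<sigma>\<close>, the sides from \<open>a\<close> to \<open>b\<close> and from
  \<open>\<sigma> \<circ> a\<close> to \<open>\<sigma> \<circ> b\<close> have the same value by
  invariance, hence so do the other two.\<close>

lemma beta_base:
  assumes b: "b \<in> real" and \<sigma>: "\<sigma> \<in> aut \<MM>"
  shows "beta b (\<sigma> \<circ> b) - beta a (\<sigma> \<circ> a) \<in> S"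
proof -
  note r = a_real b real_aut[OF a_real \<sigma>] real_aut[OF b \<sigma>]
  have 1: "beta a b + beta b (\<sigma> \<circ> b) - beta a (\<sigma> \<circ> b) \<in> S" by (rule beta_cocycle[OF r(1,2,4)])
  have 2: "beta a (\<sigma> \<circ> a) + beta (\<sigma> \<circ> a) (\<sigma> \<circ> b) - beta a (\<sigma> \<circ> b) \<in> S" by (rule beta_cocycle[OF r(1,3,4)])
  have 3: "beta (\<sigma> \<circ> a) (\<sigma> \<circ> b) - beta a b \<in> S" by (rule beta_aut[OF r(1,2) \<sigma>])
  show ?thesis using S_rules(4)[OF S_rules(2)[OF 1 2] 3] by (simp add: algebra_simps)
qed

lemma beta_mult:
  assumes \<sigma>: "\<sigma> \<in> aut \<MM>" and \<tau>: "\<tau> \<in> aut \<MM>"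
  shows "beta a (\<sigma> \<circ> a) + beta a (\<tau> \<circ> a) - beta a (\<sigma> \<circ> \<tau> \<circ> a) \<in> S"
proof -
  note r = real_aut[OF a_real \<sigma>] real_aut[OF a_real \<tau>]
  have 1: "beta a (\<sigma> \<circ> a) + beta (\<sigma> \<circ> a) (\<sigma> \<circ> (\<tau> \<circ> a)) - beta a (\<sigma> \<circ> (\<tau> \<circ> a)) \<in> S"
    by (rule beta_cocycle[OF a_real r(1) real_aut[OF r(2) \<sigma>]])
  have 2: "beta (\<sigma> \<circ> a) (\<sigma> \<circ> (\<tau> \<circ> a)) - beta a (\<tau> \<circ> a) \<in> S" by (rule beta_aut[OF a_real r(2) \<sigma>])
  show ?thesis using S_rules(2)[OF 1 2] by (simp add: algebra_simps comp_assoc)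
qed

lemma q_hom: "group_hom (Aut \<MM>) H1 q"
proof -
  interpret H: comm_group H1 by (rule comm_group_H1)
  have "q \<in> hom (Aut \<MM>) H1"
  proof (rule homI; unfold Aut_simps)
    show "q \<sigma> \<in> carrier H1" if "\<sigma> \<in> aut \<MM>" for \<sigma>
      unfolding q_def H1_simps(1) using beta_cycle[OF a_real real_aut[OF a_real that]] by blast
    fix \<sigma> \<tau> assume st: "\<sigma> \<in> aut \<MM>" "\<tau> \<in> aut \<MM>"
    have "q \<sigma> \<otimes>\<^bsub>H1\<^esub> q \<tau> = cos (beta a (\<sigma> \<circ> a) + beta a (\<tau> \<circ> a))"
      unfolding q_def using beta_cycle[OF a_real real_aut[OF a_real]] st by (intro H1_simps(3)) auto
    also have "\<dots> = q (\<sigma> \<circ> \<tau>)" unfolding q_def cos_eq_iff using beta_mult[OF st] .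
    finally show "q (\<sigma> \<otimes>\<^bsub>Aut \<MM>\<^esub> \<tau>) = q \<sigma> \<otimes>\<^bsub>H1\<^esub> q \<tau>" using st by (simp add: Aut_mult)
  qed
  then show ?thesis using group_Aut H.group_axioms by (simp add: group_hom_def group_hom_axioms_def)
qed

lemma hat_beta_value:
  assumes f: "f \<in> simplices \<MM> R p 1"
  shows "\<exists>\<sigma>\<in>aut \<MM>. hat beta f - beta a (\<sigma> \<circ> a) \<in> S"
proof -
  obtain i j where ij: "i < j" "spt f = {i, j}" using simplex_1_support[OF f] .
  define x y where "x = pick (obj f {i})" and "y = pick (obj f {j})"
  have x: "x \<in> real" "obj f {i} = ac x" and y: "y \<in> real" "obj f {j} = ac y"
    unfolding x_def y_def using pick[OF f] ij(2) by simp_all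
  obtain \<tau>i \<tau>j where \<tau>: "\<tau>i \<in> aut \<MM>" "\<tau>j \<in> aut \<MM>"
    "\<And>t. t \<in> obj f {i} \<Longrightarrow> mor f {i} {i, j} t = \<tau>i t" "\<And>t. t \<in> obj f {j} \<Longrightarrow> mor f {j} {i, j} t = \<tau>j t"
    by (rule simplex_edge[OF f ij x(1) y(1) x(2) y(2)]) blast
  have h: "hat beta f = beta (\<tau>i \<circ> x) (\<tau>j \<circ> y)"
    unfolding hat_pair[OF ij(2,1)] x_def[symmetric] y_def[symmetric]
    using comp_mor[OF \<tau>(3) x(2)[symmetric]] comp_mor[OF \<tau>(4) y(2)[symmetric]] by simp
  have r: "\<tau>i \<circ> x \<in> real" "\<tau>j \<circ> y \<in> real" using x y \<tau> real_aut by auto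
  obtain \<sigma> where \<sigma>: "\<sigma> \<in> aut \<MM>" "\<sigma> \<circ> (\<tau>i \<circ> x) = \<tau>j \<circ> y" by (rule real_trans[OF r])
  show ?thesis using beta_base[OF r(1) \<sigma>(1)] unfolding h \<sigma>(2) using \<sigma>(1) by blast
qed

text \<open>The \<open>beta\<close> value of any chain, not only of a cycle, is congruent to some
  \<open>beta a (\<sigma> \<circ> a)\<close>, because these values form a subgroup modulo
  boundaries. For a cycle it represents the class itself.\<close>

lemma q_surj: "q ` aut \<MM> = carrier H1"
proof
  show "q ` aut \<MM> \<subseteq> carrier H1" using group_hom.hom_closed[OF q_hom] by (auto simp: Aut_simps)
  show "carrier H1 \<subseteq> q ` aut \<MM>"
  proof
    fix Z assume "Z \<in> carrier H1"
    then obtain c where c: "Poly_Mapping.keys c \<subseteq> simplices \<MM> R p 1" "boundary 1 c = 0" "Z = cos c"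
      unfolding H1_simps(1) cycles_simps by blast
    have "\<exists>\<sigma>\<in>aut \<MM>. frag_extend (hat beta) c - beta a (\<sigma> \<circ> a) \<in> S"
      using c(1)
    proof (induction c rule: frag_induction)
      case zero
      show ?case using S_rules(3)[OF beta_refl[OF a_real]] id_aut by (intro bexI[of _ id]) simp_all
    next
      case (one f)
      then show ?case unfolding frag_extend_of by (rule hat_beta_value)
    next
      case (diff c d)
      then obtain \<sigma> \<tau> where st: "\<sigma> \<in> aut \<MM>" "frag_extend (hat beta) c - beta a (\<sigma> \<circ> a) \<in> S"
        "\<tau> \<in> aut \<MM>" "frag_extend (hat beta) d - beta a (\<tau> \<circ> a) \<in> S" by blast
      define \<rho> where "\<rho> = \<sigma> \<circ> ainv \<tau>"
      have \<rho>: "\<rho> \<in> aut \<MM>" unfolding \<rho>_def using st by (intro comp_aut inv_aut)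
      have "\<rho> \<circ> \<tau> = \<sigma>" unfolding \<rho>_def using st(3) by (simp add: comp_assoc)
      then have "beta a (\<rho> \<circ> a) + beta a (\<tau> \<circ> a) - beta a (\<sigma> \<circ> a) \<in> S" using beta_mult[OF \<rho> st(3)] by simp
      from S_rules(2)[OF S_rules(2)[OF st(2,4)] this]
      have "frag_extend (hat beta) (c - d) - beta a (\<rho> \<circ> a) \<in> S" by (simp add: frag_extend_diff algebra_simps)
      then show ?case using \<rho> by blast
    qed
    then obtain \<sigma> where \<sigma>: "\<sigma> \<in> aut \<MM>" "frag_extend (hat beta) c - beta a (\<sigma> \<circ> a) \<in> S" by blast
    have "c - frag_extend (hat beta) c \<in> S" using chain_formula[OF c(1)] c(2) by simp
    from S_rules(4)[OF this \<sigma>(2)] have "cos c = q \<sigma>" unfolding q_def cos_eq_iff by simp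
    then show "Z \<in> q ` aut \<MM>" using c(3) \<sigma>(1) by blast
  qed
qed

lemma q_one_iff: "q \<sigma> = \<one>\<^bsub>H1\<^esub> \<longleftrightarrow> beta a (\<sigma> \<circ> a) \<in> S"
  unfolding q_def H1_simps(2) cos_eq_iff by simp

lemma q_base: "b \<in> real \<Longrightarrow> \<sigma> \<in> aut \<MM> \<Longrightarrow> bracket \<MM> R p b (\<sigma> \<circ> b) = q \<sigma>"
  using beta_base by (simp add: bracket_eq real_aut q_def cos_eq_iff)

lemma psi_act: "\<sigma> \<in> aut \<MM> \<Longrightarrow> psi \<MM> R p a (act \<MM> p \<sigma>) = q \<sigma>"
  unfolding psi_def act_apply[OF a_real] by (rule q_base[OF a_real])

lemma q_cong: "\<sigma> \<circ> a = \<tau> \<circ> a \<Longrightarrow> q \<sigma> = q \<tau>"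
  by (simp add: q_def)

lemma q_Autf:
  assumes "\<sigma> \<in> Autf \<MM>"
  shows "q \<sigma> = \<one>\<^bsub>H1\<^esub>"
proof -
  interpret Q: group_hom "Aut \<MM>" H1 q by (rule q_hom)
  have "Autf \<MM> \<subseteq> kernel (Aut \<MM>) H1 q"
    unfolding Autf_def
  proof (rule Q.G.generate_subgroup_incl[OF _ Q.subgroup_kernel])
    show "{\<sigma> \<in> aut \<MM>. \<exists>U. small U \<and> elem_substructure \<MM> U \<and> (\<forall>x\<in>U. \<sigma> x = x)} \<subseteq> kernel (Aut \<MM>) H1 q"
    proof
      fix \<sigma> assume "\<sigma> \<in> {\<sigma> \<in> aut \<MM>. \<exists>U. small U \<and> elem_substructure \<MM> U \<and> (\<forall>x\<in>U. \<sigma> x = x)}"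
      then obtain U where U: "\<sigma> \<in> aut \<MM>" "elem_substructure \<MM> U" "\<And>x. x \<in> U \<Longrightarrow> \<sigma> x = x" by blast
      obtain c \<rho> \<tau> where *: "\<rho> \<in> aut \<MM>" "c = \<rho> \<circ> a" "\<tau> \<in> aut \<MM>" "\<tau> \<circ> c = c" "\<tau> \<circ> a = \<sigma> \<circ> a"
        using model_fixing_automorphism[OF U(2,1,3) card_index, of a] by blast
      have c: "c \<in> real" using *(1,2) real_aut[OF a_real] by simp
      \<comment> \<open>\<open>\<tau>\<close> fixes \<open>c\<close> and acts on \<open>a\<close> as
        \<open>\<sigma>\<close> does, so \<open>c\<close> can be taken as base point.\<close>
      have "beta c c - beta a (\<sigma> \<circ> a) \<in> S" using beta_base[OF c *(3)] *(4,5) by simp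
      from S_rules(2)[OF beta_refl[OF c] this] have "q \<sigma> = \<one>\<^bsub>H1\<^esub>" by (simp add: q_one_iff)
      then show "\<sigma> \<in> kernel (Aut \<MM>) H1 q" using U(1) by (simp add: kernel_def Aut_simps)
    qed
  qed
  then show ?thesis using assms by (auto simp: kernel_def)
qed

text \<open>A constant sequence shows that \<open>\<sigma>\<close> acts on \<open>a\<close> like an
  element of \<open>Autf\<close>, and \<open>q\<close> sees nothing else.\<close>

lemma q_LF:
  assumes "\<sigma> \<in> LF"
  shows "q \<sigma> = \<one>\<^bsub>H1\<^esub>"
proof -
  have "range (\<lambda>n :: nat. a) \<subseteq> real" using a_real by auto
  then obtain \<rho> where \<rho>: "\<rho> \<in> Autf \<MM>" "\<And>n i. \<sigma> (a i) = \<rho> (a i)" using assms unfolding LF_iff by blast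
  then have "\<sigma> \<circ> a = \<rho> \<circ> a" by auto
  then show ?thesis using q_cong q_Autf[OF \<rho>(1)] by metis
qed

theorem psi_hom: "group_hom (Aut_real \<MM> p) H1 (psi \<MM> R p a)" "psi \<MM> R p a ` carrier (Aut_real \<MM> p) = carrier H1"
proof -
  interpret Q: group_hom "Aut \<MM>" H1 q by (rule q_hom)
  have "psi \<MM> R p a \<in> hom (Aut_real \<MM> p) H1"
  proof (rule homI; unfold Aut_real_simps)
    fix g h assume "g \<in> act' ` aut \<MM>" "h \<in> act' ` aut \<MM>"
    then obtain \<sigma> \<tau> where st: "\<sigma> \<in> aut \<MM>" "g = act' \<sigma>" "\<tau> \<in> aut \<MM>" "h = act' \<tau>" by blast
    then show "psi \<MM> R p a (g \<otimes>\<^bsub>Aut_real \<MM> p\<^esub> h) = psi \<MM> R p a g \<otimes>\<^bsub>H1\<^esub> psi \<MM> R p a h"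
      using Q.hom_mult[of \<sigma> \<tau>] by (simp add: Aut_simps Aut_mult Aut_real_mult psi_act comp_aut)
  qed (use q_surj psi_act in auto)
  then show "group_hom (Aut_real \<MM> p) H1 (psi \<MM> R p a)"
    using group_Aut_real Q.H.group_axioms by (simp add: group_hom_def group_hom_axioms_def)
  show "psi \<MM> R p a ` carrier (Aut_real \<MM> p) = carrier H1"
    unfolding Aut_real_simps q_surj[symmetric] image_image using psi_act by (intro image_cong) auto
qed

theorem Gal_L_hom:
  "group_hom (Gal_L \<MM>) H1 (Gal_L_to_H1 \<MM> R p a)" "Gal_L_to_H1 \<MM> R p a \<in> epi (Gal_L \<MM>) H1"
  "\<And>\<sigma>. \<sigma> \<in> aut \<MM> \<Longrightarrow> Gal_L_to_H1 \<MM> R p a (Autf \<MM> #>\<^bsub>Aut \<MM>\<^esub> \<sigma>) = q \<sigma>"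
proof -
  interpret Q: group_hom "Aut \<MM>" H1 q by (rule q_hom)
  have "(\<lambda>\<sigma>. psi \<MM> R p a (act' \<sigma>)) \<in> hom (Aut \<MM>) H1"
    using Q.homh by (intro homI) (simp_all add: Aut_simps psi_act hom_def comp_aut Aut_mult Pi_iff)
  then have h: "group_hom (Aut \<MM>) H1 (\<lambda>\<sigma>. psi \<MM> R p a (act' \<sigma>))"
    using Q.G.group_axioms Q.H.group_axioms by (simp add: group_hom_def group_hom_axioms_def)
  have triv: "psi \<MM> R p a (act' \<sigma>) = \<one>\<^bsub>H1\<^esub>" if "\<sigma> \<in> Autf \<MM>" for \<sigma>
    using that Autf_aut q_Autf by (simp add: psi_act)
  have onto: "(\<lambda>\<sigma>. psi \<MM> R p a (act' \<sigma>)) ` carrier (Aut \<MM>) = carrier H1"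
    unfolding Aut_simps q_surj[symmetric] using psi_act by (intro image_cong) auto
  have eq: "Gal_L_to_H1 \<MM> R p a = (\<lambda>Z. the_elem ((\<lambda>\<sigma>. psi \<MM> R p a (act' \<sigma>)) ` Z))"
    by (simp add: Gal_L_to_H1_def fun_eq_iff)
  note F = factor_hom[OF h Autf_normal triv]
  show "group_hom (Gal_L \<MM>) H1 (Gal_L_to_H1 \<MM> R p a)" unfolding eq Gal_L_def using F(2) by blast
  show "Gal_L_to_H1 \<MM> R p a \<in> epi (Gal_L \<MM>) H1" unfolding eq Gal_L_def using F(3) onto by blast
  show "Gal_L_to_H1 \<MM> R p a (Autf \<MM> #>\<^bsub>Aut \<MM>\<^esub> \<sigma>) = q \<sigma>" if "\<sigma> \<in> aut \<MM>" for \<sigma>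
    unfolding eq using F(1)[of \<sigma>] that by (simp add: Aut_simps psi_act)
qed

theorem Gal_fix_hom:
  "group_hom (Gal_fix \<MM> p) H1 (Gal_fix_to_H1 \<MM> R p a)" "Gal_fix_to_H1 \<MM> R p a \<in> epi (Gal_fix \<MM> p) H1"
  "\<And>\<sigma>. \<sigma> \<in> aut \<MM> \<Longrightarrow> Gal_fix_to_H1 \<MM> R p a (Autf_fix \<MM> p #>\<^bsub>Aut_real \<MM> p\<^esub> act \<MM> p \<sigma>) = q \<sigma>"
proof -
  have triv: "psi \<MM> R p a g = \<one>\<^bsub>H1\<^esub>" if "g \<in> Autf_fix \<MM> p" for g
    using that LF_aut q_LF unfolding Autf_fix_LF by (auto simp: psi_act)
  have eq: "Gal_fix_to_H1 \<MM> R p a = (\<lambda>Z. the_elem (psi \<MM> R p a ` Z))"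
    by (simp add: Gal_fix_to_H1_def fun_eq_iff)
  note F = factor_hom[OF psi_hom(1) Autf_fix_normal triv]
  show "group_hom (Gal_fix \<MM> p) H1 (Gal_fix_to_H1 \<MM> R p a)" unfolding eq Gal_fix_def using F(2) by blast
  show "Gal_fix_to_H1 \<MM> R p a \<in> epi (Gal_fix \<MM> p) H1" unfolding eq Gal_fix_def using F(3) psi_hom(2) by blast
  show "Gal_fix_to_H1 \<MM> R p a (Autf_fix \<MM> p #>\<^bsub>Aut_real \<MM> p\<^esub> act \<MM> p \<sigma>) = q \<sigma>" if "\<sigma> \<in> aut \<MM>" for \<sigma>
    unfolding eq using F(1)[of "act' \<sigma>"] that by (simp add: Aut_real_simps psi_act)
qed

text \<open>The cocycle \<open>D\<close> may come from another independence relation.\<close>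

lemma q_kernel_cocycle:
  assumes D: "inv_cocycle S' D" and \<sigma>: "\<sigma> \<in> aut \<MM>" and one: "q \<sigma> = \<one>\<^bsub>H1\<^esub>"
  shows "D a (\<sigma> \<circ> a) \<in> S'"
proof -
  obtain f12 f02 f01 where sh: "shell1 \<MM> R p f12 f02 f01" "spt f12 \<union> spt f02 \<union> spt f01 = {0, 1, 2}"
    "endpoint_pair \<MM> p f12 f02 f01 a (\<sigma> \<circ> a)" using shell_exists[OF a_real real_aut[OF a_real \<sigma>]] .
  have "beta a (\<sigma> \<circ> a) \<in> S" using one by (simp add: q_one_iff)
  from S_rules(2)[OF shell_class[OF sh(1,3)] S_rules(2)[OF S_rules(1) this]]
  have "shell_chain f12 f02 f01 \<in> S" by simp
  then have 1: "frag_extend (hat D) (shell_chain f12 f02 f01) \<in> S'" by (rule hat_boundary[OF D])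
  show ?thesis using add_subgroupD(2)[OF inv_cocycleD(1)[OF D] 1 shell_hat(1)[OF D sh(1,3)]] by simp
qed

end

section \<open>Quotient topologies\<close>

lemma openin_quotient_topology:
  "openin (quotient_topology S f) V \<longleftrightarrow> V \<subseteq> f ` topspace S \<and> openin S {x \<in> topspace S. f x \<in> V}"
proof -
  have "istopology (\<lambda>V. V \<subseteq> f ` topspace S \<and> openin S {x \<in> topspace S. f x \<in> V})"
    unfolding istopology_def
  proof (intro conjI allI impI)
    fix U V assume U: "U \<subseteq> f ` topspace S \<and> openin S {x \<in> topspace S. f x \<in> U}"
      and V: "V \<subseteq> f ` topspace S \<and> openin S {x \<in> topspace S. f x \<in> V}"
    then show "U \<inter> V \<subseteq> f ` topspace S" by blast
    have "{x \<in> topspace S. f x \<in> U \<inter> V} = {x \<in> topspace S. f x \<in> U} \<inter> {x \<in> topspace S. f x \<in> V}" by blast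
    then show "openin S {x \<in> topspace S. f x \<in> U \<inter> V}" using U V by (simp add: openin_Int)
  next
    fix K assume K: "\<forall>V\<in>K. V \<subseteq> f ` topspace S \<and> openin S {x \<in> topspace S. f x \<in> V}"
    then show "\<Union>K \<subseteq> f ` topspace S" by blast
    have "{x \<in> topspace S. f x \<in> \<Union>K} = (\<Union>V\<in>K. {x \<in> topspace S. f x \<in> V})" by blast
    then show "openin S {x \<in> topspace S. f x \<in> \<Union>K}" using K by auto
  qed
  then show ?thesis unfolding quotient_topology_def by (simp add: topology_inverse')
qed

lemma quotient_map_quotient_topology: "quotient_map S (quotient_topology S f) f"
proof -
  have "topspace (quotient_topology S f) = f ` topspace S"
  proof
    show "topspace (quotient_topology S f) \<subseteq> f ` topspace S"
      using openin_topspace[of "quotient_topology S f"] unfolding openin_quotient_topology by blast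
    have "{x \<in> topspace S. f x \<in> f ` topspace S} = topspace S" by blast
    then have "openin (quotient_topology S f) (f ` topspace S)" by (simp add: openin_quotient_topology)
    then show "f ` topspace S \<subseteq> topspace (quotient_topology S f)" by (rule openin_subset)
  qed
  then show ?thesis unfolding quotient_map_def openin_quotient_topology by auto
qed

lemma quotient_topology_unique:
  assumes "quotient_map S T f"
  shows "T = quotient_topology S f"
  unfolding topology_eq openin_quotient_topology
  using assms unfolding quotient_map_def by (metis openin_subset)

lemma quotient_topology_comp:
  "quotient_topology (quotient_topology S f) g = quotient_topology S (\<lambda>x. g (f x))"
proof -
  have "quotient_map S (quotient_topology (quotient_topology S f) g) (g \<circ> f)"
    by (rule quotient_map_compose[OF quotient_map_quotient_topology quotient_map_quotient_topology])
  from quotient_topology_unique[OF this] show ?thesis by (simp add: o_def)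
qed

lemma quotient_topology_cong:
  assumes "\<And>x. x \<in> topspace S \<Longrightarrow> f x = g x"
  shows "quotient_topology S f = quotient_topology S g"
  by (rule quotient_topology_unique, rule quotient_map_eq[OF quotient_map_quotient_topology]) (use assms in auto)

text \<open>Points of \<open>Y\<close> are thought of as pairs of points of \<open>X\<close> together with their product; the classes of \<open>f\<close> need not be closed.
  Closed subsets of \<open>T\<close> are unions of cosets of \<open>L\<close>, the closure of \<open>1\<close>, and the saturation of a closed subset of
  \<open>X\<close> with respect to these cosets is closed. So the tube lemma applies to the compact fibres over two cosets.\<close>

lemma topological_group_quotient:
  assumes G: "comm_group G" and X: "compact_space X" "Hausdorff_space X" and Y: "compact_space Y"
    and f: "quotient_map X T f" and T: "topspace T = carrier G"
    and p: "continuous_map Y X p1" "continuous_map Y X p2" "continuous_map Y X p3"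
    and mult: "\<And>y. y \<in> topspace Y \<Longrightarrow> f (p3 y) = f (p1 y) \<otimes>\<^bsub>G\<^esub> f (p2 y)"
    and s12: "\<And>x x'. x \<in> topspace X \<Longrightarrow> x' \<in> topspace X \<Longrightarrow> \<exists>y\<in>topspace Y. p1 y = x \<and> p2 y = x'"
    and s13: "\<And>x x'. x \<in> topspace X \<Longrightarrow> x' \<in> topspace X \<Longrightarrow> \<exists>y\<in>topspace Y. p1 y = x \<and> p3 y = x'"
    and s23: "\<And>x x'. x \<in> topspace X \<Longrightarrow> x' \<in> topspace X \<Longrightarrow> \<exists>y\<in>topspace Y. p2 y = x \<and> p3 y = x'"
  shows "topological_group G T"
proof -
  interpret G: comm_group G by fact
  have fT: "f ` topspace X = carrier G" using f T by (simp add: quotient_map_def)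
  have ex: "\<exists>x. x \<in> topspace X \<and> f x = g" if "g \<in> carrier G" for g
    using that unfolding fT[symmetric] by auto
  have fc: "f x \<in> carrier G" if "x \<in> topspace X" for x using fT that by blast
  have pc: "p1 y \<in> topspace X" "p2 y \<in> topspace X" "p3 y \<in> topspace X" if "y \<in> topspace Y" for y
    using p that by (auto simp: continuous_map_def)
  have cl: "closedin T F \<longleftrightarrow> closedin X {x \<in> topspace X. f x \<in> F}" if "F \<subseteq> carrier G" for F
    using f that T by (simp add: quotient_map_closedin)
  have cls: "F \<subseteq> carrier G" if "closedin T F" for F using closedin_subset[OF that] T by simp
  have cX: "closedin X {x \<in> topspace X. f x \<in> F}" if "closedin T F" for F using that cl cls by blast
  have cm: "closed_map Y X p1" "closed_map Y X p2" "closed_map Y X p3"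
    using p X Y T1_Spaces.continuous_imp_closed_map by blast+
  have pre: "closedin Y {y \<in> topspace Y. p1 y \<in> C}" "closedin Y {y \<in> topspace Y. p2 y \<in> C}" "closedin Y {y \<in> topspace Y. p3 y \<in> C}"
    if "closedin X C" for C using p that closedin_continuous_map_preimage by blast+
  have img: "closedin X (p2 ` D)" "closedin X (p3 ` D)" if "closedin Y D" for D
    using cm that unfolding closed_map_def by blast+
  have sing: "closedin X {x}" if "x \<in> topspace X" for x using X(2) that by (rule closedin_Hausdorff_singleton)
  \<comment> \<open>When \<open>p1 y\<close> is a fixed representative of \<open>g\<close>, the
    class of \<open>p3 y\<close> is \<open>g\<close> times that of \<open>p2 y\<close>. So the
    preimage in \<open>X\<close> is the image of a closed set under the closed map
    \<open>p2\<close>.\<close>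
  have trans: "closedin T {h \<in> carrier G. g \<otimes>\<^bsub>G\<^esub> h \<in> F}" if g: "g \<in> carrier G" and F: "closedin T F" for g F
  proof -
    obtain x0 where x0: "x0 \<in> topspace X" "f x0 = g" using ex[OF g] by blast
    have "closedin X (p2 ` ({y \<in> topspace Y. p1 y \<in> {x0}} \<inter> {y \<in> topspace Y. p3 y \<in> {x \<in> topspace X. f x \<in> F}}))"
      by (intro img closedin_Int pre sing x0 cX F)
    moreover have "p2 ` ({y \<in> topspace Y. p1 y \<in> {x0}} \<inter> {y \<in> topspace Y. p3 y \<in> {x \<in> topspace X. f x \<in> F}})
      = {x \<in> topspace X. f x \<in> {h \<in> carrier G. g \<otimes>\<^bsub>G\<^esub> h \<in> F}}" (is "?L = ?R")
    proof
      show "?L \<subseteq> ?R" using pc fc mult x0(2) by auto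
      show "?R \<subseteq> ?L"
      proof
        fix x assume x: "x \<in> ?R"
        then obtain y where y: "y \<in> topspace Y" "p1 y = x0" "p2 y = x" using s12[OF x0(1)] by blast
        then have "f (p3 y) \<in> F" using x mult[OF y(1)] x0(2) by simp
        then show "x \<in> ?L" using y pc by blast
      qed
    qed
    ultimately have "closedin X {x \<in> topspace X. f x \<in> {h \<in> carrier G. g \<otimes>\<^bsub>G\<^esub> h \<in> F}}" by simp
    then show ?thesis by (subst cl) auto
  qed
  \<comment> \<open>The same with \<open>p3 y\<close> fixed over \<one>: the classes of
    \<open>p1 y\<close> and \<open>p2 y\<close> are then inverse to each other.\<close>
  have inv: "closedin T {h \<in> carrier G. inv\<^bsub>G\<^esub> h \<in> F}" if F: "closedin T F" for F
  proof -
    obtain x0 where x0: "x0 \<in> topspace X" "f x0 = \<one>\<^bsub>G\<^esub>" using ex[OF G.one_closed] by blast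
    have iv: "f (p1 y) = inv\<^bsub>G\<^esub> (f (p2 y))" if "y \<in> topspace Y" "p3 y = x0" for y
    proof -
      have "f (p1 y) \<otimes>\<^bsub>G\<^esub> f (p2 y) = \<one>\<^bsub>G\<^esub>" using mult[OF that(1)] that(2) x0(2) by simp
      then show ?thesis using G.inv_equality[OF _ fc[OF pc(2)] fc[OF pc(1)]] that(1) by simp
    qed
    have "closedin X (p2 ` ({y \<in> topspace Y. p3 y \<in> {x0}} \<inter> {y \<in> topspace Y. p1 y \<in> {x \<in> topspace X. f x \<in> F}}))"
      by (intro img closedin_Int pre sing x0 cX F)
    moreover have "p2 ` ({y \<in> topspace Y. p3 y \<in> {x0}} \<inter> {y \<in> topspace Y. p1 y \<in> {x \<in> topspace X. f x \<in> F}})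
      = {x \<in> topspace X. f x \<in> {h \<in> carrier G. inv\<^bsub>G\<^esub> h \<in> F}}" (is "?L = ?R")
    proof
      show "?L \<subseteq> ?R"
      proof
        fix x assume "x \<in> ?L"
        then obtain y where y: "y \<in> topspace Y" "p3 y = x0" "f (p1 y) \<in> F" "x = p2 y" by blast
        then show "x \<in> ?R" using iv[OF y(1,2)] pc[OF y(1)] fc by simp
      qed
      show "?R \<subseteq> ?L"
      proof
        fix x assume x: "x \<in> ?R"
        then obtain y where y: "y \<in> topspace Y" "p2 y = x" "p3 y = x0" using s23[OF _ x0(1)] by blast
        then have "f (p1 y) \<in> F" using x iv[OF y(1,3)] by simp
        then show "x \<in> ?L" using y pc by blast
      qed
    qed
    ultimately have "closedin X {x \<in> topspace X. f x \<in> {h \<in> carrier G. inv\<^bsub>G\<^esub> h \<in> F}}" by simp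
    then show ?thesis by (subst cl) auto
  qed
  define L where "L = T closure_of {\<one>\<^bsub>G\<^esub>}"
  have Lcl: "closedin T L" by (simp add: L_def)
  have L1: "\<one>\<^bsub>G\<^esub> \<in> L" unfolding L_def using closure_of_subset[of "{\<one>\<^bsub>G\<^esub>}" T] T by simp
  have Lc: "l \<in> carrier G" if "l \<in> L" for l using cls[OF Lcl] that by blast
  have Lmin: "L \<subseteq> F" if "closedin T F" "\<one>\<^bsub>G\<^esub> \<in> F" for F unfolding L_def using that by (intro closure_of_minimal) auto
  have FL: "h \<otimes>\<^bsub>G\<^esub> l \<in> F" if F: "closedin T F" and h: "h \<in> F" and l: "l \<in> L" for F h l
  proof -
    have hc: "h \<in> carrier G" using h cls[OF F] by blast
    have "L \<subseteq> {k \<in> carrier G. h \<otimes>\<^bsub>G\<^esub> k \<in> F}" by (rule Lmin[OF trans[OF hc F]]) (use h hc in simp)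
    then show ?thesis using l by blast
  qed
  have Linv: "inv\<^bsub>G\<^esub> l \<in> L" if l: "l \<in> L" for l
  proof -
    have "L \<subseteq> {h \<in> carrier G. inv\<^bsub>G\<^esub> h \<in> L}" by (rule Lmin[OF inv[OF Lcl]]) (use L1 in simp)
    then show ?thesis using l by blast
  qed
  define sat where "sat C = {x \<in> topspace X. \<exists>c\<in>C. \<exists>l\<in>L. f x = f c \<otimes>\<^bsub>G\<^esub> l}" for C
  have sat: "closedin X (sat C)" if C: "closedin X C" for C
  proof -
    have "closedin X (p3 ` ({y \<in> topspace Y. p1 y \<in> C} \<inter> {y \<in> topspace Y. p2 y \<in> {x \<in> topspace X. f x \<in> L}}))"
      by (intro img closedin_Int pre C cX Lcl)
    moreover have "p3 ` ({y \<in> topspace Y. p1 y \<in> C} \<inter> {y \<in> topspace Y. p2 y \<in> {x \<in> topspace X. f x \<in> L}}) = sat C" (is "?L = _")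
    proof
      show "?L \<subseteq> sat C" unfolding sat_def using pc mult by blast
      show "sat C \<subseteq> ?L"
      proof
        fix x assume "x \<in> sat C"
        then obtain c l where c: "x \<in> topspace X" "c \<in> C" "l \<in> L" "f x = f c \<otimes>\<^bsub>G\<^esub> l" unfolding sat_def by blast
        have cX': "c \<in> topspace X" using c(2) closedin_subset[OF C] by blast
        obtain y where y: "y \<in> topspace Y" "p1 y = c" "p3 y = x" using s13[OF cX' c(1)] by blast
        have "f c \<otimes>\<^bsub>G\<^esub> f (p2 y) = f c \<otimes>\<^bsub>G\<^esub> l" using mult[OF y(1)] y c(4) by simp
        then have "f (p2 y) = l" using fc[OF cX'] fc[OF pc(2)[OF y(1)]] Lc[OF c(3)] by simp
        then show "x \<in> ?L" using y c pc[OF y(1)] by blast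
      qed
    qed
    ultimately show ?thesis by simp
  qed
  \<comment> \<open>The way from an open set of \<open>X\<close> to an open set of \<open>T\<close>:
    the classes whose whole coset of \<open>L\<close> has its representatives in \<open>Op\<close>.
    The complement pulls back to the saturation of a closed set.\<close>
  have open_core: "openin T {h \<in> carrier G. \<forall>x\<in>topspace X. (\<exists>l\<in>L. f x = h \<otimes>\<^bsub>G\<^esub> l) \<longrightarrow> x \<in> Op}" (is "openin T ?U")
    if O: "openin X Op" for Op
  proof -
    have "closedin X (sat (topspace X - Op))" by (intro sat closedin_diff) (use O in auto)
    moreover have "sat (topspace X - Op) = {x \<in> topspace X. f x \<in> carrier G - ?U}"
    proof
      show "sat (topspace X - Op) \<subseteq> {x \<in> topspace X. f x \<in> carrier G - ?U}"
      proof
        fix x assume "x \<in> sat (topspace X - Op)"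
        then obtain c l where c: "x \<in> topspace X" "c \<in> topspace X" "c \<notin> Op" "l \<in> L" "f x = f c \<otimes>\<^bsub>G\<^esub> l" unfolding sat_def by blast
        have "f c = f x \<otimes>\<^bsub>G\<^esub> inv\<^bsub>G\<^esub> l" using c fc Lc by (simp add: G.m_assoc)
        then show "x \<in> {x \<in> topspace X. f x \<in> carrier G - ?U}" using c fc Linv[OF c(4)] by blast
      qed
      show "{x \<in> topspace X. f x \<in> carrier G - ?U} \<subseteq> sat (topspace X - Op)"
      proof
        fix x assume "x \<in> {x \<in> topspace X. f x \<in> carrier G - ?U}"
        then obtain c l where c: "x \<in> topspace X" "c \<in> topspace X" "c \<notin> Op" "l \<in> L" "f c = f x \<otimes>\<^bsub>G\<^esub> l" by blast
        have "f x = f c \<otimes>\<^bsub>G\<^esub> inv\<^bsub>G\<^esub> l" using c fc Lc by (simp add: G.m_assoc)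
        then show "x \<in> sat (topspace X - Op)" unfolding sat_def using c Linv[OF c(4)] by blast
      qed
    qed
    ultimately have "closedin T (carrier G - ?U)" by (subst cl) auto
    from openin_diff[OF openin_topspace this] have "openin T (carrier G - (carrier G - ?U))" unfolding T .
    moreover have "carrier G - (carrier G - ?U) = ?U" by blast
    ultimately show ?thesis by simp
  qed
  have cont_mult: "continuous_map (prod_topology T T) T (\<lambda>(x, y). x \<otimes>\<^bsub>G\<^esub> y)"
    unfolding continuous_map_def
  proof (intro conjI allI impI)
    show "(\<lambda>(x, y). x \<otimes>\<^bsub>G\<^esub> y) \<in> topspace (prod_topology T T) \<rightarrow> topspace T" using T by auto
    fix W assume W: "openin T W"
    define F where "F = carrier G - W"
    have F: "closedin T F" unfolding F_def using closedin_diff[OF closedin_topspace W] unfolding T .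
    \<comment> \<open>The pairs of representatives whose product falls outside \<open>W\<close>,
      presented as the image of a closed subset of \<open>Y\<close> so that they form a closed
      set.\<close>
    define Z where "Z = (\<lambda>y. (p1 y, p2 y)) ` {y \<in> topspace Y. p3 y \<in> {x \<in> topspace X. f x \<in> F}}"
    have "closed_map Y (prod_topology X X) (\<lambda>y. (p1 y, p2 y))"
      by (rule T1_Spaces.continuous_imp_closed_map) (use Y X p in \<open>auto simp: Hausdorff_space_prod_topology intro: continuous_map_pairedI\<close>)
    then have Z: "closedin (prod_topology X X) Z" unfolding Z_def closed_map_def using pre(3)[OF cX[OF F]] by blast
    have ZI: "(x, x') \<in> Z" if xx: "x \<in> topspace X" "x' \<in> topspace X" and xF: "f x \<otimes>\<^bsub>G\<^esub> f x' \<in> F" for x x'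
    proof -
      obtain y where y: "y \<in> topspace Y" "p1 y = x" "p2 y = x'" using s12[OF xx] by blast
      then have "f (p3 y) \<in> F" using mult[OF y(1)] xF y by simp
      then show ?thesis unfolding Z_def using y pc(3)[OF y(1)] by (intro image_eqI[of _ _ y]) simp_all
    qed
    have ZD: "f x \<otimes>\<^bsub>G\<^esub> f x' \<in> F" if "(x, x') \<in> Z" for x x'
      using that mult unfolding Z_def by auto
    show "openin (prod_topology T T) {z \<in> topspace (prod_topology T T). (case z of (x, y) \<Rightarrow> x \<otimes>\<^bsub>G\<^esub> y) \<in> W}"
      unfolding openin_prod_topology_alt
    proof (intro allI impI)
      fix h k assume hk: "(h, k) \<in> {z \<in> topspace (prod_topology T T). (case z of (x, y) \<Rightarrow> x \<otimes>\<^bsub>G\<^esub> y) \<in> W}"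
      then have hc: "h \<in> carrier G" "k \<in> carrier G" "h \<otimes>\<^bsub>G\<^esub> k \<in> W" using T by auto
      \<comment> \<open>The representatives of the coset of \<open>g\<close>: the saturation of a
        single point, hence compact.\<close>
      define A where "A g = {x \<in> topspace X. \<exists>l\<in>L. f x = g \<otimes>\<^bsub>G\<^esub> l}" for g
      have A: "compactin X (A g)" if g: "g \<in> carrier G" for g
      proof -
        obtain x0 where x0: "x0 \<in> topspace X" "f x0 = g" using ex[OF g] by blast
        have "A g = sat {x0}" by (simp add: A_def sat_def x0)
        then have "closedin X (A g)" using sat[OF sing[OF x0(1)]] by simp
        then show ?thesis using X(1) by (intro closedin_compact_space)
      qed
      \<comment> \<open>\<open>F\<close> is stable under multiplication by \<open>L\<close> and the
        group is commutative, so the errors \<open>l\<close> and \<open>l'\<close> can be divided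
        out.\<close>
      have sub: "A h \<times> A k \<subseteq> topspace (prod_topology X X) - Z"
      proof (rule subrelI)
        fix x x' assume "(x, x') \<in> A h \<times> A k"
        then obtain l l' where x: "x \<in> topspace X" "x' \<in> topspace X" "l \<in> L" "l' \<in> L" "f x = h \<otimes>\<^bsub>G\<^esub> l" "f x' = k \<otimes>\<^bsub>G\<^esub> l'"
          unfolding A_def by blast
        have "(x, x') \<notin> Z"
        proof
          assume "(x, x') \<in> Z"
          then have "f x \<otimes>\<^bsub>G\<^esub> f x' \<in> F" by (rule ZD)
          from FL[OF F FL[OF F this Linv[OF x(3)]] Linv[OF x(4)]]
          have "f x \<otimes>\<^bsub>G\<^esub> f x' \<otimes>\<^bsub>G\<^esub> inv\<^bsub>G\<^esub> l \<otimes>\<^bsub>G\<^esub> inv\<^bsub>G\<^esub> l' \<in> F" .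
          moreover have "f x \<otimes>\<^bsub>G\<^esub> f x' \<otimes>\<^bsub>G\<^esub> inv\<^bsub>G\<^esub> l \<otimes>\<^bsub>G\<^esub> inv\<^bsub>G\<^esub> l' = h \<otimes>\<^bsub>G\<^esub> k"
          proof -
            note c = hc(1,2) Lc[OF x(3)] Lc[OF x(4)] G.inv_closed[OF Lc[OF x(3)]] G.inv_closed[OF Lc[OF x(4)]]
            have "(h \<otimes>\<^bsub>G\<^esub> l) \<otimes>\<^bsub>G\<^esub> (k \<otimes>\<^bsub>G\<^esub> l') \<otimes>\<^bsub>G\<^esub> inv\<^bsub>G\<^esub> l \<otimes>\<^bsub>G\<^esub> inv\<^bsub>G\<^esub> l'
              = (h \<otimes>\<^bsub>G\<^esub> k) \<otimes>\<^bsub>G\<^esub> (l \<otimes>\<^bsub>G\<^esub> inv\<^bsub>G\<^esub> l) \<otimes>\<^bsub>G\<^esub> (l' \<otimes>\<^bsub>G\<^esub> inv\<^bsub>G\<^esub> l')"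
              using c by (simp only: G.m_ac G.m_closed)
            then show ?thesis using c x(5,6) by simp
          qed
          ultimately show False using hc(3) by (simp add: F_def)
        qed
        then show "(x, x') \<in> topspace (prod_topology X X) - Z" using x by simp
      qed
      have "openin (prod_topology X X) (topspace (prod_topology X X) - Z)" using Z by (simp add: closedin_def)
      from Wallace_theorem_prod_topology[OF A[OF hc(1)] A[OF hc(2)] this sub]
      obtain O1 O2 where O: "openin X O1" "openin X O2" "A h \<subseteq> O1" "A k \<subseteq> O2" "O1 \<times> O2 \<subseteq> topspace (prod_topology X X) - Z" .
      define U where "U Op = {h \<in> carrier G. \<forall>x\<in>topspace X. (\<exists>l\<in>L. f x = h \<otimes>\<^bsub>G\<^esub> l) \<longrightarrow> x \<in> Op}" for Op
      have "u \<otimes>\<^bsub>G\<^esub> v \<in> W" if uv: "u \<in> U O1" "v \<in> U O2" for u v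
      proof (rule ccontr)
        assume nW: "u \<otimes>\<^bsub>G\<^esub> v \<notin> W"
        have c: "u \<in> carrier G" "v \<in> carrier G" using uv by (auto simp: U_def)
        obtain x x' where x: "x \<in> topspace X" "f x = u" "x' \<in> topspace X" "f x' = v" using ex[OF c(1)] ex[OF c(2)] by blast
        have "x \<in> O1" using uv(1) x(1,2) c L1 G.r_one[OF c(1)] unfolding U_def by force
        moreover have "x' \<in> O2" using uv(2) x(3,4) c L1 G.r_one[OF c(2)] unfolding U_def by force
        moreover have "(x, x') \<in> Z" using ZI[OF x(1,3)] x c nW by (simp add: F_def)
        ultimately show False using O(5) by blast
      qed
      then have "U O1 \<times> U O2 \<subseteq> {z \<in> topspace (prod_topology T T). (case z of (x, y) \<Rightarrow> x \<otimes>\<^bsub>G\<^esub> y) \<in> W}"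
        using T by (auto simp: U_def)
      moreover have "h \<in> U O1" "k \<in> U O2" using O(3,4) hc by (auto simp: U_def A_def)
      moreover have "openin T (U O1)" "openin T (U O2)" unfolding U_def using open_core O(1,2) by blast+
      ultimately show "\<exists>U V. openin T U \<and> openin T V \<and> h \<in> U \<and> k \<in> V \<and>
          U \<times> V \<subseteq> {z \<in> topspace (prod_topology T T). (case z of (x, y) \<Rightarrow> x \<otimes>\<^bsub>G\<^esub> y) \<in> W}" by blast
    qed
  qed
  have "continuous_map T T (\<lambda>x. inv\<^bsub>G\<^esub> x)"
    unfolding continuous_map_closedin using inv T by auto
  then show ?thesis
    unfolding topological_group_def using cont_mult T G.group_axioms by simp
qed

text \<open>Alexander's subbase theorem concerns a topology built from unions of finite
  intersections; \<open>Y\<close> is that topology on \<open>U\<close>, and it contains every open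
  set of the subspace.\<close>

lemma compact_generated:
  assumes U: "U \<subseteq> \<Union>\<B>" and fin: "\<And>C. C \<subseteq> \<B> \<Longrightarrow> U \<subseteq> \<Union>C \<Longrightarrow> \<exists>C'. finite C' \<and> C' \<subseteq> C \<and> U \<subseteq> \<Union>C'"
  shows "compact_space (subtopology (topology_generated_by \<B>) U)"
proof -
  define Y where "Y = topology (arbitrary union_of (finite intersection_of (\<lambda>x. x \<in> \<B>) relative_to U))"
  have Y: "compact_space Y" using Alexander_subbase_alt[OF U fin] Y_def by blast
  have tY: "topspace Y = U" by (simp add: Y_def)
  have base: "openin Y (s \<inter> U)" if "s \<in> \<B>" for s
    unfolding Y_def openin_subbase
    by (rule arbitrary_union_of_inc) (metis (no_types, lifting) Int_commute finite_intersection_of_inc relative_to_inc that)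
  have gen: "openin Y (s \<inter> U)" if "generate_topology_on \<B> s" for s
    using that
  proof (induction rule: generate_topology_on.induct)
    case (Int a b)
    have "a \<inter> b \<inter> U = (a \<inter> U) \<inter> (b \<inter> U)" by blast
    then show ?case using Int by (simp add: openin_Int)
  next
    case (UN K)
    have eq: "\<Union>K \<inter> U = (\<Union>k\<in>K. k \<inter> U)" by blast
    show ?case unfolding eq by (rule openin_Union) (use UN in auto)
  qed (use base in auto)
  have op: "openin Y S" if "openin (subtopology (topology_generated_by \<B>) U) S" for S
    using that gen unfolding openin_subtopology openin_topology_generated_by_iff by blast
  have tX: "topspace (subtopology (topology_generated_by \<B>) U) = U" using U by auto
  show ?thesis
    unfolding compact_space_alt tX
  proof (intro allI impI)
    fix \<U> assume "(\<forall>W\<in>\<U>. openin (subtopology (topology_generated_by \<B>) U) W) \<and> U \<subseteq> \<Union>\<U>"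
    then have "\<forall>W\<in>\<U>. openin Y W" "topspace Y \<subseteq> \<Union>\<U>" using op tY by blast+
    then show "\<exists>\<F>. finite \<F> \<and> \<F> \<subseteq> \<U> \<and> U \<subseteq> \<Union>\<F>" using Y unfolding compact_space_alt tY by blast
  qed
qed

section \<open>Type spaces\<close>

context monster_model
begin

definition type_space :: "'k set \<Rightarrow> ('k \<Rightarrow> 'm) set \<Rightarrow> 'm set \<Rightarrow> ('s, 'f, 'r, 'm, 'k) ptype topology" where
  "type_space I \<U> D = subtopology (topology_generated_by {{t. m \<in> t} | m. True}) {tp \<MM> I u D | u. u \<in> \<U>}"

text \<open>A closed tautology belongs to every type, even without variables and parameters; this is
  why the basic open sets cover the space of types.\<close>

lemma tp_nonempty: "\<exists>m. m \<in> tp \<MM> I u D"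
proof -
  obtain v where v: "valuation \<MM> UNIV v" by (rule valuation_extend[of "{}"]) auto
  have "(Ex x (Eq (Var x) (Var x)), undefined) \<in> tp \<MM> I u D" for x
    unfolding tp_def using v by (auto intro!: exI[of _ v] exI[of _ "v x"] simp: valuation_def)
  then show ?thesis by blast
qed

lemma types_covered: "{tp \<MM> I u D | u. u \<in> \<U>} \<subseteq> \<Union>{{t. m \<in> t} | m. True}"
proof
  fix t assume "t \<in> {tp \<MM> I u D | u. u \<in> \<U>}"
  then obtain u where "t = tp \<MM> I u D" by blast
  then obtain m where "m \<in> t" using tp_nonempty[of I u D] by blast
  then show "t \<in> \<Union>{{t. m \<in> t} | m. True}" by blast
qed

lemma topspace_type_space: "topspace (type_space I \<U> D) = {tp \<MM> I u D | u. u \<in> \<U>}"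
proof -
  have "{tp \<MM> I u D | u. u \<in> \<U>} \<subseteq> \<Union>{{t. m \<in> t} | m. True}" by (rule types_covered)
  then show ?thesis by (auto simp: type_space_def)
qed

lemma openin_type_space: "openin (type_space I \<U> D) {t \<in> topspace (type_space I \<U> D). m \<in> t}"
proof -
  have "openin (topology_generated_by {{t. m \<in> t} | m. True}) {t. m \<in> t}" by (rule topology_generated_by_Basis) blast
  then have "openin (type_space I \<U> D) ({t. m \<in> t} \<inter> {tp \<MM> I u D | u. u \<in> \<U>})"
    unfolding type_space_def openin_subtopology by blast
  moreover have "{t. m \<in> t} \<inter> {tp \<MM> I u D | u. u \<in> \<U>} = {t \<in> topspace (type_space I \<U> D). m \<in> t}"
    unfolding topspace_type_space by blast
  ultimately show ?thesis by simp
qed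

text \<open>Pulls a type back along a renaming \<open>h\<close> of variables and parameters. A new
  parameter may be read as a variable of the given type, which allows a change of base.\<close>

definition reindex :: "('j + 'm \<Rightarrow> 'k + 'm) \<Rightarrow> 'j set \<Rightarrow> 'm set \<Rightarrow> ('s, 'f, 'r, 'm, 'k) ptype \<Rightarrow> ('s, 'f, 'r, 'm, 'j) ptype" where
  "reindex h J D t = {(\<phi>, e). (\<forall>x\<in>FV \<phi>. e x \<in> Inl ` J \<union> Inr ` D) \<and> (\<phi>, \<lambda>x. h (e x)) \<in> t}"

lemma tp_mem: "(\<phi>, e) \<in> tp \<MM> I u C \<longleftrightarrow> fm_ok \<MM> \<phi> \<and>
    (\<forall>x\<in>FV \<phi>. e x \<in> Inl ` I \<union> Inr ` C \<and> srt \<MM> (case_sum u id (e x)) = fst x) \<and>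
    (\<exists>v. valuation \<MM> UNIV v \<and> (\<forall>x\<in>FV \<phi>. v x = case_sum u id (e x)) \<and> sat \<MM> UNIV v \<phi>)"
  by (simp add: tp_def)

text \<open>\<open>\<theta>\<close> compares \<open>u'\<close> with the tuple read off through
  \<open>h\<close>, and satisfaction is invariant under it. It is nontrivial when the new parameters
  are read as entries that an automorphism has moved.\<close>

lemma reindex_tp:
  assumes \<theta>: "\<theta> \<in> aut \<MM>" and h: "\<And>t. t \<in> Inl ` J \<union> Inr ` D' \<Longrightarrow>
      h t \<in> Inl ` I \<union> Inr ` D \<and> case_sum u id (h t) = \<theta> (case_sum u' id t)"
  shows "reindex h J D' (tp \<MM> I u D) = tp \<MM> J u' D'"
proof -
  have "(\<phi>, e) \<in> reindex h J D' (tp \<MM> I u D) \<longleftrightarrow> (\<phi>, e) \<in> tp \<MM> J u' D'" for \<phi> e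
  proof (cases "fm_ok \<MM> \<phi> \<and> (\<forall>x\<in>FV \<phi>. e x \<in> Inl ` J \<union> Inr ` D')")
    case False
    then show ?thesis unfolding reindex_def by (auto simp: tp_mem)
  next
    case True
    define w where "w x = case_sum u' id (e x)" for x
    have hw: "h (e x) \<in> Inl ` I \<union> Inr ` D \<and> case_sum u id (h (e x)) = \<theta> (w x)" if "x \<in> FV \<phi>" for x
      using h True that unfolding w_def by blast
    have ok: "fm_ok \<MM> \<phi>" using True by simp
    have s: "(\<forall>x\<in>FV \<phi>. h (e x) \<in> Inl ` I \<union> Inr ` D \<and> srt \<MM> (case_sum u id (h (e x))) = fst x) \<longleftrightarrow>
      (\<forall>x\<in>FV \<phi>. e x \<in> Inl ` J \<union> Inr ` D' \<and> srt \<MM> (w x) = fst x)"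
      using hw True autD(2)[OF \<theta>] by (intro ball_cong) simp_all
    have v: "(\<exists>v. valuation \<MM> UNIV v \<and> (\<forall>x\<in>FV \<phi>. v x = case_sum u id (h (e x))) \<and> sat \<MM> UNIV v \<phi>) \<longleftrightarrow>
      (\<exists>v. valuation \<MM> UNIV v \<and> (\<forall>x\<in>FV \<phi>. v x = w x) \<and> sat \<MM> UNIV v \<phi>)" (is "?A \<longleftrightarrow> ?B")
    proof
      assume ?A
      then obtain v where v: "valuation \<MM> UNIV v" "\<And>x. x \<in> FV \<phi> \<Longrightarrow> v x = case_sum u id (h (e x))" "sat \<MM> UNIV v \<phi>" by blast
      have "valuation \<MM> UNIV (\<lambda>x. ainv \<theta> (v x))" using v(1) autD(2)[OF inv_aut[OF \<theta>]] by (simp add: valuation_def)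
      moreover have "sat \<MM> UNIV (\<lambda>x. ainv \<theta> (v x)) \<phi>" using aut_sat[OF inv_aut[OF \<theta>] ok v(1)] v(3) by simp
      moreover have "ainv \<theta> (v x) = w x" if "x \<in> FV \<phi>" for x using v(2)[OF that] hw[OF that] \<theta> by simp
      ultimately show ?B by blast
    next
      assume ?B
      then obtain v where v: "valuation \<MM> UNIV v" "\<And>x. x \<in> FV \<phi> \<Longrightarrow> v x = w x" "sat \<MM> UNIV v \<phi>" by blast
      have "valuation \<MM> UNIV (\<lambda>x. \<theta> (v x))" using v(1) autD(2)[OF \<theta>] by (simp add: valuation_def)
      moreover have "sat \<MM> UNIV (\<lambda>x. \<theta> (v x)) \<phi>" using aut_sat[OF \<theta> ok v(1)] v(3) by simp
      moreover have "\<theta> (v x) = case_sum u id (h (e x))" if "x \<in> FV \<phi>" for x using v(2)[OF that] hw[OF that] by simp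
      ultimately show ?A by blast
    qed
    have "(\<phi>, e) \<in> reindex h J D' (tp \<MM> I u D) \<longleftrightarrow> (\<phi>, \<lambda>x. h (e x)) \<in> tp \<MM> I u D"
      unfolding reindex_def using True by simp
    also have "\<dots> \<longleftrightarrow> (\<phi>, e) \<in> tp \<MM> J u' D'" unfolding tp_mem s v w_def[symmetric] ..
    finally show ?thesis .
  qed
  then show ?thesis by auto
qed

lemma reindex_continuous:
  fixes J :: "'j set"
  assumes "reindex h J D' ` topspace (type_space I \<U> D) \<subseteq> topspace (type_space J \<U>' D')"
  shows "continuous_map (type_space I \<U> D) (type_space J \<U>' D') (reindex h J D')"
proof -
  have "continuous_map (type_space I \<U> D) (topology_generated_by {{t. m \<in> t} | m. True}) (reindex h J D')"
    unfolding continuous_on_generated_topo_iff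
  proof (intro conjI allI impI)
    fix V :: "('s, 'f, 'r, 'm, 'j) ptype set" assume "V \<in> {{t. m \<in> t} | m. True}"
    then obtain m where "V = {t. m \<in> t}" by blast
    then obtain \<phi> e where V: "V = {t. (\<phi>, e) \<in> t}" by (cases m) simp
    have "reindex h J D' -` V \<inter> topspace (type_space I \<U> D) =
      (if \<forall>x\<in>FV \<phi>. e x \<in> Inl ` J \<union> Inr ` D' then {t \<in> topspace (type_space I \<U> D). (\<phi>, \<lambda>x. h (e x)) \<in> t} else {})"
      unfolding V reindex_def by auto
    then show "openin (type_space I \<U> D) (reindex h J D' -` V \<inter> topspace (type_space I \<U> D))"
      by (simp add: openin_type_space)
  next
    show "reindex h J D' ` topspace (type_space I \<U> D) \<subseteq> \<Union>{{t. m \<in> t} | m. True}"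
      by (rule order_trans[OF assms]) (unfold topspace_type_space, rule types_covered)
  qed
  then show ?thesis
    unfolding type_space_def[of J]
    using assms unfolding topspace_type_space by (intro continuous_map_into_subtopology) (auto simp: topspace_type_space)
qed

text \<open>All tuples in \<open>\<U>\<close> have the same sorts, so a formula that is well-sorted
  for one of them is so for all, and each type contains exactly one of it and its negation.\<close>

lemma Hausdorff_type_space:
  assumes srt: "\<And>u i. u \<in> \<U> \<Longrightarrow> i \<in> I \<Longrightarrow> srt \<MM> (u i) = s i"
  shows "Hausdorff_space (type_space I \<U> D)"
  unfolding Hausdorff_space_def
proof (intro allI impI)
  have neg: "(Neg \<phi>, e) \<in> tp \<MM> I u D \<longleftrightarrow> (\<phi>, e) \<notin> tp \<MM> I u D"
    if u: "u \<in> \<U>" "u' \<in> \<U>" and m: "(\<phi>, e) \<in> tp \<MM> I u' D" for u u' \<phi> e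
  proof -
    have ok: "fm_ok \<MM> \<phi>" and e: "\<And>x. x \<in> FV \<phi> \<Longrightarrow> e x \<in> Inl ` I \<union> Inr ` D \<and> srt \<MM> (case_sum u' id (e x)) = fst x"
      using m by (auto simp: tp_mem)
    define s' where "s' t = srt \<MM> (case_sum u id t)" for t
    have e': "e x \<in> Inl ` I \<union> Inr ` D \<and> s' (e x) = fst x" if "x \<in> FV \<phi>" for x
      using e[OF that] srt u unfolding s'_def by auto
    obtain v where v: "valuation \<MM> UNIV v" "\<And>x. x \<in> FV \<phi> \<Longrightarrow> v x = case_sum u id (e x)"
    proof (rule valuation_extend[of "FV \<phi>" "\<lambda>x. case_sum u id (e x)"])
      show "srt \<MM> (case_sum u id (e x)) = fst x" if "x \<in> FV \<phi>" for x using e'[OF that] by (simp add: s'_def)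
    qed blast
    have so: "sorted_on \<MM> s' (Inl ` I \<union> Inr ` D) (case_sum u id)" by (simp add: sorted_on_def s'_def)
    have "(\<phi>, e) \<in> tp \<MM> I u D \<longleftrightarrow> sat \<MM> UNIV v \<phi>" by (rule tp_mem_dfn[OF ok e' so v])
    moreover have "(Neg \<phi>, e) \<in> tp \<MM> I u D \<longleftrightarrow> sat \<MM> UNIV v (Neg \<phi>)"
      by (rule tp_mem_dfn[OF _ _ so v(1)]) (use ok e' v(2) in auto)
    ultimately show ?thesis by simp
  qed
  have sep: "\<exists>U V. openin (type_space I \<U> D) U \<and> openin (type_space I \<U> D) V \<and> x \<in> U \<and> y \<in> V \<and> disjnt U V"
    if xy: "x \<in> topspace (type_space I \<U> D)" "y \<in> topspace (type_space I \<U> D)" and m: "(\<phi>, e) \<in> x" "(\<phi>, e) \<notin> y" for x y \<phi> e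
  proof (intro exI conjI)
    let ?T = "topspace (type_space I \<U> D)"
    obtain u u' where u: "u \<in> \<U>" "x = tp \<MM> I u D" "u' \<in> \<U>" "y = tp \<MM> I u' D" using xy unfolding topspace_type_space by blast
    show "openin (type_space I \<U> D) {t \<in> ?T. (\<phi>, e) \<in> t}" "openin (type_space I \<U> D) {t \<in> ?T. (Neg \<phi>, e) \<in> t}"
      by (rule openin_type_space)+
    show "x \<in> {t \<in> ?T. (\<phi>, e) \<in> t}" using xy m by simp
    have "(Neg \<phi>, e) \<in> y" using neg[OF u(3,1)] m u by simp
    then show "y \<in> {t \<in> ?T. (Neg \<phi>, e) \<in> t}" using xy by simp
    show "disjnt {t \<in> ?T. (\<phi>, e) \<in> t} {t \<in> ?T. (Neg \<phi>, e) \<in> t}"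
      unfolding disjnt_iff
    proof (intro allI notI)
      fix t assume "t \<in> {t \<in> ?T. (\<phi>, e) \<in> t} \<and> t \<in> {t \<in> ?T. (Neg \<phi>, e) \<in> t}"
      then obtain w where w: "w \<in> \<U>" "(\<phi>, e) \<in> tp \<MM> I w D" "(Neg \<phi>, e) \<in> tp \<MM> I w D" unfolding topspace_type_space by blast
      then show False using neg[OF w(1,1,2)] by simp
    qed
  qed
  fix x y assume xy: "x \<in> topspace (type_space I \<U> D) \<and> y \<in> topspace (type_space I \<U> D) \<and> x \<noteq> y"
  then consider \<phi> e where "(\<phi>, e) \<in> x" "(\<phi>, e) \<notin> y" | \<phi> e where "(\<phi>, e) \<in> y" "(\<phi>, e) \<notin> x" by auto
  then show "\<exists>U V. openin (type_space I \<U> D) U \<and> openin (type_space I \<U> D) V \<and> x \<in> U \<and> y \<in> V \<and> disjnt U V"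
  proof cases
    case 1
    show ?thesis by (rule sep[OF conjunct1[OF xy] conjunct1[OF conjunct2[OF xy]] 1])
  next
    case 2
    from sep[OF conjunct1[OF conjunct2[OF xy]] conjunct1[OF xy] 2]
    obtain U V where "openin (type_space I \<U> D) U" "openin (type_space I \<U> D) V" "y \<in> U" "x \<in> V" "disjnt U V"
      by (elim exE conjE)
    then show ?thesis by (intro exI[of _ V] exI[of _ U]) (simp add: disjnt_sym)
  qed
qed

definition aut_pairs :: "('m + 'm \<Rightarrow> 'm) set" where
  "aut_pairs = {case_sum \<sigma> \<rho> | \<sigma> \<rho>. \<sigma> \<in> aut \<MM> \<and> \<rho> \<in> aut \<MM>}"

text \<open>If there were no finite subcover, any finitely many formulas of the cover could be
  avoided; by compactness a pair of tuples avoids all of them. Homogeneity turns both halves into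
  restrictions of automorphisms, so the pair contradicts the covering.\<close>

lemma compact_pair_space:
  assumes M: "small M" and D: "small D"
  shows "compact_space (type_space (M <+> M) aut_pairs D)"
  unfolding type_space_def
proof (rule compact_generated)
  show "{tp \<MM> (M <+> M) u D | u. u \<in> aut_pairs} \<subseteq> \<Union>{{t. m \<in> t} | m. True}" by (rule types_covered)
  fix C assume C: "C \<subseteq> {{t. m \<in> t} | m. True}" and cov: "{tp \<MM> (M <+> M) u D | u. u \<in> aut_pairs} \<subseteq> \<Union>C"
  define \<Gamma> where "\<Gamma> = {m. {t. m \<in> t} \<in> C}"
  have \<Gamma>: "\<exists>m\<in>\<Gamma>. m \<in> tp \<MM> (M <+> M) u D" if "u \<in> aut_pairs" for u
  proof -
    have "tp \<MM> (M <+> M) u D \<in> \<Union>C" by (rule subsetD[OF cov]) (use that in blast)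
    then obtain c where c: "c \<in> C" "tp \<MM> (M <+> M) u D \<in> c" by (rule UnionE)
    from subsetD[OF C c(1)] obtain m where m: "c = {t. m \<in> t}" by blast
    have "m \<in> \<Gamma>" using c(1) unfolding m \<Gamma>_def by simp
    moreover have "m \<in> tp \<MM> (M <+> M) u D" using c(2) unfolding m by simp
    ultimately show ?thesis by (rule rev_bexI)
  qed
  have "\<exists>\<Gamma>0. finite \<Gamma>0 \<and> \<Gamma>0 \<subseteq> \<Gamma> \<and> (\<forall>u\<in>aut_pairs. \<exists>m\<in>\<Gamma>0. m \<in> tp \<MM> (M <+> M) u D)"
  proof (rule ccontr)
    assume nex: "\<not> ?thesis"
    have no: "\<exists>u\<in>aut_pairs. \<forall>m\<in>\<Gamma>0. m \<notin> tp \<MM> (M <+> M) u D" if "finite \<Gamma>0" "\<Gamma>0 \<subseteq> \<Gamma>" for \<Gamma>0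
    proof (rule ccontr)
      assume "\<not> (\<exists>u\<in>aut_pairs. \<forall>m\<in>\<Gamma>0. m \<notin> tp \<MM> (M <+> M) u D)"
      then have "finite \<Gamma>0 \<and> \<Gamma>0 \<subseteq> \<Gamma> \<and> (\<forall>u\<in>aut_pairs. \<exists>m\<in>\<Gamma>0. m \<in> tp \<MM> (M <+> M) u D)" using that by simp
      then show False by - (rule notE[OF nex], rule exI[of _ \<Gamma>0])
    qed
    define s where "s = case_sum (case_sum (srt \<MM>) (srt \<MM>)) (srt \<MM>)"
    define I where "I = (Inl ` (M <+> M) :: (('m + 'm) + 'm) set)"
    define A where "A = (Inr ` D :: (('m + 'm) + 'm) set)"
    define u0 where "u0 = (case_sum undefined id :: ('m + 'm) + 'm \<Rightarrow> 'm)"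
    \<comment> \<open>Membership in a type splits into a condition \<open>wfc\<close> on the formula
      and its assignment, which is the same for all pairs because it depends on sorts only, and
      truth at the tuple.\<close>
    define wfc where "wfc m \<longleftrightarrow> fm_ok \<MM> (fst m) \<and> (\<forall>x\<in>FV (fst m). snd m x \<in> I \<union> A \<and> s (snd m x) = fst x)" for m
    define hold where "hold m u \<longleftrightarrow> (\<exists>v. valuation \<MM> UNIV v \<and> (\<forall>x\<in>FV (fst m). v x = u (snd m x)) \<and> sat \<MM> UNIV v (fst m))"
      for m :: "('s, 'f, 'r) fm \<times> ('s var \<Rightarrow> ('m + 'm) + 'm)" and u
    \<comment> \<open>\<open>\<P>1\<close> and \<open>\<P>2\<close> make the two halves conjugates
      of \<open>M\<close> enumerated by itself, and \<open>\<P>3\<close> keeps the pair out of the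
      cover.\<close>
    define \<P>1 where "\<P>1 = (\<lambda>Q (u :: ('m + 'm) + 'm \<Rightarrow> 'm). Q (\<lambda>x. u (Inl (Inl x)))) ` {Q. dfn \<MM> (srt \<MM>) M Q \<and> Q id}"
    define \<P>2 where "\<P>2 = (\<lambda>Q (u :: ('m + 'm) + 'm \<Rightarrow> 'm). Q (\<lambda>x. u (Inl (Inr x)))) ` {Q. dfn \<MM> (srt \<MM>) M Q \<and> Q id}"
    define \<P>3 where "\<P>3 = (\<lambda>m u. \<not> hold m u) ` {m \<in> \<Gamma>. wfc m}"
    have mem: "m \<in> tp \<MM> (M <+> M) u D \<longleftrightarrow> wfc m \<and> hold m (case_sum u id)"
      if u: "\<And>x. x \<in> M \<Longrightarrow> srt \<MM> (u (Inl x)) = srt \<MM> x" "\<And>x. x \<in> M \<Longrightarrow> srt \<MM> (u (Inr x)) = srt \<MM> x" for m u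
    proof -
      have "(t \<in> I \<union> A \<and> s t = z) \<longleftrightarrow> (t \<in> Inl ` (M <+> M) \<union> Inr ` D \<and> srt \<MM> (case_sum u id t) = z)" for t z
        using u by (auto simp: I_def A_def s_def)
      then show ?thesis by (cases m) (simp add: tp_mem wfc_def hold_def)
    qed
    have hold_dfn: "dfn \<MM> s (I \<union> A) (hold m)" if "wfc m" for m
      unfolding dfn_def
    proof (intro exI conjI allI impI)
      show "fm_ok \<MM> (fst m)" "\<forall>x\<in>FV (fst m). snd m x \<in> I \<union> A \<and> s (snd m x) = fst x" using that by (simp_all add: wfc_def)
      fix u v assume v: "valuation \<MM> UNIV v" "\<forall>x\<in>FV (fst m). v x = u (snd m x)"
      have "sat \<MM> UNIV w (fst m) = sat \<MM> UNIV v (fst m)" if "\<forall>x\<in>FV (fst m). w x = u (snd m x)" for w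
        by (rule sat_cong) (use that v(2) in simp)
      then show "hold m u = sat \<MM> UNIV v (fst m)" unfolding hold_def using v by blast
    qed
    have "\<exists>u. sorted_on \<MM> s (I \<union> A) u \<and> (\<forall>t\<in>A. u t = u0 t) \<and> (\<forall>P\<in>\<P>1 \<union> \<P>2 \<union> \<P>3. P u)"
    proof (rule compactness)
      have "|M <+> M| <o |UNIV :: 'm set|"
        unfolding Plus_def using M by (intro card_Un card_image) (simp_all add: small_def)
      then show "|I| <o |UNIV :: 'm set|" unfolding I_def by (rule card_image)
      show "|A| <o |UNIV :: 'm set|" unfolding A_def using D by (intro card_image) (simp add: small_def)
      show "I \<inter> A = {}" by (auto simp: I_def A_def)
      show "sorted_on \<MM> s A u0" by (auto simp: sorted_on_def A_def s_def u0_def)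
      fix P assume "P \<in> \<P>1 \<union> \<P>2 \<union> \<P>3"
      then consider "P \<in> \<P>1" | "P \<in> \<P>2" | "P \<in> \<P>3" by blast
      then show "dfn \<MM> s (I \<union> A) P"
      proof cases
        case 1
        then obtain Q where Q: "dfn \<MM> (srt \<MM>) M Q" "P = (\<lambda>u. Q (\<lambda>x. u (Inl (Inl x))))" unfolding \<P>1_def by blast
        show ?thesis unfolding Q(2) by (rule dfn_reindex[OF Q(1)]) (auto simp: I_def s_def)
      next
        case 2
        then obtain Q where Q: "dfn \<MM> (srt \<MM>) M Q" "P = (\<lambda>u. Q (\<lambda>x. u (Inl (Inr x))))" unfolding \<P>2_def by blast
        show ?thesis unfolding Q(2) by (rule dfn_reindex[OF Q(1)]) (auto simp: I_def s_def)
      next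
        case 3
        then obtain m where "wfc m" "P = (\<lambda>u. \<not> hold m u)" unfolding \<P>3_def by blast
        then show ?thesis using dfn_Not[OF hold_dfn] by simp
      qed
    next
      fix F assume F: "finite F" "F \<subseteq> \<P>1 \<union> \<P>2 \<union> \<P>3"
      have "finite (F \<inter> \<P>3)" "F \<inter> \<P>3 \<subseteq> (\<lambda>m u. \<not> hold m u) ` {m \<in> \<Gamma>. wfc m}" using F(1) by (auto simp: \<P>3_def)
      from finite_subset_image[OF this] obtain \<Gamma>0 where \<Gamma>0: "\<Gamma>0 \<subseteq> {m \<in> \<Gamma>. wfc m}" "finite \<Gamma>0" "F \<inter> \<P>3 = (\<lambda>m u. \<not> hold m u) ` \<Gamma>0"
        by blast
      have "\<Gamma>0 \<subseteq> \<Gamma>" using \<Gamma>0(1) by blast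
      from no[OF \<Gamma>0(2) this] obtain \<sigma> \<rho> where sr: "\<sigma> \<in> aut \<MM>" "\<rho> \<in> aut \<MM>" "\<forall>m\<in>\<Gamma>0. m \<notin> tp \<MM> (M <+> M) (case_sum \<sigma> \<rho>) D"
        unfolding aut_pairs_def by blast
      define u where "u = case_sum (case_sum \<sigma> \<rho>) id"
      have Qa: "Q \<tau>" if "\<tau> \<in> aut \<MM>" "dfn \<MM> (srt \<MM>) M Q" "Q id" for Q \<tau>
      proof -
        have "eqtp (srt \<MM>) M id (\<lambda>t. \<tau> (id t))" by (rule eqtp_aut[OF that(1)]) (simp add: sorted_on_def)
        then have "Q id = Q (\<lambda>t. \<tau> (id t))" using that(2) unfolding eqtp_def by blast
        then show ?thesis using that(3) by simp
      qed
      have "P u" if P: "P \<in> F" for P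
      proof -
        consider "P \<in> \<P>1" | "P \<in> \<P>2" | "P \<in> F \<inter> \<P>3" using P F(2) by blast
        then show ?thesis
        proof cases
          case 1
          then obtain Q where "dfn \<MM> (srt \<MM>) M Q" "Q id" "P = (\<lambda>u. Q (\<lambda>x. u (Inl (Inl x))))" unfolding \<P>1_def by blast
          then show ?thesis using Qa[OF sr(1)] by (simp add: u_def)
        next
          case 2
          then obtain Q where "dfn \<MM> (srt \<MM>) M Q" "Q id" "P = (\<lambda>u. Q (\<lambda>x. u (Inl (Inr x))))" unfolding \<P>2_def by blast
          then show ?thesis using Qa[OF sr(2)] by (simp add: u_def)
        next
          case 3
          then obtain m where m: "m \<in> \<Gamma>0" "P = (\<lambda>u. \<not> hold m u)" unfolding \<Gamma>0(3) by blast
          have "m \<notin> tp \<MM> (M <+> M) (case_sum \<sigma> \<rho>) D" using sr(3) m(1) by blast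
          moreover have "wfc m" using m(1) \<Gamma>0(1) by blast
          ultimately have "\<not> hold m u" unfolding u_def using mem[of "case_sum \<sigma> \<rho>" m] autD(2) sr(1,2) by simp
          then show ?thesis by (simp add: m(2))
        qed
      qed
      moreover have "sorted_on \<MM> s (I \<union> A) u"
        using autD(2) sr(1,2) by (auto simp: sorted_on_def I_def A_def s_def u_def)
      moreover have "\<forall>t\<in>A. u t = u0 t" by (auto simp: A_def u_def u0_def)
      ultimately show "\<exists>u. sorted_on \<MM> s (I \<union> A) u \<and> (\<forall>t\<in>A. u t = u0 t) \<and> (\<forall>P\<in>F. P u)" by blast
    qed
    then obtain u where u: "sorted_on \<MM> s (I \<union> A) u" "\<And>t. t \<in> A \<Longrightarrow> u t = u0 t"
      "\<And>P. P \<in> \<P>1 \<Longrightarrow> P u" "\<And>P. P \<in> \<P>2 \<Longrightarrow> P u" "\<And>P. P \<in> \<P>3 \<Longrightarrow> P u" by blast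
    have half: "\<exists>\<sigma>\<in>aut \<MM>. \<forall>x\<in>M. w x = \<sigma> x"
      if w: "\<And>Q. dfn \<MM> (srt \<MM>) M Q \<Longrightarrow> Q id \<Longrightarrow> Q w" and ws: "sorted_on \<MM> (srt \<MM>) M w" for w
    proof -
      have "eqtp (srt \<MM>) M id w"
        unfolding eqtp_def
      proof (intro conjI allI impI)
        show "sorted_on \<MM> (srt \<MM>) M id" by (simp add: sorted_on_def)
        fix Q assume Q: "dfn \<MM> (srt \<MM>) M Q"
        show "Q id = Q w" using w[OF Q] w[OF dfn_Not[OF Q]] by blast
      qed (rule ws)
      then obtain \<sigma> where "\<sigma> \<in> aut \<MM>" "\<And>t. t \<in> M \<Longrightarrow> w t = \<sigma> (id t)"
        by (rule homogeneity) (use M in \<open>auto simp: small_def\<close>)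
      then show ?thesis by auto
    qed
    have "\<exists>\<sigma>\<in>aut \<MM>. \<forall>x\<in>M. u (Inl (Inl x)) = \<sigma> x"
    proof (rule half)
      show "Q (\<lambda>x. u (Inl (Inl x)))" if "dfn \<MM> (srt \<MM>) M Q" "Q id" for Q
        by (rule u(3)[unfolded \<P>1_def]) (use that in blast)
      show "sorted_on \<MM> (srt \<MM>) M (\<lambda>x. u (Inl (Inl x)))"
        unfolding sorted_on_def
      proof
        fix x assume "x \<in> M"
        then have "Inl (Inl x) \<in> I \<union> A" unfolding I_def by (intro UnI1 imageI InlI InrI)
        then have "srt \<MM> (u (Inl (Inl x))) = s (Inl (Inl x))" using u(1) unfolding sorted_on_def by blast
        then show "srt \<MM> (u (Inl (Inl x))) = srt \<MM> x" by (simp add: s_def)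
      qed
    qed
    then obtain \<sigma> where \<sigma>: "\<sigma> \<in> aut \<MM>" "\<And>x. x \<in> M \<Longrightarrow> u (Inl (Inl x)) = \<sigma> x" by blast
    have "\<exists>\<sigma>\<in>aut \<MM>. \<forall>x\<in>M. u (Inl (Inr x)) = \<sigma> x"
    proof (rule half)
      show "Q (\<lambda>x. u (Inl (Inr x)))" if "dfn \<MM> (srt \<MM>) M Q" "Q id" for Q
        by (rule u(4)[unfolded \<P>2_def]) (use that in blast)
      show "sorted_on \<MM> (srt \<MM>) M (\<lambda>x. u (Inl (Inr x)))"
        unfolding sorted_on_def
      proof
        fix x assume "x \<in> M"
        then have "Inl (Inr x) \<in> I \<union> A" unfolding I_def by (intro UnI1 imageI InlI InrI)
        then have "srt \<MM> (u (Inl (Inr x))) = s (Inl (Inr x))" using u(1) unfolding sorted_on_def by blast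
        then show "srt \<MM> (u (Inl (Inr x))) = srt \<MM> x" by (simp add: s_def)
      qed
    qed
    then obtain \<rho> where \<rho>: "\<rho> \<in> aut \<MM>" "\<And>x. x \<in> M \<Longrightarrow> u (Inl (Inr x)) = \<rho> x" by blast
    have "case_sum \<sigma> \<rho> \<in> aut_pairs" using \<sigma>(1) \<rho>(1) by (auto simp: aut_pairs_def)
    then obtain m where m: "m \<in> \<Gamma>" "m \<in> tp \<MM> (M <+> M) (case_sum \<sigma> \<rho>) D" using \<Gamma> by blast
    then have wm: "wfc m" and hm: "hold m (case_sum (case_sum \<sigma> \<rho>) id)"
      using mem[of "case_sum \<sigma> \<rho>" m] autD(2) \<sigma>(1) \<rho>(1) by simp_all
    have "u t = case_sum (case_sum \<sigma> \<rho>) id t" if "t \<in> I \<union> A" for t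
      using that \<sigma>(2) \<rho>(2) u(2)[of t] by (auto simp: I_def A_def u0_def)
    then have "u (snd m x) = case_sum (case_sum \<sigma> \<rho>) id (snd m x)" if "x \<in> FV (fst m)" for x
      using wm that unfolding wfc_def by blast
    then have "hold m u" using hm unfolding hold_def by simp
    moreover have "(\<lambda>u. \<not> hold m u) \<in> \<P>3" unfolding \<P>3_def using m(1) wm by blast
    then have "\<not> hold m u" by (rule u(5))
    ultimately show False by blast
  qed
  then obtain \<Gamma>0 where \<Gamma>0: "finite \<Gamma>0" "\<Gamma>0 \<subseteq> \<Gamma>" "\<forall>u\<in>aut_pairs. \<exists>m\<in>\<Gamma>0. m \<in> tp \<MM> (M <+> M) u D" by blast
  show "\<exists>C'. finite C' \<and> C' \<subseteq> C \<and> {tp \<MM> (M <+> M) u D | u. u \<in> aut_pairs} \<subseteq> \<Union>C'"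
  proof (intro exI conjI)
    show "finite ((\<lambda>m. {t. m \<in> t}) ` \<Gamma>0)" using \<Gamma>0(1) by simp
    show "(\<lambda>m. {t. m \<in> t}) ` \<Gamma>0 \<subseteq> C" using \<Gamma>0(2) by (auto simp: \<Gamma>_def)
    show "{tp \<MM> (M <+> M) u D | u. u \<in> aut_pairs} \<subseteq> \<Union>((\<lambda>m. {t. m \<in> t}) ` \<Gamma>0)"
    proof
      fix t assume "t \<in> {tp \<MM> (M <+> M) u D | u. u \<in> aut_pairs}"
      then obtain u where u: "u \<in> aut_pairs" "t = tp \<MM> (M <+> M) u D" by blast
      with \<Gamma>0(3) obtain m where "m \<in> \<Gamma>0" "m \<in> t" by blast
      then show "t \<in> \<Union>((\<lambda>m. {t. m \<in> t}) ` \<Gamma>0)" by (intro UN_I[of m]) simp_all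
    qed
  qed
qed

end

section \<open>The topology on the first homology group\<close>

context monster_model
begin

lemma stone_space_eq: "stone_space \<MM> M D = type_space M (aut \<MM>) D"
  by (simp add: stone_space_def type_space_def)

lemma Hausdorff_stone_space: "Hausdorff_space (stone_space \<MM> M D)"
  unfolding stone_space_eq by (rule Hausdorff_type_space[where s = "srt \<MM>"]) (simp add: autD(2))

lemma topspace_stone_space: "topspace (stone_space \<MM> M D) = (\<lambda>\<sigma>. tp \<MM> M \<sigma> D) ` aut \<MM>"
  unfolding stone_space_eq topspace_type_space by blast

abbreviation pair_space :: "'m set \<Rightarrow> 'm set \<Rightarrow> ('s, 'f, 'r, 'm, 'm + 'm) ptype topology" where
  "pair_space M D \<equiv> type_space (M <+> M) aut_pairs D"

lemma pair_spaceE: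
  assumes "t \<in> topspace (pair_space M D)"
  obtains \<sigma> \<rho> where "\<sigma> \<in> aut \<MM>" "\<rho> \<in> aut \<MM>" "t = tp \<MM> (M <+> M) (case_sum \<sigma> \<rho>) D"
proof -
  obtain u where "u \<in> aut_pairs" "t = tp \<MM> (M <+> M) u D" using assms unfolding topspace_type_space by blast
  moreover from this(1) obtain \<sigma> \<rho> where "u = case_sum \<sigma> \<rho>" "\<sigma> \<in> aut \<MM>" "\<rho> \<in> aut \<MM>" unfolding aut_pairs_def by blast
  ultimately show thesis using that by blast
qed

lemma pair_spaceI:
  "\<sigma> \<in> aut \<MM> \<Longrightarrow> \<rho> \<in> aut \<MM> \<Longrightarrow> tp \<MM> (M <+> M) (case_sum \<sigma> \<rho>) D \<in> topspace (pair_space M D)"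
  unfolding topspace_type_space aut_pairs_def by blast

text \<open>The three maps send the type of \<open>(\<sigma>, \<rho>)\<close> to the types of \<open>\<sigma>\<close>, \<open>\<rho>\<close> and \<open>\<sigma>\<inverse>\<rho>\<close>. The last one is only
  available over \<open>M\<close> itself: \<open>tp(\<rho>M / \<sigma>M)\<close> is transported to a type over \<open>M\<close> by \<open>\<sigma>\<inverse>\<close>.\<close>

abbreviation pr1 where "pr1 M D \<equiv> reindex (case_sum (Inl \<circ> Inl) Inr) M D"
abbreviation pr2 where "pr2 M D \<equiv> reindex (case_sum (Inl \<circ> Inr) Inr) M D"
abbreviation pr_diff where "pr_diff M \<equiv> reindex (case_sum (Inl \<circ> Inr) (Inl \<circ> Inl)) M M"

lemma pr_tp:
  assumes "\<sigma> \<in> aut \<MM>"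
  shows "pr1 M D (tp \<MM> (M <+> M) (case_sum \<sigma> \<rho>) D) = tp \<MM> M \<sigma> D"
    and "pr2 M D (tp \<MM> (M <+> M) (case_sum \<sigma> \<rho>) D) = tp \<MM> M \<rho> D"
    and "pr_diff M (tp \<MM> (M <+> M) (case_sum \<sigma> \<rho>) M) = tp \<MM> M (ainv \<sigma> \<circ> \<rho>) M"
proof -
  show "pr1 M D (tp \<MM> (M <+> M) (case_sum \<sigma> \<rho>) D) = tp \<MM> M \<sigma> D"
    by (rule reindex_tp[OF id_aut]) auto
  show "pr2 M D (tp \<MM> (M <+> M) (case_sum \<sigma> \<rho>) D) = tp \<MM> M \<rho> D"
    by (rule reindex_tp[OF id_aut]) auto
  show "pr_diff M (tp \<MM> (M <+> M) (case_sum \<sigma> \<rho>) M) = tp \<MM> M (ainv \<sigma> \<circ> \<rho>) M"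
    by (rule reindex_tp[OF assms]) (use assms in auto)
qed

lemma pr_continuous:
  shows "continuous_map (pair_space M D) (stone_space \<MM> M D) (pr1 M D)"
    and "continuous_map (pair_space M D) (stone_space \<MM> M D) (pr2 M D)"
    and "continuous_map (pair_space M M) (stone_space \<MM> M M) (pr_diff M)"
proof -
  have *: "F ` topspace (pair_space M D) \<subseteq> topspace (type_space M (aut \<MM>) D')"
    if "\<And>\<sigma> \<rho>. \<sigma> \<in> aut \<MM> \<Longrightarrow> \<rho> \<in> aut \<MM> \<Longrightarrow> \<exists>\<tau>\<in>aut \<MM>. F (tp \<MM> (M <+> M) (case_sum \<sigma> \<rho>) D) = tp \<MM> M \<tau> D'" for F D D'
  proof
    fix x assume "x \<in> F ` topspace (pair_space M D)"
    then obtain t where t: "t \<in> topspace (pair_space M D)" "x = F t" by blast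
    obtain \<sigma> \<rho> where sr: "\<sigma> \<in> aut \<MM>" "\<rho> \<in> aut \<MM>" "t = tp \<MM> (M <+> M) (case_sum \<sigma> \<rho>) D" using pair_spaceE[OF t(1)] .
    from that[OF sr(1,2)] obtain \<tau> where "\<tau> \<in> aut \<MM>" "x = tp \<MM> M \<tau> D'" unfolding t(2) sr(3) by blast
    then show "x \<in> topspace (type_space M (aut \<MM>) D')" unfolding topspace_type_space by blast
  qed
  show "continuous_map (pair_space M D) (stone_space \<MM> M D) (pr1 M D)"
    "continuous_map (pair_space M D) (stone_space \<MM> M D) (pr2 M D)"
    "continuous_map (pair_space M M) (stone_space \<MM> M M) (pr_diff M)"
    unfolding stone_space_eq
    by (rule reindex_continuous, rule *, metis pr_tp comp_aut inv_aut)+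
qed

text \<open>An image of the pair space: the diagonal shows that the first projection is
  onto.\<close>

lemma compact_stone_space:
  assumes "small M" "small D"
  shows "compact_space (stone_space \<MM> M D)"
proof -
  have "pr1 M D ` topspace (pair_space M D) = topspace (stone_space \<MM> M D)"
  proof
    show "pr1 M D ` topspace (pair_space M D) \<subseteq> topspace (stone_space \<MM> M D)"
      by (rule continuous_map_image_subset_topspace[OF pr_continuous(1)])
    show "topspace (stone_space \<MM> M D) \<subseteq> pr1 M D ` topspace (pair_space M D)"
    proof
      fix x assume "x \<in> topspace (stone_space \<MM> M D)"
      then obtain \<sigma> where \<sigma>: "\<sigma> \<in> aut \<MM>" "x = tp \<MM> M \<sigma> D" unfolding topspace_stone_space by blast
      show "x \<in> pr1 M D ` topspace (pair_space M D)"
        unfolding \<sigma>(2) pr_tp(1)[OF \<sigma>(1), of M D \<sigma>, symmetric] by (intro imageI pair_spaceI \<sigma>(1))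
    qed
  qed
  then show ?thesis
    using image_compactin[OF compact_pair_space[OF assms, unfolded compact_space_def] pr_continuous(1)]
    by (simp add: compact_space_def)
qed

text \<open>A continuous surjection from a compact space to a Hausdorff space is a quotient map.
  This lets the parameter set be changed without changing an induced quotient topology.\<close>

lemma restrict_quotient_map:
  assumes "small M" "small D" "N \<subseteq> D"
  shows "quotient_map (stone_space \<MM> M D) (stone_space \<MM> M N) (reindex id M N)"
    and "reindex id M N (tp \<MM> M \<sigma> D) = tp \<MM> M \<sigma> N"
proof -
  have val: "reindex id M N (tp \<MM> M \<sigma> D) = tp \<MM> M \<sigma> N" for \<sigma>
    by (rule reindex_tp[OF id_aut]) (use assms(3) in auto)
  then show "reindex id M N (tp \<MM> M \<sigma> D) = tp \<MM> M \<sigma> N" .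
  have img: "reindex id M N ` topspace (stone_space \<MM> M D) = topspace (stone_space \<MM> M N)"
    unfolding topspace_stone_space image_image val ..
  have c: "continuous_map (stone_space \<MM> M D) (stone_space \<MM> M N) (reindex id M N)"
    unfolding stone_space_eq by (rule reindex_continuous) (use img stone_space_eq in auto)
  then show "quotient_map (stone_space \<MM> M D) (stone_space \<MM> M N) (reindex id M N)"
    using T1_Spaces.continuous_imp_closed_map[OF c compact_stone_space[OF assms(1,2)] Hausdorff_stone_space] img
    by (intro continuous_closed_imp_quotient_map) auto
qed

lemma Autf_fixing_model:
  "\<sigma> \<in> aut \<MM> \<Longrightarrow> small U \<Longrightarrow> elem_substructure \<MM> U \<Longrightarrow> (\<And>x. x \<in> U \<Longrightarrow> \<sigma> x = x) \<Longrightarrow> \<sigma> \<in> Autf \<MM>"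
  unfolding Autf_def by (intro generate.incl) blast

end

section \<open>From types over a model to homology classes\<close>

context indep_setup
begin

lemma q_closed: "\<sigma> \<in> aut \<MM> \<Longrightarrow> q \<sigma> \<in> carrier H1"
  using q_surj by blast

lemma q_comp: "\<sigma> \<in> aut \<MM> \<Longrightarrow> \<tau> \<in> aut \<MM> \<Longrightarrow> q (\<sigma> \<circ> \<tau>) = q \<sigma> \<otimes>\<^bsub>H1\<^esub> q \<tau>"
  using group_hom.hom_mult[OF q_hom, of \<sigma> \<tau>] by (simp add: Aut_simps Aut_mult)

text \<open>Equality of the types gives
  \<open>\<tau> = \<rho> \<circ> \<sigma> \<circ> \<kappa>\<close>, where \<open>\<rho>\<close>
  fixes the model inside \<open>D\<close> and \<open>\<kappa>\<close> fixes \<open>M\<close>; both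
  have trivial class.\<close>

lemma q_tp:
  assumes M: "small M" "elem_substructure \<MM> M" and D: "small D" and M0: "M0 \<subseteq> D" "small M0" "elem_substructure \<MM> M0"
    and st: "\<sigma> \<in> aut \<MM>" "\<tau> \<in> aut \<MM>" and eq: "tp \<MM> M \<sigma> D = tp \<MM> M \<tau> D"
  shows "q \<sigma> = q \<tau>"
proof -
  interpret H: comm_group H1 by (rule comm_group_H1)
  have "|M| <o |UNIV :: 'm set|" using M(1) by (simp add: small_def)
  from eq[unfolded tp_eq_iff[OF this D]] obtain \<rho> where
    \<rho>: "\<rho> \<in> aut \<MM>" "\<And>c. c \<in> D \<Longrightarrow> \<rho> c = c" "\<And>x. x \<in> M \<Longrightarrow> \<tau> x = \<rho> (\<sigma> x)" by blast
  define \<kappa> where "\<kappa> = ainv (\<rho> \<circ> \<sigma>) \<circ> \<tau>"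
  have rs: "\<rho> \<circ> \<sigma> \<in> aut \<MM>" using \<rho>(1) st(1) by (rule comp_aut)
  have \<kappa>: "\<kappa> \<in> aut \<MM>" unfolding \<kappa>_def by (intro comp_aut inv_aut rs st)
  have "\<kappa> x = x" if "x \<in> M" for x
    using aut_inv_simps(1)[OF rs, of x] \<rho>(3)[OF that] by (simp add: \<kappa>_def)
  then have k1: "q \<kappa> = \<one>\<^bsub>H1\<^esub>" by (intro q_Autf Autf_fixing_model[OF \<kappa> M])
  have r1: "q \<rho> = \<one>\<^bsub>H1\<^esub>" using \<rho>(2) M0(1) by (intro q_Autf Autf_fixing_model[OF \<rho>(1) M0(2,3)]) blast
  have "\<tau> = \<rho> \<circ> \<sigma> \<circ> \<kappa>" unfolding \<kappa>_def comp_assoc[symmetric] aut_inv_simps(4)[OF rs] by simp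
  then have "q \<tau> = q \<rho> \<otimes>\<^bsub>H1\<^esub> q \<sigma> \<otimes>\<^bsub>H1\<^esub> q \<kappa>" using q_comp[OF rs \<kappa>] q_comp[OF \<rho>(1) st(1)] by simp
  then show ?thesis using k1 r1 q_closed[OF st(1)] by simp
qed

text \<open>The same choice of an automorphism as in \<open>nu\<close>, so that the composites with
  \<open>nu\<close> equal \<open>qt\<close> literally.\<close>

definition qt :: "'m set \<Rightarrow> 'm set \<Rightarrow> ('s, 'f, 'r, 'm, 'm) ptype \<Rightarrow> ('m cube \<Rightarrow>\<^sub>0 int) set" where
  "qt M D t = q (SOME \<sigma>. \<sigma> \<in> aut \<MM> \<and> tp \<MM> M \<sigma> D = t)"

lemma qt_tp:
  assumes M: "small M" "elem_substructure \<MM> M" and D: "small D" and M0: "M0 \<subseteq> D" "small M0" "elem_substructure \<MM> M0"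
    and \<sigma>: "\<sigma> \<in> aut \<MM>"
  shows "qt M D (tp \<MM> M \<sigma> D) = q \<sigma>"
proof -
  have "\<exists>\<tau>. \<tau> \<in> aut \<MM> \<and> tp \<MM> M \<tau> D = tp \<MM> M \<sigma> D" using \<sigma> by blast
  from someI_ex[OF this] show ?thesis unfolding qt_def using q_tp[OF M D M0 _ \<sigma>] by blast
qed

text \<open>Both towers of quotients compose to the same map on the Stone space.\<close>

lemma H1_topology_eq:
  shows "H1_topology \<MM> R p a M M0 = quotient_topology (stone_space \<MM> M M0) (qt M M0)"
    and "quotient_topology (Gal_fix_topology \<MM> p M M0) (Gal_fix_to_H1 \<MM> R p a) = quotient_topology (stone_space \<MM> M M0) (qt M M0)"
proof -
  have ex: "(SOME \<tau>. \<tau> \<in> aut \<MM> \<and> tp \<MM> M \<tau> M0 = t) \<in> aut \<MM>" if "t \<in> topspace (stone_space \<MM> M M0)" for t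
  proof -
    have "\<exists>\<tau>. \<tau> \<in> aut \<MM> \<and> tp \<MM> M \<tau> M0 = t" using that unfolding topspace_stone_space by blast
    from someI_ex[OF this] show ?thesis by blast
  qed
  show "H1_topology \<MM> R p a M M0 = quotient_topology (stone_space \<MM> M M0) (qt M M0)"
    unfolding H1_topology_def Gal_L_topology_def quotient_topology_comp
    by (rule quotient_topology_cong) (simp add: nu_def qt_def Gal_L_hom(3)[OF ex])
  show "quotient_topology (Gal_fix_topology \<MM> p M M0) (Gal_fix_to_H1 \<MM> R p a) = quotient_topology (stone_space \<MM> M M0) (qt M M0)"
    unfolding Gal_fix_topology_def Gal_L_topology_def quotient_topology_comp
    by (rule quotient_topology_cong) (simp add: nu_def qt_def Gal_L_to_fix_eq[OF ex] Gal_fix_hom(3)[OF ex])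
qed

lemma qt_topology_restrict:
  assumes M: "small M" "elem_substructure \<MM> M" and D: "small D" and M0: "M0 \<subseteq> D" "small M0" "elem_substructure \<MM> M0"
  shows "quotient_topology (stone_space \<MM> M D) (qt M D) = quotient_topology (stone_space \<MM> M M0) (qt M M0)"
proof -
  note r = restrict_quotient_map[OF M(1) D M0(1)]
  have "quotient_topology (stone_space \<MM> M M0) (qt M M0) = quotient_topology (stone_space \<MM> M D) (qt M M0 \<circ> reindex id M M0)"
    by (rule quotient_topology_unique[OF quotient_map_compose[OF r(1) quotient_map_quotient_topology]])
  also have "\<dots> = quotient_topology (stone_space \<MM> M D) (qt M D)"
  proof (rule quotient_topology_cong)
    fix t assume "t \<in> topspace (stone_space \<MM> M D)"
    then obtain \<sigma> where \<sigma>: "\<sigma> \<in> aut \<MM>" "t = tp \<MM> M \<sigma> D" unfolding topspace_stone_space by blast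
    show "(qt M M0 \<circ> reindex id M M0) t = qt M D t"
      unfolding \<sigma>(2) comp_apply r(2) qt_tp[OF M D M0 \<sigma>(1)] by (rule qt_tp[OF M M0(2) subset_refl M0(2,3) \<sigma>(1)])
  qed
  finally show ?thesis by (rule sym)
qed

theorem topological_group_H1:
  assumes M: "small M" "elem_substructure \<MM> M" and M0: "small M0" "elem_substructure \<MM> M0"
  shows "topological_group H1 (H1_topology \<MM> R p a M M0)"
proof -
  have MN: "small (M \<union> M0)" using M(1) M0(1) by (rule small_Un)
  have "H1_topology \<MM> R p a M M0 = quotient_topology (stone_space \<MM> M M0) (qt M M0)" by (rule H1_topology_eq(1))
  \<comment> \<open>The map \<open>pr_diff\<close> is available only for types over \<open>M\<close>
    itself, so the parameters \<open>M0\<close> are replaced by \<open>M\<close> by way of their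
    union.\<close>
  also have "\<dots> = quotient_topology (stone_space \<MM> M (M \<union> M0)) (qt M (M \<union> M0))"
    by (rule qt_topology_restrict[OF M MN _ M0, symmetric]) blast
  also have "\<dots> = quotient_topology (stone_space \<MM> M M) (qt M M)"
    by (rule qt_topology_restrict[OF M MN _ M]) blast
  finally have top: "H1_topology \<MM> R p a M M0 = quotient_topology (stone_space \<MM> M M) (qt M M)" .
  note qv = qt_tp[OF M M(1) subset_refl M]
  let ?X = "stone_space \<MM> M M" and ?Y = "pair_space M M"
  have qm: "quotient_map ?X (quotient_topology ?X (qt M M)) (qt M M)" by (rule quotient_map_quotient_topology)
  have XE: "\<exists>\<sigma>\<in>aut \<MM>. x = tp \<MM> M \<sigma> M" if "x \<in> topspace ?X" for x using that unfolding topspace_stone_space by blast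
  show ?thesis
    unfolding top
  \<comment> \<open>For the type of a pair \<open>(\<sigma>, \<rho>)\<close> the three maps give
    \<open>\<sigma>\<close>, \<open>\<sigma>\<inverse>\<rho>\<close> and \<open>\<rho>\<close>, the
    last being the product of the first two.\<close>
  proof (rule topological_group_quotient[where ?p1.0 = "pr1 M M" and ?p2.0 = "pr_diff M" and ?p3.0 = "pr2 M M"])
    have "topspace (quotient_topology ?X (qt M M)) = qt M M ` topspace ?X" using qm by (simp add: quotient_map_def)
    also have "\<dots> = q ` aut \<MM>" unfolding topspace_stone_space image_image using qv by (intro image_cong) auto
    finally show "topspace (quotient_topology ?X (qt M M)) = carrier H1" by (simp add: q_surj)
    show "qt M M (pr2 M M y) = qt M M (pr1 M M y) \<otimes>\<^bsub>H1\<^esub> qt M M (pr_diff M y)" if y: "y \<in> topspace ?Y" for y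
    proof -
      obtain \<sigma> \<rho> where sr: "\<sigma> \<in> aut \<MM>" "\<rho> \<in> aut \<MM>" "y = tp \<MM> (M <+> M) (case_sum \<sigma> \<rho>) M" using pair_spaceE[OF y] .
      have d: "ainv \<sigma> \<circ> \<rho> \<in> aut \<MM>" using sr by (intro comp_aut inv_aut)
      have "\<sigma> \<circ> (ainv \<sigma> \<circ> \<rho>) = \<rho>" using sr(1) by (simp add: comp_assoc[symmetric])
      then show ?thesis
        unfolding sr(3) pr_tp[OF sr(1)] qv[OF sr(1)] qv[OF sr(2)] qv[OF d] using q_comp[OF sr(1) d] by simp
    qed
    fix x x' assume "x \<in> topspace ?X" "x' \<in> topspace ?X"
    then obtain \<sigma> \<tau> where st: "\<sigma> \<in> aut \<MM>" "x = tp \<MM> M \<sigma> M" "\<tau> \<in> aut \<MM>" "x' = tp \<MM> M \<tau> M" using XE by blast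
    \<comment> \<open>Representatives for the surjectivity conditions: any two of
      \<open>\<sigma>\<close>, \<open>\<sigma>\<inverse>\<rho>\<close> and \<open>\<rho>\<close>
      determine the third.\<close>
    have c: "\<sigma> \<circ> \<tau> \<in> aut \<MM>" "\<tau> \<circ> ainv \<sigma> \<in> aut \<MM>" using st by (simp_all add: comp_aut inv_aut)
    have e1: "ainv \<sigma> \<circ> (\<sigma> \<circ> \<tau>) = \<tau>" using st(1) by (simp add: comp_assoc[symmetric])
    have e2: "ainv (\<tau> \<circ> ainv \<sigma>) \<circ> \<tau> = \<sigma>"
    proof
      fix t
      have k: "(\<tau> \<circ> ainv \<sigma>) (\<sigma> t) = \<tau> t" using st(1) by simp
      show "(ainv (\<tau> \<circ> ainv \<sigma>) \<circ> \<tau>) t = \<sigma> t" using aut_inv_simps(1)[OF c(2), of "\<sigma> t"] unfolding k by simp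
    qed
    show "\<exists>y\<in>topspace ?Y. pr1 M M y = x \<and> pr_diff M y = x'"
      using pr_tp(1)[OF st(1), of M M "\<sigma> \<circ> \<tau>"] pr_tp(3)[OF st(1), of M "\<sigma> \<circ> \<tau>"] st e1 by (intro bexI[OF _ pair_spaceI[OF st(1) c(1)]]) simp
    show "\<exists>y\<in>topspace ?Y. pr1 M M y = x \<and> pr2 M M y = x'"
      using pr_tp(1,2)[OF st(1), of M M \<tau>] st by (intro bexI[OF _ pair_spaceI[OF st(1,3)]]) simp
    show "\<exists>y\<in>topspace ?Y. pr_diff M y = x \<and> pr2 M M y = x'"
      using pr_tp(2)[OF c(2), of M M \<tau>] pr_tp(3)[OF c(2), of M \<tau>] st e2 by (intro bexI[OF _ pair_spaceI[OF c(2) st(3)]]) simp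
  qed (intro comm_group_H1 compact_stone_space M Hausdorff_stone_space compact_pair_space qm pr_continuous)+
qed

lemma kernel_psi: "kernel (Aut_real \<MM> p) H1 (psi \<MM> R p a) = act' ` {\<sigma> \<in> aut \<MM>. q \<sigma> = \<one>\<^bsub>H1\<^esub>}"
  unfolding kernel_def Aut_real_simps using psi_act by auto

end

theorem mainTheorem9:
  fixes \<MM> :: "('s, 'f, 'r, 'm) fostruct"
    and a :: "'i \<Rightarrow> 'm"
    and p :: "('s, 'f, 'r, 'm, 'i) ptype"
    and R1 R2 :: "'m indep"
    and M N :: "'m set"
  assumes "monster \<MM>" and "eq_closed \<MM>"
    and "acl \<MM> {} = dcl \<MM> {}"
    and "|UNIV :: 'i set| <o |UNIV :: 'm set|"
    and "p = tp \<MM> UNIV a {}"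
    and "range a = acl \<MM> (range a) \<or> acl \<MM> (range a) = dcl \<MM> (range a)"
    and "small M" and "elem_substructure \<MM> M"
    and "small N" and "elem_substructure \<MM> N"
    and "indep_relation \<MM> R1" and "indep_relation \<MM> R2"
  shows
    "kernel (Aut_real \<MM> p) (homology \<MM> R1 p 1) (psi \<MM> R1 p a)
       = kernel (Aut_real \<MM> p) (homology \<MM> R2 p 1) (psi \<MM> R2 p a)
     \<and> (\<forall>R\<in>{R1, R2}.
          group_hom (Aut_real \<MM> p) (homology \<MM> R p 1) (psi \<MM> R p a)
        \<and> psi \<MM> R p a \<in> epi (Aut_real \<MM> p) (homology \<MM> R p 1)
        \<and> (\<lambda>Z. the_elem (psi \<MM> R p a ` Z))
            \<in> iso (Aut_real \<MM> p Mod kernel (Aut_real \<MM> p) (homology \<MM> R1 p 1) (psi \<MM> R1 p a))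
                  (homology \<MM> R p 1))
     \<and> (\<forall>R\<in>{R1, R2}.
          group_hom (Gal_L \<MM>) (homology \<MM> R p 1) (Gal_L_to_H1 \<MM> R p a)
        \<and> Gal_L_to_H1 \<MM> R p a \<in> epi (Gal_L \<MM>) (homology \<MM> R p 1)
        \<and> group_hom (Gal_fix \<MM> p) (homology \<MM> R p 1) (Gal_fix_to_H1 \<MM> R p a)
        \<and> Gal_fix_to_H1 \<MM> R p a \<in> epi (Gal_fix \<MM> p) (homology \<MM> R p 1)
        \<and> (\<forall>\<sigma>\<in>aut \<MM>. \<forall>b\<in>realizations \<MM> p.
              Gal_L_to_H1 \<MM> R p a (Autf \<MM> #>\<^bsub>Aut \<MM>\<^esub> \<sigma>) = bracket \<MM> R p b (\<sigma> \<circ> b)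
            \<and> Gal_fix_to_H1 \<MM> R p a (Autf_fix \<MM> p #>\<^bsub>Aut_real \<MM> p\<^esub> act \<MM> p \<sigma>)
                = bracket \<MM> R p b (\<sigma> \<circ> b))
        \<and> H1_topology \<MM> R p a M N
            = quotient_topology (Gal_fix_topology \<MM> p M N) (Gal_fix_to_H1 \<MM> R p a)
        \<and> topological_group (homology \<MM> R p 1) (H1_topology \<MM> R p a M N))
     \<and> (\<exists>\<theta>\<in>iso (homology \<MM> R1 p 1) (homology \<MM> R2 p 1).
          (\<forall>g\<in>carrier (Aut_real \<MM> p). \<theta> (psi \<MM> R1 p a g) = psi \<MM> R2 p a g)
        \<and> homeomorphic_map (H1_topology \<MM> R1 p a M N) (H1_topology \<MM> R2 p a M N) \<theta>)"
proof -
  interpret I1: indep_setup \<MM> a p R1 by unfold_locales (use assms in auto)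
  interpret I2: indep_setup \<MM> a p R2 by unfold_locales (use assms in auto)
  let ?G = "Aut_real \<MM> p"
  let ?H = "\<lambda>R. homology \<MM> R p 1"
  let ?K = "kernel ?G (?H R1) (psi \<MM> R1 p a)"
  let ?F = "\<lambda>R Z. the_elem (psi \<MM> R p a ` Z)"
  \<comment> \<open>Each relation plays both parts: its shells are evaluated, and its
    \<open>beta\<close> serves as the cocycle on the shells of the other.\<close>
  have "I1.q \<sigma> = \<one>\<^bsub>?H R1\<^esub> \<longleftrightarrow> I2.q \<sigma> = \<one>\<^bsub>?H R2\<^esub>" if \<sigma>: "\<sigma> \<in> aut \<MM>" for \<sigma>
  proof
    show "I2.q \<sigma> = \<one>\<^bsub>?H R2\<^esub>" if "I1.q \<sigma> = \<one>\<^bsub>?H R1\<^esub>"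
      using I1.q_kernel_cocycle[OF I2.beta_inv_cocycle \<sigma> that] by (simp only: I2.q_one_iff)
    show "I1.q \<sigma> = \<one>\<^bsub>?H R1\<^esub>" if "I2.q \<sigma> = \<one>\<^bsub>?H R2\<^esub>"
      using I2.q_kernel_cocycle[OF I1.beta_inv_cocycle \<sigma> that] by (simp only: I1.q_one_iff)
  qed
  then have "{\<sigma> \<in> aut \<MM>. I1.q \<sigma> = \<one>\<^bsub>?H R1\<^esub>} = {\<sigma> \<in> aut \<MM>. I2.q \<sigma> = \<one>\<^bsub>?H R2\<^esub>}" by blast
  then have ker: "?K = kernel ?G (?H R2) (psi \<MM> R2 p a)" by (simp only: I1.kernel_psi I2.kernel_psi)
  have quot: "group_hom ?G (?H R) (psi \<MM> R p a) \<and> psi \<MM> R p a \<in> epi ?G (?H R) \<and> ?F R \<in> iso (?G Mod ?K) (?H R)"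
    if "R \<in> {R1, R2}" for R
  proof -
    have h: "group_hom ?G (?H R) (psi \<MM> R p a)" "psi \<MM> R p a ` carrier ?G = carrier (?H R)" "?K = kernel ?G (?H R) (psi \<MM> R p a)"
      using that I1.psi_hom I2.psi_hom ker by auto
    then have "psi \<MM> R p a \<in> epi ?G (?H R)" by (simp add: epi_def group_hom.homh)
    then show ?thesis using h group_hom.FactGroup_iso_set[OF h(1,2)] by simp
  qed
  have gal: "group_hom (Gal_L \<MM>) (?H R) (Gal_L_to_H1 \<MM> R p a)
      \<and> Gal_L_to_H1 \<MM> R p a \<in> epi (Gal_L \<MM>) (?H R)
      \<and> group_hom (Gal_fix \<MM> p) (?H R) (Gal_fix_to_H1 \<MM> R p a)
      \<and> Gal_fix_to_H1 \<MM> R p a \<in> epi (Gal_fix \<MM> p) (?H R)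
      \<and> (\<forall>\<sigma>\<in>aut \<MM>. \<forall>b\<in>realizations \<MM> p.
            Gal_L_to_H1 \<MM> R p a (Autf \<MM> #>\<^bsub>Aut \<MM>\<^esub> \<sigma>) = bracket \<MM> R p b (\<sigma> \<circ> b)
          \<and> Gal_fix_to_H1 \<MM> R p a (Autf_fix \<MM> p #>\<^bsub>?G\<^esub> act \<MM> p \<sigma>) = bracket \<MM> R p b (\<sigma> \<circ> b))
      \<and> H1_topology \<MM> R p a M N = quotient_topology (Gal_fix_topology \<MM> p M N) (Gal_fix_to_H1 \<MM> R p a)
      \<and> topological_group (?H R) (H1_topology \<MM> R p a M N)"
    if "R \<in> {R1, R2}" for R
  proof -
    interpret I: indep_setup \<MM> a p R by unfold_locales (use that assms in auto)
    show ?thesis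
      using I.Gal_L_hom I.Gal_fix_hom I.q_base I.topological_group_H1[OF assms(7-10)]
      by (auto simp: I.H1_topology_eq)
  qed
  have "\<exists>\<theta>\<in>iso (?H R1) (?H R2). (\<forall>g\<in>carrier ?G. \<theta> (psi \<MM> R1 p a g) = psi \<MM> R2 p a g)
      \<and> homeomorphic_map (H1_topology \<MM> R1 p a M N) (H1_topology \<MM> R2 p a M N) \<theta>"
  proof -
    have F: "?F R1 \<in> iso (?G Mod ?K) (?H R1)" "?F R2 \<in> iso (?G Mod ?K) (?H R2)" using quot by auto
    have K: "?K \<lhd> ?G" by (rule group_hom.normal_kernel[OF I1.psi_hom(1)])
    have val: "?F R (?K #>\<^bsub>?G\<^esub> g) = psi \<MM> R p a g" if "R \<in> {R1, R2}" "g \<in> carrier ?G" for R g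
    proof -
      have "psi \<MM> R p a n = \<one>\<^bsub>?H R\<^esub>" if "n \<in> ?K" for n
        using that ker \<open>R \<in> {R1, R2}\<close> by (auto simp: kernel_def)
      then show ?thesis using factor_hom(1)[OF conjunct1[OF quot[OF that(1)]] K _ that(2)] by blast
    qed
    \<comment> \<open>The isomorphism goes through the common quotient of \<open>Aut_real\<close> by
      the kernel, and so matches the values of the two \<open>psi\<close>.\<close>
    define \<eta> where "\<eta> = inv_into (carrier (?G Mod ?K)) (?F R1)"
    have grp: "group (?G Mod ?K)" by (rule normal.factorgroup_is_group[OF K])
    have \<eta>: "\<eta> \<in> iso (?H R1) (?G Mod ?K)" unfolding \<eta>_def by (rule group.iso_set_sym[OF grp F(1)])
    define \<theta> where "\<theta> = ?F R2 \<circ> \<eta>"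
    have \<theta>: "\<theta> \<in> iso (?H R1) (?H R2)"
      unfolding \<theta>_def by (rule iso_set_trans[OF \<eta> F(2)])
    have eq: "\<theta> (psi \<MM> R1 p a g) = psi \<MM> R2 p a g" if g: "g \<in> carrier ?G" for g
    proof -
      have Kg: "?K #>\<^bsub>?G\<^esub> g \<in> carrier (?G Mod ?K)" using g by (auto simp: FactGroup_def RCOSETS_def)
      have "inj_on (?F R1) (carrier (?G Mod ?K))" using F(1) by (simp add: iso_def bij_betw_def)
      from inv_into_f_f[OF this Kg] have "\<eta> (psi \<MM> R1 p a g) = ?K #>\<^bsub>?G\<^esub> g" unfolding \<eta>_def val[OF insertI1 g] .
      then show ?thesis using val[of R2, OF _ g] by (simp add: \<theta>_def)
    qed
    \<comment> \<open>Both topologies are quotients of one Stone space and \<open>\<theta>\<close>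
      carries one quotient map to the other; an injective quotient map is a homeomorphism.\<close>
    let ?X = "stone_space \<MM> M N"
    have t1: "quotient_map ?X (H1_topology \<MM> R1 p a M N) (I1.qt M N)"
      and t2: "quotient_map ?X (H1_topology \<MM> R2 p a M N) (I2.qt M N)"
      unfolding I1.H1_topology_eq I2.H1_topology_eq by (rule quotient_map_quotient_topology)+
    have "I2.qt M N t = (\<theta> \<circ> I1.qt M N) t" if t: "t \<in> topspace ?X" for t
    proof -
      obtain \<sigma> where \<sigma>: "\<sigma> \<in> aut \<MM>" "t = tp \<MM> M \<sigma> N" using t unfolding I1.topspace_stone_space by blast
      have "act \<MM> p \<sigma> \<in> carrier ?G" using \<sigma>(1) by (auto simp: I1.Aut_real_simps)
      from eq[OF this] show ?thesis
        unfolding \<sigma>(2) comp_apply I1.qt_tp[OF assms(7,8,9) subset_refl assms(9,10) \<sigma>(1)]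
          I2.qt_tp[OF assms(7,8,9) subset_refl assms(9,10) \<sigma>(1)] I1.psi_act[OF \<sigma>(1)] I2.psi_act[OF \<sigma>(1)] by simp
    qed
    from quotient_map_eq[OF t2 this] have "quotient_map (H1_topology \<MM> R1 p a M N) (H1_topology \<MM> R2 p a M N) \<theta>"
      using quotient_map_compose_eq[OF t1] by blast
    moreover have "inj_on \<theta> (topspace (H1_topology \<MM> R1 p a M N))"
      using \<theta> I1.topological_group_H1[OF assms(7-10)] by (simp add: iso_def bij_betw_def topological_group_def)
    ultimately have "homeomorphic_map (H1_topology \<MM> R1 p a M N) (H1_topology \<MM> R2 p a M N) \<theta>"
      by (simp add: homeomorphic_map_def)
    then show ?thesis using \<theta> eq by blast
  qed
  then show ?thesis using ker quot gal by (intro conjI ballI) blast+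
qed

end
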